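(* Let $q\in L_{1,loc}(\mathbb{R}_+)$ be real-valued and let $T>0$. Let $B^T_S$ be the set of Fourier images of the states at time $T$ of the wave equation with potential $q$ generated by real controls, $$B_S^T=\left\{F:\ F(\mu)=\int_0^T\frac{\sin(\sqrt{\mu}\,s)}{\sqrt{\mu}}f(T-s)\,ds,\ \mu\in\mathbb{C},\ \ f\in L_2(0,T),\ f \text{ real-valued}\right\},$$ equipped with the scalar product $[F,G]_{B^T_S}=(C^Tf,g)_{L_2(0,T)}$, where $f,g$ are the controls representing $F,G$ and $C^T$ is the connecting operator of the wave equation. Then $B_S^T$ with the norm generated by this scalar product is a Hilbert space. For every $z\in\mathbb{C}$ the Krein equation $$(C^Tj_z)(s)=\overline{\frac{\sin(\sqrt{z}\,(T-s))}{\sqrt{z}}},\qquad s\in(0,T),$$ has a unique solution $j_z$, and the reproducing kernel of $B^T_S$, i.e. the function $J_z$ with $[J_z,F]_{B^T_S}=F(z)$ for all $F\in B^T_S$, is $$J_z(\mu)=\int_0^T\frac{\sin(\sqrt{\mu}\,(T-s))}{\sqrt{\mu}}j_z(s)\,ds .$$ Moreover, $B^T_S$ satisfies the following three conditions: (1) for every $\omega\in\mathbb{C}$, evaluation $F\mapsto F(\omega)$ is a bounded functional; (2) if $F\in B^T_S$ then $F^\#\in B^T_S$ and $\|F^\#\|=\|F\|$; (3) if $F\in B^T_S$ and $F(\omega)=0$ for some $\omega\in\mathbb{C}$, then $\frac{z-\overline\omega}{z-\omega}F(z)\in B^T_S$, with the same norm as $F$. Consequently $B_S^T$ is a De Branges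 space, based on the Hermite-Biehler function $$E(z)=\sqrt{\pi}\,(1-iz)\,J_i(z)\,\|J_i\|_{B^T_S}^{-1}.$$
   Context: Scalar products are conjugate-linear in the first argument: $(f,g)=\int_0^T\overline{f(t)}g(t)\,dt$. The function $\mu\mapsto \sin(\sqrt\mu\, s)/\sqrt\mu$ is the entire function of $\mu$ with value $s$ at $\mu=0$. Notation: $F^\#(z)=\overline{F(\overline z)}$. Wave equation and operators: for a control $f$ on $(0,T)$ let $u^f$ be the solution of $u_{tt}-u_{xx}+q(x)u=0$ for $x>0$, $0<t<T$, with $u(x,0)=u_t(x,0)=0$, $u(0,t)=f(t)$. It has the form $u^f(x,t)=f(t-x)+\int_x^t w(x,s)f(t-s)\,ds$ for $x\le t$ and $u^f(x,t)=0$ for $x>t$, with a kernel $w$ determined by $q$. The control operator is $W^Tf=u^f(\cdot,T)$, acting from $L_2(0,T)$ to $L_2(0,T)$, and the connecting operator is $C^T=(W^T)^*W^T$. The controls defining $B^T_S$ are real; on complex-valued functions such as $j_z$, $C^T$ acts by the same formula (by complex linearity), and $[J_z,F]_{B^T_S}$ means $(C^Tj_z,f)$. The Fourier image of a state is $\int_0^\infty u^f(x,T)\varphi(x,\mu)\,dx$, where $-\varphi''+q\varphi=\mu\varphi$, $\varphi(0,\mu)=0$, $\varphi'(0,\mu)=1$; it equals $\int_0^T\frac{\sin(\sqrt{\mu}\,s)}{\sqrt{\mu}}f(T-s)\,ds$. An entire function $E$ is a Hermite-Biehler function if $|E(z)|>|E(\overline z)|$ for $\operatorname{Im}z>0$.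 Let $H_2$ be the Hardy space of functions $f$ holomorphic in the upper half-plane with $\sup_{y>0}\int_{-\infty}^\infty|f(x+iy)|^2dx<\infty$. The De Branges space $B(E)$ based on $E$ is the set of entire functions $F$ with $\int_{\mathbb{R}}|F(\lambda)/E(\lambda)|^2d\lambda<\infty$ and $F/E,\ F^\#/E\in H_2$, with scalar product $[F,G]_{B(E)}=\frac1\pi\int_{\mathbb{R}}\overline{F(\lambda)}G(\lambda)\frac{d\lambda}{|E(\lambda)|^2}$.
   Formalization: Condition (3), the kernel J_z and the De Branges space B(E) refer to the complexification B_S^T + i B_S^T, since (3) fails in the real space for nonreal ω; and [F,G]_{B_S^T} = π[F,G]_{B(E)}, since equality with the 1/π-normalised product is false. *)

theory Defs
  imports "HOL-Complex_Analysis.Complex_Analysis"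
begin

text \<open>
  Elements of \<open>L\<^sub>2(0,T)\<close> are represented by complex functions on the real line of which only the
  values on \<open>(0,T)\<close> matter; equality in \<open>L\<^sub>2(0,T)\<close> is equality almost everywhere.  Every Lebesgue class
  has a Borel representative, so nothing is lost by using \<^const>\<open>lborel\<close>.
\<close>

definition L2 :: "real \<Rightarrow> (real \<Rightarrow> complex) set" where
  "L2 T = {f. set_borel_measurable lborel {0<..<T} f \<and>
              set_integrable lborel {0<..<T} (\<lambda>t. (cmod (f t))\<^sup>2)}"

definition L2_inner :: "real \<Rightarrow> (real \<Rightarrow> complex) \<Rightarrow> (real \<Rightarrow> complex) \<Rightarrow> complex" where
  "L2_inner T f g = (LINT t:{0<..<T}|lborel. cnj (f t) * g t)"

definition eq_on_interval :: "real \<Rightarrow> (real \<Rightarrow> complex) \<Rightarrow> (real \<Rightarrow> complex) \<Rightarrow> bool" where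
  "eq_on_interval T f g \<longleftrightarrow> (AE t in lborel. t \<in> {0<..<T} \<longrightarrow> f t = g t)"

definition L2_adjoint ::
  "real \<Rightarrow> ((real \<Rightarrow> complex) \<Rightarrow> (real \<Rightarrow> complex)) \<Rightarrow> (real \<Rightarrow> complex) \<Rightarrow> (real \<Rightarrow> complex)" where
  "L2_adjoint T A h =
     (SOME k. k \<in> L2 T \<and> (\<forall>g\<in>L2 T. L2_inner T k g = L2_inner T h (A g)))"

text \<open>
  For a merely integrable potential and a square-integrable control, the solution of
  \<open>u\<^sub>t\<^sub>t - u\<^sub>x\<^sub>x + q u = 0\<close> on the half-line with \<open>u(x,0) = u\<^sub>t(x,0) = 0\<close> and \<open>u(0,t) = f(t)\<close> is understood
  in the mild sense: \<open>q u\<close> is locally integrable and \<open>u\<close> is given by d'Alembert's formula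
  (free wave \<open>f(t-x)\<close> produced by the boundary control) plus Duhamel's formula for the
  half-line with a Dirichlet condition and right-hand side \<open>-q u\<close>.  The backward characteristic
  region of \<open>(x,t)\<close> is the triangle with this vertex, reflected at \<open>x = 0\<close>: the contributions of the
  odd extension cancel, which leaves the lower bound \<open>|x - (t - \<tau>)|\<close>.
\<close>

definition characteristic_region :: "real \<Rightarrow> real \<Rightarrow> (real \<times> real) set" where
  "characteristic_region x t = {(y, \<tau>). 0 \<le> \<tau> \<and> \<tau> \<le> t \<and> \<bar>x - (t - \<tau>)\<bar> \<le> y \<and> y \<le> x + (t - \<tau>)}"

definition wave_solution ::
  "(real \<Rightarrow> real) \<Rightarrow> real \<Rightarrow> (real \<Rightarrow> complex) \<Rightarrow> (real \<Rightarrow> real \<Rightarrow> complex) \<Rightarrow> bool" where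
  "wave_solution q T f u \<longleftrightarrow>
     (\<forall>R. set_integrable lborel ({0..R} \<times> {0..T}) (\<lambda>(y, \<tau>). of_real (q y) * u y \<tau>)) \<and>
     (\<forall>x\<ge>0. \<forall>t\<in>{0..T}.
        u x t = (if x \<le> t then f (t - x) else 0)
          - (1/2) * (LINT p:characteristic_region x t|lborel. of_real (q (fst p)) * u (fst p) (snd p)))"

definition control_operator ::
  "(real \<Rightarrow> real) \<Rightarrow> real \<Rightarrow> (real \<Rightarrow> complex) \<Rightarrow> (real \<Rightarrow> complex)" where
  "control_operator q T f = (\<lambda>x. (SOME u. wave_solution q T f u) x T)"

definition connecting_operator ::
  "(real \<Rightarrow> real) \<Rightarrow> real \<Rightarrow> (real \<Rightarrow> complex) \<Rightarrow> (real \<Rightarrow> complex)" where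
  "connecting_operator q T f = L2_adjoint T (control_operator q T) (control_operator q T f)"

definition sin_kernel :: "complex \<Rightarrow> real \<Rightarrow> complex" where
  "sin_kernel \<mu> s =
     (if \<mu> = 0 then of_real s else sin (csqrt \<mu> * of_real s) / csqrt \<mu>)"

definition fourier_image :: "real \<Rightarrow> (real \<Rightarrow> complex) \<Rightarrow> (complex \<Rightarrow> complex)" where
  "fourier_image T f = (\<lambda>\<mu>. LINT s:{0<..<T}|lborel. sin_kernel \<mu> s * f (T - s))"

definition BS :: "real \<Rightarrow> (complex \<Rightarrow> complex) set" where
  "BS T = {F. \<exists>f\<in>L2 T. (\<forall>t\<in>{0<..<T}. f t \<in> \<real>) \<and> F = fourier_image T f}"

text \<open>
  The elements of the real space are real entire functions, while the kernels \<open>J\<^sub>z\<close>, the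
  functions \<open>(z - cnj \<omega>) / (z - \<omega>) * F z\<close> and De Branges spaces are complex.
  They live in the complexification.
\<close>

definition BS_complex :: "real \<Rightarrow> (complex \<Rightarrow> complex) set" where
  "BS_complex T = {H. \<exists>F\<in>BS T. \<exists>G\<in>BS T. H = (\<lambda>z. F z + \<i> * G z)}"

definition control_of :: "real \<Rightarrow> (complex \<Rightarrow> complex) \<Rightarrow> (real \<Rightarrow> complex)" where
  "control_of T F = (SOME f. f \<in> L2 T \<and> F = fourier_image T f)"

definition BS_inner ::
  "(real \<Rightarrow> real) \<Rightarrow> real \<Rightarrow> (complex \<Rightarrow> complex) \<Rightarrow> (complex \<Rightarrow> complex) \<Rightarrow> complex" where
  "BS_inner q T F G = L2_inner T (connecting_operator q T (control_of T F)) (control_of T G)"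

definition BS_norm :: "(real \<Rightarrow> real) \<Rightarrow> real \<Rightarrow> (complex \<Rightarrow> complex) \<Rightarrow> real" where
  "BS_norm q T F = sqrt (Re (BS_inner q T F F))"

text \<open>
  \<open>K\<close> is the scalar field, \<open>\<real>\<close> or \<open>UNIV\<close>, and the scalar product takes values in it.
\<close>

definition hilbert_space_on ::
  "complex set \<Rightarrow> (complex \<Rightarrow> complex) set \<Rightarrow>
   ((complex \<Rightarrow> complex) \<Rightarrow> (complex \<Rightarrow> complex) \<Rightarrow> complex) \<Rightarrow> bool" where
  "hilbert_space_on K V ip \<longleftrightarrow>
     (\<lambda>z. 0) \<in> V \<and>
     (\<forall>F\<in>V. \<forall>G\<in>V. (\<lambda>z. F z + G z) \<in> V) \<and>
     (\<forall>c\<in>K. \<forall>F\<in>V. (\<lambda>z. c * F z) \<in> V) \<and>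
     (\<forall>F\<in>V. \<forall>G\<in>V. ip F G \<in> K) \<and>
     (\<forall>F\<in>V. \<forall>G\<in>V. \<forall>H\<in>V. ip F (\<lambda>z. G z + H z) = ip F G + ip F H) \<and>
     (\<forall>c\<in>K. \<forall>F\<in>V. \<forall>G\<in>V. ip F (\<lambda>z. c * G z) = c * ip F G) \<and>
     (\<forall>F\<in>V. \<forall>G\<in>V. ip G F = cnj (ip F G)) \<and>
     (\<forall>F\<in>V. F \<noteq> (\<lambda>z. 0) \<longrightarrow> Re (ip F F) > 0) \<and>
     (\<forall>S. (\<forall>n. S n \<in> V) \<and>
          (\<forall>e>0. \<exists>N. \<forall>m\<ge>N. \<forall>n\<ge>N.
             sqrt (Re (ip (\<lambda>z. S m z - S n z) (\<lambda>z. S m z - S n z))) < e)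
        \<longrightarrow> (\<exists>F\<in>V. (\<lambda>n::nat. sqrt (Re (ip (\<lambda>z. S n z - F z) (\<lambda>z. S n z - F z))))
                      \<longlonglongrightarrow> 0))"

definition krein_solution ::
  "(real \<Rightarrow> real) \<Rightarrow> real \<Rightarrow> complex \<Rightarrow> (real \<Rightarrow> complex) \<Rightarrow> bool" where
  "krein_solution q T z j \<longleftrightarrow>
     j \<in> L2 T \<and>
     eq_on_interval T (connecting_operator q T j) (\<lambda>s. cnj (sin_kernel z (T - s)))"

definition krein_j :: "(real \<Rightarrow> real) \<Rightarrow> real \<Rightarrow> complex \<Rightarrow> (real \<Rightarrow> complex)" where
  "krein_j q T z = (SOME j. krein_solution q T z j)"

definition J_kernel :: "(real \<Rightarrow> real) \<Rightarrow> real \<Rightarrow> complex \<Rightarrow> (complex \<Rightarrow> complex)" where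
  "J_kernel q T z = (\<lambda>\<mu>. LINT s:{0<..<T}|lborel. sin_kernel \<mu> (T - s) * krein_j q T z s)"

definition sharp :: "(complex \<Rightarrow> complex) \<Rightarrow> (complex \<Rightarrow> complex)" where
  "sharp F = (\<lambda>z. cnj (F (cnj z)))"

text \<open>
  The entire function \<open>(z - cnj \<omega>) / (z - \<omega>) * F z\<close> for an entire \<open>F\<close> vanishing at \<open>\<omega>\<close>; its value at
  \<open>\<omega>\<close> is the limit.
\<close>

definition move_zero :: "complex \<Rightarrow> (complex \<Rightarrow> complex) \<Rightarrow> (complex \<Rightarrow> complex)" where
  "move_zero \<omega> F =
     (\<lambda>z. if z = \<omega> then (\<omega> - cnj \<omega>) * deriv F \<omega> else (z - cnj \<omega>) / (z - \<omega>) * F z)"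

definition hermite_biehler :: "(complex \<Rightarrow> complex) \<Rightarrow> bool" where
  "hermite_biehler E \<longleftrightarrow>
     E holomorphic_on UNIV \<and> (\<forall>z. Im z > 0 \<longrightarrow> cmod (E z) > cmod (E (cnj z)))"

definition hardy_H2 :: "(complex \<Rightarrow> complex) set" where
  "hardy_H2 = {f. f holomorphic_on {z. Im z > 0} \<and>
     (SUP y\<in>{0<..}. \<integral>\<^sup>+x. ennreal ((cmod (f (Complex x y)))\<^sup>2) \<partial>lborel) < \<infinity>}"

definition de_branges_space :: "(complex \<Rightarrow> complex) \<Rightarrow> (complex \<Rightarrow> complex) set" where
  "de_branges_space E = {F. F holomorphic_on UNIV \<and>
     integrable lborel (\<lambda>x::real. (cmod (F (of_real x) / E (of_real x)))\<^sup>2) \<and>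
     (\<lambda>z. F z / E z) \<in> hardy_H2 \<and> (\<lambda>z. sharp F z / E z) \<in> hardy_H2}"

definition de_branges_inner ::
  "(complex \<Rightarrow> complex) \<Rightarrow> (complex \<Rightarrow> complex) \<Rightarrow> (complex \<Rightarrow> complex) \<Rightarrow> complex" where
  "de_branges_inner E F G =
     (1 / of_real pi) *
     (LINT x|lborel. cnj (F (of_real x)) * G (of_real x) / of_real ((cmod (E (of_real x)))\<^sup>2))"

text \<open>
  \<open>J\<^sub>i / E\<close> has square-integral \<open>\<parallel>J\<^sub>i\<parallel>\<^sup>2\<close> on the real line because of the factor \<open>sqrt pi\<close>; the factor \<open>1 / pi\<close>
  in \<^const>\<open>de_branges_inner\<close> is therefore not absorbed, and the scalar product of the wave equation
  is \<open>pi\<close> times that of the De Branges space.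
\<close>

definition E_function :: "(real \<Rightarrow> real) \<Rightarrow> real \<Rightarrow> (complex \<Rightarrow> complex)" where
  "E_function q T =
     (\<lambda>z. of_real (sqrt pi) * (1 - \<i> * z) * J_kernel q T \<i> z
            / of_real (BS_norm q T (J_kernel q T \<i>)))"

end

(*
  Up to the reflection t -> T - t the control operator W^T is a Volterra perturbation of the
  identity, hence boundedly invertible. So f -> F carries L_2(0,T), with the norm ||W^T f||,
  isometrically onto B_S^T; this gives completeness and the unique solvability of the Krein
  equation. The wave equation, tested against phi, shows that the Fourier image is
  F(mu) = int_0^T phi(x,mu) (W^T f)(x) dx; hence W^T j_z = conj(phi(.,z)), and the Lagrange
  identity puts the kernel in Christoffel-Darboux form:
    (mu - conj z) J_z(mu) = phi(T,mu) conj(phi'(T,z)) - phi'(T,mu) conj(phi(T,z)).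
  As in de Branges' characterisation of his spaces, the kernel is then the one of B(E). That B(E)
  is no larger than B_S^T, and that the norms agree, comes from Cauchy's formula for Hardy
  functions, by which pi J_z reproduces the values of every function in B(E).
*)


theory Submission
  imports Defs
begin

section \<open>Pre-Hilbert spaces of functions\<close>

text \<open>Controls are functions, not classes, so the norms on L_2 are only seminorms; one
  semidefinite theory serves L_2(0,T), boundary values on the real line and spaces of entire
  functions. As the potential is merely integrable, the wave, phi and the moments int u(x,t) phi(x)
  dx are all treated as solutions of integral equations whose operators halve a weighted sup-norm,
  and integration by parts becomes Fubini's theorem on triangles. The control is merely integrable
  too; bounded, and found by a Neumann series, is the wave minus the free wave. Its bound by the L_1
  norm of the control up to time t - x is the Volterra estimate behind the inversion of W^T. In the
  comparison with B(E) the kernels J_w are shown to lie in B(E) for Im w > 0; this is enough because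
  an entire function is determined by its values on the upper half-plane. The two scalar products
  are compared first on a subspace containing these kernels, then by density. Condition (3) is read
  off from the equality with B(E): the factor (z - conj omega) / (z - omega) has modulus 1 on the
  real line.\<close>

locale pre_hilbert =
  fixes V :: "('x \<Rightarrow> complex) set" and ip :: "('x \<Rightarrow> complex) \<Rightarrow> ('x \<Rightarrow> complex) \<Rightarrow> complex"
  assumes zero_mem: "(\<lambda>x. 0) \<in> V"
    and add_mem: "F \<in> V \<Longrightarrow> G \<in> V \<Longrightarrow> (\<lambda>x. F x + G x) \<in> V"
    and scale_mem: "F \<in> V \<Longrightarrow> (\<lambda>x. c * F x) \<in> V"
    and ip_add: "F \<in> V \<Longrightarrow> G \<in> V \<Longrightarrow> H \<in> V \<Longrightarrow> ip F (\<lambda>x. G x + H x) = ip F G + ip F H"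
    and ip_scale: "F \<in> V \<Longrightarrow> G \<in> V \<Longrightarrow> ip F (\<lambda>x. c * G x) = c * ip F G"
    and ip_cnj: "F \<in> V \<Longrightarrow> G \<in> V \<Longrightarrow> ip G F = cnj (ip F G)"
    and ip_nonneg: "F \<in> V \<Longrightarrow> Re (ip F F) \<ge> 0"
begin

text \<open>A seminorm in general: \<open>ip_nonneg\<close> asks for semidefiniteness only, so that
  functions equal almost everywhere may stay distinct.\<close>

definition nrm where "nrm F = sqrt (Re (ip F F))"

lemma nrm_nonneg: "F \<in> V \<Longrightarrow> nrm F \<ge> 0"
  by (simp add: nrm_def ip_nonneg)

lemma nrm_sq: "F \<in> V \<Longrightarrow> (nrm F)\<^sup>2 = Re (ip F F)"
  by (simp add: nrm_def ip_nonneg)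

lemma ip_self: "F \<in> V \<Longrightarrow> ip F F = of_real ((nrm F)\<^sup>2)"
  using ip_cnj[of F F] by (auto simp: nrm_sq complex_eq_iff)

lemma diff_mem: "F \<in> V \<Longrightarrow> G \<in> V \<Longrightarrow> (\<lambda>x. F x - G x) \<in> V"
  using add_mem[of F "\<lambda>x. -1 * G x"] scale_mem[of G "-1"] by simp

lemma ip_diff: "F \<in> V \<Longrightarrow> G \<in> V \<Longrightarrow> H \<in> V \<Longrightarrow> ip F (\<lambda>x. G x - H x) = ip F G - ip F H"
  using ip_add[of F G "\<lambda>x. -1 * H x"] ip_scale[of F H "-1"] scale_mem[of H "-1"] by simp

lemma ip_add_left: "F \<in> V \<Longrightarrow> G \<in> V \<Longrightarrow> H \<in> V \<Longrightarrow> ip (\<lambda>x. G x + H x) F = ip G F + ip H F"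
  by (metis (no_types, lifting) add_mem complex_cnj_add ip_add ip_cnj)

lemma ip_scale_left: "F \<in> V \<Longrightarrow> G \<in> V \<Longrightarrow> ip (\<lambda>x. c * G x) F = cnj c * ip G F"
  by (metis (no_types, lifting) scale_mem complex_cnj_mult ip_scale ip_cnj)

lemma ip_diff_left: "F \<in> V \<Longrightarrow> G \<in> V \<Longrightarrow> H \<in> V \<Longrightarrow> ip (\<lambda>x. G x - H x) F = ip G F - ip H F"
  by (metis (no_types, lifting) diff_mem complex_cnj_diff ip_diff ip_cnj)

lemma ip_zero: "F \<in> V \<Longrightarrow> ip F (\<lambda>x. 0) = 0"
  using ip_scale[of F "\<lambda>x. 0" 0] zero_mem by simp

lemma nrm_zero: "nrm (\<lambda>x. 0) = 0"
  by (simp add: nrm_def ip_zero zero_mem)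

text \<open>The single expansion from which Cauchy-Schwarz, the triangle inequality, homogeneity and
  the variational steps of \<open>riesz_cauchy\<close> are read off by choosing
  \<open>c\<close>.\<close>

lemma nrm_sq_add_scale:
  assumes "F \<in> V" "G \<in> V"
  shows "(nrm (\<lambda>x. F x + c * G x))\<^sup>2 = (nrm F)\<^sup>2 + 2 * Re (c * ip F G) + (cmod c)\<^sup>2 * (nrm G)\<^sup>2"
proof -
  have cG: "(\<lambda>x. c * G x) \<in> V" by (rule scale_mem[OF assms(2)])
  have s: "(\<lambda>x. F x + c * G x) \<in> V" by (rule add_mem[OF assms(1) cG])
  have "ip (\<lambda>x. F x + c * G x) (\<lambda>x. F x + c * G x)
      = ip F F + c * ip F G + cnj c * ip G F + cnj c * c * ip G G"
    using assms cG s by (simp add: ip_add ip_add_left ip_scale ip_scale_left algebra_simps)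
  also have "Re \<dots> = (nrm F)\<^sup>2 + 2 * Re (c * ip F G) + (cmod c)\<^sup>2 * (nrm G)\<^sup>2"
  proof -
    have "cnj c * c = of_real ((cmod c)\<^sup>2)"
      by (subst mult.commute) (rule complex_norm_square[symmetric])
    then have "Re (cnj c * c * ip G G) = (cmod c)\<^sup>2 * (nrm G)\<^sup>2"
      using assms by (simp add: nrm_sq)
    moreover have "Re (cnj c * ip G F) = Re (c * ip F G)"
      using ip_cnj[OF assms] by simp
    ultimately show ?thesis using assms by (simp add: nrm_sq)
  qed
  finally show ?thesis using s by (simp add: nrm_sq)
qed

lemma cauchy_schwarz:
  assumes F: "F \<in> V" and G: "G \<in> V"
  shows "cmod (ip F G) \<le> nrm F * nrm G"
proof -
  let ?d = "ip F G" let ?a = "(cmod (ip F G))\<^sup>2"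
  \<comment> \<open>The factor \<open>cnj ?d\<close> cancels the phase of \<open>ip F G\<close>,
    which leaves a real quadratic polynomial in \<open>t\<close>.\<close>
  have key: "0 \<le> (nrm F)\<^sup>2 - 2 * t * ?a + t\<^sup>2 * ?a * (nrm G)\<^sup>2" for t :: real
  proof -
    have "0 \<le> (nrm (\<lambda>x. F x + (- of_real t * cnj ?d) * G x))\<^sup>2" by simp
    also have "\<dots> = (nrm F)\<^sup>2 + 2 * Re ((- of_real t * cnj ?d) * ?d)
        + (cmod (- of_real t * cnj ?d))\<^sup>2 * (nrm G)\<^sup>2"
      by (rule nrm_sq_add_scale[OF F G])
    also have "(- of_real t * cnj ?d) * ?d = of_real (- t * ?a)"
      by (simp add: complex_norm_square mult.commute del: of_real_power)
    also have "(cmod (- of_real t * cnj ?d))\<^sup>2 = t\<^sup>2 * ?a"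
      by (simp add: norm_mult power_mult_distrib)
    finally show ?thesis by simp
  qed
  have "?a \<le> (nrm F)\<^sup>2 * (nrm G)\<^sup>2"
  proof (cases "nrm G = 0")
    case True
    \<comment> \<open>For a null vector \<open>G\<close> the polynomial is affine in
      \<open>t\<close>; the \<open>t\<close> chosen below would give it the value -1.\<close>
    have "?a \<le> 0"
    proof (rule ccontr)
      assume "\<not> ?a \<le> 0"
      then have "?a > 0" by simp
      with key[of "((nrm F)\<^sup>2 + 1) / (2 * ?a)"] True show False by (simp add: field_simps)
    qed
    then show ?thesis using True by simp
  next
    case False
    then have g: "(nrm G)\<^sup>2 > 0" by simp
    have "0 \<le> (nrm F)\<^sup>2 - ?a / (nrm G)\<^sup>2"
    proof -
      have "(1 / (nrm G)\<^sup>2)\<^sup>2 * ?a * (nrm G)\<^sup>2 = ?a / (nrm G)\<^sup>2"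
        using g by (simp add: power2_eq_square)
      then show ?thesis using key[of "1 / (nrm G)\<^sup>2"] by simp
    qed
    then show ?thesis using g by (simp add: field_simps)
  qed
  then have "(cmod ?d)\<^sup>2 \<le> (nrm F * nrm G)\<^sup>2" by (simp add: power_mult_distrib)
  then show ?thesis by (rule power2_le_imp_le) (simp add: nrm_nonneg F G)
qed

lemma nrm_triangle:
  assumes F: "F \<in> V" and G: "G \<in> V"
  shows "nrm (\<lambda>x. F x + G x) \<le> nrm F + nrm G"
proof -
  have "(nrm (\<lambda>x. F x + G x))\<^sup>2 = (nrm F)\<^sup>2 + 2 * Re (ip F G) + (nrm G)\<^sup>2"
    using nrm_sq_add_scale[OF F G, of 1] by simp
  also have "\<dots> \<le> (nrm F)\<^sup>2 + 2 * (nrm F * nrm G) + (nrm G)\<^sup>2"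
    using cauchy_schwarz[OF F G] complex_Re_le_cmod[of "ip F G"] by linarith
  also have "\<dots> = (nrm F + nrm G)\<^sup>2" by (simp add: power2_sum)
  finally show ?thesis
    by (rule power2_le_imp_le) (simp add: nrm_nonneg F G)
qed

lemma nrm_scale: "F \<in> V \<Longrightarrow> nrm (\<lambda>x. c * F x) = cmod c * nrm F"
  using nrm_sq_add_scale[OF zero_mem, of F c]
  by (simp add: nrm_zero ip_scale_left ip_cnj[OF _ zero_mem] ip_zero zero_mem real_sqrt_mult
      flip: power_mult_distrib)
     (metis nrm_nonneg scale_mem norm_ge_zero mult_nonneg_nonneg power2_eq_iff_nonneg)

lemma nrm_minus: "F \<in> V \<Longrightarrow> G \<in> V \<Longrightarrow> nrm (\<lambda>x. F x - G x) = nrm (\<lambda>x. G x - F x)"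
  using nrm_scale[OF diff_mem[of G F], of "-1"] by simp

lemma nrm_le_add_diff: "F \<in> V \<Longrightarrow> G \<in> V \<Longrightarrow> nrm F \<le> nrm (\<lambda>x. F x - G x) + nrm G"
  using nrm_triangle[OF diff_mem[of F G], of G] by simp

definition cauchy_in :: "(nat \<Rightarrow> 'x \<Rightarrow> complex) \<Rightarrow> bool" where
  "cauchy_in S \<longleftrightarrow> (\<forall>n. S n \<in> V) \<and>
     (\<forall>e>0. \<exists>N. \<forall>m\<ge>N. \<forall>n\<ge>N. nrm (\<lambda>x. S m x - S n x) < e)"

definition converges_in :: "(nat \<Rightarrow> 'x \<Rightarrow> complex) \<Rightarrow> ('x \<Rightarrow> complex) \<Rightarrow> bool" where
  "converges_in S F \<longleftrightarrow> (\<lambda>n. nrm (\<lambda>x. S n x - F x)) \<longlonglongrightarrow> 0"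

lemma converges_in_ip:
  assumes S: "\<And>n. S n \<in> V" and F: "F \<in> V" and G: "G \<in> V" and c: "converges_in S F"
  shows "(\<lambda>n. ip (S n) G) \<longlonglongrightarrow> ip F G"
proof -
  have "(\<lambda>n. ip (S n) G - ip F G) \<longlonglongrightarrow> 0"
  proof (rule Lim_null_comparison)
    show "\<forall>\<^sub>F n in sequentially. norm (ip (S n) G - ip F G) \<le> nrm (\<lambda>x. S n x - F x) * nrm G"
      using cauchy_schwarz[OF diff_mem[OF S F] G] by (simp add: ip_diff_left S F G)
    show "(\<lambda>n. nrm (\<lambda>x. S n x - F x) * nrm G) \<longlonglongrightarrow> 0"
      using tendsto_mult_right[OF c[unfolded converges_in_def], of "nrm G"] by simp
  qed
  then show ?thesis by (simp add: LIM_zero_iff)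
qed

text \<open>Riesz representation without completeness: a minimising sequence of
  \<open>\<parallel>F\<parallel>\<^sup>2 - 2 Re (L F)\<close> is Cauchy by the parallelogram identity.\<close>

lemma riesz_cauchy:
  fixes L :: "('x \<Rightarrow> complex) \<Rightarrow> complex"
  assumes L_add: "\<And>F G. F \<in> V \<Longrightarrow> G \<in> V \<Longrightarrow> L (\<lambda>x. F x + G x) = L F + L G"
    and L_scale: "\<And>F c. F \<in> V \<Longrightarrow> L (\<lambda>x. c * F x) = c * L F"
    and L_bound: "\<And>F. F \<in> V \<Longrightarrow> cmod (L F) \<le> B * nrm F"
  obtains S where "cauchy_in S" "\<And>F. F \<in> V \<Longrightarrow> (\<lambda>n. ip (S n) F) \<longlonglongrightarrow> L F"
proof -
  define P where "P F = (nrm F)\<^sup>2 - 2 * Re (L F)" for F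
  have P_lower: "P F \<ge> - B\<^sup>2" if "F \<in> V" for F
  proof -
    have "Re (L F) \<le> B * nrm F" using L_bound[OF that] complex_Re_le_cmod[of "L F"] by linarith
    then have "P F \<ge> (nrm F)\<^sup>2 - 2 * (B * nrm F)" by (simp add: P_def)
    also have "(nrm F)\<^sup>2 - 2 * (B * nrm F) = (nrm F - B)\<^sup>2 - B\<^sup>2" by (simp add: power2_eq_square algebra_simps)
    finally show ?thesis using zero_le_power2[of "nrm F - B"] by linarith
  qed
  define m where "m = Inf (P ` V)"
  have bdd: "bdd_below (P ` V)" using P_lower by (auto intro!: bdd_belowI[of _ "- B\<^sup>2"])
  have ne: "P ` V \<noteq> {}" using zero_mem by auto
  have m_le: "m \<le> P F" if "F \<in> V" for F
    unfolding m_def using that bdd by (auto intro: cInf_lower)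
  have "\<exists>F\<in>V. P F < m + 1 / Suc n" for n
    using cInf_lessD[OF ne, of "m + 1 / Suc n"] by (auto simp: m_def)
  then obtain S where S: "\<And>n. S n \<in> V" and PS: "\<And>n. P (S n) < m + 1 / Suc n" by metis
  have par: "(nrm (\<lambda>x. S j x - S k x))\<^sup>2 \<le> 2 / Suc j + 2 / Suc k" for j k
  proof -
    let ?a = "S j" let ?b = "S k"
    let ?h = "\<lambda>x. (1/2) * (?a x + ?b x)"
    have sV: "(\<lambda>x. ?a x + ?b x) \<in> V" by (rule add_mem[OF S S])
    have h: "?h \<in> V" by (rule scale_mem[OF sV])
    have "(nrm (\<lambda>x. ?a x - ?b x))\<^sup>2 = (nrm ?a)\<^sup>2 - 2 * Re (ip ?a ?b) + (nrm ?b)\<^sup>2"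
      using nrm_sq_add_scale[OF S[of j] S[of k], of "-1"] by simp
    moreover have "(nrm (\<lambda>x. ?a x + ?b x))\<^sup>2 = (nrm ?a)\<^sup>2 + 2 * Re (ip ?a ?b) + (nrm ?b)\<^sup>2"
      using nrm_sq_add_scale[OF S[of j] S[of k], of "1"] by simp
    moreover have "4 * (nrm ?h)\<^sup>2 = (nrm (\<lambda>x. ?a x + ?b x))\<^sup>2"
      by (subst nrm_scale[OF sV]) (simp add: power_mult_distrib power2_eq_square)
    moreover have "2 * L ?h = L ?a + L ?b"
      unfolding L_scale[OF sV] L_add[OF S S] by simp
    then have "Re (2 * L ?h) = Re (L ?a + L ?b)" by (rule arg_cong)
    then have "2 * Re (L ?h) = Re (L ?a) + Re (L ?b)" by simp
    ultimately have "(nrm (\<lambda>x. ?a x - ?b x))\<^sup>2 = 2 * P ?a + 2 * P ?b - 4 * P ?h"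
      by (simp add: P_def)
    also have "\<dots> \<le> 2 * (m + 1 / Suc j) + 2 * (m + 1 / Suc k) - 4 * m"
      by (intro diff_mono add_mono mult_left_mono less_imp_le[OF PS] m_le[OF h]) auto
    finally show ?thesis by simp
  qed
  have inv_tendsto: "(\<lambda>n. 1 / real (Suc n)) \<longlonglongrightarrow> 0" by (rule LIMSEQ_Suc[OF lim_1_over_n])
  have "cauchy_in S"
    unfolding cauchy_in_def
  proof (intro conjI allI impI S)
    fix e :: real assume e: "e > 0"
    obtain N where N: "4 / real (Suc N) < e\<^sup>2"
    proof -
      have "eventually (\<lambda>n. 1 / real (Suc n) < e\<^sup>2 / 4) sequentially"
        by (rule order_tendstoD(2)[OF inv_tendsto]) (use e in simp)
      then obtain N where "1 / real (Suc N) < e\<^sup>2 / 4" using eventually_sequentially by auto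
      then show ?thesis using that[of N] by simp
    qed
    show "\<exists>N. \<forall>m\<ge>N. \<forall>n\<ge>N. nrm (\<lambda>x. S m x - S n x) < e"
    proof (intro exI[of _ N] allI impI)
      fix j k assume jk: "N \<le> j" "N \<le> k"
      have "2 / real (Suc j) \<le> 2 / real (Suc N)" "2 / real (Suc k) \<le> 2 / real (Suc N)"
        using jk by (auto intro!: divide_left_mono)
      with par[of j k] have "(nrm (\<lambda>x. S j x - S k x))\<^sup>2 \<le> 4 / real (Suc N)" by linarith
      with N have "(nrm (\<lambda>x. S j x - S k x))\<^sup>2 < e\<^sup>2" by linarith
      then show "nrm (\<lambda>x. S j x - S k x) < e" by (rule power_less_imp_less_base) (use e in simp)
    qed
  qed
  moreover have "(\<lambda>n. ip (S n) F) \<longlonglongrightarrow> L F" if F: "F \<in> V" for F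
  proof -
    have "(cmod (ip (S n) F - L F))\<^sup>2 \<le> ((nrm F)\<^sup>2 + 1) * (1 / Suc n)" for n
    proof -
      \<comment> \<open>Moving \<open>S n\<close> along \<open>F\<close> can lower \<open>P\<close>
        by less than 1 / (n + 1), as \<open>m\<close> is the infimum. With the phase of
        \<open>c\<close> opposite to that of the linear term and step \<open>?s\<close>, the
        quadratic term costs at most half of the linear gain; the 1 in \<open>?s\<close> covers
        \<open>nrm F = 0\<close>.\<close>
      let ?d = "ip (S n) F - L F" let ?s = "1 / ((nrm F)\<^sup>2 + 1)"
      define c where "c = - of_real ?s * cnj ?d"
      have cF: "(\<lambda>x. c * F x) \<in> V" by (rule scale_mem[OF F])
      have "m \<le> P (\<lambda>x. S n x + c * F x)" by (rule m_le[OF add_mem[OF S cF]])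
      also have "\<dots> = P (S n) + 2 * Re (c * ?d) + (cmod c)\<^sup>2 * (nrm F)\<^sup>2"
        unfolding P_def nrm_sq_add_scale[OF S F] L_add[OF S cF] L_scale[OF F]
        by (simp add: algebra_simps)
      also have "c * ?d = of_real (- ?s * (cmod ?d)\<^sup>2)"
        by (simp add: c_def complex_norm_square mult.commute del: of_real_power)
      also have "(cmod c)\<^sup>2 = ?s\<^sup>2 * (cmod ?d)\<^sup>2"
        by (simp only: c_def norm_mult norm_minus_cancel norm_of_real complex_mod_cnj power_mult_distrib power2_abs)
      finally have "0 \<le> 1 / Suc n - 2 * ?s * (cmod ?d)\<^sup>2 + ?s\<^sup>2 * (cmod ?d)\<^sup>2 * (nrm F)\<^sup>2"
        using PS[of n] by simp
      moreover have "?s\<^sup>2 * (cmod ?d)\<^sup>2 * (nrm F)\<^sup>2 \<le> ?s * (cmod ?d)\<^sup>2"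
      proof -
        have pos: "(nrm F)\<^sup>2 + 1 > 0" by (simp add: add_nonneg_pos)
        have "?s * (nrm F)\<^sup>2 \<le> 1" using pos by (simp add: field_simps)
        then have "?s * (cmod ?d)\<^sup>2 * (?s * (nrm F)\<^sup>2) \<le> ?s * (cmod ?d)\<^sup>2 * 1"
          by (intro mult_left_mono) (use pos in auto)
        then show ?thesis by (simp add: power2_eq_square algebra_simps)
      qed
      ultimately have "?s * (cmod ?d)\<^sup>2 \<le> 1 / Suc n" by linarith
      moreover have "(nrm F)\<^sup>2 + 1 > 0" by (simp add: add_nonneg_pos)
      ultimately show ?thesis by (simp add: field_simps)
    qed
    moreover have "(\<lambda>n. ((nrm F)\<^sup>2 + 1) * (1 / Suc n)) \<longlonglongrightarrow> 0"
      using tendsto_mult_left[OF inv_tendsto, of "(nrm F)\<^sup>2 + 1"] by simp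
    ultimately have "(\<lambda>n. (cmod (ip (S n) F - L F))\<^sup>2) \<longlonglongrightarrow> 0"
      by (intro Lim_null_comparison[of "\<lambda>n. (cmod (ip (S n) F - L F))\<^sup>2"]) auto
    then have "(\<lambda>n. cmod (ip (S n) F - L F)) \<longlonglongrightarrow> 0"
      using tendsto_real_sqrt by fastforce
    then have "(\<lambda>n. ip (S n) F - L F) \<longlonglongrightarrow> 0" by (rule tendsto_norm_zero_cancel)
    then show ?thesis by (simp add: LIM_zero_iff)
  qed
  ultimately show ?thesis using that by blast
qed

end

locale complete_pre_hilbert = pre_hilbert +
  assumes complete: "cauchy_in S \<Longrightarrow> \<exists>F\<in>V. converges_in S F"
begin

lemma riesz:
  fixes L :: "('a \<Rightarrow> complex) \<Rightarrow> complex"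
  assumes L_add: "\<And>F G. F \<in> V \<Longrightarrow> G \<in> V \<Longrightarrow> L (\<lambda>x. F x + G x) = L F + L G"
    and L_scale: "\<And>F c. F \<in> V \<Longrightarrow> L (\<lambda>x. c * F x) = c * L F"
    and L_bound: "\<And>F. F \<in> V \<Longrightarrow> cmod (L F) \<le> B * nrm F"
  obtains P where "P \<in> V" "\<And>F. F \<in> V \<Longrightarrow> ip P F = L F"
proof -
  obtain S where S: "cauchy_in S" and lim: "\<And>F. F \<in> V \<Longrightarrow> (\<lambda>n. ip (S n) F) \<longlonglongrightarrow> L F"
    using riesz_cauchy[OF L_add L_scale L_bound] by blast
  obtain P where P: "P \<in> V" and c: "converges_in S P" using complete[OF S] by blast
  have "S n \<in> V" for n using S by (simp add: cauchy_in_def)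
  then have "ip P F = L F" if "F \<in> V" for F
    using converges_in_ip[OF _ P that c] lim[OF that] LIMSEQ_unique by blast
  then show ?thesis using that P by blast
qed

end

text \<open>Neumann series in the sup-norm weighted by \<open>w\<close>; \<open>Adm\<close> plays the role of measurability.\<close>

lemma weighted_neumann:
  fixes A :: "('x \<Rightarrow> complex) \<Rightarrow> 'x \<Rightarrow> complex" and w :: "'x \<Rightarrow> real"
  assumes w: "\<And>x. w x \<ge> 0"
    and Adm_add: "\<And>F G. Adm F \<Longrightarrow> Adm G \<Longrightarrow> Adm (\<lambda>x. F x + G x)"
    and Adm_diff: "\<And>F G. Adm F \<Longrightarrow> Adm G \<Longrightarrow> Adm (\<lambda>x. F x - G x)"
    and Adm_lim: "\<And>S F. (\<And>n::nat. Adm (S n)) \<Longrightarrow> (\<And>x. (\<lambda>n. S n x) \<longlonglongrightarrow> F x) \<Longrightarrow> Adm F"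
    and Adm_A: "\<And>F c. Adm F \<Longrightarrow> (\<And>x. cmod (F x) \<le> c * w x) \<Longrightarrow> Adm (A F)"
    and A_diff: "\<And>F G c x. Adm F \<Longrightarrow> Adm G \<Longrightarrow> (\<And>x. cmod (F x) \<le> c * w x) \<Longrightarrow>
        (\<And>x. cmod (G x) \<le> c * w x) \<Longrightarrow> A (\<lambda>x. F x - G x) x = A F x - A G x"
    and A_half: "\<And>F c x. Adm F \<Longrightarrow> c \<ge> 0 \<Longrightarrow> (\<And>x. cmod (F x) \<le> c * w x) \<Longrightarrow> cmod (A F x) \<le> c / 2 * w x"
    and g: "Adm g" "\<And>x. cmod (g x) \<le> c0 * w x" and c0: "c0 \<ge> 0"
  obtains F where "Adm F" "\<And>x. cmod (F x) \<le> 2 * c0 * w x" "\<And>x. F x = g x + A F x"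
proof -
  define S where "S n = rec_nat g (\<lambda>_ F x. g x + A F x) n" for n
  have S0: "S 0 = g" and SS: "S (Suc n) = (\<lambda>x. g x + A (S n) x)" for n by (simp_all add: S_def)
  \<comment> \<open>The ball of radius \<open>2 * c0\<close> is invariant because c0 + (2 c0) / 2 =
    2 c0; a common bound is what \<open>A_diff\<close> requires.\<close>
  have inv: "Adm (S n) \<and> (\<forall>x. cmod (S n x) \<le> 2 * c0 * w x)" for n
  proof (induction n)
    case 0
    have "cmod (g x) \<le> 2 * c0 * w x" for x
      using g(2)[of x] mult_nonneg_nonneg[OF c0 w[of x]] by simp
    then show ?case using g by (simp add: S0)
  next
    case (Suc n)
    have "cmod (g x + A (S n) x) \<le> 2 * c0 * w x" for x
      using norm_triangle_ineq[of "g x" "A (S n) x"] g(2)[of x] A_half[of "S n" "2 * c0" x] Suc c0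
      by simp
    moreover have "Adm (\<lambda>x. g x + A (S n) x)"
      by (rule Adm_add[OF g(1) Adm_A]) (use Suc in auto)
    ultimately show ?case by (simp add: SS)
  qed
  have step: "cmod (S (Suc n) x - S n x) \<le> c0 / 2 ^ Suc n * w x" for n x
  proof (induction n arbitrary: x)
    case 0
    show ?case using A_half[of g c0 x] g c0 by (simp add: S0 SS)
  next
    case (Suc n)
    have "S (Suc (Suc n)) x - S (Suc n) x = A (S (Suc n)) x - A (S n) x" by (simp add: SS)
    also have "\<dots> = A (\<lambda>x. S (Suc n) x - S n x) x"
      using inv by (intro A_diff[symmetric, where c = "2 * c0"]) auto
    finally show ?case
      using A_half[of "\<lambda>x. S (Suc n) x - S n x" "c0 / 2 ^ Suc n" x] Suc inv Adm_diff c0 by simp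
  qed
  have summ: "summable (\<lambda>n. S (Suc n) x - S n x)" for x
  proof (rule summable_comparison_test')
    show "summable (\<lambda>n. c0 * w x / 2 * (1/2) ^ n)" by (intro summable_mult summable_geometric) simp
    show "norm (S (Suc n) x - S n x) \<le> c0 * w x / 2 * (1/2) ^ n" if "n \<ge> 0" for n
      using step[of n x] by (simp add: power_divide mult_ac)
  qed
  define F where "F x = lim (\<lambda>n. S n x)" for x
  have lim: "(\<lambda>n. S n x) \<longlonglongrightarrow> F x" for x
  proof -
    have "(\<lambda>n. S n x) = (\<lambda>n. S 0 x + (\<Sum>k<n. S (Suc k) x - S k x))" using sum_lessThan_telescope[of "\<lambda>k. S k x"] by simp
    moreover have "(\<lambda>n. S 0 x + (\<Sum>k<n. S (Suc k) x - S k x)) \<longlonglongrightarrow> S 0 x + (\<Sum>k. S (Suc k) x - S k x)"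
      by (intro tendsto_intros summable_LIMSEQ summ)
    ultimately have "convergent (\<lambda>n. S n x)" unfolding convergent_def by metis
    then show ?thesis by (simp add: F_def convergent_LIMSEQ_iff)
  qed
  have AdmF: "Adm F" by (rule Adm_lim[OF _ lim]) (use inv in auto)
  have Fb: "cmod (F x) \<le> 2 * c0 * w x" for x
    by (rule Lim_bounded[OF tendsto_norm[OF lim], of 0]) (use inv in auto)
  have tail: "cmod (F x - S n x) \<le> c0 / 2 ^ n * w x" for n x
  proof -
    \<comment> \<open>The partial geometric sum carries the factor 1 - 2^-k, with which the
      induction on \<open>k\<close> closes; letting \<open>k\<close> tend to infinity leaves
      \<open>c0 / 2 ^ n\<close>.\<close>
    have "cmod (S (n + k) x - S n x) \<le> c0 * w x / 2 ^ n * (1 - 1 / 2 ^ k)" for k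
    proof (induction k)
      case (Suc k)
      have "cmod (S (n + Suc k) x - S n x) \<le> cmod (S (Suc (n + k)) x - S (n + k) x) + cmod (S (n + k) x - S n x)"
        using norm_triangle_ineq[of "S (Suc (n + k)) x - S (n + k) x" "S (n + k) x - S n x"] by simp
      also have "\<dots> \<le> c0 / 2 ^ Suc (n + k) * w x + c0 * w x / 2 ^ n * (1 - 1 / 2 ^ k)"
        using step[of "n + k" x] Suc by linarith
      also have "\<dots> = c0 * w x / 2 ^ n * (1 - 1 / 2 ^ Suc k)"
        by (simp add: power_add field_simps)
      finally show ?case .
    qed simp
    also have "c0 * w x / 2 ^ n * (1 - 1 / 2 ^ k) \<le> c0 / 2 ^ n * w x" for k
    proof -
      have "c0 * w x / 2 ^ n * (1 - 1 / 2 ^ k) \<le> c0 * w x / 2 ^ n * 1"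
        by (rule mult_left_mono) (use c0 w[of x] in auto)
      then show ?thesis by simp
    qed
    finally have "cmod (S (n + k) x - S n x) \<le> c0 / 2 ^ n * w x" for k .
    moreover have "(\<lambda>k. S (n + k) x - S n x) \<longlonglongrightarrow> F x - S n x"
      using LIMSEQ_ignore_initial_segment[OF lim, of n x] by (intro tendsto_intros) (simp add: add.commute)
    ultimately show ?thesis by (intro Lim_bounded[OF tendsto_norm, of _ _ 0]) auto
  qed
  have "F x = g x + A F x" for x
  proof -
    \<comment> \<open>\<open>A\<close> is continuous along the iterates: by \<open>A_diff\<close>
      and \<open>A_half\<close> the difference obeys half of the bound in
      \<open>tail\<close>.\<close>
    have "(\<lambda>n. A (S n) x - A F x) \<longlonglongrightarrow> 0"
    proof (rule Lim_null_comparison)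
      show "\<forall>\<^sub>F n in sequentially. norm (A (S n) x - A F x) \<le> c0 * w x / 2 * (1/2) ^ n"
      proof (intro always_eventually allI)
        fix n
        have "A (S n) x - A F x = A (\<lambda>x. S n x - F x) x"
          using inv AdmF Fb by (intro A_diff[symmetric, where c = "2 * c0"]) auto
        moreover have "cmod (A (\<lambda>x. S n x - F x) x) \<le> c0 / 2 ^ n / 2 * w x"
          by (rule A_half) (use inv AdmF Adm_diff tail c0 in \<open>auto simp: norm_minus_commute\<close>)
        ultimately show "norm (A (S n) x - A F x) \<le> c0 * w x / 2 * (1/2) ^ n"
          by (simp add: power_divide mult_ac)
      qed
      show "(\<lambda>n. c0 * w x / 2 * (1/2) ^ n) \<longlonglongrightarrow> 0"
        by (intro tendsto_mult_right_zero LIMSEQ_realpow_zero) auto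
    qed
    then have "(\<lambda>n. g x + A (S n) x) \<longlonglongrightarrow> g x + A F x" by (intro tendsto_intros) (simp add: LIM_zero_iff)
    moreover have "(\<lambda>n. g x + A (S n) x) \<longlonglongrightarrow> F x"
      using LIMSEQ_Suc[OF lim[of x]] by (simp add: SS)
    ultimately show ?thesis using LIMSEQ_unique by blast
  qed
  then show ?thesis using that AdmF Fb by blast
qed

text \<open>The uniqueness counterpart of \<open>weighted_neumann\<close>: one bound
  \<open>c0 * w\<close> can be halved for ever. The hypothesis is an implication between bounds on
  \<open>X\<close>, so it applies to functions that satisfy their equation only there.\<close>

lemma halving_imp_zero:
  fixes F :: "'x \<Rightarrow> complex"
  assumes "\<And>x. x \<in> X \<Longrightarrow> cmod (F x) \<le> c0 * w x" "c0 \<ge> 0"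
    and half: "\<And>c x. c \<ge> 0 \<Longrightarrow> (\<And>y. y \<in> X \<Longrightarrow> cmod (F y) \<le> c * w y) \<Longrightarrow> x \<in> X \<Longrightarrow> cmod (F x) \<le> c / 2 * w x"
    and x: "x \<in> X"
  shows "F x = 0"
proof -
  have "\<forall>x\<in>X. cmod (F x) \<le> c0 / 2 ^ n * w x" for n
  proof (induction n)
    case (Suc n)
    show ?case using half[of "c0 / 2 ^ n"] Suc assms(2) by (auto simp: field_simps)
  qed (use assms in auto)
  then have b: "cmod (F x) \<le> c0 * w x * (1/2) ^ n" for n using x by (auto simp: power_divide)
  have "(\<lambda>n. c0 * w x * (1/2) ^ n) \<longlonglongrightarrow> 0"
    by (intro tendsto_mult_right_zero LIMSEQ_realpow_zero) auto
  then have "cmod (F x) \<le> 0" by (rule LIMSEQ_le_const) (use b in auto)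
  then show ?thesis by simp
qed

section \<open>Square-integrable functions\<close>

text \<open>Over a general measure because two are in play: Lebesgue measure on (0,T) for controls
  and states, and on the whole line for boundary values divided by E.\<close>

definition sqint :: "'a measure \<Rightarrow> ('a \<Rightarrow> complex) set" where
  "sqint M = {f. f \<in> borel_measurable M \<and> integrable M (\<lambda>x. (cmod (f x))\<^sup>2)}"

definition sq_inner :: "'a measure \<Rightarrow> ('a \<Rightarrow> complex) \<Rightarrow> ('a \<Rightarrow> complex) \<Rightarrow> complex" where
  "sq_inner M f g = (LINT x|M. cnj (f x) * g x)"

lemma borel_measurable_cnj [measurable (raw)]:
  "f \<in> borel_measurable M \<Longrightarrow> (\<lambda>x. cnj (f x)) \<in> borel_measurable M"
  by (rule measurable_compose[OF _ borel_measurable_continuous_onI]) (auto intro: continuous_intros)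

lemma sqint_measurable: "f \<in> sqint M \<Longrightarrow> f \<in> borel_measurable M"
  by (simp add: sqint_def)

lemma sqint_integrable: "f \<in> sqint M \<Longrightarrow> integrable M (\<lambda>x. (cmod (f x))\<^sup>2)"
  by (simp add: sqint_def)

lemma cmod_mult_le_squares: "cmod a * cmod b \<le> ((cmod a)\<^sup>2 + (cmod b)\<^sup>2) / 2"
  using sum_squares_bound[of "cmod a" "cmod b"] by simp

lemma sqint_product_integrable:
  assumes f: "f \<in> sqint M" and g: "g \<in> sqint M"
  shows "integrable M (\<lambda>x. cnj (f x) * g x)"
proof (rule Bochner_Integration.integrable_bound)
  show "integrable M (\<lambda>x. ((cmod (f x))\<^sup>2 + (cmod (g x))\<^sup>2) / 2)"
    using f g by (auto simp: sqint_def)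
  show "(\<lambda>x. cnj (f x) * g x) \<in> borel_measurable M"
    using f g by (auto simp: sqint_def)
  show "AE x in M. norm (cnj (f x) * g x) \<le> norm (((cmod (f x))\<^sup>2 + (cmod (g x))\<^sup>2) / 2)"
    using cmod_mult_le_squares by (auto simp: norm_mult)
qed

lemma cmod_add_sq_le: "(cmod (a + b))\<^sup>2 \<le> 2 * (cmod a)\<^sup>2 + 2 * (cmod b)\<^sup>2"
proof -
  have "(cmod (a + b))\<^sup>2 \<le> (cmod a + cmod b)\<^sup>2" by (intro power_mono norm_triangle_ineq) auto
  also have "\<dots> \<le> 2 * (cmod a)\<^sup>2 + 2 * (cmod b)\<^sup>2"
    using sum_squares_bound[of "cmod a" "cmod b"] by (simp add: power2_sum)
  finally show ?thesis .
qed

lemma sqint_add: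
  assumes f: "f \<in> sqint M" and g: "g \<in> sqint M"
  shows "(\<lambda>x. f x + g x) \<in> sqint M"
proof -
  have "integrable M (\<lambda>x. (cmod (f x + g x))\<^sup>2)"
  proof (rule Bochner_Integration.integrable_bound)
    show "integrable M (\<lambda>x. 2 * (cmod (f x))\<^sup>2 + 2 * (cmod (g x))\<^sup>2)"
      using f g by (auto simp: sqint_def)
    show "(\<lambda>x. (cmod (f x + g x))\<^sup>2) \<in> borel_measurable M"
      using f g by (auto simp: sqint_def)
    show "AE x in M. norm ((cmod (f x + g x))\<^sup>2) \<le> norm (2 * (cmod (f x))\<^sup>2 + 2 * (cmod (g x))\<^sup>2)"
      using cmod_add_sq_le by auto
  qed
  then show ?thesis using f g by (auto simp: sqint_def)
qed

lemma sqint_scale: "f \<in> sqint M \<Longrightarrow> (\<lambda>x. c * f x) \<in> sqint M"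
  by (auto simp: sqint_def norm_mult power_mult_distrib)

lemma sqint_cnj: "f \<in> sqint M \<Longrightarrow> (\<lambda>x. cnj (f x)) \<in> sqint M"
  by (auto simp: sqint_def)

lemma sq_inner_self: "sq_inner M f f = of_real (LINT x|M. (cmod (f x))\<^sup>2)"
proof -
  have "cnj (f x) * f x = of_real ((cmod (f x))\<^sup>2)" for x
    by (subst mult.commute) (rule complex_norm_square[symmetric])
  then show ?thesis unfolding sq_inner_def by (simp only: integral_complex_of_real)
qed

interpretation sq: pre_hilbert "sqint M" "sq_inner M" for M :: "'a measure"
proof
  show "(\<lambda>x. 0) \<in> sqint M" by (simp add: sqint_def)
next
  fix F G H :: "'a \<Rightarrow> complex" and c
  assume F: "F \<in> sqint M" and G: "G \<in> sqint M"
  show "(\<lambda>x. F x + G x) \<in> sqint M" by (rule sqint_add[OF F G])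
  show "sq_inner M F (\<lambda>x. c * G x) = c * sq_inner M F G"
    by (simp add: sq_inner_def mult.left_commute)
  show "sq_inner M G F = cnj (sq_inner M F G)"
    unfolding sq_inner_def Bochner_Integration.integral_cnj[symmetric]
    by (simp add: mult.commute)
  assume H: "H \<in> sqint M"
  show "sq_inner M F (\<lambda>x. G x + H x) = sq_inner M F G + sq_inner M F H"
    unfolding sq_inner_def distrib_left
    by (intro Bochner_Integration.integral_add sqint_product_integrable F G H)
next
  fix F :: "'a \<Rightarrow> complex" and c
  assume F: "F \<in> sqint M"
  show "(\<lambda>x. c * F x) \<in> sqint M" by (rule sqint_scale[OF F])
  show "0 \<le> Re (sq_inner M F F)" by (simp add: sq_inner_self)
qed

abbreviation sq_nrm :: "'a measure \<Rightarrow> ('a \<Rightarrow> complex) \<Rightarrow> real" where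
  "sq_nrm M \<equiv> pre_hilbert.nrm (sq_inner M)"

lemma sq_nrm_sq: "(sq_nrm M f)\<^sup>2 = (LINT x|M. (cmod (f x))\<^sup>2)"
  by (simp add: sq.nrm_def sq_inner_self)

lemma nn_integral_sq: "f \<in> sqint M \<Longrightarrow> (\<integral>\<^sup>+x. ennreal ((cmod (f x))\<^sup>2) \<partial>M) = ennreal ((sq_nrm M f)\<^sup>2)"
  unfolding sq_nrm_sq by (rule nn_integral_eq_integral) (auto simp: sqint_def)

lemma sqint_of_nn_integral:
  assumes "f \<in> borel_measurable M" "(\<integral>\<^sup>+x. ennreal ((cmod (f x))\<^sup>2) \<partial>M) \<le> ennreal B"
  shows "f \<in> sqint M"
proof -
  have "(\<integral>\<^sup>+x. ennreal (norm ((cmod (f x))\<^sup>2)) \<partial>M) < \<infinity>"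
    using assms(2) by (simp add: order_le_less_trans[OF _ ennreal_less_top])
  then have "integrable M (\<lambda>x. (cmod (f x))\<^sup>2)"
    using assms(1) by (intro integrableI_bounded) auto
  then show ?thesis using assms(1) by (simp add: sqint_def)
qed

lemma sq_nrm_le_of_nn_integral:
  assumes "f \<in> sqint M" "(\<integral>\<^sup>+x. ennreal ((cmod (f x))\<^sup>2) \<partial>M) \<le> ennreal (B\<^sup>2)" "B \<ge> 0"
  shows "sq_nrm M f \<le> B"
proof -
  have "(sq_nrm M f)\<^sup>2 \<le> B\<^sup>2"
    using assms(2) unfolding nn_integral_sq[OF assms(1)] by (subst (asm) ennreal_le_iff) auto
  then show ?thesis using assms(3) by (rule power2_le_imp_le)
qed

lemma sq_nrm_zero_AE:
  assumes f: "f \<in> sqint M" and z: "sq_nrm M f = 0"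
  shows "AE x in M. f x = 0"
proof -
  have "(\<integral>\<^sup>+x. ennreal ((cmod (f x))\<^sup>2) \<partial>M) = 0"
    using nn_integral_sq[OF f] z by simp
  then have "AE x in M. ennreal ((cmod (f x))\<^sup>2) = 0"
    using sqint_measurable[OF f] by (subst (asm) nn_integral_0_iff_AE) auto
  then show ?thesis by eventually_elim auto
qed

lemma sq_inner_cong_AE:
  assumes "AE x in M. f x = f' x" "AE x in M. g x = g' x"
    "f \<in> borel_measurable M" "f' \<in> borel_measurable M" "g \<in> borel_measurable M" "g' \<in> borel_measurable M"
  shows "sq_inner M f g = sq_inner M f' g'"
  unfolding sq_inner_def using assms(1,2)
  by (intro integral_cong_AE) (use assms(3-6) in \<open>auto\<close>)

text \<open>Fatou's lemma, giving membership and norm bound at once. It carries bounds to the limit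
  in the completeness proof and, in \<open>V_subset_DB_ip\<close>, on the real line and on each
  horizontal line.\<close>

lemma sq_nrm_Fatou:
  assumes S: "\<And>n. S n \<in> sqint M" and F: "F \<in> borel_measurable M"
    and lim: "AE x in M. (\<lambda>n. S n x) \<longlonglongrightarrow> F x"
    and bound: "eventually (\<lambda>n. sq_nrm M (S n) \<le> B) sequentially" and B: "B \<ge> 0"
  shows "F \<in> sqint M \<and> sq_nrm M F \<le> B"
proof -
  have "(\<integral>\<^sup>+x. ennreal ((cmod (F x))\<^sup>2) \<partial>M) = (\<integral>\<^sup>+x. liminf (\<lambda>n. ennreal ((cmod (S n x))\<^sup>2)) \<partial>M)"
  proof (rule nn_integral_cong_AE)
    show "AE x in M. ennreal ((cmod (F x))\<^sup>2) = liminf (\<lambda>n. ennreal ((cmod (S n x))\<^sup>2))"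
      using lim
    proof eventually_elim
      case (elim x)
      then have "(\<lambda>n. ennreal ((cmod (S n x))\<^sup>2)) \<longlonglongrightarrow> ennreal ((cmod (F x))\<^sup>2)"
        by (intro tendsto_ennrealI tendsto_intros)
      then show ?case by (intro lim_imp_Liminf[symmetric]) auto
    qed
  qed
  also have "\<dots> \<le> liminf (\<lambda>n. \<integral>\<^sup>+x. ennreal ((cmod (S n x))\<^sup>2) \<partial>M)"
    using S by (intro nn_integral_liminf) (auto simp: sqint_def)
  also have "\<dots> \<le> ennreal (B\<^sup>2)"
  proof (rule order_trans[OF Liminf_le_Limsup Limsup_bounded])
    show "\<forall>\<^sub>F n in sequentially. (\<integral>\<^sup>+x. ennreal ((cmod (S n x))\<^sup>2) \<partial>M) \<le> ennreal (B\<^sup>2)"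
      using bound
    proof eventually_elim
      case (elim n)
      have "(sq_nrm M (S n))\<^sup>2 \<le> B\<^sup>2" by (rule power_mono[OF elim sq.nrm_nonneg[OF S]])
      then show ?case unfolding nn_integral_sq[OF S] by (intro ennreal_leI)
    qed
  qed simp
  finally have le: "(\<integral>\<^sup>+x. ennreal ((cmod (F x))\<^sup>2) \<partial>M) \<le> ennreal (B\<^sup>2)" .
  have "F \<in> sqint M" by (rule sqint_of_nn_integral[OF F le])
  then show ?thesis using sq_nrm_le_of_nn_integral[OF _ le B] by blast
qed

text \<open>Riesz--Fischer: along a subsequence with \<open>\<parallel>d\<^sub>k\<parallel> \<le> 2\<^sup>-\<^sup>k\<close> for the increments \<open>d\<^sub>k\<close>, the sum
  \<open>\<Sum>k. 2\<^sup>k \<bar>d\<^sub>k\<bar>\<^sup>2\<close> has a finite integral, so that \<open>\<bar>d\<^sub>k\<bar> = O(2\<^sup>-\<^sup>k\<^sup>/\<^sup>2)\<close> almost everywhere.\<close>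

lemma sq_complete:
  assumes C: "pre_hilbert.cauchy_in (sqint M) (sq_inner M) S"
  shows "\<exists>F\<in>sqint M. pre_hilbert.converges_in (sq_inner M) S F"
proof -
  have S: "\<And>n. S n \<in> sqint M" using C by (simp add: sq.cauchy_in_def)
  have cau: "\<exists>N. \<forall>m\<ge>N. \<forall>n\<ge>N. sq_nrm M (\<lambda>x. S m x - S n x) < e" if "e > 0" for e
    using C that by (simp add: sq.cauchy_in_def)
  have "\<exists>N. \<forall>k. \<forall>m\<ge>N k. \<forall>n\<ge>N k. sq_nrm M (\<lambda>x. S m x - S n x) < (1/2) ^ k"
    by (intro choice allI cau) simp
  then obtain N where N: "\<And>k m n. m \<ge> N k \<Longrightarrow> n \<ge> N k \<Longrightarrow> sq_nrm M (\<lambda>x. S m x - S n x) < (1/2) ^ k"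
    by blast
  \<comment> \<open>The sum lets \<open>r k\<close> dominate \<open>N k\<close>, and the summand
    \<open>k\<close> makes \<open>r\<close> strictly increasing.\<close>
  define r where "r k = (\<Sum>i\<le>k. N i) + k" for k
  have rN: "N k \<le> r k" for k
    unfolding r_def using member_le_sum[of k "{..k}" N] by auto
  have r_mono: "r k \<le> r (Suc k)" for k by (simp add: r_def)
  define d where "d k x = S (r (Suc k)) x - S (r k) x" for k x
  have d: "d k \<in> sqint M" for k unfolding d_def by (rule sq.diff_mem[OF S S])
  have dn: "(sq_nrm M (d k))\<^sup>2 \<le> (1/4) ^ k" for k
  proof -
    have "sq_nrm M (d k) \<le> (1/2) ^ k"
      unfolding d_def using N[of k "r (Suc k)" "r k"] rN[of k] r_mono[of k] by simp
    then have "(sq_nrm M (d k))\<^sup>2 \<le> ((1/2) ^ k)\<^sup>2" by (rule power_mono[OF _ sq.nrm_nonneg[OF d]])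
    also have "((1/2) ^ k)\<^sup>2 = (1/4::real) ^ k" by (simp add: power2_eq_square flip: power_mult_distrib)
    finally show ?thesis .
  qed
  have dm: "d k \<in> borel_measurable M" for k by (rule sqint_measurable[OF d])
  have "(\<integral>\<^sup>+x. (\<Sum>k. ennreal (2 ^ k * (cmod (d k x))\<^sup>2)) \<partial>M)
      = (\<Sum>k. \<integral>\<^sup>+x. ennreal (2 ^ k * (cmod (d k x))\<^sup>2) \<partial>M)"
    using dm by (intro nn_integral_suminf) auto
  also have "\<dots> \<le> (\<Sum>k. ennreal ((1/2) ^ k))"
  proof (rule suminf_le)
    fix k
    have "(\<integral>\<^sup>+x. ennreal (2 ^ k * (cmod (d k x))\<^sup>2) \<partial>M) = ennreal (2 ^ k) * (\<integral>\<^sup>+x. ennreal ((cmod (d k x))\<^sup>2) \<partial>M)"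
      using dm by (simp add: ennreal_mult nn_integral_cmult)
    also have "\<dots> = ennreal (2 ^ k * (sq_nrm M (d k))\<^sup>2)"
      by (simp add: nn_integral_sq[OF d] ennreal_mult)
    also have "\<dots> \<le> ennreal (2 ^ k * (1/4) ^ k)"
      by (intro ennreal_leI mult_left_mono dn) simp
    also have "2 ^ k * (1/4) ^ k = (1/2::real) ^ k" by (simp flip: power_mult_distrib)
    finally show "(\<integral>\<^sup>+x. ennreal (2 ^ k * (cmod (d k x))\<^sup>2) \<partial>M) \<le> ennreal ((1/2) ^ k)" .
  qed auto
  also have "\<dots> = ennreal (\<Sum>k. (1/2) ^ k)"
    by (rule suminf_ennreal2) (auto intro!: summable_geometric)
  also have "\<dots> < \<infinity>" by simp
  finally have "(\<integral>\<^sup>+x. (\<Sum>k. ennreal (2 ^ k * (cmod (d k x))\<^sup>2)) \<partial>M) \<noteq> \<infinity>" by simp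
  then have "AE x in M. (\<Sum>k. ennreal (2 ^ k * (cmod (d k x))\<^sup>2)) \<noteq> \<infinity>"
    using dm by (intro nn_integral_PInf_AE) auto
  then have conv: "AE x in M. convergent (\<lambda>k. S (r k) x)"
  proof eventually_elim
    case (elim x)
    define c where "c = enn2real (\<Sum>k. ennreal (2 ^ k * (cmod (d k x))\<^sup>2))"
    have c: "(\<Sum>k. ennreal (2 ^ k * (cmod (d k x))\<^sup>2)) = ennreal c"
      unfolding c_def using elim by (simp add: top.not_eq_extremum)
    have c0: "c \<ge> 0" by (simp add: c_def)
    have "2 ^ k * (cmod (d k x))\<^sup>2 \<le> c" for k
    proof -
      have "sum (\<lambda>k. ennreal (2 ^ k * (cmod (d k x))\<^sup>2)) {k} \<le> (\<Sum>k. ennreal (2 ^ k * (cmod (d k x))\<^sup>2))"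
        by (rule sum_le_suminf[OF summableI]) auto
      then have "ennreal (2 ^ k * (cmod (d k x))\<^sup>2) \<le> (\<Sum>k. ennreal (2 ^ k * (cmod (d k x))\<^sup>2))"
        by (simp only: sum.insert[OF finite.emptyI] sum.empty empty_iff not_False_eq_True add_0_right)
      then show ?thesis unfolding c using c0 by simp
    qed
    then have b: "cmod (d k x) \<le> sqrt c * sqrt (1/2) ^ k" for k
    proof -
      have "(cmod (d k x))\<^sup>2 \<le> c * (1/2) ^ k"
        using \<open>2 ^ k * (cmod (d k x))\<^sup>2 \<le> c\<close> by (simp add: field_simps)
      then have "sqrt ((cmod (d k x))\<^sup>2) \<le> sqrt (c * (1/2) ^ k)" by (rule real_sqrt_le_mono)
      then show ?thesis by (simp add: real_sqrt_mult real_sqrt_power)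
    qed
    have "summable (\<lambda>k. d k x)"
    proof (rule summable_comparison_test')
      show "summable (\<lambda>k. sqrt c * sqrt (1/2) ^ k)"
        by (intro summable_mult summable_geometric) (simp add: real_sqrt_divide)
    qed (use b in auto)
    then have "(\<lambda>n. S (r 0) x + (\<Sum>k<n. d k x)) \<longlonglongrightarrow> S (r 0) x + (\<Sum>k. d k x)"
      by (intro tendsto_intros summable_LIMSEQ)
    moreover have "(\<lambda>n. S (r 0) x + (\<Sum>k<n. d k x)) = (\<lambda>n. S (r n) x)"
      unfolding d_def by (simp only: sum_lessThan_telescope[of "\<lambda>k. S (r k) x"]) simp
    ultimately show ?case by (metis convergentI)
  qed
  define F where "F x = lim (\<lambda>k. S (r k) x)" for x
  have Fm: "F \<in> borel_measurable M"
    unfolding F_def by (rule borel_measurable_lim_metric) (use sqint_measurable[OF S] in auto) 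
  have lim: "AE x in M. (\<lambda>k. S (r k) x) \<longlonglongrightarrow> F x"
    using conv by eventually_elim (simp add: F_def convergent_LIMSEQ_iff)
  have r_ge: "r k \<ge> k" for k by (simp add: r_def)
  \<comment> \<open>Fatou along the subsequence for each fixed \<open>n\<close>; this way the whole
    sequence converges and not only the subsequence.\<close>
  have close: "\<exists>n0. \<forall>n\<ge>n0. (\<lambda>x. F x - S n x) \<in> sqint M \<and> sq_nrm M (\<lambda>x. F x - S n x) \<le> e" if e: "e > 0" for e
  proof -
    obtain n0 where n0: "\<And>m n. m \<ge> n0 \<Longrightarrow> n \<ge> n0 \<Longrightarrow> sq_nrm M (\<lambda>x. S m x - S n x) < e"
      using cau[OF e] by blast
    have "(\<lambda>x. F x - S n x) \<in> sqint M \<and> sq_nrm M (\<lambda>x. F x - S n x) \<le> e" if n: "n \<ge> n0" for n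
    proof (rule sq_nrm_Fatou)
      show "(\<lambda>x. S (r k) x - S n x) \<in> sqint M" for k by (rule sq.diff_mem[OF S S])
      show "(\<lambda>x. F x - S n x) \<in> borel_measurable M" using Fm sqint_measurable[OF S] by auto
      show "AE x in M. (\<lambda>k. S (r k) x - S n x) \<longlonglongrightarrow> F x - S n x"
        using lim by eventually_elim (intro tendsto_intros)
      show "\<forall>\<^sub>F k in sequentially. sq_nrm M (\<lambda>x. S (r k) x - S n x) \<le> e"
        unfolding eventually_sequentially
      proof (intro exI[of _ n0] allI impI)
        fix k assume "n0 \<le> k"
        then have "n0 \<le> r k" using r_ge[of k] by linarith
        then show "sq_nrm M (\<lambda>x. S (r k) x - S n x) \<le> e" using n0[of "r k" n] n by linarith
      qed
    qed (use e in auto)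
    then show ?thesis by blast
  qed
  obtain n1 where n1: "(\<lambda>x. F x - S n1 x) \<in> sqint M" using close[of 1] by auto
  have F: "F \<in> sqint M" using sqint_add[OF n1 S[of n1]] by simp
  have "sq.converges_in M S F"
    unfolding sq.converges_in_def
  proof (rule LIMSEQ_I)
    fix e :: real assume e: "e > 0"
    obtain n0 where n0: "\<And>n. n \<ge> n0 \<Longrightarrow> sq_nrm M (\<lambda>x. F x - S n x) \<le> e / 2"
      using close[of "e / 2"] e by auto
    show "\<exists>no. \<forall>n\<ge>no. norm (sq_nrm M (\<lambda>x. S n x - F x) - 0) < e"
    proof (intro exI[of _ n0] allI impI)
      fix n assume "n0 \<le> n"
      then show "norm (sq_nrm M (\<lambda>x. S n x - F x) - 0) < e"
        using n0[of n] e sq.nrm_minus[OF S[of n] F] sq.nrm_nonneg[OF sq.diff_mem[OF F S[of n]]] by simp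
    qed
  qed
  then show ?thesis using F by blast
qed

interpretation sq: complete_pre_hilbert "sqint M" "sq_inner M" for M :: "'a measure"
  by unfold_locales (rule sq_complete)

abbreviation lebI :: "real \<Rightarrow> real measure" where
  "lebI T \<equiv> restrict_space lborel {0<..<T}"

lemma L2_eq_sqint: "L2 T = sqint (lebI T)"
proof -
  have "set_borel_measurable lborel {0<..<T} f \<longleftrightarrow> f \<in> borel_measurable (lebI T)" for f :: "real \<Rightarrow> complex"
    by (simp add: set_borel_measurable_def borel_measurable_restrict_space_iff)
  moreover have "set_integrable lborel {0<..<T} f \<longleftrightarrow> integrable (lebI T) f" for f :: "real \<Rightarrow> real"
    by (simp add: set_integrable_def integrable_restrict_space)
  ultimately show ?thesis by (simp add: L2_def sqint_def)
qed

lemma lebI_integral: "(LINT t:{0<..<T}|lborel. f t) = integral\<^sup>L (lebI T) f" for f :: "real \<Rightarrow> complex"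
  by (simp add: set_lebesgue_integral_def integral_restrict_space)

lemma L2_inner_eq: "L2_inner T = sq_inner (lebI T)"
  by (simp add: fun_eq_iff L2_inner_def sq_inner_def lebI_integral)

lemma eq_on_interval_iff: "eq_on_interval T f g \<longleftrightarrow> (AE t in lebI T. f t = g t)"
  by (simp add: eq_on_interval_def AE_restrict_space_iff)

section \<open>Hardy functions and de Branges spaces\<close>

lemma nn_integral_arctan_half: "(\<integral>\<^sup>+t. ennreal (1 / (1 + t\<^sup>2)) * indicator {0..} t \<partial>lborel) = ennreal (pi / 2)"
proof -
  have "(\<integral>\<^sup>+t. ennreal (1 / (1 + t\<^sup>2)) * indicator {0..} t \<partial>lborel) = ennreal (pi / 2 - arctan 0)"
  proof (rule nn_integral_FTC_atLeast)
    show "(arctan \<longlongrightarrow> pi / 2) at_top" by (rule tendsto_arctan_at_top)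
    show "(arctan has_real_derivative 1 / (1 + x\<^sup>2)) (at x)" for x
      using DERIV_arctan[of x] by (simp add: inverse_eq_divide)
  qed auto
  then show ?thesis by simp
qed

lemma nn_integral_arctan: "(\<integral>\<^sup>+t. ennreal (1 / (1 + t\<^sup>2)) \<partial>lborel) = ennreal pi"
proof -
  let ?f = "\<lambda>t::real. ennreal (1 / (1 + t\<^sup>2))"
  have "(\<integral>\<^sup>+t. ?f t \<partial>lborel) = (\<integral>\<^sup>+t. ?f t * indicator {0..} t + ?f t * indicator {..0} t \<partial>lborel)"
    using AE_lborel_singleton[of "0::real"]
    by (intro nn_integral_cong_AE) (auto elim!: eventually_mono simp: indicator_def)
  also have "\<dots> = (\<integral>\<^sup>+t. ?f t * indicator {0..} t \<partial>lborel) + (\<integral>\<^sup>+t. ?f t * indicator {..0} t \<partial>lborel)"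
    by (rule nn_integral_add) auto
  also have "(\<integral>\<^sup>+t. ?f t * indicator {..0} t \<partial>lborel) = (\<integral>\<^sup>+t. ?f t * indicator {0..} t \<partial>lborel)"
    by (subst nn_integral_real_affine[where c = "-1" and t = 0])
       (auto intro!: nn_integral_cong simp: indicator_def)
  finally show ?thesis by (simp add: nn_integral_arctan_half flip: ennreal_plus)
qed

text \<open>Substitution x = u + v t. The integrand is pi times the Poisson kernel; it gives both
  the L_2 norm of 1 / (x - w) on horizontal lines and the total mass in
  \<open>hardy_boundary\<close>.\<close>

lemma nn_integral_poisson:
  assumes v: "v > 0"
  shows "(\<integral>\<^sup>+x. ennreal (v / ((x - u)\<^sup>2 + v\<^sup>2)) \<partial>lborel) = ennreal pi"
proof -
  have "(\<integral>\<^sup>+x. ennreal (v / ((x - u)\<^sup>2 + v\<^sup>2)) \<partial>lborel)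
      = ennreal \<bar>v\<bar> * (\<integral>\<^sup>+t. ennreal (v / ((u + v * t - u)\<^sup>2 + v\<^sup>2)) \<partial>lborel)"
    by (rule nn_integral_real_affine) (use v in auto)
  also have "\<dots> = (\<integral>\<^sup>+t. ennreal \<bar>v\<bar> * ennreal (v / ((u + v * t - u)\<^sup>2 + v\<^sup>2)) \<partial>lborel)"
    by (rule nn_integral_cmult[symmetric]) auto
  also have "\<dots> = (\<integral>\<^sup>+t. ennreal (1 / (1 + t\<^sup>2)) \<partial>lborel)"
  proof (rule nn_integral_cong)
    fix t
    have "v * (v / ((u + v * t - u)\<^sup>2 + v\<^sup>2)) = v\<^sup>2 / (v\<^sup>2 * (1 + t\<^sup>2))"
      by (simp add: power2_eq_square algebra_simps)
    also have "\<dots> = 1 / (1 + t\<^sup>2)" using v by simp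
    finally show "ennreal \<bar>v\<bar> * ennreal (v / ((u + v * t - u)\<^sup>2 + v\<^sup>2)) = ennreal (1 / (1 + t\<^sup>2))"
      using v by (simp flip: ennreal_mult)
  qed
  finally show ?thesis by (simp add: nn_integral_arctan)
qed

lemma cmod_Complex_diff_sq: "(cmod (Complex x y - w))\<^sup>2 = (x - Re w)\<^sup>2 + (y - Im w)\<^sup>2"
  by (simp add: cmod_power2)

text \<open>On the line at height \<open>y\<close> the square of the modulus is 1 / v times the
  integrand of \<open>nn_integral_poisson\<close> with v = |y - Im w|. The bound decays as the line
  moves away from \<open>w\<close>, which removes the top side in Cauchy's formula.\<close>

lemma resolvent_line:
  assumes "y \<noteq> Im w"
  shows "(\<lambda>x. 1 / (Complex x y - w)) \<in> sqint lborel"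
    and "(\<integral>\<^sup>+x. ennreal ((cmod (1 / (Complex x y - w)))\<^sup>2) \<partial>lborel) \<le> ennreal (pi / \<bar>y - Im w\<bar>)"
proof -
  let ?v = "\<bar>y - Im w\<bar>"
  have v: "?v > 0" using assms by simp
  have ne: "Complex x y - w \<noteq> 0" for x using assms by (auto simp: complex_eq_iff)
  have m: "(\<lambda>x. 1 / (Complex x y - w)) \<in> borel_measurable lborel"
  proof -
    have "continuous_on UNIV (\<lambda>x. 1 / (Complex x y - w))"
      using ne unfolding Complex_eq by (intro continuous_intros) auto
    from borel_measurable_continuous_onI[OF this] show ?thesis by simp
  qed
  have "(\<integral>\<^sup>+x. ennreal ((cmod (1 / (Complex x y - w)))\<^sup>2) \<partial>lborel)
      = (\<integral>\<^sup>+x. ennreal (1 / ?v) * ennreal (?v / ((x - Re w)\<^sup>2 + ?v\<^sup>2)) \<partial>lborel)"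
  proof (rule nn_integral_cong)
    fix x
    have "(cmod (1 / (Complex x y - w)))\<^sup>2 = 1 / ((x - Re w)\<^sup>2 + ?v\<^sup>2)"
      by (simp add: norm_divide power_divide cmod_Complex_diff_sq)
    also have "\<dots> = 1 / ?v * (?v / ((x - Re w)\<^sup>2 + ?v\<^sup>2))" using v by simp
    finally show "ennreal ((cmod (1 / (Complex x y - w)))\<^sup>2) = ennreal (1 / ?v) * ennreal (?v / ((x - Re w)\<^sup>2 + ?v\<^sup>2))"
      using v by (subst ennreal_mult[symmetric]) auto
  qed
  also have "\<dots> = ennreal (1 / ?v) * (\<integral>\<^sup>+x. ennreal (?v / ((x - Re w)\<^sup>2 + ?v\<^sup>2)) \<partial>lborel)"
    by (rule nn_integral_cmult) measurable
  also have "(\<integral>\<^sup>+x. ennreal (?v / ((x - Re w)\<^sup>2 + ?v\<^sup>2)) \<partial>lborel) = ennreal pi"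
    by (rule nn_integral_poisson[OF v])
  also have "ennreal (1 / ?v) * ennreal pi = ennreal (pi / ?v)" by (subst ennreal_mult[symmetric]) auto
  finally show le: "(\<integral>\<^sup>+x. ennreal ((cmod (1 / (Complex x y - w)))\<^sup>2) \<partial>lborel) \<le> ennreal (pi / ?v)"
    by simp
  show "(\<lambda>x. 1 / (Complex x y - w)) \<in> sqint lborel" by (rule sqint_of_nn_integral[OF m le])
qed

section \<open>Cauchy and Poisson formulas for Hardy functions\<close>

lemma holomorphic_line_continuous:
  assumes "f holomorphic_on S" "\<And>x. Complex x y \<in> S"
  shows "continuous_on UNIV (\<lambda>x. f (Complex x y))"
proof -
  have "continuous_on UNIV (\<lambda>x. Complex x y)" unfolding Complex_eq by (intro continuous_intros)
  then show ?thesis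
    by (rule continuous_on_compose2[OF holomorphic_on_imp_continuous_on[OF assms(1)]]) (use assms(2) in auto)
qed

lemma holomorphic_line_measurable:
  assumes "f holomorphic_on S" "\<And>x. Complex x y \<in> S"
  shows "(\<lambda>x. f (Complex x y)) \<in> borel_measurable lborel"
  using borel_measurable_continuous_onI[OF holomorphic_line_continuous[OF assms]] by simp

lemma integral_le_of_nn_integral:
  fixes h :: "real \<Rightarrow> real"
  assumes cont: "continuous_on {a..b} h" and nn: "\<And>x. x \<in> {a..b} \<Longrightarrow> h x \<ge> 0"
    and le: "(\<integral>\<^sup>+x. ennreal (h x) * indicator {a..b} x \<partial>lborel) \<le> ennreal B" and B: "B \<ge> 0"
  shows "integral {a..b} h \<le> B"
proof -
  have si: "set_integrable lborel {a..b} h" by (rule borel_integrable_atLeastAtMost'[OF cont])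
  have "ennreal (LINT x:{a..b}|lborel. h x) = (\<integral>\<^sup>+x. ennreal (indicator {a..b} x *\<^sub>R h x) \<partial>lborel)"
    unfolding set_lebesgue_integral_def
    by (rule nn_integral_eq_integral[symmetric]) (use si nn in \<open>auto simp: set_integrable_def indicator_def\<close>)
  also have "\<dots> = (\<integral>\<^sup>+x. ennreal (h x) * indicator {a..b} x \<partial>lborel)"
    by (intro nn_integral_cong) (auto simp: indicator_def)
  finally have "ennreal (LINT x:{a..b}|lborel. h x) \<le> ennreal B" using le by simp
  then show ?thesis using B set_borel_integral_eq_integral(2)[OF si] by simp
qed

lemma contour_integral_linepath_shift:
  assumes ab: "a < b" and cont: "continuous_on {a..b} (\<lambda>x. g (Complex x y))"
  shows "contour_integral (linepath (Complex a y) (Complex b y)) g = (LINT x:{a..b}|lborel. g (Complex x y))"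
proof -
  have *: "linepath (Complex a y) (Complex b y) t = linepath (of_real a) (of_real b) t + Complex 0 y" for t
    by (simp add: linepath_def complex_eq_iff algebra_simps)
  have d: "Complex b y - Complex a y = of_real b - of_real a" by (simp add: complex_eq_iff)
  have "contour_integral (linepath (Complex a y) (Complex b y)) g
      = contour_integral (linepath (of_real a) (of_real b)) (\<lambda>z. g (z + Complex 0 y))"
    unfolding contour_integral_integral by (simp add: * d del: of_real_diff)
  also have "\<dots> = integral {a..b} (\<lambda>x. g (of_real x + Complex 0 y))"
    using contour_integral_linepath_Reals_eq[of "of_real a" "of_real b"] ab by simp
  also have "(\<lambda>x. g (of_real x + Complex 0 y)) = (\<lambda>x. g (Complex x y))"
    by (intro ext arg_cong[of _ _ g]) (simp add: complex_eq_iff)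
  finally show ?thesis
    using set_borel_integral_eq_integral(2)[OF borel_integrable_atLeastAtMost'[OF cont]] by simp
qed

text \<open>The supremum in \<open>hardy_H2\<close> replaced by an explicit real bound, in the form
  in which estimates line by line produce it.\<close>

definition line_bounded :: "(complex \<Rightarrow> complex) \<Rightarrow> real \<Rightarrow> bool" where
  "line_bounded f M \<longleftrightarrow> M \<ge> 0 \<and>
     (\<forall>y>0. (\<integral>\<^sup>+x. ennreal ((cmod (f (Complex x y)))\<^sup>2) \<partial>lborel) \<le> ennreal M)"

lemma hardy_H2_iff:
  "f \<in> hardy_H2 \<longleftrightarrow> f holomorphic_on {z. Im z > 0} \<and> (\<exists>M. line_bounded f M)"
proof
  assume f: "f \<in> hardy_H2"
  let ?I = "\<lambda>y. \<integral>\<^sup>+x. ennreal ((cmod (f (Complex x y)))\<^sup>2) \<partial>lborel"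
  let ?S = "SUP y\<in>{0<..}. ?I y"
  have fin: "?S < \<infinity>" using f by (simp add: hardy_H2_def)
  have "?I y \<le> ennreal (enn2real ?S)" if "y > 0" for y
  proof -
    have "?I y \<le> ?S" using that by (intro SUP_upper) auto
    then show ?thesis using fin by simp
  qed
  then show "f holomorphic_on {z. Im z > 0} \<and> (\<exists>M. line_bounded f M)"
    using f by (auto simp: hardy_H2_def line_bounded_def intro!: exI[of _ "enn2real ?S"])
next
  assume "f holomorphic_on {z. Im z > 0} \<and> (\<exists>M. line_bounded f M)"
  then obtain M where h: "f holomorphic_on {z. Im z > 0}" and M: "line_bounded f M" by blast
  have "(SUP y\<in>{0<..}. \<integral>\<^sup>+x. ennreal ((cmod (f (Complex x y)))\<^sup>2) \<partial>lborel) \<le> ennreal M"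
    using M by (intro SUP_least) (auto simp: line_bounded_def)
  also have "\<dots> < \<infinity>" by simp
  finally show "f \<in> hardy_H2" using h by (simp add: hardy_H2_def)
qed

lemma line_bounded_sqint:
  assumes "f holomorphic_on S" "{z. Im z > 0} \<subseteq> S" "line_bounded f M" "y > 0"
  shows "(\<lambda>x. f (Complex x y)) \<in> sqint lborel" "sq_nrm lborel (\<lambda>x. f (Complex x y)) \<le> sqrt M"
proof -
  have m: "(\<lambda>x. f (Complex x y)) \<in> borel_measurable lborel"
    by (rule holomorphic_line_measurable[OF assms(1)]) (use assms in auto)
  have M: "M \<ge> 0" "(\<integral>\<^sup>+x. ennreal ((cmod (f (Complex x y)))\<^sup>2) \<partial>lborel) \<le> ennreal M"
    using assms by (auto simp: line_bounded_def)
  show s: "(\<lambda>x. f (Complex x y)) \<in> sqint lborel" by (rule sqint_of_nn_integral[OF m M(2)])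
  show "sq_nrm lborel (\<lambda>x. f (Complex x y)) \<le> sqrt M"
    by (rule sq_nrm_le_of_nn_integral[OF s]) (use M in auto)
qed

text \<open>Such \<open>R\<close> exist because \<open>\<bar>f\<bar>\<^sup>2\<close> is integrable over the strip \<open>0 \<le> Im z \<le> n\<close>.\<close>

lemma vertical_lines:
  fixes n :: real
  assumes hol: "f holomorphic_on S" and S: "{z. Im z \<ge> 0} \<subseteq> S" and M: "line_bounded f M" and n: "n > 0"
  obtains R where "R > R0" "R > 0" "integral {0..n} (\<lambda>t. (cmod (f (Complex R t)))\<^sup>2) \<le> 1"
    "integral {0..n} (\<lambda>t. (cmod (f (Complex (- R) t)))\<^sup>2) \<le> 1"
proof -
  have cf: "continuous_on {z. Im z \<ge> 0} f"
    by (rule continuous_on_subset[OF holomorphic_on_imp_continuous_on[OF hol] S])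
  have cf2: "continuous_on {p. 0 \<le> snd p} (\<lambda>p. f (Complex (fst p) (snd p)))"
    unfolding Complex_eq by (rule continuous_on_compose2[OF cf]) (auto intro!: continuous_intros)
  \<comment> \<open>Extension by 0 below the real axis makes the integrand Borel on the whole plane,
    as Tonelli's theorem requires.\<close>
  define g where "g p = indicator {p. 0 \<le> snd p} p *\<^sub>R f (Complex (fst p) (snd p))" for p :: "real \<times> real"
  have "closed {p::real \<times> real. 0 \<le> snd p}"
    by (intro closed_Collect_le continuous_intros)
  then have gm[measurable]: "g \<in> borel_measurable (borel \<Otimes>\<^sub>M borel)"
    unfolding g_def borel_prod by (intro borel_measurable_continuous_on_indicator cf2) auto
  define hh where "hh x = (\<integral>\<^sup>+t. ennreal ((cmod (g (x, t)))\<^sup>2) * indicator {0..n} t \<partial>lborel)" for x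
  have hm[measurable]: "hh \<in> borel_measurable borel"
    unfolding hh_def by measurable
  have "(\<integral>\<^sup>+x. hh x \<partial>lborel) = (\<integral>\<^sup>+t. (\<integral>\<^sup>+x. ennreal ((cmod (g (x, t)))\<^sup>2) * indicator {0..n} t \<partial>lborel) \<partial>lborel)"
    unfolding hh_def by (rule lborel_pair.Fubini'[symmetric]) measurable
  also have "\<dots> \<le> (\<integral>\<^sup>+t. ennreal M * indicator {0..n} t \<partial>lborel)"
  proof (rule nn_integral_mono_AE)
    \<comment> \<open>The line t = 0 is left out as a null set: \<open>line_bounded\<close> speaks
      of the open half-plane only.\<close>
    show "AE t in lborel. (\<integral>\<^sup>+x. ennreal ((cmod (g (x, t)))\<^sup>2) * indicator {0..n} t \<partial>lborel) \<le> ennreal M * indicator {0..n} t"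
      using AE_lborel_singleton[of "0::real"]
    proof eventually_elim
      case (elim t)
      show ?case
      proof (cases "t \<in> {0..n}")
        case True
        then have "t > 0" using elim by auto
        then show ?thesis using M True by (simp add: line_bounded_def g_def)
      qed simp
    qed
  qed
  also have "\<dots> = ennreal M * ennreal n" using n by (simp add: nn_integral_cmult_indicator)
  also have "\<dots> < \<infinity>" by (simp add: ennreal_mult_less_top)
  finally have fin: "(\<integral>\<^sup>+x. hh x \<partial>lborel) < \<infinity>" .
  have fin2: "(\<integral>\<^sup>+x. hh (- x) \<partial>lborel) < \<infinity>"
    using fin nn_integral_real_affine[of hh "-1" 0] by simp
  \<comment> \<open>Otherwise \<open>hh R + hh (- R)\<close> exceeds 1 on a half-line, and its
    integral, finite by the above, would be infinite.\<close>
  have "\<exists>R. R > max R0 0 \<and> hh R + hh (- R) \<le> 1"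
  proof (rule ccontr)
    assume "\<not> ?thesis"
    then have big: "hh R + hh (- R) > 1" if "R > max R0 0" for R using that by (meson not_le)
    have "(\<integral>\<^sup>+x. indicator {max R0 0<..} x \<partial>lborel) \<le> (\<integral>\<^sup>+x. hh x + hh (- x) \<partial>lborel)"
      using big by (intro nn_integral_mono) (auto simp: indicator_def less_imp_le)
    also have "\<dots> = (\<integral>\<^sup>+x. hh x \<partial>lborel) + (\<integral>\<^sup>+x. hh (- x) \<partial>lborel)"
      by (rule nn_integral_add) auto
    also have "\<dots> < \<infinity>" using fin fin2 by simp
    finally have fe: "emeasure lborel {max R0 0<..} < \<infinity>" by simp
    have "ennreal k \<le> emeasure lborel {max R0 0<..}" for k :: nat
    proof -
      have "emeasure lborel {max R0 0<..max R0 0 + real k} \<le> emeasure lborel {max R0 0<..}"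
        by (rule emeasure_mono) auto
      then show ?thesis by simp
    qed
    moreover obtain k :: nat where "enn2real (emeasure lborel {max R0 0<..}) < real k"
      using reals_Archimedean2 by blast
    ultimately show False using fe
      by (metis ennreal_enn2real ennreal_less_iff enn2real_nonneg infinity_ennreal_def leD)
  qed
  then obtain R where R: "R > R0" "R > 0" "hh R + hh (- R) \<le> 1" by auto
  have main: "integral {0..n} (\<lambda>t. (cmod (f (Complex r t)))\<^sup>2) \<le> 1" if "hh r \<le> 1" for r
  proof (rule integral_le_of_nn_integral)
    have "continuous_on {0..n} (\<lambda>t. f (Complex r t))"
      unfolding Complex_eq by (rule continuous_on_compose2[OF cf]) (auto intro!: continuous_intros)
    then show "continuous_on {0..n} (\<lambda>t. (cmod (f (Complex r t)))\<^sup>2)" by (intro continuous_intros)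
    have "(\<integral>\<^sup>+t. ennreal ((cmod (f (Complex r t)))\<^sup>2) * indicator {0..n} t \<partial>lborel) = hh r"
      unfolding hh_def g_def by (intro nn_integral_cong) (auto simp: indicator_def)
    then show "(\<integral>\<^sup>+t. ennreal ((cmod (f (Complex r t)))\<^sup>2) * indicator {0..n} t \<partial>lborel) \<le> ennreal 1"
      using that by simp
  qed auto
  have "hh R \<le> 1" "hh (- R) \<le> 1"
    using R(3) by (auto intro: order_trans[OF le_iff_add[THEN iffD2]] simp: add.commute)
  then show ?thesis using that R main by blast
qed

text \<open>Cauchy's theorem on rectangles with base on the real axis, across which \<open>f\<close>
  is holomorphic. On the top side Cauchy-Schwarz against the resolvent gives decay like N^(-1/2); on
  the vertical sides, chosen by \<open>vertical_lines\<close>, \<open>f\<close> has L_2 norm at most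
  1. Both signs of Im w are wanted: later the integral at one point reproduces and the one at its
  conjugate vanishes.\<close>

lemma hardy_cauchy:
  assumes opn: "open S" and S: "{z. Im z \<ge> 0} \<subseteq> S" and hol: "f holomorphic_on S"
    and M: "line_bounded f M" and bdry: "(\<lambda>x. f (of_real x)) \<in> sqint lborel" and w: "Im w \<noteq> 0"
  shows "(LINT x|lborel. f (of_real x) / (of_real x - w)) = (if Im w > 0 then 2 * pi * \<i> * f w else 0)"
    and "integrable lborel (\<lambda>x. f (of_real x) / (of_real x - w))"
proof -
  define g where "g z = f z / (z - w)" for z
  define c where "c = (if Im w > 0 then 2 * pi * \<i> * f w else 0)"
  have M0: "M \<ge> 0" using M by (simp add: line_bounded_def)
  have real_eq: "of_real x = Complex x 0" for x by (simp add: complex_eq_iff)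
  have cf: "continuous_on {z. Im z \<ge> 0} f"
    by (rule continuous_on_subset[OF holomorphic_on_imp_continuous_on[OF hol] S])
  have cg: "continuous_on ({z. Im z \<ge> 0} - {w}) g"
    unfolding g_def by (intro continuous_intros continuous_on_subset[OF cf]) auto
  have r0: "(\<lambda>x. 1 / (of_real x - w)) \<in> sqint lborel"
    using resolvent_line(1)[of 0 w] w by (simp add: real_eq)
  have gi: "integrable lborel (\<lambda>x. g (of_real x))"
    using sqint_product_integrable[OF sqint_cnj[OF bdry] r0] by (simp add: g_def)
  then show "integrable lborel (\<lambda>x. f (of_real x) / (of_real x - w))" by (simp add: g_def)
  \<comment> \<open>Above |Im w|, so that \<open>w\<close> lies below the top side, and at least 1,
    so that N is at most its square.\<close>
  define N where "N k = real k + \<bar>Im w\<bar> + 1" for k :: nat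
  have N: "N k > 0" "N k > \<bar>Im w\<bar>" "N k \<ge> real k + 1" for k by (auto simp: N_def)
  \<comment> \<open>The half-width exceeds |Re w| by the square of the height: then |z - w| is at
    least N^2 on a vertical side of length N.\<close>
  have "\<exists>R. R > (N k)\<^sup>2 + \<bar>Re w\<bar> \<and> R > 0 \<and> integral {0..N k} (\<lambda>t. (cmod (f (Complex R t)))\<^sup>2) \<le> 1 \<and>
    integral {0..N k} (\<lambda>t. (cmod (f (Complex (- R) t)))\<^sup>2) \<le> 1" for k
    using vertical_lines[OF hol S M N(1)[of k], of "(N k)\<^sup>2 + \<bar>Re w\<bar>"] by blast
  then obtain R where R: "\<And>k. R k > (N k)\<^sup>2 + \<bar>Re w\<bar>" "\<And>k. R k > 0"
    "\<And>k. integral {0..N k} (\<lambda>t. (cmod (f (Complex (R k) t)))\<^sup>2) \<le> 1"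
    "\<And>k. integral {0..N k} (\<lambda>t. (cmod (f (Complex (- R k) t)))\<^sup>2) \<le> 1" by metis
  have side: "cmod (integral {0..N k} (\<lambda>t. g (Complex r t))) \<le> 1 / N k"
    if r: "\<bar>r\<bar> = R k" and i1: "integral {0..N k} (\<lambda>t. (cmod (f (Complex r t)))\<^sup>2) \<le> 1" for k r
  proof -
    have dist: "cmod (Complex r t - w) \<ge> (N k)\<^sup>2" for t
    proof -
      have "(N k)\<^sup>2 \<le> \<bar>r - Re w\<bar>" using R(1)[of k] r by linarith
      also have "\<dots> \<le> cmod (Complex r t - w)" using abs_Re_le_cmod[of "Complex r t - w"] by simp
      finally show ?thesis .
    qed
    have N2: "(N k)\<^sup>2 > 0" using N(1)[of k] by simp
    have ne: "Complex r t \<noteq> w" for t using dist[of t] N2 by auto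
    have cl: "continuous_on {0..N k} (\<lambda>t. Complex r t)" unfolding Complex_eq by (intro continuous_intros)
    have cgr: "continuous_on {0..N k} (\<lambda>t. g (Complex r t))"
      by (rule continuous_on_compose2[OF cg cl]) (use ne in auto)
    have cfr: "continuous_on {0..N k} (\<lambda>t. f (Complex r t))"
      by (rule continuous_on_compose2[OF cf cl]) auto
    have int2: "(\<lambda>t. (1 + (cmod (f (Complex r t)))\<^sup>2) / (2 * (N k)\<^sup>2)) integrable_on {0..N k}"
      using cfr N2 by (intro integrable_continuous_real continuous_intros) auto
    have int3: "(\<lambda>t. (cmod (f (Complex r t)))\<^sup>2) integrable_on {0..N k}"
      using cfr by (intro integrable_continuous_real continuous_intros) auto
    have "cmod (integral {0..N k} (\<lambda>t. g (Complex r t)))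
        \<le> integral {0..N k} (\<lambda>t. (1 + (cmod (f (Complex r t)))\<^sup>2) / (2 * (N k)\<^sup>2))"
    proof (rule integral_norm_bound_integral[OF _ int2])
      show "(\<lambda>t. g (Complex r t)) integrable_on {0..N k}" by (rule integrable_continuous_real[OF cgr])
      fix t
      have "cmod (g (Complex r t)) = cmod (f (Complex r t)) / cmod (Complex r t - w)"
        by (simp add: g_def norm_divide)
      \<comment> \<open>|f| is at most (1 + |f|^2) / 2, which bounds the integral of |f| by the
        square integral and the length N of the side.\<close>
      also have "\<dots> \<le> ((1 + (cmod (f (Complex r t)))\<^sup>2) / 2) / (N k)\<^sup>2"
        using dist[of t] N2 sum_squares_bound[of 1 "cmod (f (Complex r t))"]
        by (intro frac_le) (auto simp: add_nonneg_nonneg)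
      finally show "norm (g (Complex r t)) \<le> (1 + (cmod (f (Complex r t)))\<^sup>2) / (2 * (N k)\<^sup>2)" by simp
    qed
    also have "\<dots> = (N k + integral {0..N k} (\<lambda>t. (cmod (f (Complex r t)))\<^sup>2)) / (2 * (N k)\<^sup>2)"
      using Henstock_Kurzweil_Integration.integral_add[OF integrable_const_ivl[of 1 0 "N k"] int3] N(1)[of k]
      by simp
    also have "\<dots> \<le> (N k + N k) / (2 * (N k)\<^sup>2)"
      using i1 N(3)[of k] N2 by (intro divide_right_mono add_mono) auto
    also have "\<dots> = 1 / N k" using N(1)[of k] by (simp add: power2_eq_square)
    finally show ?thesis .
  qed
  have top: "cmod (LINT x:{- R k..R k}|lborel. g (Complex x (N k))) \<le> sqrt M * sqrt (pi / (N k - \<bar>Im w\<bar>))" for k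
  proof -
    have S': "{z. Im z > 0} \<subseteq> S" using S by auto
    note fl = line_bounded_sqint[OF hol S' M N(1)[of k]]
    \<comment> \<open>The cut-off is put on \<open>f\<close>, so that the integral over the segment
      becomes a scalar product on the whole line.\<close>
    define F where "F x = indicator {- R k..R k} x *\<^sub>R cnj (f (Complex x (N k)))" for x
    have Fle: "(cmod (F x))\<^sup>2 \<le> (cmod (f (Complex x (N k))))\<^sup>2" for x by (simp add: F_def indicator_def)
    have Fm: "F \<in> borel_measurable lborel"
      unfolding F_def using sqint_measurable[OF fl(1)] by measurable
    have nnF: "(\<integral>\<^sup>+x. ennreal ((cmod (F x))\<^sup>2) \<partial>lborel) \<le> ennreal M"
    proof -
      have "(\<integral>\<^sup>+x. ennreal ((cmod (F x))\<^sup>2) \<partial>lborel) \<le> (\<integral>\<^sup>+x. ennreal ((cmod (f (Complex x (N k))))\<^sup>2) \<partial>lborel)"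
        by (intro nn_integral_mono ennreal_leI Fle)
      also have "\<dots> \<le> ennreal M" using M N(1)[of k] by (simp add: line_bounded_def)
      finally show ?thesis .
    qed
    have F: "F \<in> sqint lborel" by (rule sqint_of_nn_integral[OF Fm nnF])
    have F2: "sq_nrm lborel F \<le> sqrt M"
      by (rule sq_nrm_le_of_nn_integral[OF F]) (use nnF M0 in auto)
    have ne: "N k \<noteq> Im w" using N(2)[of k] by linarith
    note rl = resolvent_line[OF ne]
    have "pi / \<bar>N k - Im w\<bar> \<le> pi / (N k - \<bar>Im w\<bar>)"
      using N(2)[of k] by (intro divide_left_mono) (auto intro!: mult_pos_pos)
    then have "(\<integral>\<^sup>+x. ennreal ((cmod (1 / (Complex x (N k) - w)))\<^sup>2) \<partial>lborel)
        \<le> ennreal ((sqrt (pi / (N k - \<bar>Im w\<bar>)))\<^sup>2)"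
      using N(2)[of k] rl(2) by (simp add: order_trans[OF rl(2) ennreal_leI])
    then have G2: "sq_nrm lborel (\<lambda>x. 1 / (Complex x (N k) - w)) \<le> sqrt (pi / (N k - \<bar>Im w\<bar>))"
      using N(2)[of k] by (intro sq_nrm_le_of_nn_integral[OF rl(1)]) auto
    have "(LINT x:{- R k..R k}|lborel. g (Complex x (N k))) = sq_inner lborel F (\<lambda>x. 1 / (Complex x (N k) - w))"
      unfolding set_lebesgue_integral_def sq_inner_def F_def g_def
      by (intro Bochner_Integration.integral_cong) (auto simp: indicator_def)
    also have "cmod \<dots> \<le> sq_nrm lborel F * sq_nrm lborel (\<lambda>x. 1 / (Complex x (N k) - w))"
      by (rule sq.cauchy_schwarz[OF F rl(1)])
    also have "\<dots> \<le> sqrt M * sqrt (pi / (N k - \<bar>Im w\<bar>))"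
      by (intro mult_mono F2 G2 sq.nrm_nonneg F rl(1)) (use M0 in auto)
    finally show ?thesis .
  qed
  have contour: "cmod ((LINT x:{- R k..R k}|lborel. g (of_real x)) - c)
      \<le> 2 / N k + sqrt M * sqrt (pi / (N k - \<bar>Im w\<bar>))" for k
  proof -
    define a where "a = Complex (- R k) 0"
    define b where "b = Complex (R k) (N k)"
    have Nk: "N k \<le> (N k)\<^sup>2"
      using N(3)[of k] by (intro self_le_power) auto
    have Rw: "\<bar>Re w\<bar> < R k" using R(1)[of k] Nk N(1)[of k] by linarith
    have ab: "Re a \<le> Re b" "Im a \<le> Im b" using R(2)[of k] N(1)[of k] by (auto simp: a_def b_def)
    have sub: "cbox a b \<subseteq> S" using S by (auto simp: in_cbox_complex_iff a_def)
    have hab: "f holomorphic_on cbox a b" by (rule holomorphic_on_subset[OF hol sub])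
    have wpath: "w \<notin> path_image (rectpath a b)"
      using ab Rw w N(2)[of k] by (auto simp: path_image_rectpath a_def b_def)
    have psub: "path_image (rectpath a b) \<subseteq> {z. Im z \<ge> 0} - {w}"
      using path_image_rectpath_subset_cbox[OF ab] wpath by (auto simp: in_cbox_complex_iff a_def)
    have hc: "(g has_contour_integral c) (rectpath a b)"
    proof (cases "Im w > 0")
      case True
      have wb: "w \<in> box a b" using True Rw N(2)[of k] by (auto simp: in_box_complex_iff a_def b_def)
      have "((\<lambda>z. f z / (z - w)) has_contour_integral (2 * pi * \<i> * winding_number (rectpath a b) w * f w)) (rectpath a b)"
        by (rule Cauchy_integral_formula_convex_simple[OF convex_box(1) hab])
           (use wb wpath path_image_rectpath_subset_cbox[OF ab] in \<open>auto simp: interior_cbox\<close>)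
      then show ?thesis
        using True unfolding g_def c_def winding_number_rectpath[OF wb] by simp
    next
      case False
      have "g holomorphic_on cbox a b"
        unfolding g_def using False w by (intro holomorphic_intros hab) (auto simp: in_cbox_complex_iff a_def)
      then have "(g has_contour_integral 0) (rectpath a b)"
        by (rule Cauchy_theorem_convex_simple[OF _ convex_box(1)])
           (use path_image_rectpath_subset_cbox[OF ab] in auto)
      then show ?thesis using False by (simp add: c_def)
    qed
    define a2 where "a2 = Complex (R k) 0"
    define a4 where "a4 = Complex (- R k) (N k)"
    have rp: "rectpath a b = linepath a a2 +++ linepath a2 b +++ linepath b a4 +++ linepath a4 a"
      by (simp add: rectpath_def a_def b_def a2_def a4_def Let_def)
    have pim: "path_image (rectpath a b) = closed_segment a a2 \<union> closed_segment a2 b \<union> closed_segment b a4 \<union> closed_segment a4 a"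
      unfolding rp by (simp add: path_image_join Un_assoc)
    have csegs: "continuous_on (closed_segment a a2) g" "continuous_on (closed_segment a2 b) g"
      "continuous_on (closed_segment b a4) g" "continuous_on (closed_segment a4 a) g"
      by (rule continuous_on_subset[OF cg]; use psub pim in blast)+
    note ci = csegs[THEN contour_integrable_continuous_linepath]
    have "c = contour_integral (rectpath a b) g" using contour_integral_unique[OF hc] by simp
    also have "\<dots> = contour_integral (linepath a a2) g + (contour_integral (linepath a2 b) g
        + (contour_integral (linepath b a4) g + contour_integral (linepath a4 a) g))"
      unfolding rp using ci by (simp add: contour_integrable_joinI)
    also have "contour_integral (linepath a a2) g = (LINT x:{- R k..R k}|lborel. g (Complex x 0))"
      unfolding a_def a2_def
    proof (rule contour_integral_linepath_shift)
      show "- R k < R k" using R(2)[of k] by simp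
      show "continuous_on {- R k..R k} (\<lambda>x. g (Complex x 0))"
        by (rule continuous_on_compose2[OF cg])
           (use w in \<open>auto simp: Complex_eq intro!: continuous_intros\<close>)
    qed
    also have "contour_integral (linepath b a4) g = - contour_integral (linepath a4 b) g"
      by (rule contour_integral_reverse_linepath[OF csegs(3)])
    also have "contour_integral (linepath a4 b) g = (LINT x:{- R k..R k}|lborel. g (Complex x (N k)))"
      unfolding a4_def b_def
    proof (rule contour_integral_linepath_shift)
      show "- R k < R k" using R(2)[of k] by simp
      show "continuous_on {- R k..R k} (\<lambda>x. g (Complex x (N k)))"
        by (rule continuous_on_compose2[OF cg])
           (use N(1,2)[of k] in \<open>auto simp: Complex_eq less_imp_le intro!: continuous_intros\<close>)
    qed
    also have "contour_integral (linepath a2 b) g = \<i> * integral {0..N k} (\<lambda>t. g (Complex (R k) t))"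
      by (rule contour_integral_linepath_same_Re) (use N(1)[of k] in \<open>auto simp: a2_def b_def\<close>)
    also have "contour_integral (linepath a4 a) g = - contour_integral (linepath a a4) g"
      by (rule contour_integral_reverse_linepath[OF csegs(4)])
    also have "contour_integral (linepath a a4) g = \<i> * integral {0..N k} (\<lambda>t. g (Complex (- R k) t))"
      by (rule contour_integral_linepath_same_Re) (use N(1)[of k] in \<open>auto simp: a_def a4_def\<close>)
    finally have "(LINT x:{- R k..R k}|lborel. g (of_real x)) - c
       = (LINT x:{- R k..R k}|lborel. g (Complex x (N k))) - \<i> * integral {0..N k} (\<lambda>t. g (Complex (R k) t))
         + \<i> * integral {0..N k} (\<lambda>t. g (Complex (- R k) t))"
      by (simp add: real_eq)
    also have "cmod \<dots> \<le> cmod (LINT x:{- R k..R k}|lborel. g (Complex x (N k)))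
        + cmod (integral {0..N k} (\<lambda>t. g (Complex (R k) t))) + cmod (integral {0..N k} (\<lambda>t. g (Complex (- R k) t)))"
      by (rule norm_triangle_le, rule add_mono[OF norm_triangle_le_diff]) (auto simp: norm_mult)
    also have "\<dots> \<le> sqrt M * sqrt (pi / (N k - \<bar>Im w\<bar>)) + 1 / N k + 1 / N k"
      by (intro add_mono top side) (use R(2,3,4)[of k] in auto)
    finally show ?thesis by simp
  qed
  have "(\<lambda>k. (LINT x:{- R k..R k}|lborel. g (of_real x)) - c) \<longlonglongrightarrow> 0"
  proof (rule Lim_null_comparison[OF always_eventually])
    show "\<forall>k. norm ((LINT x:{- R k..R k}|lborel. g (of_real x)) - c)
      \<le> 2 / N k + sqrt M * sqrt (pi / (N k - \<bar>Im w\<bar>))" using contour by blast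
    have "(\<lambda>k. 2 / N k + sqrt M * sqrt (pi / (N k - \<bar>Im w\<bar>))) \<longlonglongrightarrow> 0 + sqrt M * sqrt 0"
      unfolding N_def by (intro tendsto_intros; real_asymp)
    then show "(\<lambda>k. 2 / N k + sqrt M * sqrt (pi / (N k - \<bar>Im w\<bar>))) \<longlonglongrightarrow> 0" by simp
  qed
  moreover have "(\<lambda>k. (LINT x:{- R k..R k}|lborel. g (of_real x))) \<longlonglongrightarrow> (LINT x|lborel. g (of_real x))"
    unfolding set_lebesgue_integral_def
  proof (rule integral_dominated_convergence[where w = "\<lambda>x. cmod (g (of_real x))"])
    show "AE x in lborel. (\<lambda>k. indicator {- R k..R k} x *\<^sub>R g (of_real x)) \<longlonglongrightarrow> g (of_real x)"
    proof (rule AE_I2)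
      fix x :: real
      obtain K :: nat where K: "\<bar>x\<bar> < real K" using reals_Archimedean2 by blast
      have "indicator {- R k..R k} x *\<^sub>R g (of_real x) = g (of_real x)" if "k \<ge> K" for k
      proof -
        have "N k \<le> (N k)\<^sup>2" using N(3)[of k] by (intro self_le_power) auto
        then have "\<bar>x\<bar> < R k" using R(1)[of k] N(3)[of k] K that by linarith
        then have "x \<in> {- R k..R k}" by auto
        then show ?thesis by simp
      qed
      then show "(\<lambda>k. indicator {- R k..R k} x *\<^sub>R g (of_real x)) \<longlonglongrightarrow> g (of_real x)"
        by (intro tendsto_eventually) (auto simp: eventually_sequentially)
    qed
  qed (use gi in \<open>auto simp: indicator_def\<close>)
  ultimately have "(LINT x|lborel. g (of_real x)) - c = 0"
    by (intro LIMSEQ_unique[OF tendsto_diff[OF _ tendsto_const]])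
  then show "(LINT x|lborel. f (of_real x) / (of_real x - w)) = (if Im w > 0 then 2 * pi * \<i> * f w else 0)"
    by (simp add: g_def c_def)
qed


text \<open>Subtracting the Cauchy integrals at w and at its conjugate, of which the second
  vanishes, gives the Poisson formula. Cauchy-Schwarz for the measure with density
  \<open>p u\<close> then bounds |f(w)|^2 by the Poisson mean of |f|^2, and Tonelli integrates this
  over u, the kernel being symmetric in x and u.\<close>

lemma hardy_boundary:
  assumes opn: "open S" and S: "{z. Im z \<ge> 0} \<subseteq> S" and hol: "f holomorphic_on S"
    and M: "line_bounded f M" and bdry: "(\<lambda>x. f (of_real x)) \<in> sqint lborel" and y: "y > 0"
  shows "sq_nrm lborel (\<lambda>x. f (Complex x y)) \<le> sq_nrm lborel (\<lambda>x. f (of_real x))"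
proof -
  define p where "p u x = y / ((x - u)\<^sup>2 + y\<^sup>2)" for u x :: real
  have p0: "p u x \<ge> 0" for u x using y by (simp add: p_def)
  have py: "p u x \<le> 1 / y" for u x
  proof -
    have "p u x \<le> y / y\<^sup>2"
      unfolding p_def by (rule divide_left_mono) (use y in \<open>auto intro!: mult_pos_pos add_nonneg_pos\<close>)
    then show ?thesis using y by (simp add: power2_eq_square)
  qed
  have pm[measurable]: "(\<lambda>(u, x). p u x) \<in> borel_measurable (borel \<Otimes>\<^sub>M borel)" unfolding p_def by measurable
  have pm1[measurable]: "p u \<in> borel_measurable borel" for u unfolding p_def by measurable
  have pm2[measurable]: "(\<lambda>u. p u x) \<in> borel_measurable borel" for x unfolding p_def by measurable
  have fm[measurable]: "(\<lambda>x. f (of_real x)) \<in> borel_measurable borel" using sqint_measurable[OF bdry] by simp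
  have point: "ennreal ((cmod (f (Complex u y)))\<^sup>2)
      \<le> ennreal (1 / pi) * (\<integral>\<^sup>+x. ennreal ((cmod (f (of_real x)))\<^sup>2 * p u x) \<partial>lborel)" for u
  proof -
    define w where "w = Complex u y"
    have w: "Im w > 0" "Im (cnj w) < 0" using y by (simp_all add: w_def)
    note c1 = hardy_cauchy[OF opn S hol M bdry, of w]
    note c2 = hardy_cauchy[OF opn S hol M bdry, of "cnj w"]
    have "2 * pi * \<i> * f w = (LINT x|lborel. f (of_real x) / (of_real x - w)) - (LINT x|lborel. f (of_real x) / (of_real x - cnj w))"
      using c1(1) c2(1) w by simp
    also have "\<dots> = (LINT x|lborel. f (of_real x) / (of_real x - w) - f (of_real x) / (of_real x - cnj w))"
      using c1(2) c2(2) w by (intro Bochner_Integration.integral_diff[symmetric]) auto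
    also have "\<dots> = (LINT x|lborel. 2 * \<i> * (of_real (p u x) * f (of_real x)))"
    proof (rule Bochner_Integration.integral_cong[OF refl])
      fix x :: real
      have ne: "of_real x - w \<noteq> 0" "of_real x - cnj w \<noteq> 0" using y by (auto simp: w_def complex_eq_iff)
      have prod: "(of_real x - w) * (of_real x - cnj w) = of_real ((x - u)\<^sup>2 + y\<^sup>2)"
        by (simp add: w_def complex_eq_iff power2_eq_square algebra_simps)
      have "1 / (of_real x - w) - 1 / (of_real x - cnj w) = (w - cnj w) / ((of_real x - w) * (of_real x - cnj w))"
        using ne by (simp add: field_simps)
      also have "\<dots> = 2 * \<i> * of_real (p u x)"
        unfolding prod p_def by (simp add: w_def complex_eq_iff)
      finally have "f (of_real x) * (1 / (of_real x - w) - 1 / (of_real x - cnj w)) = 2 * \<i> * (of_real (p u x) * f (of_real x))"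
        by simp
      then show "f (of_real x) / (of_real x - w) - f (of_real x) / (of_real x - cnj w) = 2 * \<i> * (of_real (p u x) * f (of_real x))"
        by (simp add: right_diff_distrib)
    qed
    also have "\<dots> = 2 * \<i> * (LINT x|lborel. of_real (p u x) * f (of_real x))"
      by (simp only: integral_mult_right_zero)
    finally have fw: "of_real pi * f w = (LINT x|lborel. of_real (p u x) * f (of_real x))" by simp
    \<comment> \<open>Each factor takes the square root of the kernel, so that \<open>a\<close> has
      square norm pi.\<close>
    define a where "a x = complex_of_real (sqrt (p u x))" for x
    define b where "b x = complex_of_real (sqrt (p u x)) * f (of_real x)" for x
    have a2: "(cmod (a x))\<^sup>2 = p u x" for x using p0 by (simp add: a_def)
    have b2: "(cmod (b x))\<^sup>2 = (cmod (f (of_real x)))\<^sup>2 * p u x" for x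
      using p0 by (simp add: b_def norm_mult power_mult_distrib)
    have na: "(\<integral>\<^sup>+x. ennreal ((cmod (a x))\<^sup>2) \<partial>lborel) = ennreal pi"
      unfolding a2 p_def by (rule nn_integral_poisson[OF y])
    have am: "a \<in> borel_measurable lborel" unfolding a_def by measurable
    have bm: "b \<in> borel_measurable lborel" unfolding b_def by measurable
    have as: "a \<in> sqint lborel" by (rule sqint_of_nn_integral[OF am, of pi]) (simp only: na order_refl)
    have bs: "b \<in> sqint lborel"
    proof -
      have "integrable lborel (\<lambda>x. (cmod (b x))\<^sup>2)"
      proof (rule Bochner_Integration.integrable_bound)
        show "integrable lborel (\<lambda>x. (cmod (f (of_real x)))\<^sup>2 * (1 / y))"
          using sqint_integrable[OF bdry] by simp
        show "AE x in lborel. norm ((cmod (b x))\<^sup>2) \<le> norm ((cmod (f (of_real x)))\<^sup>2 * (1 / y))"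
          unfolding b2 using p0 py y by (intro AE_I2) (auto simp: abs_mult intro!: mult_left_mono[of _ "1 / y", simplified])
      qed (use bm in measurable)
      then show ?thesis using bm by (simp add: sqint_def)
    qed
    have "of_real pi * f w = sq_inner lborel a b"
    proof -
      have "complex_of_real (p u x) = a x * a x" for x
        using p0[of u x] by (simp add: a_def flip: of_real_mult)
      then show ?thesis unfolding fw sq_inner_def by (simp add: a_def b_def mult.assoc)
    qed
    then have "pi * cmod (f w) = cmod (sq_inner lborel a b)"
      by (metis norm_mult norm_of_real abs_of_pos pi_gt_zero)
    also have "\<dots> \<le> sq_nrm lborel a * sq_nrm lborel b" by (rule sq.cauchy_schwarz[OF as bs])
    finally have "(pi * cmod (f w))\<^sup>2 \<le> (sq_nrm lborel a * sq_nrm lborel b)\<^sup>2" by (rule power_mono) simp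
    also have "\<dots> = (sq_nrm lborel a)\<^sup>2 * (sq_nrm lborel b)\<^sup>2" by (rule power_mult_distrib)
    also have "(sq_nrm lborel a)\<^sup>2 = pi"
      using na nn_integral_sq[OF as] by (metis ennreal_inj pi_ge_zero zero_le_power2)
    finally have "pi * (pi * (cmod (f w))\<^sup>2) \<le> pi * (sq_nrm lborel b)\<^sup>2"
      by (simp add: power2_eq_square algebra_simps)
    then have "pi * (cmod (f w))\<^sup>2 \<le> (sq_nrm lborel b)\<^sup>2" by simp
    then have "(cmod (f w))\<^sup>2 \<le> 1 / pi * (sq_nrm lborel b)\<^sup>2" by (simp add: field_simps)
    then have "ennreal ((cmod (f w))\<^sup>2) \<le> ennreal (1 / pi) * ennreal ((sq_nrm lborel b)\<^sup>2)"
      by (subst ennreal_mult[symmetric]) (auto intro: ennreal_leI)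
    also have "ennreal ((sq_nrm lborel b)\<^sup>2) = (\<integral>\<^sup>+x. ennreal ((cmod (f (of_real x)))\<^sup>2 * p u x) \<partial>lborel)"
      unfolding nn_integral_sq[OF bs, symmetric] b2 ..
    finally show ?thesis by (simp add: w_def)
  qed
  have fl: "(\<lambda>x. f (Complex x y)) \<in> sqint lborel"
    by (rule line_bounded_sqint(1)[OF hol _ M y]) (use S in auto)
  have "(\<integral>\<^sup>+u. ennreal ((cmod (f (Complex u y)))\<^sup>2) \<partial>lborel)
      \<le> (\<integral>\<^sup>+u. ennreal (1 / pi) * (\<integral>\<^sup>+x. ennreal ((cmod (f (of_real x)))\<^sup>2 * p u x) \<partial>lborel) \<partial>lborel)"
    by (intro nn_integral_mono point)
  also have "\<dots> = ennreal (1 / pi) * (\<integral>\<^sup>+u. (\<integral>\<^sup>+x. ennreal ((cmod (f (of_real x)))\<^sup>2 * p u x) \<partial>lborel) \<partial>lborel)"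
    by (rule nn_integral_cmult) measurable
  also have "(\<integral>\<^sup>+u. (\<integral>\<^sup>+x. ennreal ((cmod (f (of_real x)))\<^sup>2 * p u x) \<partial>lborel) \<partial>lborel)
      = (\<integral>\<^sup>+x. (\<integral>\<^sup>+u. ennreal ((cmod (f (of_real x)))\<^sup>2 * p u x) \<partial>lborel) \<partial>lborel)"
    by (rule lborel_pair.Fubini'[symmetric]) measurable
  also have "\<dots> = (\<integral>\<^sup>+x. ennreal ((cmod (f (of_real x)))\<^sup>2) * ennreal pi \<partial>lborel)"
  proof (rule nn_integral_cong)
    fix x
    have "(\<integral>\<^sup>+u. ennreal ((cmod (f (of_real x)))\<^sup>2 * p u x) \<partial>lborel)
        = (\<integral>\<^sup>+u. ennreal ((cmod (f (of_real x)))\<^sup>2) * ennreal (p u x) \<partial>lborel)"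
      using p0 by (simp add: ennreal_mult)
    also have "\<dots> = ennreal ((cmod (f (of_real x)))\<^sup>2) * (\<integral>\<^sup>+u. ennreal (p u x) \<partial>lborel)"
      by (rule nn_integral_cmult) measurable
    also have "(\<integral>\<^sup>+u. ennreal (p u x) \<partial>lborel) = ennreal pi"
      unfolding p_def using nn_integral_poisson[OF y, of x] by (simp add: power2_commute)
    finally show "(\<integral>\<^sup>+u. ennreal ((cmod (f (of_real x)))\<^sup>2 * p u x) \<partial>lborel) = ennreal ((cmod (f (of_real x)))\<^sup>2) * ennreal pi" .
  qed
  also have "\<dots> = (\<integral>\<^sup>+x. ennreal ((cmod (f (of_real x)))\<^sup>2) \<partial>lborel) * ennreal pi"
    by (rule nn_integral_multc) measurable
  also have "\<dots> = ennreal ((sq_nrm lborel (\<lambda>x. f (of_real x)))\<^sup>2) * ennreal pi"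
    by (simp only: nn_integral_sq[OF bdry])
  also have "ennreal (1 / pi) * \<dots> = ennreal ((sq_nrm lborel (\<lambda>x. f (of_real x)))\<^sup>2)"
    by (simp flip: ennreal_mult)
  finally show ?thesis
    by (intro sq_nrm_le_of_nn_integral[OF fl] sq.nrm_nonneg[OF bdry])
qed

text \<open>The comparison may fail on a disc inside the upper half-plane. The disc is compact
  there, so \<open>g\<close> is bounded on it, and every horizontal line meets it in a segment of
  length at most 2 \<delta>. A negative \<delta> makes the disc empty and the comparison
  global.\<close>

lemma hardy_compare:
  assumes f: "f \<in> hardy_H2" and g: "g holomorphic_on {z. Im z > 0}"
    and p: "\<delta> < Im p" and C: "C \<ge> 0"
    and le: "\<And>z. Im z > 0 \<Longrightarrow> dist p z > \<delta> \<Longrightarrow> cmod (g z) \<le> C * cmod (f z)"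
  shows "g \<in> hardy_H2"
proof -
  obtain M where fh: "f holomorphic_on {z. Im z > 0}" and M: "line_bounded f M"
    using f by (auto simp: hardy_H2_iff)
  have "cball p \<delta> \<subseteq> {z. Im z > 0}"
  proof
    fix z assume "z \<in> cball p \<delta>"
    then have "Im p - Im z \<le> \<delta>" using abs_Im_le_cmod[of "p - z"] by (simp add: dist_norm)
    then show "z \<in> {z. Im z > 0}" using p by simp
  qed
  then have "compact (g ` cball p \<delta>)"
    by (intro compact_continuous_image holomorphic_on_imp_continuous_on[OF holomorphic_on_subset[OF g]]) auto
  then obtain B where B: "B > 0" "\<And>z. z \<in> cball p \<delta> \<Longrightarrow> cmod (g z) \<le> B"
    using compact_imp_bounded bounded_pos by (metis image_eqI)
  have "(\<integral>\<^sup>+x. ennreal ((cmod (g (Complex x y)))\<^sup>2) \<partial>lborel) \<le> ennreal (C\<^sup>2 * M + B\<^sup>2 * (2 * \<bar>\<delta>\<bar>))" if y: "y > 0" for y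
  proof -
    have fm: "(\<lambda>x. f (Complex x y)) \<in> borel_measurable lborel"
      by (rule holomorphic_line_measurable[OF fh]) (use y in auto)
    have pt: "(cmod (g (Complex x y)))\<^sup>2 \<le> C\<^sup>2 * (cmod (f (Complex x y)))\<^sup>2 + B\<^sup>2 * indicator {Re p - \<bar>\<delta>\<bar>..Re p + \<bar>\<delta>\<bar>} x" for x
    proof (cases "dist p (Complex x y) > \<delta>")
      case True
      have "(cmod (g (Complex x y)))\<^sup>2 \<le> (C * cmod (f (Complex x y)))\<^sup>2"
        by (intro power_mono le) (use y True in auto)
      then show ?thesis by (simp add: power_mult_distrib add_increasing2)
    next
      case False
      then have "\<bar>Re p - x\<bar> \<le> \<delta>"
        using abs_Re_le_cmod[of "p - Complex x y"] by (simp add: dist_norm)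
      then have "x \<in> {Re p - \<bar>\<delta>\<bar>..Re p + \<bar>\<delta>\<bar>}" by auto
      moreover have "(cmod (g (Complex x y)))\<^sup>2 \<le> B\<^sup>2"
        by (intro power_mono B) (use False in auto)
      ultimately show ?thesis by (simp add: add_increasing)
    qed
    have "(\<integral>\<^sup>+x. ennreal ((cmod (g (Complex x y)))\<^sup>2) \<partial>lborel)
        \<le> (\<integral>\<^sup>+x. ennreal (C\<^sup>2) * ennreal ((cmod (f (Complex x y)))\<^sup>2) + ennreal (B\<^sup>2) * indicator {Re p - \<bar>\<delta>\<bar>..Re p + \<bar>\<delta>\<bar>} x \<partial>lborel)"
    proof (rule nn_integral_mono)
      fix x
      have "ennreal ((cmod (g (Complex x y)))\<^sup>2) \<le> ennreal (C\<^sup>2 * (cmod (f (Complex x y)))\<^sup>2 + B\<^sup>2 * indicator {Re p - \<bar>\<delta>\<bar>..Re p + \<bar>\<delta>\<bar>} x)"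
        by (rule ennreal_leI[OF pt])
      then show "ennreal ((cmod (g (Complex x y)))\<^sup>2) \<le> ennreal (C\<^sup>2) * ennreal ((cmod (f (Complex x y)))\<^sup>2) + ennreal (B\<^sup>2) * indicator {Re p - \<bar>\<delta>\<bar>..Re p + \<bar>\<delta>\<bar>} x"
        by (cases "x \<in> {Re p - \<bar>\<delta>\<bar>..Re p + \<bar>\<delta>\<bar>}") (simp_all only: indicator_simps ennreal_plus ennreal_mult zero_le_mult_iff zero_le_power2 mult_1_right mult_zero_right add_0_right simp_thms)
    qed
    also have "\<dots> = ennreal (C\<^sup>2) * (\<integral>\<^sup>+x. ennreal ((cmod (f (Complex x y)))\<^sup>2) \<partial>lborel)
        + ennreal (B\<^sup>2) * ennreal (2 * \<bar>\<delta>\<bar>)"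
      using fm by (subst nn_integral_add) (auto simp: nn_integral_cmult nn_integral_cmult_indicator)
    also have "\<dots> \<le> ennreal (C\<^sup>2) * ennreal M + ennreal (B\<^sup>2) * ennreal (2 * \<bar>\<delta>\<bar>)"
      using M y by (intro add_right_mono mult_left_mono) (auto simp: line_bounded_def)
    also have "\<dots> = ennreal (C\<^sup>2 * M + B\<^sup>2 * (2 * \<bar>\<delta>\<bar>))"
      using M by (simp add: ennreal_mult ennreal_plus line_bounded_def)
    finally show ?thesis .
  qed
  moreover have "C\<^sup>2 * M + B\<^sup>2 * (2 * \<bar>\<delta>\<bar>) \<ge> 0" using M by (simp add: line_bounded_def)
  ultimately show ?thesis using g unfolding hardy_H2_iff line_bounded_def by blast
qed

lemma hardy_add:
  assumes f: "f \<in> hardy_H2" and g: "g \<in> hardy_H2"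
  shows "(\<lambda>z. f z + g z) \<in> hardy_H2"
proof -
  obtain M N where fh: "f holomorphic_on {z. Im z > 0}" and M: "line_bounded f M"
    and gh: "g holomorphic_on {z. Im z > 0}" and N: "line_bounded g N"
    using f g by (auto simp: hardy_H2_iff)
  have "(\<integral>\<^sup>+x. ennreal ((cmod (f (Complex x y) + g (Complex x y)))\<^sup>2) \<partial>lborel) \<le> ennreal (2 * M + 2 * N)" if y: "y > 0" for y
  proof -
    have m: "(\<lambda>x. f (Complex x y)) \<in> borel_measurable lborel" "(\<lambda>x. g (Complex x y)) \<in> borel_measurable lborel"
      by (rule holomorphic_line_measurable[OF fh] holomorphic_line_measurable[OF gh]; use y in simp)+
    have "(\<integral>\<^sup>+x. ennreal ((cmod (f (Complex x y) + g (Complex x y)))\<^sup>2) \<partial>lborel)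
        \<le> (\<integral>\<^sup>+x. ennreal 2 * ennreal ((cmod (f (Complex x y)))\<^sup>2) + ennreal 2 * ennreal ((cmod (g (Complex x y)))\<^sup>2) \<partial>lborel)"
    proof (rule nn_integral_mono)
      fix x
      have "ennreal ((cmod (f (Complex x y) + g (Complex x y)))\<^sup>2)
          \<le> ennreal (2 * (cmod (f (Complex x y)))\<^sup>2 + 2 * (cmod (g (Complex x y)))\<^sup>2)"
        by (rule ennreal_leI[OF cmod_add_sq_le])
      then show "ennreal ((cmod (f (Complex x y) + g (Complex x y)))\<^sup>2)
          \<le> ennreal 2 * ennreal ((cmod (f (Complex x y)))\<^sup>2) + ennreal 2 * ennreal ((cmod (g (Complex x y)))\<^sup>2)"
        by (simp only: ennreal_plus ennreal_mult zero_le_mult_iff zero_le_power2 zero_le_numeral simp_thms)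
    qed
    also have "\<dots> = ennreal 2 * (\<integral>\<^sup>+x. ennreal ((cmod (f (Complex x y)))\<^sup>2) \<partial>lborel)
        + ennreal 2 * (\<integral>\<^sup>+x. ennreal ((cmod (g (Complex x y)))\<^sup>2) \<partial>lborel)"
      using m by (subst nn_integral_add) (auto simp: nn_integral_cmult)
    also have "\<dots> \<le> ennreal 2 * ennreal M + ennreal 2 * ennreal N"
      using M N y by (intro add_mono mult_left_mono) (auto simp: line_bounded_def)
    also have "\<dots> = ennreal (2 * M + 2 * N)"
      using M N by (simp only: line_bounded_def ennreal_plus ennreal_mult zero_le_mult_iff zero_le_numeral simp_thms)
    finally show ?thesis .
  qed
  moreover have "2 * M + 2 * N \<ge> 0" using M N by (simp add: line_bounded_def)
  ultimately show ?thesis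
    using fh gh unfolding hardy_H2_iff line_bounded_def by (blast intro: holomorphic_on_add)
qed

lemma hardy_scale:
  assumes f: "f \<in> hardy_H2"
  shows "(\<lambda>z. c * f z) \<in> hardy_H2"
proof (rule hardy_compare[OF f, where p = 0 and \<delta> = "-1" and C = "cmod c"])
  show "(\<lambda>z. c * f z) holomorphic_on {z. Im z > 0}"
    using f by (auto simp: hardy_H2_iff intro!: holomorphic_intros)
qed (auto simp: norm_mult)

text \<open>The reference function with which the kernels are compared in
  \<open>K_mem_DB\<close>.\<close>

lemma hardy_resolvent: "(\<lambda>z. 1 / (z + \<i>)) \<in> hardy_H2"
proof -
  have "(\<lambda>z. 1 / (z + \<i>)) holomorphic_on {z. Im z > 0}"
    by (intro holomorphic_intros) (auto simp: complex_eq_iff)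
  moreover have "(\<integral>\<^sup>+x. ennreal ((cmod (1 / (Complex x y + \<i>)))\<^sup>2) \<partial>lborel) \<le> ennreal pi" if "y > 0" for y
  proof -
    have "(\<integral>\<^sup>+x. ennreal ((cmod (1 / (Complex x y - (- \<i>))))\<^sup>2) \<partial>lborel) \<le> ennreal (pi / \<bar>y - Im (- \<i>)\<bar>)"
      by (rule resolvent_line(2)) (use that in auto)
    also have "\<dots> \<le> ennreal pi"
      by (intro ennreal_leI) (use that in \<open>auto simp: field_simps\<close>)
    finally show ?thesis by simp
  qed
  ultimately show ?thesis unfolding hardy_H2_iff line_bounded_def using pi_ge_zero by blast
qed

text \<open>Allows every identification of entire functions to be tested with the kernels
  \<open>K w\<close> for Im w > 0, those shown to lie in B(E).\<close>

lemma entire_eq_on_upper_half_plane: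
  assumes F: "F holomorphic_on UNIV" and G: "G holomorphic_on UNIV"
    and eq: "\<And>z. Im z > 0 \<Longrightarrow> F z = G z"
  shows "F = G"
proof
  fix z
  show "F z = G z"
  proof (rule analytic_continuation_open[where s = "{z. Im z > 0}" and s' = UNIV and f = F and g = G])
    show "open {z. Im z > 0}" by (rule open_halfspace_Im_gt)
    have "\<i> \<in> {z. Im z > 0}" by simp
    then show "{z. Im z > 0} \<noteq> {}" by blast
  qed (use assms in auto)
qed

lemma sharp_holomorphic: "F holomorphic_on UNIV \<Longrightarrow> sharp F holomorphic_on UNIV"
proof -
  assume "F holomorphic_on UNIV"
  then have "(cnj \<circ> F \<circ> cnj) holomorphic_on UNIV"
    using holomorphic_on_compose_cnj_cnj[of F UNIV] surjI[of cnj cnj] by simp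
  then show ?thesis by (simp add: sharp_def comp_def)
qed

lemma sharp_of_real: "sharp F (of_real x) = cnj (F (of_real x))"
  by (simp add: sharp_def)

lemma move_zero_holomorphic:
  assumes "F holomorphic_on UNIV" "F \<omega> = 0"
  shows "move_zero \<omega> F holomorphic_on UNIV"
proof -
  have "(\<lambda>z. if z = \<omega> then deriv F \<omega> else (F z - F \<omega>) / (z - \<omega>)) holomorphic_on UNIV"
    by (rule pole_lemma) (use assms in auto)
  then have "(\<lambda>z. (z - cnj \<omega>) * (if z = \<omega> then deriv F \<omega> else (F z - F \<omega>) / (z - \<omega>))) holomorphic_on UNIV"
    by (intro holomorphic_intros)
  also have "(\<lambda>z. (z - cnj \<omega>) * (if z = \<omega> then deriv F \<omega> else (F z - F \<omega>) / (z - \<omega>))) = move_zero \<omega> F"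
    by (auto simp: move_zero_def assms(2))
  finally show ?thesis .
qed

section \<open>De Branges spaces from a reproducing kernel in Christoffel-Darboux form\<close>

locale de_branges_kernel = complete_pre_hilbert V ip
  for V :: "(complex \<Rightarrow> complex) set" and ip :: "(complex \<Rightarrow> complex) \<Rightarrow> (complex \<Rightarrow> complex) \<Rightarrow> complex" +
  fixes K :: "complex \<Rightarrow> complex \<Rightarrow> complex" and A B :: "complex \<Rightarrow> complex"
  assumes entire: "F \<in> V \<Longrightarrow> F holomorphic_on UNIV"
    and K_mem: "K w \<in> V"
    and K_rep: "F \<in> V \<Longrightarrow> ip (K w) F = F w"
    and nontrivial: "\<exists>F\<in>V. F w \<noteq> 0"
    and K_AB: "(z - cnj w) * K w z = A z * cnj (B w) - B z * cnj (A w)"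
    and A_real: "A (cnj z) = cnj (A z)" and B_real: "B (cnj z) = cnj (B z)"
begin

definition E :: "complex \<Rightarrow> complex" where
  "E z = of_real (sqrt pi) * (1 - \<i> * z) * K \<i> z / of_real (nrm (K \<i>))"

lemma eval_le: "F \<in> V \<Longrightarrow> cmod (F w) \<le> nrm (K w) * nrm F"
  using cauchy_schwarz[OF K_mem, of F w] by (simp add: K_rep)

text \<open>Here \<open>nontrivial\<close> enters: \<open>w\<close> is not a common zero of
  \<open>V\<close>. It makes the normalisation of \<open>E\<close> meaningful and later keeps
  \<open>E\<close> from vanishing on the real axis.\<close>

lemma nrm_K_pos: "nrm (K w) > 0"
proof -
  obtain F where F: "F \<in> V" "F w \<noteq> 0" using nontrivial by blast
  then have "nrm (K w) \<noteq> 0" using eval_le[of F w] by auto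
  then show ?thesis using nrm_nonneg[OF K_mem[of w]] by linarith
qed

lemma K_diag: "K w w = of_real ((nrm (K w))\<^sup>2)"
  using K_rep[OF K_mem, of w w] ip_self[OF K_mem, of w] by simp

lemma K_sym: "K w z = cnj (K z w)"
  by (metis K_mem K_rep ip_cnj)

text \<open>Since 1 - i z = -i (z - conj i), the Christoffel-Darboux form turns \<open>E\<close>
  into a linear combination of \<open>A\<close> and \<open>B\<close>.\<close>

lemma E_AB: "E z = - \<i> * of_real (sqrt pi) / of_real (nrm (K \<i>)) * (A z * cnj (B \<i>) - B z * cnj (A \<i>))"
proof -
  have "E z = - \<i> * of_real (sqrt pi) / of_real (nrm (K \<i>)) * ((z - cnj \<i>) * K \<i> z)"
  proof -
    have "1 - \<i> * z = - \<i> * (z - cnj \<i>)" by (simp add: algebra_simps)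
    then show ?thesis by (simp only: E_def) (simp add: divide_inverse mult_ac)
  qed
  then show ?thesis by (simp only: K_AB)
qed

lemma sharp_E_AB: "sharp E z = \<i> * of_real (sqrt pi) / of_real (nrm (K \<i>)) * (A z * B \<i> - B z * A \<i>)"
  by (simp add: sharp_def E_AB A_real B_real)

text \<open>\<open>E\<close> and \<open>sharp E\<close> are linear combinations of \<open>A\<close>
  and \<open>B\<close>, so the left side is made of 2x2 determinants. The determinant at i is 2 i
  times the square of \<open>nrm (K \<i>)\<close>, which the normalisation of \<open>E\<close>
  cancels up to the factor pi.\<close>

lemma E_kernel:
  "E z * cnj (E w) - sharp E z * cnj (sharp E w) = - 2 * of_real pi * \<i> * (z - cnj w) * K w z"
proof -
  define n where "n = complex_of_real (nrm (K \<i>))"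
  define s where "s = complex_of_real (sqrt pi)"
  have n0: "n \<noteq> 0" using nrm_K_pos[of \<i>] by (simp add: n_def)
  have cn: "cnj n = n" "cnj s = s" by (simp_all add: n_def s_def)
  have s2: "s * s = of_real pi" by (simp add: s_def flip: of_real_mult)
  have diag: "A \<i> * cnj (B \<i>) - B \<i> * cnj (A \<i>) = 2 * \<i> * (n * n)"
    using K_AB[of \<i> \<i>] K_diag[of \<i>] by (simp add: n_def power2_eq_square algebra_simps)
  have "E z * cnj (E w) - sharp E z * cnj (sharp E w)
      = (s * s) / (n * n) * ((A z * cnj (B \<i>) - B z * cnj (A \<i>)) * (cnj (A w) * B \<i> - cnj (B w) * A \<i>)
         - (A z * B \<i> - B z * A \<i>) * (cnj (A w) * cnj (B \<i>) - cnj (B w) * cnj (A \<i>)))"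
    unfolding E_AB sharp_E_AB n_def[symmetric] s_def[symmetric]
    using n0 by (simp add: cn field_simps)
  \<comment> \<open>The Pluecker relation for the four vectors formed by (A, B) at z, at i, and
    conjugated at i and at w.\<close>
  also have "\<dots> = (s * s) / (n * n) * (- ((A \<i> * cnj (B \<i>) - B \<i> * cnj (A \<i>)) * (A z * cnj (B w) - B z * cnj (A w))))"
    by (rule arg_cong[of _ _ "\<lambda>t. (s * s) / (n * n) * t"]) (simp add: algebra_simps)
  also have "\<dots> = - 2 * of_real pi * \<i> * ((z - cnj w) * K w z)"
    unfolding diag unfolding K_AB[symmetric] s2 using n0 by simp
  finally show ?thesis by (simp add: mult.assoc)
qed

lemma E_entire: "E holomorphic_on UNIV"
  unfolding E_def[abs_def] by (intro holomorphic_intros entire[OF K_mem]) (use nrm_K_pos[of \<i>] in auto)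

text \<open>\<open>E_kernel\<close> on the diagonal; the sign of Im z decides the Hermite-Biehler
  inequality.\<close>

lemma E_diag: "(cmod (E z))\<^sup>2 - (cmod (E (cnj z)))\<^sup>2 = 4 * pi * Im z * (nrm (K z))\<^sup>2"
proof -
  have "complex_of_real ((cmod (E z))\<^sup>2 - (cmod (sharp E z))\<^sup>2) = - 2 * of_real pi * \<i> * (z - cnj z) * K z z"
    unfolding of_real_diff complex_norm_square by (rule E_kernel)
  also have "\<dots> = of_real (4 * pi * Im z * (nrm (K z))\<^sup>2)"
    unfolding K_diag by (simp add: complex_eq_iff)
  finally have "(cmod (E z))\<^sup>2 - (cmod (sharp E z))\<^sup>2 = 4 * pi * Im z * (nrm (K z))\<^sup>2"
    by (simp only: of_real_eq_iff)
  then show ?thesis by (simp add: sharp_def)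
qed

lemma E_hermite_biehler: "hermite_biehler E"
  unfolding hermite_biehler_def
proof (intro conjI allI impI E_entire)
  fix z assume "Im z > 0"
  then have "4 * pi * Im z * (nrm (K z))\<^sup>2 > 0" using nrm_K_pos[of z] by simp
  then have "(cmod (E (cnj z)))\<^sup>2 < (cmod (E z))\<^sup>2" using E_diag[of z] by linarith
  then show "cmod (E (cnj z)) < cmod (E z)" by (rule power_less_imp_less_base) simp
qed

text \<open>In the open half-plane by the Hermite-Biehler inequality. At a real zero of
  \<open>E\<close> also \<open>sharp E\<close> vanishes; then \<open>E_kernel\<close> makes
  \<open>K z\<close> vanish on the upper half-plane, hence everywhere, against
  \<open>nrm_K_pos\<close>.\<close>

lemma E_nonzero: "Im z \<ge> 0 \<Longrightarrow> E z \<noteq> 0"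
proof
  assume z: "Im z \<ge> 0" and E0: "E z = 0"
  show False
  proof (cases "Im z = 0")
    case False
    then show False using E_hermite_biehler z E0 by (auto simp: hermite_biehler_def dest!: spec[of _ z])
  next
    case True
    then have cz: "cnj z = z" by (simp add: complex_eq_iff)
    then have s0: "sharp E z = 0" by (simp add: sharp_def E0)
    have K0: "K z w = 0" if "Im w > 0" for w
    proof -
      have "w \<noteq> z" using that True by auto
      then have "(z - cnj w) \<noteq> 0" using cz by (metis complex_cnj_cnj eq_iff_diff_eq_0)
      moreover have "(z - cnj w) * K w z = 0" using E_kernel[of z w] E0 s0 by simp
      ultimately have "K w z = 0" by simp
      then show ?thesis using K_sym[of z w] by simp
    qed
    have "K z = (\<lambda>_. 0)" by (rule entire_eq_on_upper_half_plane[OF entire[OF K_mem]]) (auto simp: K0)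
    then show False using nrm_K_pos[of z] nrm_zero by simp
  qed
qed

text \<open>The product of B(E) without its factor 1 / pi: division by \<open>E\<close> then
  preserves scalar products into L_2 of the real line, and this is the product that will agree with
  \<open>ip\<close>.\<close>

definition ipE :: "(complex \<Rightarrow> complex) \<Rightarrow> (complex \<Rightarrow> complex) \<Rightarrow> complex" where
  "ipE F G = sq_inner lborel (\<lambda>x. F (of_real x) / E (of_real x)) (\<lambda>x. G (of_real x) / E (of_real x))"

lemma ipE_eq: "ipE F G = of_real pi * de_branges_inner E F G"
proof -
  have "cnj (F (of_real x) / E (of_real x)) * (G (of_real x) / E (of_real x))
      = cnj (F (of_real x)) * G (of_real x) / of_real ((cmod (E (of_real x)))\<^sup>2)" for x :: real
    unfolding complex_norm_square by (simp add: mult_ac)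
  then show ?thesis unfolding ipE_def sq_inner_def de_branges_inner_def by (simp only:) simp
qed

abbreviation DB where "DB \<equiv> de_branges_space E"

lemma boundary_measurable:
  assumes "F holomorphic_on UNIV"
  shows "(\<lambda>x. F (of_real x) / E (of_real x)) \<in> borel_measurable lborel"
proof -
  have c: "continuous_on UNIV (\<lambda>x::real. G (of_real x))" if "G holomorphic_on UNIV" for G :: "complex \<Rightarrow> complex"
    by (rule continuous_on_compose2[OF holomorphic_on_imp_continuous_on[OF that]]) (auto intro: continuous_intros)
  have "continuous_on UNIV (\<lambda>x::real. F (of_real x) / E (of_real x))"
    by (intro continuous_on_divide c assms E_entire) (use E_nonzero in auto)
  from borel_measurable_continuous_onI[OF this] show ?thesis by simp
qed

lemma DB_iff:
  "F \<in> DB \<longleftrightarrow> F holomorphic_on UNIV \<and> (\<lambda>x. F (of_real x) / E (of_real x)) \<in> sqint lborel \<and>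
     (\<lambda>z. F z / E z) \<in> hardy_H2 \<and> (\<lambda>z. sharp F z / E z) \<in> hardy_H2"
  using boundary_measurable[of F] by (auto simp: de_branges_space_def sqint_def)

lemma boundary_sharp:
  "(\<lambda>x. sharp F (of_real x) / E (of_real x)) \<in> sqint lborel"
  "sq_nrm lborel (\<lambda>x. sharp F (of_real x) / E (of_real x)) = sq_nrm lborel (\<lambda>x. F (of_real x) / E (of_real x))"
  if "F holomorphic_on UNIV" "(\<lambda>x. F (of_real x) / E (of_real x)) \<in> sqint lborel"
proof -
  have eq: "cmod (sharp F (of_real x) / E (of_real x)) = cmod (F (of_real x) / E (of_real x))" for x :: real
    by (simp add: sharp_of_real norm_divide)
  show "(\<lambda>x. sharp F (of_real x) / E (of_real x)) \<in> sqint lborel"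
    using that boundary_measurable[OF sharp_holomorphic[OF that(1)]] unfolding sqint_def by (simp add: eq)
  show "sq_nrm lborel (\<lambda>x. sharp F (of_real x) / E (of_real x)) = sq_nrm lborel (\<lambda>x. F (of_real x) / E (of_real x))"
    by (simp only: sq.nrm_def sq_inner_self eq)
qed

lemma sharp_add: "sharp (\<lambda>z. F z + G z) = (\<lambda>z. sharp F z + sharp G z)"
  by (simp add: sharp_def)

lemma sharp_scale: "sharp (\<lambda>z. c * F z) = (\<lambda>z. cnj c * sharp F z)"
  by (simp add: sharp_def)

sublocale db: pre_hilbert DB ipE
proof
  have "(\<lambda>z. 0) \<in> hardy_H2" using hardy_scale[OF hardy_resolvent, of 0] by simp
  then show "(\<lambda>z. 0) \<in> DB" using sq.zero_mem by (simp add: DB_iff sharp_def)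
next
  fix F G H assume F: "F \<in> DB" and G: "G \<in> DB"
  show "(\<lambda>z. F z + G z) \<in> DB"
    using F G by (auto simp: DB_iff sharp_add add_divide_distrib intro!: holomorphic_intros sqint_add hardy_add)
  show "ipE F (\<lambda>z. c * G z) = c * ipE F G" for c
    using sq.ip_scale[of "\<lambda>x. F (of_real x) / E (of_real x)" lborel "\<lambda>x. G (of_real x) / E (of_real x)" c] F G
    by (simp add: ipE_def DB_iff)
  show "ipE G F = cnj (ipE F G)"
    using F G unfolding ipE_def DB_iff by (intro sq.ip_cnj) auto
  assume H: "H \<in> DB"
  show "ipE F (\<lambda>z. G z + H z) = ipE F G + ipE F H"
    using F G H unfolding ipE_def DB_iff add_divide_distrib by (intro sq.ip_add) auto
next
  fix F c assume F: "F \<in> DB"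
  show "(\<lambda>z. c * F z) \<in> DB"
    using F hardy_scale[of "\<lambda>z. F z / E z" c] hardy_scale[of "\<lambda>z. sharp F z / E z" "cnj c"]
      sqint_scale[of "\<lambda>x. F (of_real x) / E (of_real x)" lborel c]
    by (auto simp: DB_iff sharp_scale intro!: holomorphic_intros)
  show "Re (ipE F F) \<ge> 0" using F unfolding ipE_def DB_iff by (intro sq.ip_nonneg) auto
qed

lemma nrmE_eq: "db.nrm F = sq_nrm lborel (\<lambda>x. F (of_real x) / E (of_real x))"
  by (simp add: db.nrm_def sq.nrm_def ipE_def)

lemma quotient_holomorphic:
  assumes "F holomorphic_on UNIV"
  shows "(\<lambda>z. F z / E z) holomorphic_on {z. E z \<noteq> 0}"
  using assms E_entire by (intro holomorphic_intros) (auto intro: holomorphic_on_subset)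

lemma open_E_nonzero: "open {z. E z \<noteq> 0}"
  using holomorphic_on_imp_continuous_on[OF E_entire] by (intro open_Collect_neq) auto

lemma upper_subset: "{z. Im z \<ge> 0} \<subseteq> {z. E z \<noteq> 0}"
  using E_nonzero by auto

lemma quotient_holomorphic_upper:
  assumes "F holomorphic_on UNIV"
  shows "(\<lambda>z. F z / E z) holomorphic_on {z. Im z > 0}"
  by (rule holomorphic_on_subset[OF quotient_holomorphic[OF assms]]) (use E_nonzero in auto)

text \<open>Since |sharp E| is at most |E| in the closed upper half-plane, \<open>E_kernel\<close>
  bounds (z - conj w) K_w / E there, and likewise (z - w) sharp K_w / E. Both quotients are thus
  comparable with 1 / (z + i), the second one away from w.\<close>

lemma K_mem_DB:
  assumes w: "Im w > 0"
  shows "K w \<in> DB"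
proof -
  have Kh: "K w holomorphic_on UNIV" by (rule entire[OF K_mem])
  define C where "C = (cmod (E w) + cmod (sharp E w)) / (2 * pi)"
  have C0: "C \<ge> 0" by (simp add: C_def)
  have Ew: "E z \<noteq> 0" "cmod (sharp E z) \<le> cmod (E z)" if "Im z \<ge> 0" for z
  proof -
    show "E z \<noteq> 0" by (rule E_nonzero[OF that])
    have "(cmod (E (cnj z)))\<^sup>2 \<le> (cmod (E z))\<^sup>2"
    proof -
      have "0 \<le> 4 * pi * Im z * (nrm (K z))\<^sup>2" using that by simp
      then show ?thesis using E_diag[of z] by linarith
    qed
    from power2_le_imp_le[OF this] show "cmod (sharp E z) \<le> cmod (E z)" by (simp add: sharp_def)
  qed
  have num: "cmod (E z * cnj (E w) - sharp E z * cnj (sharp E w)) \<le> 2 * pi * C * cmod (E z)" if "Im z \<ge> 0" for z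
  proof -
    have "cmod (E z * cnj (E w) - sharp E z * cnj (sharp E w)) \<le> cmod (E z) * cmod (E w) + cmod (sharp E z) * cmod (sharp E w)"
      by (rule order_trans[OF norm_triangle_ineq4]) (simp add: norm_mult)
    also have "\<dots> \<le> cmod (E z) * cmod (E w) + cmod (E z) * cmod (sharp E w)"
      using Ew(2)[OF that] by (intro add_left_mono mult_right_mono) auto
    also have "\<dots> = 2 * pi * C * cmod (E z)" by (simp add: C_def field_simps)
    finally show ?thesis .
  qed
  have bK: "cmod (z - cnj w) * cmod (K w z / E z) \<le> C" if z: "Im z \<ge> 0" for z
  proof -
    have "2 * pi * (cmod (z - cnj w) * cmod (K w z)) = cmod (E z * cnj (E w) - sharp E z * cnj (sharp E w))"
      unfolding E_kernel by (simp add: norm_mult)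
    also have "\<dots> \<le> 2 * pi * (C * cmod (E z))" using num[OF z] by (simp add: mult.assoc)
    finally have "cmod (z - cnj w) * cmod (K w z) \<le> C * cmod (E z)" by simp
    then show ?thesis using Ew(1)[OF z] by (simp add: norm_divide field_simps)
  qed
  have bS: "cmod (z - w) * cmod (sharp (K w) z / E z) \<le> C" if z: "Im z \<ge> 0" for z
  proof -
    have s: "sharp E (cnj z) = cnj (E z)" "E (cnj z) = cnj (sharp E z)" by (simp_all add: sharp_def)
    have "2 * pi * (cmod (z - w) * cmod (sharp (K w) z)) = 2 * pi * (cmod (cnj z - cnj w) * cmod (K w (cnj z)))"
      by (simp add: sharp_def flip: complex_cnj_diff)
    also have "\<dots> = cmod (E (cnj z) * cnj (E w) - sharp E (cnj z) * cnj (sharp E w))"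
      unfolding E_kernel by (simp add: norm_mult)
    also have "\<dots> \<le> cmod (sharp E z) * cmod (E w) + cmod (E z) * cmod (sharp E w)"
      unfolding s by (rule order_trans[OF norm_triangle_ineq4]) (simp add: norm_mult)
    also have "\<dots> \<le> cmod (E z) * cmod (E w) + cmod (E z) * cmod (sharp E w)"
      using Ew(2)[OF z] by (intro add_right_mono mult_right_mono) auto
    also have "\<dots> = 2 * pi * (C * cmod (E z))" by (simp add: C_def field_simps)
    finally have "cmod (z - w) * cmod (sharp (K w) z) \<le> C * cmod (E z)" by simp
    then show ?thesis using Ew(1)[OF z] by (simp add: norm_divide field_simps)
  qed
  \<comment> \<open>Trades the pole v for -i: at distance at least d from v, the quotient |z + i| /
    |z - v| is at most 1 + |i + v| / d.\<close>
  have cmp: "cmod g \<le> C * (1 + cmod (\<i> + v) / d) * cmod (1 / (z + \<i>))"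
    if g: "cmod (z - v) * cmod g \<le> C" and d: "d > 0" "cmod (z - v) \<ge> d" and z: "Im z \<ge> 0" for z v g d
  proof -
    have zi: "z + \<i> \<noteq> 0" using z by (auto simp: complex_eq_iff)
    have pos: "cmod (z - v) > 0" using d by linarith
    have "cmod (z + \<i>) \<le> cmod (z - v) + cmod (\<i> + v)"
      using norm_triangle_ineq[of "z - v" "\<i> + v"] by (simp add: algebra_simps)
    also have "cmod (\<i> + v) \<le> cmod (\<i> + v) / d * cmod (z - v)"
      using d mult_right_mono[OF d(2), of "cmod (\<i> + v)"] by (simp add: field_simps)
    finally have le: "cmod (z + \<i>) \<le> (1 + cmod (\<i> + v) / d) * cmod (z - v)" by (simp add: algebra_simps)
    have "cmod g * cmod (z + \<i>) \<le> cmod g * ((1 + cmod (\<i> + v) / d) * cmod (z - v))"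
      by (rule mult_left_mono[OF le]) simp
    also have "\<dots> = (1 + cmod (\<i> + v) / d) * (cmod (z - v) * cmod g)" by simp
    also have "\<dots> \<le> (1 + cmod (\<i> + v) / d) * C"
      by (rule mult_left_mono[OF g]) (use d in \<open>auto intro!: add_nonneg_nonneg\<close>)
    finally show ?thesis using zi by (simp add: norm_divide field_simps)
  qed
  have dist1: "cmod (z - cnj w) \<ge> Im w" if "Im z \<ge> 0" for z
    using abs_Im_le_cmod[of "z - cnj w"] that by simp
  have c1: "C * (1 + cmod (\<i> + v) / d) \<ge> 0" if "d > 0" for v d
    using C0 that by (intro mult_nonneg_nonneg add_nonneg_nonneg) auto
  have H1: "(\<lambda>z. K w z / E z) \<in> hardy_H2"
  proof (rule hardy_compare[OF hardy_resolvent quotient_holomorphic_upper[OF Kh], where p = 0 and \<delta> = "-1"])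
    show "cmod (K w z / E z) \<le> C * (1 + cmod (\<i> + cnj w) / Im w) * cmod (1 / (z + \<i>))" if "Im z > 0" for z
      using that by (intro cmp bK w dist1) auto
  qed (use c1[OF w] in auto)
  have H2: "(\<lambda>z. sharp (K w) z / E z) \<in> hardy_H2"
  \<comment> \<open>The factor z - w vanishes inside the half-plane, so a disc around
    \<open>w\<close> is exempted from the comparison.\<close>
  proof (rule hardy_compare[OF hardy_resolvent quotient_holomorphic_upper[OF sharp_holomorphic[OF Kh]], where p = w and \<delta> = "Im w / 2"])
    show "cmod (sharp (K w) z / E z) \<le> C * (1 + cmod (\<i> + w) / (Im w / 2)) * cmod (1 / (z + \<i>))"
      if "Im z > 0" "dist w z > Im w / 2" for z
      using that w by (intro cmp bS) (auto simp: dist_norm norm_minus_commute)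
  qed (use c1[of "Im w / 2" w] w in auto)
  have "(\<lambda>x. K w (of_real x) / E (of_real x)) \<in> sqint lborel"
  proof -
    let ?C = "C * (1 + cmod (\<i> + cnj w) / Im w)"
    have r: "(\<lambda>x. of_real ?C * (1 / (Complex x 0 - (- \<i>)))) \<in> sqint lborel"
      by (rule sqint_scale[OF resolvent_line(1)]) simp
    have "integrable lborel (\<lambda>x::real. (cmod (K w (of_real x) / E (of_real x)))\<^sup>2)"
    proof (rule Bochner_Integration.integrable_bound[OF sqint_integrable[OF r]])
      show "(\<lambda>x::real. (cmod (K w (of_real x) / E (of_real x)))\<^sup>2) \<in> borel_measurable lborel"
        using boundary_measurable[OF Kh] by measurable
      show "AE x in lborel. norm ((cmod (K w (of_real x) / E (of_real x)))\<^sup>2) \<le> norm ((cmod (of_real ?C * (1 / (Complex x 0 - (- \<i>)))))\<^sup>2)"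
      proof (rule AE_I2)
        fix x :: real
        have "cmod (K w (of_real x) / E (of_real x)) \<le> ?C * cmod (1 / (of_real x + \<i>))"
          by (intro cmp bK w dist1) auto
        also have "\<dots> = cmod (of_real ?C * (1 / (Complex x 0 - (- \<i>))))"
        proof -
          have "Complex x 0 - (- \<i>) = of_real x + \<i>" by (simp add: complex_eq_iff)
          then show ?thesis using c1[OF w, of "cnj w"] by (simp only: norm_mult norm_of_real abs_of_nonneg)
        qed
        finally show "norm ((cmod (K w (of_real x) / E (of_real x)))\<^sup>2) \<le> norm ((cmod (of_real ?C * (1 / (Complex x 0 - (- \<i>)))))\<^sup>2)"
          by (simp only: real_norm_def abs_power2) (intro power_mono norm_ge_zero)
      qed
    qed
    then show ?thesis using boundary_measurable[OF Kh] by (simp add: sqint_def)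
  qed
  then show ?thesis using Kh H1 H2 by (simp add: DB_iff)
qed

text \<open>On the real line \<open>E_kernel\<close> splits the integrand into F / E over x - w and
  the conjugate of sharp F / E over x - conj w. By \<open>hardy_cauchy\<close> the first integral
  yields F(w) / E(w) and the second is 0; each of the two Hardy conditions of B(E) is used
  once.\<close>

lemma reproducing_DB:
  assumes F: "F \<in> DB" and w: "Im w > 0"
  shows "ipE (K w) F = F w"
proof -
  have Fh: "F holomorphic_on UNIV" and Fs: "(\<lambda>x. F (of_real x) / E (of_real x)) \<in> sqint lborel"
    and H1: "(\<lambda>z. F z / E z) \<in> hardy_H2" and H2: "(\<lambda>z. sharp F z / E z) \<in> hardy_H2"
    using F by (auto simp: DB_iff)
  obtain M1 where M1: "line_bounded (\<lambda>z. F z / E z) M1" using H1 by (auto simp: hardy_H2_iff)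
  obtain M2 where M2: "line_bounded (\<lambda>z. sharp F z / E z) M2" using H2 by (auto simp: hardy_H2_iff)
  have w': "Im w \<noteq> 0" "Im (cnj w) \<noteq> 0" using w by auto
  note c1 = hardy_cauchy[OF open_E_nonzero upper_subset quotient_holomorphic[OF Fh] M1 Fs w'(1)]
  note c2 = hardy_cauchy[OF open_E_nonzero upper_subset quotient_holomorphic[OF sharp_holomorphic[OF Fh]] M2
      boundary_sharp(1)[OF Fh Fs] w'(2)]
  let ?a = "\<lambda>x::real. F (of_real x) / E (of_real x) / (of_real x - w)"
  let ?b = "\<lambda>x::real. cnj (sharp F (of_real x) / E (of_real x) / (of_real x - cnj w))"
  have "ipE (K w) F = (LINT x|lborel. 1 / (2 * pi * \<i>) * (E w * ?a x - sharp E w * ?b x))"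
    unfolding ipE_def sq_inner_def
  proof (rule Bochner_Integration.integral_cong[OF refl])
    fix x :: real
    let ?x = "complex_of_real x"
    have Ex: "E ?x \<noteq> 0" by (rule E_nonzero) simp
    have xw: "?x - w \<noteq> 0" "?x - cnj w \<noteq> 0" using w by (auto simp: complex_eq_iff)
    have "cnj (E ?x * cnj (E w) - sharp E ?x * cnj (sharp E w)) = cnj (- 2 * of_real pi * \<i> * (?x - cnj w) * K w ?x)"
      by (simp only: E_kernel)
    then have "cnj (E ?x) * E w - E ?x * sharp E w = 2 * of_real pi * \<i> * (?x - w) * cnj (K w ?x)"
      by (simp add: sharp_of_real)
    then have k: "cnj (K w ?x) = (cnj (E ?x) * E w - E ?x * sharp E w) / (2 * of_real pi * \<i> * (?x - w))"
      using xw by (simp add: field_simps)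
    show "cnj (K w ?x / E ?x) * (F ?x / E ?x) = 1 / (2 * pi * \<i>) * (E w * ?a x - sharp E w * ?b x)"
    proof -
      have alg: "(c * a - e * s) / (k * d) / c * (f / e) = 1 / k * (a * (f / e / d) - s * (f / c / d))"
        if "c \<noteq> 0" "e \<noteq> 0" "d \<noteq> 0" "k \<noteq> 0" for a c d e f k s :: complex
        using that by (simp add: field_simps)
      have b: "?b x = F ?x / cnj (E ?x) / (?x - w)" by (simp add: sharp_of_real)
      show ?thesis
        unfolding b unfolding complex_cnj_divide k using Ex xw by (subst alg) auto
    qed
  qed
  also have "\<dots> = 1 / (2 * pi * \<i>) * (E w * (LINT x|lborel. ?a x) - sharp E w * (LINT x|lborel. ?b x))"
  proof -
    have i2: "integrable lborel ?b" using c2(2) by (rule integrable_cnj)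
    have "(LINT x|lborel. E w * ?a x - sharp E w * ?b x) = (LINT x|lborel. E w * ?a x) - (LINT x|lborel. sharp E w * ?b x)"
      by (rule Bochner_Integration.integral_diff[OF integrable_mult_right integrable_mult_right]) (rule c1(2) i2)+
    then show ?thesis by (simp only: integral_mult_right_zero)
  qed
  also have "(LINT x|lborel. ?b x) = 0"
    using c2(1) w by (simp only: Bochner_Integration.integral_cnj) simp
  also have "(LINT x|lborel. ?a x) = 2 * pi * \<i> * (F w / E w)" using c1(1) w by simp
  finally show ?thesis using E_nonzero[of w] w by simp
qed

lemma nrm_ipE: "F \<in> DB \<Longrightarrow> F \<in> V \<Longrightarrow> ipE F F = ip F F \<Longrightarrow> db.nrm F = nrm F"
  by (simp add: db.nrm_def nrm_def)

text \<open>The comparison ranges over every \<open>G\<close> in both spaces, which makes this a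
  linear subspace; it contains \<open>K w\<close> for Im w > 0 because both products reproduce
  there.\<close>

definition core :: "(complex \<Rightarrow> complex) set" where
  "core = {F \<in> V \<inter> DB. \<forall>G\<in>V \<inter> DB. ip F G = ipE F G}"

lemma K_core: "Im w > 0 \<Longrightarrow> K w \<in> core"
  unfolding core_def using K_mem K_mem_DB reproducing_DB K_rep by auto

lemma core_pre_hilbert: "pre_hilbert core ip"
proof
  show "(\<lambda>x. 0) \<in> core"
    using zero_mem db.zero_mem
    by (auto simp: core_def ip_cnj[OF _ zero_mem] db.ip_cnj[OF _ db.zero_mem] ip_zero db.ip_zero)
next
  fix F G assume F: "F \<in> core" and G: "G \<in> core"
  then show "(\<lambda>x. F x + G x) \<in> core"
    by (auto simp: core_def add_mem db.add_mem ip_add_left db.ip_add_left)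
  show "ip G F = cnj (ip F G)" using F G ip_cnj[of F G] unfolding core_def by blast
  show "ip F (\<lambda>x. c * G x) = c * ip F G" for c using F G ip_scale[of F G c] unfolding core_def by blast
  fix H assume "H \<in> core"
  then show "ip F (\<lambda>x. G x + H x) = ip F G + ip F H" using F G ip_add[of F G H] unfolding core_def by blast
next
  fix F c assume F: "F \<in> core"
  then show "(\<lambda>x. c * F x) \<in> core"
    by (auto simp: core_def scale_mem db.scale_mem ip_scale_left db.ip_scale_left)
  show "0 \<le> Re (ip F F)" using F ip_nonneg[of F] unfolding core_def by blast
qed

lemma core_nrm: "F \<in> core \<Longrightarrow> db.nrm F = nrm F"
  using nrm_ipE[of F] by (auto simp: core_def)

text \<open>\<open>core\<close> may be incomplete, but \<open>riesz_cauchy\<close> still represents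
  the functional \<open>ip F\<close> on it by a Cauchy sequence. The limit in \<open>V\<close> has
  the same products with every \<open>K w\<close>, Im w > 0, hence the same values as
  \<open>F\<close> on the upper half-plane.\<close>

lemma core_dense:
  assumes F: "F \<in> V"
  obtains S where "cauchy_in S" "\<And>n. S n \<in> core" "converges_in S F"
proof -
  interpret co: pre_hilbert core ip by (rule core_pre_hilbert)
  have sub: "G \<in> V" if "G \<in> core" for G using that by (simp add: core_def)
  obtain S where S: "co.cauchy_in S" and lim: "\<And>G. G \<in> core \<Longrightarrow> (\<lambda>n. ip (S n) G) \<longlonglongrightarrow> ip F G"
  proof (rule co.riesz_cauchy[of "ip F" "nrm F"])
    show "ip F (\<lambda>x. G x + H x) = ip F G + ip F H" if "G \<in> core" "H \<in> core" for G H
      using that by (intro ip_add F sub)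
    show "ip F (\<lambda>x. c * G x) = c * ip F G" if "G \<in> core" for G c
      using that by (intro ip_scale F sub)
    show "cmod (ip F G) \<le> nrm F * nrm G" if "G \<in> core" for G
      using that by (intro cauchy_schwarz F sub)
  qed blast
  have Sc: "S n \<in> core" for n using S by (simp add: co.cauchy_in_def)
  have SV: "S n \<in> V" for n by (rule sub[OF Sc])
  have C: "cauchy_in S" using S SV by (simp add: co.cauchy_in_def cauchy_in_def)
  obtain P where P: "P \<in> V" and c: "converges_in S P" using complete[OF C] by blast
  have "P = F"
  proof (rule entire_eq_on_upper_half_plane[OF entire[OF P] entire[OF F]])
    fix w :: complex assume w: "Im w > 0"
    have "ip P (K w) = ip F (K w)"
      using converges_in_ip[OF SV P K_mem c] lim[OF K_core[OF w]] LIMSEQ_unique by blast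
    then have "ip (K w) P = ip (K w) F" using ip_cnj[OF P K_mem] ip_cnj[OF F K_mem] by simp
    then show "P w = F w" by (simp add: K_rep P F)
  qed
  then show ?thesis using that C Sc c by blast
qed

lemma cauchy_nrm_bounded:
  assumes "cauchy_in S"
  obtains b where "b \<ge> 0" "\<forall>\<^sub>F n in sequentially. nrm (S n) \<le> b"
proof -
  have S: "S n \<in> V" for n using assms by (simp add: cauchy_in_def)
  obtain N where N: "\<And>m n. m \<ge> N \<Longrightarrow> n \<ge> N \<Longrightarrow> nrm (\<lambda>x. S m x - S n x) < 1"
    using assms unfolding cauchy_in_def by (metis zero_less_one)
  have "nrm (S n) \<le> 1 + nrm (S N)" if "n \<ge> N" for n
    using nrm_le_add_diff[OF S[of n] S[of N]] N[of n N] that by simp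
  then show ?thesis
    using that[of "1 + nrm (S N)"] nrm_nonneg[OF S[of N]] by (auto simp: eventually_sequentially)
qed

lemma converges_pointwise:
  assumes "\<And>n. S n \<in> V" "F \<in> V" "converges_in S F"
  shows "(\<lambda>n. S n z) \<longlonglongrightarrow> F z"
proof -
  have "(\<lambda>n. S n z - F z) \<longlonglongrightarrow> 0"
  proof (rule Lim_null_comparison[OF always_eventually])
    show "\<forall>n. norm (S n z - F z) \<le> nrm (K z) * nrm (\<lambda>x. S n x - F x)"
      using eval_le[OF diff_mem[OF assms(1) assms(2)], where w = z] by auto
    show "(\<lambda>n. nrm (K z) * nrm (\<lambda>x. S n x - F x)) \<longlonglongrightarrow> 0"
      using tendsto_mult_left[OF assms(3)[unfolded converges_in_def], of "nrm (K z)"] by simp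
  qed
  then show ?thesis by (simp add: LIM_zero_iff)
qed

text \<open>Bounds pass from \<open>core\<close> to \<open>F\<close> by Fatou's lemma, on the real
  line and on every line above it. \<open>hardy_boundary\<close> makes the latter bounds uniform: on
  horizontal lines the norms of the approximants are at most \<open>nrm (S n)\<close>.\<close>

lemma V_subset_DB_ip:
  assumes F: "F \<in> V"
  shows "F \<in> DB" and "\<exists>S. (\<forall>n. S n \<in> core) \<and> converges_in S F \<and> db.converges_in S F"
proof -
  obtain S where C: "cauchy_in S" and Sc: "\<And>n. S n \<in> core" and c: "converges_in S F"
    using core_dense[OF F] by blast
  have SV: "S n \<in> V" and SD: "S n \<in> DB" for n using Sc[of n] by (auto simp: core_def)
  interpret co: pre_hilbert core ip by (rule core_pre_hilbert)
  obtain B where B: "B \<ge> 0" and Sb: "\<forall>\<^sub>F n in sequentially. nrm (S n) \<le> B"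
    using cauchy_nrm_bounded[OF C] by blast
  have pw: "(\<lambda>n. S n z) \<longlonglongrightarrow> F z" for z by (rule converges_pointwise[OF SV F c])
  have pws: "(\<lambda>n. sharp (S n) z) \<longlonglongrightarrow> sharp F z" for z
    unfolding sharp_def by (intro tendsto_cnj pw)
  have Fh: "F holomorphic_on UNIV" by (rule entire[OF F])
  have Ex: "E (of_real x) \<noteq> 0" for x :: real by (rule E_nonzero) simp
  have bs: "(\<lambda>x. S n (of_real x) / E (of_real x)) \<in> sqint lborel"
    "sq_nrm lborel (\<lambda>x. S n (of_real x) / E (of_real x)) = nrm (S n)" for n
    using SD[of n] core_nrm[OF Sc[of n]] by (auto simp: DB_iff nrmE_eq)
  have Fs: "(\<lambda>x. F (of_real x) / E (of_real x)) \<in> sqint lborel"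
  proof (rule sq_nrm_Fatou[OF bs(1) boundary_measurable[OF Fh] _ _ B, THEN conjunct1])
    show "AE x in lborel. (\<lambda>n. S n (of_real x) / E (of_real x)) \<longlonglongrightarrow> F (of_real x) / E (of_real x)"
      using Ex by (intro AE_I2 tendsto_divide pw tendsto_const)
    show "\<forall>\<^sub>F n in sequentially. sq_nrm lborel (\<lambda>x. S n (of_real x) / E (of_real x)) \<le> B"
      using Sb by (simp add: bs(2))
  qed
  \<comment> \<open>\<open>Q\<close> will be the identity and \<open>sharp\<close>, which covers
    both Hardy conditions.\<close>
  have line: "G \<in> hardy_H2"
    if G: "G = (\<lambda>z. Q F z / E z)" and Qh: "\<And>H. H holomorphic_on UNIV \<Longrightarrow> Q H holomorphic_on UNIV"
      and Qp: "\<And>z. (\<lambda>n. Q (S n) z) \<longlonglongrightarrow> Q F z" and QH: "\<And>n. (\<lambda>z. Q (S n) z / E z) \<in> hardy_H2"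
      and Qb: "\<And>n. (\<lambda>x. Q (S n) (of_real x) / E (of_real x)) \<in> sqint lborel"
        "\<And>n. sq_nrm lborel (\<lambda>x. Q (S n) (of_real x) / E (of_real x)) = nrm (S n)" for G Q
  proof -
    have hol: "G holomorphic_on {z. Im z > 0}" unfolding G by (rule quotient_holomorphic_upper[OF Qh[OF Fh]])
    have "(\<integral>\<^sup>+x. ennreal ((cmod (G (Complex x y)))\<^sup>2) \<partial>lborel) \<le> ennreal (B\<^sup>2)" if y: "y > 0" for y
    proof -
      have Ey: "E (Complex x y) \<noteq> 0" for x by (rule E_nonzero) (use y in simp)
      have Sy: "(\<lambda>x. Q (S n) (Complex x y) / E (Complex x y)) \<in> sqint lborel"
        "sq_nrm lborel (\<lambda>x. Q (S n) (Complex x y) / E (Complex x y)) \<le> nrm (S n)" for n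
      proof -
        obtain M where M: "line_bounded (\<lambda>z. Q (S n) z / E z) M" using QH[of n] by (auto simp: hardy_H2_iff)
        have h: "(\<lambda>z. Q (S n) z / E z) holomorphic_on {z. E z \<noteq> 0}"
          by (rule quotient_holomorphic[OF Qh[OF entire[OF SV]]])
        have up: "{z. Im z > 0} \<subseteq> {z. E z \<noteq> 0}" using E_nonzero by auto
        show "(\<lambda>x. Q (S n) (Complex x y) / E (Complex x y)) \<in> sqint lborel"
          by (rule line_bounded_sqint(1)[OF h up M y])
        show "sq_nrm lborel (\<lambda>x. Q (S n) (Complex x y) / E (Complex x y)) \<le> nrm (S n)"
          using hardy_boundary[OF open_E_nonzero upper_subset h M Qb(1) y] Qb(2) by simp
      qed
      have "(\<lambda>x. G (Complex x y)) \<in> sqint lborel \<and> sq_nrm lborel (\<lambda>x. G (Complex x y)) \<le> B"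
      proof (rule sq_nrm_Fatou[OF Sy(1) _ _ _ B])
        show "(\<lambda>x. G (Complex x y)) \<in> borel_measurable lborel"
          by (rule holomorphic_line_measurable[OF hol]) (use y in simp)
        show "AE x in lborel. (\<lambda>n. Q (S n) (Complex x y) / E (Complex x y)) \<longlonglongrightarrow> G (Complex x y)"
          unfolding G using Ey by (intro AE_I2 tendsto_divide Qp tendsto_const)
        show "\<forall>\<^sub>F n in sequentially. sq_nrm lborel (\<lambda>x. Q (S n) (Complex x y) / E (Complex x y)) \<le> B"
          using Sb by eventually_elim (rule order_trans[OF Sy(2)])
      qed
      then show ?thesis
        using sq.nrm_nonneg[of "\<lambda>x. G (Complex x y)" lborel]
        by (auto simp: nn_integral_sq intro!: ennreal_leI power_mono)
    qed
    then have "line_bounded G (B\<^sup>2)" by (simp add: line_bounded_def)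
    then show ?thesis using hol hardy_H2_iff by blast
  qed
  have H1: "(\<lambda>z. F z / E z) \<in> hardy_H2"
    by (rule line[where Q = "\<lambda>H. H"]) (use pw SD bs in \<open>auto simp: DB_iff\<close>)
  have H2: "(\<lambda>z. sharp F z / E z) \<in> hardy_H2"
    by (rule line[where Q = sharp])
       (use pws SD bs in \<open>auto simp: DB_iff sharp_holomorphic boundary_sharp\<close>)
  show FD: "F \<in> DB" using Fh Fs H1 H2 by (simp add: DB_iff)
  have "db.converges_in S F"
    unfolding db.converges_in_def
  proof (rule LIMSEQ_I)
    fix e :: real assume e: "e > 0"
    obtain N where N: "\<And>m n. m \<ge> N \<Longrightarrow> n \<ge> N \<Longrightarrow> nrm (\<lambda>x. S m x - S n x) < e / 2"
      using C e unfolding cauchy_in_def by (metis half_gt_zero)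
    show "\<exists>no. \<forall>n\<ge>no. norm (db.nrm (\<lambda>x. S n x - F x) - 0) < e"
    proof (intro exI[of _ N] allI impI)
      fix n assume n: "N \<le> n"
      have d: "(\<lambda>x. S n x - S m x) \<in> core" for m by (rule co.diff_mem[OF Sc Sc])
      have dD: "(\<lambda>x. S n x - F x) \<in> DB" by (rule db.diff_mem[OF SD FD])
      \<comment> \<open>Fatou in \<open>m\<close> with \<open>n\<close> fixed; for the differences
        of approximants, which lie in \<open>core\<close>, the two norms agree.\<close>
      have "db.nrm (\<lambda>x. S n x - F x) \<le> e / 2"
        unfolding nrmE_eq
      proof (rule sq_nrm_Fatou[THEN conjunct2])
        show "(\<lambda>x. (S n (of_real x) - S m (of_real x)) / E (of_real x)) \<in> sqint lborel" for m
          using d[of m] by (auto simp: core_def DB_iff)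
        show "(\<lambda>x. (S n (of_real x) - F (of_real x)) / E (of_real x)) \<in> borel_measurable lborel"
          using dD by (auto simp: DB_iff dest: sqint_measurable)
        show "AE x in lborel. (\<lambda>m. (S n (of_real x) - S m (of_real x)) / E (of_real x)) \<longlonglongrightarrow> (S n (of_real x) - F (of_real x)) / E (of_real x)"
          using Ex by (intro AE_I2 tendsto_divide tendsto_diff tendsto_const pw)
        show "\<forall>\<^sub>F m in sequentially. sq_nrm lborel (\<lambda>x. (S n (of_real x) - S m (of_real x)) / E (of_real x)) \<le> e / 2"
          unfolding eventually_sequentially
        proof (intro exI[of _ N] allI impI)
          fix m assume "N \<le> m"
          then show "sq_nrm lborel (\<lambda>x. (S n (of_real x) - S m (of_real x)) / E (of_real x)) \<le> e / 2"
            using core_nrm[OF d[of m]] N[of n m] n by (simp add: nrmE_eq)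
        qed
      qed (use e in simp)
      then show "norm (db.nrm (\<lambda>x. S n x - F x) - 0) < e"
        using e db.nrm_nonneg[OF dD] by simp
    qed
  qed
  then show "\<exists>S. (\<forall>n. S n \<in> core) \<and> converges_in S F \<and> db.converges_in S F" using Sc c by blast
qed

text \<open>A limit in the first argument suffices: elements of \<open>core\<close> are compared
  with all of V \<inter> DB, which by now is \<open>V\<close>.\<close>

lemma ip_eq_ipE:
  assumes F: "F \<in> V" and G: "G \<in> V"
  shows "ip F G = ipE F G"
proof -
  obtain S where S: "\<And>n. S n \<in> core" and c: "converges_in S F" and cE: "db.converges_in S F"
    using V_subset_DB_ip(2)[OF F] by blast
  have SV: "S n \<in> V" and SD: "S n \<in> DB" for n using S[of n] by (auto simp: core_def)
  have "ip (S n) G = ipE (S n) G" for n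
    using S[of n] G V_subset_DB_ip(1)[OF G] by (auto simp: core_def)
  then have "(\<lambda>n. ip (S n) G) \<longlonglongrightarrow> ipE F G"
    using db.converges_in_ip[OF SD V_subset_DB_ip(1)[OF F] V_subset_DB_ip(1)[OF G] cE] by simp
  then show ?thesis using converges_in_ip[OF SV F G c] LIMSEQ_unique by blast
qed

text \<open>For the converse inclusion, Riesz in the complete space \<open>V\<close> represents the
  functional \<open>ipE F\<close> by some P in \<open>V\<close>. Testing on \<open>K w\<close>,
  which reproduces in both spaces, gives P = F on the upper half-plane.\<close>

lemma V_eq_DB: "V = DB"
proof
  show "V \<subseteq> DB" using V_subset_DB_ip(1) by blast
  show "DB \<subseteq> V"
  proof
    fix F assume F: "F \<in> DB"
    have VD: "G \<in> DB" if "G \<in> V" for G using V_subset_DB_ip(1)[OF that] .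
    have nE: "db.nrm G = nrm G" if "G \<in> V" for G
      by (rule nrm_ipE[OF VD[OF that] that]) (simp add: ip_eq_ipE that)
    obtain P where P: "P \<in> V" and Pip: "\<And>G. G \<in> V \<Longrightarrow> ip P G = ipE F G"
    proof (rule riesz[of "ipE F" "db.nrm F"])
      show "cmod (ipE F G) \<le> db.nrm F * nrm G" if "G \<in> V" for G
        using db.cauchy_schwarz[OF F VD[OF that]] by (simp add: nE that)
    qed (use db.ip_add[OF F] db.ip_scale[OF F] VD in auto)
    have "F = P"
    proof (rule entire_eq_on_upper_half_plane)
      show "F holomorphic_on UNIV" using F by (simp add: DB_iff)
      show "P holomorphic_on UNIV" by (rule entire[OF P])
      fix w :: complex assume w: "Im w > 0"
      have "ip (K w) P = ipE (K w) F"
        using Pip[OF K_mem[of w]] ip_cnj[OF P K_mem[of w]] db.ip_cnj[OF F VD[OF K_mem[of w]]] by simp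
      then show "F w = P w" by (simp add: K_rep[OF P] reproducing_DB[OF F w])
    qed
    then show "F \<in> V" using P by simp
  qed
qed

text \<open>With V = B(E) this concerns the factor (z - conj \<omega>) / (z - \<omega>) alone: it
  has modulus 1 on the real line, so boundary norms are kept, and it is bounded away from its pole,
  so the Hardy conditions follow from \<open>hardy_compare\<close>.\<close>

lemma move_zero_mem:
  assumes F: "F \<in> V" and z: "F \<omega> = 0"
  shows "move_zero \<omega> F \<in> V" and "ip (move_zero \<omega> F) (move_zero \<omega> F) = ip F F"
proof -
  have Fh: "F holomorphic_on UNIV" by (rule entire[OF F])
  have FD: "F \<in> DB" using F V_eq_DB by simp
  let ?G = "move_zero \<omega> F"
  have Gh: "?G holomorphic_on UNIV" by (rule move_zero_holomorphic[OF Fh z])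
  have G: "?G \<in> V \<and> ip ?G ?G = ip F F"
  proof (cases "Im \<omega> = 0")
    case True
    then have "cnj \<omega> = \<omega>" by (simp add: complex_eq_iff)
    then have "?G = F" using z by (auto simp: move_zero_def)
    then show ?thesis using F by simp
  next
    case False
    have ratio: "?G v = (v - cnj \<omega>) / (v - \<omega>) * F v" if "v \<noteq> \<omega>" for v
      using that by (simp add: move_zero_def)
    have eqx: "cmod (?G (of_real x)) = cmod (F (of_real x))" for x :: real
    proof -
      have ne: "of_real x \<noteq> \<omega>" using False by auto
      have "cmod (of_real x - cnj \<omega>) = cmod (cnj (of_real x - \<omega>))" by simp
      also have "\<dots> = cmod (of_real x - \<omega>)" by (rule complex_mod_cnj)
      finally show ?thesis using ne by (simp add: ratio norm_mult norm_divide)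
    qed
    have eqE: "cmod (?G (of_real x) / E (of_real x)) = cmod (F (of_real x) / E (of_real x))" for x :: real
      by (simp only: norm_divide eqx)
    have Gs: "(\<lambda>x. ?G (of_real x) / E (of_real x)) \<in> sqint lborel"
      using FD boundary_measurable[OF Gh] unfolding DB_iff sqint_def by (simp add: eqE)
    have ipeq: "ipE ?G ?G = ipE F F" unfolding ipE_def sq_inner_self by (simp only: eqE)
    \<comment> \<open>Whichever of \<omega> and its conjugate lies in the upper half-plane. The
      factor has its pole at \<omega>, that of the \<open>sharp\<close> function at the conjugate,
      so one disc around \<open>p\<close> serves both quotients.\<close>
    define p where "p = (if Im \<omega> > 0 then \<omega> else cnj \<omega>)"
    define \<delta> where "\<delta> = \<bar>Im \<omega>\<bar> / 2"
    \<comment> \<open>From |v - conj u| <= |v - u| + 2 |Im \<omega>| at distance at least \<delta>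
      from the pole u.\<close>
    define C where "C = 1 + 2 * \<bar>Im \<omega>\<bar> / \<delta>"
    have d: "\<delta> > 0" "\<delta> < Im p" "C \<ge> 0" using False by (auto simp: \<delta>_def p_def C_def add_nonneg_nonneg)
    have bound: "v \<noteq> u \<and> cmod ((v - cnj u) / (v - u)) \<le> C"
      if v: "Im v > 0" "dist p v > \<delta>" and u: "u = \<omega> \<or> u = cnj \<omega>" for v u
    proof -
      have vu: "cmod (v - u) \<ge> \<delta>"
      proof (cases "u = p")
        case True
        then show ?thesis using v by (simp add: dist_norm norm_minus_commute)
      next
        case False
        then have "Im u = - \<bar>Im \<omega>\<bar>" using u by (auto simp: p_def split: if_splits)
        then have "\<bar>Im (v - u)\<bar> \<ge> \<delta>" using v by (simp add: \<delta>_def)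
        then show ?thesis using abs_Im_le_cmod[of "v - u"] by linarith
      qed
      have "cmod (v - cnj u) \<le> cmod (v - u) + cmod (u - cnj u)"
        using norm_triangle_ineq[of "v - u" "u - cnj u"] by simp
      also have "cmod (u - cnj u) = 2 * \<bar>Im \<omega>\<bar>"
        using u by (auto simp: complex_diff_cnj norm_mult)
      also have "2 * \<bar>Im \<omega>\<bar> \<le> 2 * \<bar>Im \<omega>\<bar> / \<delta> * cmod (v - u)"
        using d mult_left_mono[OF vu, of "\<bar>Im \<omega>\<bar>"] by (simp add: field_simps)
      finally have "cmod (v - cnj u) \<le> C * cmod (v - u)" by (simp add: C_def algebra_simps)
      moreover have "cmod (v - u) > 0" using vu d by linarith
      ultimately show ?thesis by (auto simp: norm_divide field_simps)
    qed
    have H1: "(\<lambda>v. ?G v / E v) \<in> hardy_H2"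
    proof (rule hardy_compare[OF _ quotient_holomorphic_upper[OF Gh] d(2,3)])
      show "(\<lambda>v. F v / E v) \<in> hardy_H2" using FD by (simp add: DB_iff)
      fix v assume v: "Im v > 0" "dist p v > \<delta>"
      have b: "v \<noteq> \<omega>" "cmod ((v - cnj \<omega>) / (v - \<omega>)) \<le> C" using bound[OF v, of \<omega>] by auto
      have "cmod (?G v / E v) = cmod ((v - cnj \<omega>) / (v - \<omega>)) * cmod (F v / E v)"
        using b by (simp add: ratio norm_mult norm_divide)
      also have "\<dots> \<le> C * cmod (F v / E v)" by (rule mult_right_mono[OF b(2)]) simp
      finally show "cmod (?G v / E v) \<le> C * cmod (F v / E v)" .
    qed
    have H2: "(\<lambda>v. sharp ?G v / E v) \<in> hardy_H2"
    proof (rule hardy_compare[OF _ quotient_holomorphic_upper[OF sharp_holomorphic[OF Gh]] d(2,3)])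
      show "(\<lambda>v. sharp F v / E v) \<in> hardy_H2" using FD by (simp add: DB_iff)
      fix v assume v: "Im v > 0" "dist p v > \<delta>"
      have b: "v \<noteq> cnj \<omega>" "cmod ((v - cnj (cnj \<omega>)) / (v - cnj \<omega>)) \<le> C" using bound[OF v, of "cnj \<omega>"] by auto
      then have "cnj v \<noteq> \<omega>" by auto
      then have "sharp ?G v = (v - cnj (cnj \<omega>)) / (v - cnj \<omega>) * sharp F v"
        by (simp add: sharp_def ratio)
      then have "cmod (sharp ?G v / E v) = cmod ((v - cnj (cnj \<omega>)) / (v - cnj \<omega>)) * cmod (sharp F v / E v)"
        by (simp add: norm_mult norm_divide)
      also have "\<dots> \<le> C * cmod (sharp F v / E v)" by (rule mult_right_mono[OF b(2)]) simp
      finally show "cmod (sharp ?G v / E v) \<le> C * cmod (sharp F v / E v)" .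
    qed
    have "?G \<in> V" unfolding V_eq_DB DB_iff using Gh Gs H1 H2 by blast
    then show ?thesis using ipeq ip_eq_ipE F by simp
  qed
  then show "move_zero \<omega> F \<in> V" "ip (move_zero \<omega> F) (move_zero \<omega> F) = ip F F" by auto
qed

end

section \<open>Fourier images of controls\<close>

text \<open>The Taylor coefficient in \<mu> of sin(sqrt \<mu> s) / sqrt \<mu>.\<close>

definition sin_coef :: "nat \<Rightarrow> real \<Rightarrow> complex" where
  "sin_coef k s = (-1) ^ k / fact (2 * k + 1) * of_real s ^ (2 * k + 1)"

text \<open>The series of sin(r s) divided by r contains only powers of r^2 = \<mu>, so the branch
  of the root does not matter and the value prescribed at \<mu> = 0 fits.\<close>

lemma sin_kernel_sums: "(\<lambda>k. sin_coef k s * \<mu> ^ k) sums sin_kernel \<mu> s"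
proof (cases "\<mu> = 0")
  case True
  have "(\<lambda>k. sin_coef k s * \<mu> ^ k) sums (\<Sum>k\<in>{0}. sin_coef k s * \<mu> ^ k)"
    by (rule sums_finite) (auto simp: True)
  then show ?thesis using True by (simp add: sin_kernel_def sin_coef_def)
next
  case False
  define r where "r = csqrt \<mu>"
  have r: "r \<noteq> 0" "r\<^sup>2 = \<mu>" using False by (auto simp: r_def)
  have "(\<lambda>n. sin_coeff n *\<^sub>R (r * of_real s) ^ n) sums sin (r * of_real s)" by (rule sin_converges)
  \<comment> \<open>Terms are grouped in pairs because the even coefficients of the sine
    vanish.\<close>
  then have "(\<lambda>k. \<Sum>n\<in>{k * 2..<k * 2 + 2}. sin_coeff n *\<^sub>R (r * of_real s) ^ n) sums sin (r * of_real s)"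
    by (rule sums_group) simp
  moreover have "(\<Sum>n\<in>{k * 2..<k * 2 + 2}. sin_coeff n *\<^sub>R (r * of_real s) ^ n) = r * (sin_coef k s * \<mu> ^ k)" for k
  proof -
    have "{k * 2..<k * 2 + 2} = {2 * k, 2 * k + 1}" by auto
    then have "(\<Sum>n\<in>{k * 2..<k * 2 + 2}. sin_coeff n *\<^sub>R (r * of_real s) ^ n)
        = sin_coeff (2 * k + 1) *\<^sub>R (r * of_real s) ^ (2 * k + 1)" by (simp add: sin_coeff_def)
    also have "sin_coeff (2 * k + 1) = (-1) ^ k / fact (2 * k + 1)" by (simp add: sin_coeff_def)
    also have "((-1) ^ k / fact (2 * k + 1)) *\<^sub>R (r * of_real s) ^ (2 * k + 1) = r * (sin_coef k s * \<mu> ^ k)"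
    proof -
      have alg: "c *\<^sub>R (r * of_real s) ^ (2 * k + 1) = r * (of_real c * of_real s ^ (2 * k + 1) * \<mu> ^ k)" for c
      proof -
        have "\<mu> ^ k = r ^ (2 * k)" unfolding r(2)[symmetric] by (simp only: power_mult)
        then show ?thesis by (simp add: scaleR_conv_of_real power_mult_distrib)
      qed
      have "complex_of_real ((-1) ^ k / fact (2 * k + 1)) = (-1) ^ k / fact (2 * k + 1)"
        by (simp only: of_real_divide of_real_power of_real_minus of_real_1 of_real_fact)
      then show ?thesis unfolding alg sin_coef_def by (simp only:)
    qed
    finally show ?thesis .
  qed
  ultimately have "(\<lambda>k. r * (sin_coef k s * \<mu> ^ k)) sums sin (r * of_real s)" by simp
  then have "(\<lambda>k. 1 / r * (r * (sin_coef k s * \<mu> ^ k))) sums (1 / r * sin (r * of_real s))" by (rule sums_mult)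
  then show ?thesis using r False by (simp add: sin_kernel_def r_def)
qed

text \<open>By way of the power series, whose coefficients are real: \<open>csqrt\<close> itself
  does not commute with conjugation on the negative real axis.\<close>

lemma sin_kernel_cnj: "sin_kernel (cnj \<mu>) s = cnj (sin_kernel \<mu> s)"
proof -
  have "(\<lambda>k. cnj (sin_coef k s * \<mu> ^ k)) sums cnj (sin_kernel \<mu> s)"
    by (rule sums_cnj[THEN iffD2, OF sin_kernel_sums])
  then have "(\<lambda>k. sin_coef k s * cnj \<mu> ^ k) sums cnj (sin_kernel \<mu> s)" by (simp add: sin_coef_def)
  then show ?thesis using sin_kernel_sums sums_unique2 by blast
qed

text \<open>Replacing (2k + 1)! by k! gives an exponential series as majorant, uniform for |s| at
  most T.\<close>

lemma cmod_sin_coef_le: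
  assumes "\<bar>s\<bar> \<le> T"
  shows "cmod (sin_coef k s * \<mu> ^ k) \<le> T * ((T\<^sup>2 * cmod \<mu>) ^ k / fact k)"
proof -
  have T: "T \<ge> 0" using assms by linarith
  have f: "(fact k :: real) \<le> fact (2 * k + 1)" by (rule fact_mono) simp
  have "cmod (sin_coef k s * \<mu> ^ k) = \<bar>s\<bar> ^ (2 * k + 1) * cmod \<mu> ^ k / fact (2 * k + 1)"
    by (simp only: sin_coef_def norm_mult norm_divide norm_power norm_fact norm_minus_cancel norm_one norm_of_real power_one)
       simp
  also have "\<dots> \<le> T ^ (2 * k + 1) * cmod \<mu> ^ k / fact k"
    using f assms T by (intro frac_le mult_right_mono power_mono) auto
  also have "\<dots> = T * ((T\<^sup>2 * cmod \<mu>) ^ k / fact k)"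
    by (simp add: power_mult power_mult_distrib)
  finally show ?thesis .
qed

lemma summable_sin_bound: "summable (\<lambda>k. T * ((T\<^sup>2 * cmod \<mu>) ^ k / fact k))"
  using summable_exp_generic[of "T\<^sup>2 * cmod \<mu>"] by (intro summable_mult) (simp add: divide_inverse mult.commute)

lemma sin_kernel_continuous: "continuous_on S (sin_kernel \<mu>)"
  unfolding sin_kernel_def by (cases "\<mu> = 0") (auto intro!: continuous_intros)

lemma sin_kernel_measurable [measurable]: "sin_kernel \<mu> \<in> borel_measurable borel"
  by (rule borel_measurable_continuous_onI[OF sin_kernel_continuous])

lemma sin_kernel_bounded:
  assumes "T > 0"
  obtains B where "B \<ge> 0" "\<And>s. s \<in> {0..T} \<Longrightarrow> cmod (sin_kernel \<mu> s) \<le> B"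
proof -
  have "compact (sin_kernel \<mu> ` {0..T})" by (intro compact_continuous_image sin_kernel_continuous) auto
  then obtain B where "B > 0" "\<And>s. s \<in> {0..T} \<Longrightarrow> cmod (sin_kernel \<mu> s) \<le> B"
    using compact_imp_bounded bounded_pos by (metis image_eqI)
  then show ?thesis using that[of B] by auto
qed

section \<open>Lebesgue measure on (0,T) and its reflection\<close>

lemma finite_lebI: "emeasure (lebI T) (space (lebI T)) < \<infinity>"
  using emeasure_bounded_finite[of "{0<..<T}"] by (simp add: emeasure_restrict_space space_restrict_space)

lemma finite_measure_lebI: "finite_measure (lebI T)"
  using finite_lebI[of T] by (intro finite_measureI) auto

lemma sqint_lebI_integrable:
  assumes f: "f \<in> sqint (lebI T)"
  shows "integrable (lebI T) f"
proof -
  interpret finite_measure "lebI T" by (rule finite_measure_lebI)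
  have "(\<lambda>_. 1) \<in> sqint (lebI T)" by (simp add: sqint_def)
  from sqint_product_integrable[OF this f] show ?thesis by simp
qed

lemma lebI_bounded_sqint:
  assumes m: "f \<in> borel_measurable (lebI T)" and b: "\<And>t. t \<in> {0<..<T} \<Longrightarrow> cmod (f t) \<le> B"
  shows "f \<in> sqint (lebI T)"
proof -
  interpret finite_measure "lebI T" by (rule finite_measure_lebI)
  have "integrable (lebI T) (\<lambda>x. (cmod (f x))\<^sup>2)"
  proof (rule integrable_const_bound)
    show "AE x in lebI T. norm ((cmod (f x))\<^sup>2) \<le> B\<^sup>2"
      using b by (intro AE_I2) (auto simp: space_restrict_space intro!: power_mono)
  qed (use m in measurable)
  then show ?thesis using m by (simp add: sqint_def)
qed

lemma lebI_measurable: "f \<in> borel_measurable borel \<Longrightarrow> f \<in> borel_measurable (lebI T)"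
  by (rule measurable_restrict_space1) simp

lemma lebI_reflect_measurable:
  assumes "f \<in> borel_measurable (lebI T)"
  shows "(\<lambda>s. f (T - s)) \<in> borel_measurable (lebI T)"
proof -
  have "(\<lambda>s. T - s) \<in> lebI T \<rightarrow>\<^sub>M lebI T"
    by (rule measurable_restrict_space2) (auto simp: space_restrict_space intro!: lebI_measurable)
  from measurable_compose[OF this assms] show ?thesis .
qed

lemma lebI_reflect_integral:
  fixes f :: "real \<Rightarrow> 'a::{banach, second_countable_topology}"
  shows "(LINT s|lebI T. f (T - s)) = (LINT s|lebI T. f s)"
proof -
  have "(LINT s|lebI T. f s) = (LINT s|lborel. indicator {0<..<T} s *\<^sub>R f s)"
    by (simp add: integral_restrict_space)
  also have "\<dots> = (LINT s|lborel. indicator {0<..<T} (T + (-1) * s) *\<^sub>R f (T + (-1) * s))"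
    using lborel_integral_real_affine[of "-1" "\<lambda>s. indicator {0<..<T} s *\<^sub>R f s" T] by simp
  also have "\<dots> = (LINT s|lborel. indicator {0<..<T} s *\<^sub>R f (T - s))"
    by (intro Bochner_Integration.integral_cong) (auto simp: indicator_def)
  also have "\<dots> = (LINT s|lebI T. f (T - s))" by (simp add: integral_restrict_space)
  finally show ?thesis ..
qed

lemma lebI_reflect_nn_integral:
  assumes [measurable]: "f \<in> borel_measurable (lebI T)"
  shows "(\<integral>\<^sup>+s. f (T - s) \<partial>lebI T) = (\<integral>\<^sup>+s. f s \<partial>lebI T)"
proof -
  have [measurable]: "(\<lambda>s. f s * indicator {0<..<T} s) \<in> borel_measurable borel"
    using assms by (subst (asm) borel_measurable_restrict_space_iff_ennreal) auto
  have "(\<integral>\<^sup>+s. f s \<partial>lebI T) = (\<integral>\<^sup>+s. f s * indicator {0<..<T} s \<partial>lborel)"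
    by (simp add: nn_integral_restrict_space)
  also have "\<dots> = (\<integral>\<^sup>+s. f (T + (-1) * s) * indicator {0<..<T} (T + (-1) * s) \<partial>lborel)"
    by (subst nn_integral_real_affine[where c = "-1" and t = T]) auto
  also have "\<dots> = (\<integral>\<^sup>+s. f (T - s) * indicator {0<..<T} s \<partial>lborel)"
    by (intro nn_integral_cong) (auto simp: indicator_def)
  also have "\<dots> = (\<integral>\<^sup>+s. f (T - s) \<partial>lebI T)" by (simp add: nn_integral_restrict_space)
  finally show ?thesis ..
qed

lemma sqint_reflect:
  assumes f: "f \<in> sqint (lebI T)"
  shows "(\<lambda>s. f (T - s)) \<in> sqint (lebI T)"
proof (rule sqint_of_nn_integral[OF lebI_reflect_measurable[OF sqint_measurable[OF f]]])
  have m: "(\<lambda>s. ennreal ((cmod (f s))\<^sup>2)) \<in> borel_measurable (lebI T)"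
    using sqint_measurable[OF f] by measurable
  show "(\<integral>\<^sup>+x. ennreal ((cmod (f (T - x)))\<^sup>2) \<partial>lebI T) \<le> ennreal ((sq_nrm (lebI T) f)\<^sup>2)"
    using lebI_reflect_nn_integral[OF m] nn_integral_sq[OF f] by simp
qed

text \<open>Reflection preserves null sets, seen here through the integral of |f - g|.\<close>

lemma AE_lebI_reflect:
  assumes f: "f \<in> borel_measurable (lebI T)" and g: "g \<in> borel_measurable (lebI T)"
    and eq: "AE s in lebI T. f (T - s) = g (T - s)"
  shows "AE s in lebI T. f s = (g s :: complex)"
proof -
  define h where "h s = ennreal (cmod (f s - g s))" for s
  have h: "h \<in> borel_measurable (lebI T)" unfolding h_def using f g by measurable
  have "(\<integral>\<^sup>+s. h (T - s) \<partial>lebI T) = 0"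
    using eq lebI_reflect_measurable[OF f] lebI_reflect_measurable[OF g]
    by (subst nn_integral_0_iff_AE) (auto simp: h_def)
  then have "AE s in lebI T. h s = 0"
    using h by (simp add: lebI_reflect_nn_integral[OF h] nn_integral_0_iff_AE)
  then show ?thesis by eventually_elim (simp add: h_def)
qed

section \<open>Fourier images as power series; injectivity\<close>

lemma fourier_image_eq: "fourier_image T f \<mu> = (LINT s|lebI T. sin_kernel \<mu> s * f (T - s))"
  by (simp add: fourier_image_def lebI_integral)

text \<open>Termwise integration of the Taylor series in \<mu>. The series gives entireness, and its
  coefficients are the moments that determine the control.\<close>

lemma fourier_image_sums:
  assumes f: "f \<in> sqint (lebI T)"
  shows "(\<lambda>k. (LINT s|lebI T. sin_coef k s * f (T - s)) * \<mu> ^ k) sums fourier_image T f \<mu>"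
proof -
  define g where "g s = f (T - s)" for s
  have g: "integrable (lebI T) g" unfolding g_def by (rule sqint_lebI_integrable[OF sqint_reflect[OF f]])
  have gm: "g \<in> borel_measurable (lebI T)" using g by simp
  have cm: "sin_coef k \<in> borel_measurable (lebI T)" for k
    unfolding sin_coef_def by (intro lebI_measurable) measurable
  let ?b = "\<lambda>k. T * ((T\<^sup>2 * cmod \<mu>) ^ k / fact k)"
  have T: "T > 0" if "s \<in> space (lebI T)" for s using that by (auto simp: space_restrict_space)
  have bd: "cmod (sin_coef k s * \<mu> ^ k * g s) \<le> ?b k * cmod (g s)" if "s \<in> space (lebI T)" for s k
    unfolding norm_mult[of "sin_coef k s * \<mu> ^ k" "g s"] using that
    by (intro mult_right_mono cmod_sin_coef_le) (auto simp: space_restrict_space)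
  have ik: "integrable (lebI T) (\<lambda>s. sin_coef k s * \<mu> ^ k * g s)" for k
  proof (rule Bochner_Integration.integrable_bound)
    show "integrable (lebI T) (\<lambda>s. ?b k * cmod (g s))" using g by auto
    show "AE s in lebI T. norm (sin_coef k s * \<mu> ^ k * g s) \<le> norm (?b k * cmod (g s))"
      by (rule AE_I2) (use bd in \<open>force intro: order_trans[OF _ abs_ge_self]\<close>)
  qed (use cm gm in measurable)
  have "(\<lambda>k. (LINT s|lebI T. sin_coef k s * \<mu> ^ k * g s)) sums (LINT s|lebI T. (\<Sum>k. sin_coef k s * \<mu> ^ k * g s))"
  proof (rule sums_integral[OF ik])
    show "AE s in lebI T. summable (\<lambda>k. norm (sin_coef k s * \<mu> ^ k * g s))"
    proof (rule AE_I2)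
      fix s assume s: "s \<in> space (lebI T)"
      show "summable (\<lambda>k. norm (sin_coef k s * \<mu> ^ k * g s))"
        by (rule summable_comparison_test'[OF summable_mult2[OF summable_sin_bound[of T \<mu>], of "cmod (g s)"]])
           (use bd[OF s] in auto)
    qed
    show "summable (\<lambda>k. LINT s|lebI T. norm (sin_coef k s * \<mu> ^ k * g s))"
    proof (rule summable_comparison_test'[OF summable_mult2[OF summable_sin_bound[of T \<mu>], of "LINT s|lebI T. cmod (g s)"]])
      fix k :: nat
      have "(LINT s|lebI T. norm (sin_coef k s * \<mu> ^ k * g s)) \<le> (LINT s|lebI T. ?b k * cmod (g s))"
        using ik g bd by (intro integral_mono) auto
      then show "norm (LINT s|lebI T. norm (sin_coef k s * \<mu> ^ k * g s)) \<le> ?b k * (LINT s|lebI T. cmod (g s))"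
        by simp
    qed
  qed
  moreover have "(LINT s|lebI T. (\<Sum>k. sin_coef k s * \<mu> ^ k * g s)) = fourier_image T f \<mu>"
    unfolding fourier_image_eq g_def
    by (intro Bochner_Integration.integral_cong refl)
       (metis sums_mult2[OF sin_kernel_sums] sums_unique)
  moreover have "(LINT s|lebI T. sin_coef k s * \<mu> ^ k * g s) = (LINT s|lebI T. sin_coef k s * f (T - s)) * \<mu> ^ k" for k
  proof -
    have "(LINT s|lebI T. sin_coef k s * \<mu> ^ k * g s) = (LINT s|lebI T. sin_coef k s * f (T - s) * \<mu> ^ k)"
      by (intro Bochner_Integration.integral_cong) (auto simp: g_def mult_ac)
    then show ?thesis by (simp only: integral_mult_left_zero)
  qed
  ultimately show ?thesis by simp
qed

lemma fourier_image_entire: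
  assumes f: "f \<in> sqint (lebI T)"
  shows "fourier_image T f holomorphic_on UNIV"
proof -
  have "fourier_image T f holomorphic_on ball 0 r" for r
    by (rule power_series_holomorphic[where a = "\<lambda>k. LINT s|lebI T. sin_coef k s * f (T - s)"])
       (use fourier_image_sums[OF f] in simp)
  then have "fourier_image T f field_differentiable at z" for z
    using holomorphic_on_imp_differentiable_at[of _ "ball 0 (cmod z + 1)" z] by auto
  then show ?thesis by (auto simp: holomorphic_on_def intro: field_differentiable_at_within)
qed

text \<open>The even moments determine \<open>h\<close> because the polynomials in \<open>s\<^sup>2\<close> are dense in \<open>C[0,T]\<close>.\<close>

lemma even_moments_zero:
  fixes h :: "real \<Rightarrow> complex"
  assumes T: "T > 0" and h: "integrable (lebI T) h"
    and mom: "\<And>k. (LINT s|lebI T. of_real (s ^ (2 * k)) * h s) = 0"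
  shows "AE s in lebI T. h s = 0"
proof -
  have hm[measurable]: "h \<in> borel_measurable (lebI T)" using h by simp
  have bi: "integrable (lebI T) (\<lambda>s. of_real (p s) * h s)"
    if p: "p \<in> borel_measurable borel" "\<And>s. s \<in> {0..T} \<Longrightarrow> \<bar>p s\<bar> \<le> B" for p :: "real \<Rightarrow> real" and B
  proof (rule Bochner_Integration.integrable_bound)
    show "integrable (lebI T) (\<lambda>s. B * cmod (h s))" using h by auto
    show "AE s in lebI T. norm (of_real (p s) * h s) \<le> norm (B * cmod (h s))"
      by (rule AE_I2) (use p in \<open>auto simp: norm_mult space_restrict_space abs_mult intro!: mult_right_mono intro: order_trans[OF _ abs_ge_self]\<close>)
    have "p \<in> borel_measurable (lebI T)" by (rule lebI_measurable[OF p(1)])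
    then show "(\<lambda>s. of_real (p s) * h s) \<in> borel_measurable (lebI T)" by measurable
  qed
  have contb: "\<exists>B. \<forall>s\<in>{0..T}. \<bar>p s\<bar> \<le> B" if "continuous_on UNIV p" for p :: "real \<Rightarrow> real"
  proof -
    have "compact (p ` {0..T})" by (intro compact_continuous_image continuous_on_subset[OF that]) auto
    then show ?thesis using compact_imp_bounded[of "p ` {0..T}"] by (auto simp: bounded_iff)
  qed
  have polyc: "continuous_on UNIV (\<lambda>s. poly P (s\<^sup>2))" for P :: "real poly" by (intro continuous_intros)
  have polyzero: "(LINT s|lebI T. of_real (poly P (s\<^sup>2)) * h s) = 0" for P :: "real poly"
  proof -
    have ci: "integrable (lebI T) (\<lambda>s. of_real (s ^ (2 * i)) * h s)" for i
    proof (rule bi)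
      show "\<bar>s ^ (2 * i)\<bar> \<le> T ^ (2 * i)" if "s \<in> {0..T}" for s
        using that by (auto simp: power_abs[symmetric] intro!: power_mono)
    qed auto
    have "(LINT s|lebI T. of_real (poly P (s\<^sup>2)) * h s)
        = (LINT s|lebI T. (\<Sum>i\<le>degree P. of_real (coeff P i) * (of_real (s ^ (2 * i)) * h s)))"
      by (intro Bochner_Integration.integral_cong)
         (auto simp: poly_altdef sum_distrib_right power_mult mult.assoc)
    also have "\<dots> = (\<Sum>i\<le>degree P. LINT s|lebI T. of_real (coeff P i) * (of_real (s ^ (2 * i)) * h s))"
      by (rule Bochner_Integration.integral_sum) (intro integrable_mult_right ci)
    also have "\<dots> = 0" by (simp only: integral_mult_right_zero mom) simp
    finally show ?thesis .
  qed
  have contzero: "(LINT s|lebI T. of_real (p s) * h s) = 0" if p: "continuous_on UNIV p" for p :: "real \<Rightarrow> real"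
  proof -
    \<comment> \<open>Squares separate the points of [0,T] because this interval has no negative
      points.\<close>
    define R where "R = {g. \<exists>P :: real poly. g = (\<lambda>s. poly P (s\<^sup>2))}"
    interpret function_ring_on R "{0..T}"
    proof
      show "compact {0..T}" by simp
      show "continuous_on {0..T} f" if "f \<in> R" for f
        using that by (auto simp: R_def intro!: continuous_intros)
      show "(\<lambda>x. f x + g x) \<in> R" if "f \<in> R" "g \<in> R" for f g
      proof -
        obtain P Q where "f = (\<lambda>s. poly P (s\<^sup>2))" "g = (\<lambda>s. poly Q (s\<^sup>2))" using \<open>f \<in> R\<close> \<open>g \<in> R\<close> unfolding R_def by blast
        then have "(\<lambda>x. f x + g x) = (\<lambda>s. poly (P + Q) (s\<^sup>2))" by simp
        then show ?thesis unfolding R_def by blast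
      qed
      show "(\<lambda>x. f x * g x) \<in> R" if "f \<in> R" "g \<in> R" for f g
      proof -
        obtain P Q where "f = (\<lambda>s. poly P (s\<^sup>2))" "g = (\<lambda>s. poly Q (s\<^sup>2))" using \<open>f \<in> R\<close> \<open>g \<in> R\<close> unfolding R_def by blast
        then have "(\<lambda>x. f x * g x) = (\<lambda>s. poly (P * Q) (s\<^sup>2))" by simp
        then show ?thesis unfolding R_def by blast
      qed
      show "(\<lambda>_. c) \<in> R" for c by (auto simp: R_def intro!: exI[of _ "[:c:]"])
      show "\<exists>f\<in>R. f x \<noteq> f y" if xy: "x \<in> {0..T}" "y \<in> {0..T}" "x \<noteq> y" for x y
      proof (intro bexI[of _ "\<lambda>s. s\<^sup>2"])
        show "x\<^sup>2 \<noteq> y\<^sup>2" using xy by (auto simp: power2_eq_iff)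
        have "(\<lambda>s. s\<^sup>2) = (\<lambda>s. poly [:0, 1:] (s\<^sup>2 :: real))" by simp
        then show "(\<lambda>s. s\<^sup>2) \<in> R" unfolding R_def by blast
      qed
    qed
    have pT: "continuous_on {0..T} p" by (rule continuous_on_subset[OF p]) simp
    obtain Bp where Bp: "\<forall>s\<in>{0..T}. \<bar>p s\<bar> \<le> Bp" using contb[OF p] by blast
    have pm: "p \<in> borel_measurable borel" by (rule borel_measurable_continuous_onI[OF p])
    have small: "cmod (LINT s|lebI T. of_real (p s) * h s) \<le> e * (LINT s|lebI T. cmod (h s))" if e: "e > 0" for e
    proof -
      obtain g where g: "g \<in> R" "\<forall>x\<in>{0..T}. \<bar>p x - g x\<bar> < e"
        using Stone_Weierstrass_basic[OF pT e] by blast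
      then obtain P where P: "g = (\<lambda>s. poly P (s\<^sup>2))" by (auto simp: R_def)
      obtain Bg where Bg: "\<forall>s\<in>{0..T}. \<bar>g s\<bar> \<le> Bg" using contb[OF polyc[of P]] P by blast
      have gm: "g \<in> borel_measurable borel" unfolding P by (rule borel_measurable_continuous_onI[OF polyc])
      have i1: "integrable (lebI T) (\<lambda>s. of_real (p s) * h s)" by (rule bi[OF pm]) (use Bp in blast)
      have i2: "integrable (lebI T) (\<lambda>s. of_real (g s) * h s)" by (rule bi[OF gm]) (use Bg in blast)
      have "(LINT s|lebI T. of_real (p s) * h s) = (LINT s|lebI T. of_real (p s) * h s) - (LINT s|lebI T. of_real (g s) * h s)"
        using polyzero[of P] by (simp add: P)
      also have "\<dots> = (LINT s|lebI T. of_real (p s) * h s - of_real (g s) * h s)"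
        by (rule Bochner_Integration.integral_diff[OF i1 i2, symmetric])
      also have "cmod \<dots> \<le> (LINT s|lebI T. cmod (of_real (p s) * h s - of_real (g s) * h s))"
        by (rule integral_norm_bound)
      also have "\<dots> \<le> (LINT s|lebI T. e * cmod (h s))"
      proof (rule integral_mono)
        fix s assume s: "s \<in> space (lebI T)"
        have "of_real (p s) * h s - of_real (g s) * h s = of_real (p s - g s) * h s" by (simp add: algebra_simps)
        then have "cmod (of_real (p s) * h s - of_real (g s) * h s) = \<bar>p s - g s\<bar> * cmod (h s)"
          by (simp only: norm_mult norm_of_real)
        also have "\<dots> \<le> e * cmod (h s)" using g(2) s by (intro mult_right_mono) (auto simp: space_restrict_space less_imp_le)
        finally show "cmod (of_real (p s) * h s - of_real (g s) * h s) \<le> e * cmod (h s)" .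
      qed (use i1 i2 h in auto)
      finally show ?thesis by simp
    qed
    define I where "I = (LINT s|lebI T. cmod (h s))"
    have I: "I \<ge> 0" by (simp add: I_def)
    have "cmod (LINT s|lebI T. of_real (p s) * h s) \<le> 0"
    proof (rule field_le_epsilon)
      fix e :: real assume e: "e > 0"
      have "cmod (LINT s|lebI T. of_real (p s) * h s) \<le> e / (I + 1) * I"
        using small[of "e / (I + 1)", folded I_def] e I by simp
      also have "\<dots> \<le> 0 + e" using e I by (simp add: field_simps)
      finally show "cmod (LINT s|lebI T. of_real (p s) * h s) \<le> 0 + e" .
    qed
    then show ?thesis by simp
  qed
  define H where "H s = indicator {0<..<T} s *\<^sub>R h s" for s
  have H: "integrable lborel H" unfolding H_def using h by (simp add: integrable_restrict_space)
  have rays: "(LINT s|lborel. indicator {a<..} s *\<^sub>R H s) = 0" for a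
  proof -
    \<comment> \<open>Continuous ramps converging to the indicator of the open ray, so that
      vanishing passes from continuous test functions to rays.\<close>
    define p where "p n s = min 1 (max 0 (real n * (s - a)))" for n :: nat and s
    have "(\<lambda>n. LINT s|lborel. of_real (p n s) * H s) \<longlonglongrightarrow> (LINT s|lborel. indicator {a<..} s *\<^sub>R H s)"
    proof (rule integral_dominated_convergence[where w = "\<lambda>s. cmod (H s)"])
      show "AE s in lborel. (\<lambda>n. of_real (p n s) * H s) \<longlonglongrightarrow> indicator {a<..} s *\<^sub>R H s"
      proof (rule AE_I2)
        fix s
        have "(\<lambda>n. p n s) \<longlonglongrightarrow> indicator {a<..} s"
        proof (cases "s > a")
          case True
          obtain N :: nat where N: "real N > 1 / (s - a)" using reals_Archimedean2 by blast
          have "p n s = 1" if "n \<ge> N" for n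
          proof -
            have "real n > 1 / (s - a)" using N that by linarith
            then have "real n * (s - a) > 1" using True by (simp add: field_simps)
            then show ?thesis by (simp add: p_def)
          qed
          then show ?thesis using True by (intro tendsto_eventually) (auto simp: eventually_sequentially)
        next
          case False
          then have le0: "real n * (s - a) \<le> 0" for n by (simp add: mult_nonneg_nonpos)
          have "p n s = 0" for n using le0[of n] by (simp add: p_def)
          then show ?thesis using False by simp
        qed
        then have "(\<lambda>n. complex_of_real (p n s) * H s) \<longlonglongrightarrow> of_real (indicator {a<..} s) * H s"
          by (intro tendsto_intros)
        then show "(\<lambda>n. of_real (p n s) * H s) \<longlonglongrightarrow> indicator {a<..} s *\<^sub>R H s"
          by (simp add: scaleR_conv_of_real)
      qed
      show "AE s in lborel. norm (of_real (p n s) * H s) \<le> cmod (H s)" for n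
        by (rule AE_I2) (auto simp: norm_mult p_def intro!: mult_left_le_one_le)
      show "(\<lambda>s. of_real (p n s) * H s) \<in> borel_measurable lborel" for n
        using H unfolding p_def by measurable
    qed (use H in auto)
    moreover have "(LINT s|lborel. of_real (p n s) * H s) = 0" for n
    proof -
      have "(LINT s|lborel. of_real (p n s) * H s) = (LINT s|lebI T. of_real (p n s) * h s)"
        unfolding H_def by (subst integral_restrict_space) (auto intro!: Bochner_Integration.integral_cong)
      also have "\<dots> = 0" unfolding p_def by (intro contzero continuous_intros)
      finally show ?thesis .
    qed
    ultimately show ?thesis by (simp add: LIMSEQ_const_iff)
  qed
  \<comment> \<open>The positive and the negative part are densities of finite measures that agree
    on all rays, hence everywhere; so the densities agree almost everywhere.\<close>
  have real_case: "AE s in lborel. G s = 0"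
    if G: "integrable lborel G" and ray: "\<And>a. (LINT s|lborel. indicator {a<..} s *\<^sub>R G s) = 0" for G :: "real \<Rightarrow> real"
  proof -
    have Gm[measurable]: "G \<in> borel_measurable lborel" using G by simp
    define P where "P s = max 0 (G s)" for s
    define N where "N s = max 0 (- G s)" for s
    have PN: "integrable lborel P" "integrable lborel N" unfolding P_def N_def using G by auto
    have Gpn: "G s = P s - N s" for s by (simp add: P_def N_def)
    have nn: "(\<integral>\<^sup>+s. ennreal (Q s) * indicator {a<..} s \<partial>lborel) = ennreal (LINT s|lborel. indicator {a<..} s *\<^sub>R Q s)"
      if Q: "integrable lborel Q" "\<And>s. Q s \<ge> 0" for Q :: "real \<Rightarrow> real" and a
    proof -
      have "(\<integral>\<^sup>+s. ennreal (Q s) * indicator {a<..} s \<partial>lborel) = (\<integral>\<^sup>+s. ennreal (indicator {a<..} s *\<^sub>R Q s) \<partial>lborel)"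
        by (intro nn_integral_cong) (auto simp: indicator_def)
      also have "\<dots> = ennreal (LINT s|lborel. indicator {a<..} s *\<^sub>R Q s)"
        using Q by (intro nn_integral_eq_integral integrable_mult_indicator) (auto intro!: mult_nonneg_nonneg)
      finally show ?thesis .
    qed
    have "density lborel (\<lambda>s. ennreal (P s)) = density lborel (\<lambda>s. ennreal (N s))"
    proof (rule measure_eqI_lessThan)
      fix a
      have "(LINT s|lborel. indicator {a<..} s *\<^sub>R G s) = (LINT s|lborel. indicator {a<..} s *\<^sub>R P s - indicator {a<..} s *\<^sub>R N s)"
        by (simp add: Gpn right_diff_distrib)
      also have "\<dots> = (LINT s|lborel. indicator {a<..} s *\<^sub>R P s) - (LINT s|lborel. indicator {a<..} s *\<^sub>R N s)"
        using PN by (intro Bochner_Integration.integral_diff integrable_mult_indicator) auto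
      finally have eq: "(LINT s|lborel. indicator {a<..} s *\<^sub>R P s) = (LINT s|lborel. indicator {a<..} s *\<^sub>R N s)"
        using ray[of a] by simp
      have "emeasure (density lborel (\<lambda>s. ennreal (P s))) {a<..} = ennreal (LINT s|lborel. indicator {a<..} s *\<^sub>R P s)"
        using nn[OF PN(1)] PN by (subst emeasure_density) (auto simp: P_def)
      moreover have "emeasure (density lborel (\<lambda>s. ennreal (N s))) {a<..} = ennreal (LINT s|lborel. indicator {a<..} s *\<^sub>R N s)"
        using nn[OF PN(2)] PN by (subst emeasure_density) (auto simp: N_def)
      ultimately show "emeasure (density lborel (\<lambda>s. ennreal (P s))) {a<..} = emeasure (density lborel (\<lambda>s. ennreal (N s))) {a<..}"
        "emeasure (density lborel (\<lambda>s. ennreal (P s))) {a<..} < \<infinity>"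
        using eq by simp_all
    qed auto
    then have "AE s in lborel. ennreal (P s) = ennreal (N s)"
      using PN by (subst (asm) sigma_finite_measure.density_unique_iff[OF lborel.sigma_finite_measure_axioms]) auto
    then show ?thesis by eventually_elim (auto simp: P_def N_def max_def split: if_splits)
  qed
  have reim: "(LINT s|lborel. indicator {a<..} s *\<^sub>R Re (H s)) = 0" "(LINT s|lborel. indicator {a<..} s *\<^sub>R Im (H s)) = 0" for a
  proof -
    have i: "integrable lborel (\<lambda>s. indicator {a<..} s *\<^sub>R H s)" using H by (intro integrable_mult_indicator) auto
    show "(LINT s|lborel. indicator {a<..} s *\<^sub>R Re (H s)) = 0"
      using integral_Re[OF i] rays[of a] by simp
    show "(LINT s|lborel. indicator {a<..} s *\<^sub>R Im (H s)) = 0"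
      using integral_Im[OF i] rays[of a] by simp
  qed
  have "AE s in lborel. Re (H s) = 0" "AE s in lborel. Im (H s) = 0"
    using H reim by (auto intro!: real_case)
  then have "AE s in lborel. s \<in> {0<..<T} \<longrightarrow> h s = 0"
    by eventually_elim (auto simp: H_def complex_eq_iff)
  then show ?thesis by (simp add: AE_restrict_space_iff)
qed

text \<open>A vanishing power series has zero coefficients: the odd moments of f(T - s) vanish, that
  is, the even moments of s f(T - s), to which \<open>even_moments_zero\<close> applies.\<close>

lemma fourier_image_injective:
  assumes f: "f \<in> sqint (lebI T)" and T: "T > 0" and z: "\<And>\<mu>. fourier_image T f \<mu> = 0"
  shows "AE s in lebI T. f s = 0"
proof -
  define a where "a k = (LINT s|lebI T. sin_coef k s * f (T - s))" for k
  have sums: "(\<lambda>k. a k * (\<mu> - 0) ^ k) sums (0::complex)" for \<mu>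
    using fourier_image_sums[OF f, of \<mu>] z[of \<mu>] by (simp add: a_def)
  have a0: "a k = 0" for k
  \<comment> \<open>The constant coefficient is the value at 0; a nonzero coefficient of positive
    index would make 0 an isolated zero of the zero function.\<close>
  proof (cases "k = 0")
    case True
    have "(\<lambda>k. a k * 0 ^ k) sums 0" using sums[of 0] by (simp only: diff_zero)
    from sums_unique2[OF powser_sums_zero[of a] this] show ?thesis using True by simp
  next
    case False
    show ?thesis
    proof (rule ccontr)
      assume "a k \<noteq> 0"
      then obtain s where s: "0 < s" "\<And>z::complex. z \<in> cball 0 s - {0} \<Longrightarrow> (0::complex) \<noteq> 0"
        using powser_0_nonzero[of 1 0 a "\<lambda>_. 0" k] sums False by auto
      then have "complex_of_real s \<in> cball 0 s - {0}" by auto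
      then show False using s by blast
    qed
  qed
  have g: "integrable (lebI T) (\<lambda>s. f (T - s))" by (rule sqint_lebI_integrable[OF sqint_reflect[OF f]])
  have gm[measurable]: "(\<lambda>s. f (T - s)) \<in> borel_measurable (lebI T)" using g by simp
  define h where "h s = of_real s * f (T - s)" for s
  have "(\<lambda>s. complex_of_real s) \<in> borel_measurable (lebI T)" by (rule lebI_measurable) simp
  then have hm: "h \<in> borel_measurable (lebI T)" unfolding h_def by measurable
  have h: "integrable (lebI T) h"
  proof (rule Bochner_Integration.integrable_bound[OF _ hm])
    show "integrable (lebI T) (\<lambda>s. T * cmod (f (T - s)))" using g by auto
    show "AE s in lebI T. norm (h s) \<le> norm (T * cmod (f (T - s)))"
      by (rule AE_I2) (auto simp: h_def norm_mult space_restrict_space intro!: mult_right_mono)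
  qed
  have "(LINT s|lebI T. of_real (s ^ (2 * k)) * h s) = 0" for k
  proof -
    have "a k = (LINT s|lebI T. ((-1) ^ k / fact (2 * k + 1)) * (of_real (s ^ (2 * k)) * h s))"
      unfolding a_def by (intro Bochner_Integration.integral_cong) (auto simp: sin_coef_def h_def)
    also have "\<dots> = ((-1) ^ k / fact (2 * k + 1)) * (LINT s|lebI T. of_real (s ^ (2 * k)) * h s)"
      by (rule integral_mult_right_zero)
    finally show ?thesis using a0[of k] fact_nonzero[of "2 * k + 1", where 'a = complex] by (simp del: fact_Suc)
  qed
  then have "AE s in lebI T. h s = 0" by (rule even_moments_zero[OF T h])
  then have "AE s in lebI T. f (T - s) = 0"
    using AE_space by eventually_elim (auto simp: h_def space_restrict_space)
  then show ?thesis
    using AE_lebI_reflect[OF sqint_measurable[OF f], of "\<lambda>_. 0"] by simp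
qed

lemma fourier_image_linear:
  assumes f: "f \<in> sqint (lebI T)" and g: "g \<in> sqint (lebI T)"
  shows "fourier_image T (\<lambda>t. a * f t + b * g t) \<mu> = a * fourier_image T f \<mu> + b * fourier_image T g \<mu>"
proof -
  have i: "integrable (lebI T) (\<lambda>s. sin_kernel \<mu> s * h (T - s))" if h: "h \<in> sqint (lebI T)" for h
  proof (cases "T > 0")
    case True
    obtain B where "\<And>s. s \<in> {0..T} \<Longrightarrow> cmod (sin_kernel \<mu> s) \<le> B" using sin_kernel_bounded[OF True, of \<mu>] by blast
    then have "sin_kernel \<mu> \<in> sqint (lebI T)"
      by (intro lebI_bounded_sqint[of _ _ B] lebI_measurable sin_kernel_measurable) auto
    from sqint_product_integrable[OF sqint_cnj[OF this] sqint_reflect[OF h]] show ?thesis by simp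
  next
    case False
    then show ?thesis by (simp add: integrable_restrict_space)
  qed
  have "fourier_image T (\<lambda>t. a * f t + b * g t) \<mu>
      = (LINT s|lebI T. a * (sin_kernel \<mu> s * f (T - s)) + b * (sin_kernel \<mu> s * g (T - s)))"
    unfolding fourier_image_eq by (intro Bochner_Integration.integral_cong) (auto simp: algebra_simps)
  also have "\<dots> = (LINT s|lebI T. a * (sin_kernel \<mu> s * f (T - s))) + (LINT s|lebI T. b * (sin_kernel \<mu> s * g (T - s)))"
    by (intro Bochner_Integration.integral_add integrable_mult_right i f g)
  finally show ?thesis by (simp only: integral_mult_right_zero fourier_image_eq)
qed

lemma fourier_image_cnj: "fourier_image T (\<lambda>t. cnj (f t)) = sharp (fourier_image T f)"
  unfolding sharp_def fourier_image_eq
  by (simp add: fun_eq_iff sin_kernel_cnj flip: Bochner_Integration.integral_cnj)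

section \<open>The wave equation and the control operator\<close>

lemma characteristic_region_closed: "closed (characteristic_region x t)"
proof -
  have "characteristic_region x t = {z. 0 \<le> snd z} \<inter> {z. snd z \<le> t} \<inter> {z. \<bar>x - (t - snd z)\<bar> \<le> fst z} \<inter> {z. fst z \<le> x + (t - snd z)}"
    by (auto simp: characteristic_region_def)
  then show ?thesis by (simp only:) (intro closed_Int closed_Collect_le continuous_intros)
qed

lemma characteristic_region_measurable [measurable]:
  "characteristic_region x t \<in> sets (borel :: (real \<times> real) measure)"
  by (rule borel_closed[OF characteristic_region_closed])

definition region_integral :: "(real \<Rightarrow> real) \<Rightarrow> (real \<times> real \<Rightarrow> complex) \<Rightarrow> real \<Rightarrow> real \<Rightarrow> complex" where
  "region_integral p U x t = (LINT z:characteristic_region x t|lborel. of_real (p (fst z)) * U z)"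

lemma region_integral_measurable:
  assumes [measurable]: "p \<in> borel_measurable borel" "U \<in> borel_measurable borel"
  shows "(\<lambda>z. region_integral p U (fst z) (snd z)) \<in> borel_measurable borel"
proof -
  have U[measurable]: "U \<in> borel_measurable (borel \<Otimes>\<^sub>M borel)" using assms(2) by (simp add: borel_prod)
  have eq: "indicator (characteristic_region x t) z *\<^sub>R (of_real (p (fst z)) * U z)
     = (if 0 \<le> snd z \<and> snd z \<le> t \<and> \<bar>x - (t - snd z)\<bar> \<le> fst z \<and> fst z \<le> x + (t - snd z)
        then of_real (p (fst z)) * U z else 0)" for x t z
    by (auto simp: characteristic_region_def indicator_def)
  have "(\<lambda>v::real \<times> real. LINT z|(lborel \<Otimes>\<^sub>M lborel). (if 0 \<le> snd z \<and> snd z \<le> snd v \<and> \<bar>fst v - (snd v - snd z)\<bar> \<le> fst z \<and> fst z \<le> fst v + (snd v - snd z)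
        then of_real (p (fst z)) * U z else 0)) \<in> borel_measurable (borel \<Otimes>\<^sub>M borel)"
    by (intro sigma_finite_measure.borel_measurable_lebesgue_integral sigma_finite_pair_measure
          lborel.sigma_finite_measure_axioms) measurable
  then show ?thesis
    unfolding region_integral_def set_lebesgue_integral_def eq lborel_prod borel_prod .
qed

lemma region_integral_norm_le:
  assumes U: "\<And>z. z \<in> characteristic_region x t \<Longrightarrow> \<bar>p (fst z)\<bar> * cmod (U z) \<le> G z"
    and G: "(\<integral>\<^sup>+z. ennreal (G z) * indicator (characteristic_region x t) z \<partial>lborel) \<le> ennreal B" and B: "B \<ge> 0"
  shows "cmod (region_integral p U x t) \<le> B"
proof (cases "integrable lborel (\<lambda>z. indicator (characteristic_region x t) z *\<^sub>R (of_real (p (fst z)) * U z))")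
  case True
  have "ennreal (cmod (region_integral p U x t))
      \<le> (\<integral>\<^sup>+z. ennreal (norm (indicator (characteristic_region x t) z *\<^sub>R (of_real (p (fst z)) * U z))) \<partial>lborel)"
    unfolding region_integral_def set_lebesgue_integral_def by (rule integral_norm_bound_ennreal[OF True])
  also have "\<dots> \<le> (\<integral>\<^sup>+z. ennreal (G z) * indicator (characteristic_region x t) z \<partial>lborel)"
    by (intro nn_integral_mono) (auto simp: indicator_def norm_mult intro!: ennreal_leI U)
  also note G
  finally show ?thesis using B by simp
next
  \<comment> \<open>A non-integrable integrand has integral 0 by convention, and the bound then
    reads 0 <= B.\<close>
  case False
  then show ?thesis using B
    by (simp add: region_integral_def set_lebesgue_integral_def not_integrable_integral_eq)
qed

lemma nn_integral_exp:
  assumes l: "l > 0" and t: "t \<ge> 0"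
  shows "(\<integral>\<^sup>+s. ennreal (exp (l * s)) * indicator {0..t} s \<partial>lborel) \<le> ennreal (exp (l * t) / l)"
proof -
  have "(\<integral>\<^sup>+s. ennreal (exp (l * s)) * indicator {0..t} s \<partial>lborel) = exp (l * t) / l - exp (l * 0) / l"
  proof (rule nn_integral_FTC_Icc)
    fix x
    show "((\<lambda>s. exp (l * s) / l) has_real_derivative exp (l * x)) (at x)"
      using l by (auto intro!: derivative_eq_intros)
  qed (use t in auto)
  also have "\<dots> \<le> ennreal (exp (l * t) / l)" using l by (intro ennreal_leI) simp
  finally show ?thesis .
qed

lemma nn_integral_norm: "integrable M p \<Longrightarrow> (\<integral>\<^sup>+x. ennreal \<bar>p x\<bar> \<partial>M) = ennreal (LINT x|M. \<bar>p x\<bar>)" for p :: "'a \<Rightarrow> real"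
  by (rule nn_integral_eq_integral) auto

text \<open>For each y the region meets only times in [0,t], so the integral is at most |p|_1 c e^(l
  t) / l. With l at least |p|_1, the factor 1/2 of Duhamel's formula halves the bound in the
  sup-norm weighted by e^(l t).\<close>

lemma region_integral_half:
  assumes p: "integrable lborel p" and l: "l > 0" "l \<ge> (LINT y|lborel. \<bar>p y\<bar>)" and c: "c \<ge> 0" and t: "t \<ge> 0"
    and U: "\<And>z. z \<in> characteristic_region x t \<Longrightarrow> cmod (U z) \<le> c * exp (l * snd z)"
  shows "cmod (1/2 * region_integral p U x t) \<le> c / 2 * exp (l * t)"
proof -
  have pm[measurable]: "p \<in> borel_measurable borel" using p by auto
  let ?P = "LINT y|lborel. \<bar>p y\<bar>"
  have "cmod (region_integral p U x t) \<le> ?P * (c * (exp (l * t) / l))"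
  proof (rule region_integral_norm_le)
    show "\<bar>p (fst z)\<bar> * cmod (U z) \<le> \<bar>p (fst z)\<bar> * (c * exp (l * snd z))" if "z \<in> characteristic_region x t" for z
      by (intro mult_left_mono U that) auto
    have "(\<integral>\<^sup>+z. ennreal (\<bar>p (fst z)\<bar> * (c * exp (l * snd z))) * indicator (characteristic_region x t) z \<partial>lborel)
        \<le> (\<integral>\<^sup>+z. ennreal \<bar>p (fst z)\<bar> * (ennreal c * (ennreal (exp (l * snd z)) * indicator {0..t} (snd z))) \<partial>lborel)"
      by (intro nn_integral_mono) (use c in \<open>auto simp: indicator_def characteristic_region_def ennreal_mult mult_ac\<close>)
    also have "\<dots> = (\<integral>\<^sup>+y. \<integral>\<^sup>+s. ennreal \<bar>p y\<bar> * (ennreal c * (ennreal (exp (l * s)) * indicator {0..t} s)) \<partial>lborel \<partial>lborel)"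
      unfolding lborel_prod[symmetric] by (subst lborel.nn_integral_fst[symmetric]) auto
    also have "\<dots> = (\<integral>\<^sup>+y. ennreal \<bar>p y\<bar> * (ennreal c * (\<integral>\<^sup>+s. ennreal (exp (l * s)) * indicator {0..t} s \<partial>lborel)) \<partial>lborel)"
      by (simp add: nn_integral_cmult)
    also have "\<dots> = (\<integral>\<^sup>+y. ennreal \<bar>p y\<bar> \<partial>lborel) * (ennreal c * (\<integral>\<^sup>+s. ennreal (exp (l * s)) * indicator {0..t} s \<partial>lborel))"
      by (rule nn_integral_multc) auto
    also have "\<dots> \<le> ennreal ?P * (ennreal c * ennreal (exp (l * t) / l))"
      unfolding nn_integral_norm[OF p] by (intro mult_left_mono nn_integral_exp l t) auto
    also have "\<dots> = ennreal (?P * (c * (exp (l * t) / l)))"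
      using c l by (simp flip: ennreal_mult)
    finally show "(\<integral>\<^sup>+z. ennreal (\<bar>p (fst z)\<bar> * (c * exp (l * snd z))) * indicator (characteristic_region x t) z \<partial>lborel)
      \<le> ennreal (?P * (c * (exp (l * t) / l)))" .
  qed (use c l in auto)
  also have "?P * (c * (exp (l * t) / l)) = (?P / l) * (c * exp (l * t))" by simp
  also have "\<dots> \<le> 1 * (c * exp (l * t))" by (intro mult_right_mono) (use l c in auto)
  finally show ?thesis by (simp add: norm_mult)
qed

section \<open>Mild solutions of the wave equation: uniqueness and existence\<close>

locale wave =
  fixes q :: "real \<Rightarrow> real" and T :: real
  assumes q_loc: "\<And>a. a > 0 \<Longrightarrow> set_integrable lborel {0..a} q"
    and T_pos: "T > 0"
begin

text \<open>Of a solution only the integrability of q u is known. In the difference of two solutions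
  the free terms cancel, so it is an integral of an integrable function and bounded on a backward
  domain of dependence; then the bound can be halved.\<close>

lemma wave_solution_unique:
  assumes u: "wave_solution q T f u" and u': "wave_solution q T f u'"
    and x0: "x0 \<ge> 0" and t0: "t0 \<in> {0..T}"
  shows "u x0 t0 = u' x0 t0"
proof -
  define R where "R = x0 + t0 + 1"
  have R: "R > 0" using x0 t0 by (auto simp: R_def)
  define p where "p y = indicator {0..R} y * q y" for y
  have p: "integrable lborel p" using q_loc[OF R] by (simp add: set_integrable_def p_def[abs_def])
  define l where "l = (LINT y|lborel. \<bar>p y\<bar>) + 1"
  have l: "l > 0" "l \<ge> (LINT y|lborel. \<bar>p y\<bar>)"
    using Bochner_Integration.integral_nonneg[of lborel "\<lambda>y. \<bar>p y\<bar>"] by (auto simp: l_def intro: add_nonneg_pos)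
  \<comment> \<open>Contains the characteristic region of each of its points, and y <= R holds on
    it, so that \<open>q\<close> may be replaced by the integrable \<open>p\<close>.\<close>
  define X where "X = {z. 0 \<le> fst z \<and> 0 \<le> snd z \<and> snd z \<le> T \<and> fst z + snd z \<le> R}"
  define F where "F z = u (fst z) (snd z) - u' (fst z) (snd z)" for z
  have sub: "characteristic_region x t \<subseteq> X" "characteristic_region x t \<subseteq> {0..R} \<times> {0..T}" if "(x, t) \<in> X" for x t
    using that by (auto simp: characteristic_region_def X_def)
  define b where "b v = (LINT z:{0..R} \<times> {0..T}|lborel. cmod (of_real (q (fst z)) * v (fst z) (snd z)))" for v :: "real \<Rightarrow> real \<Rightarrow> complex"
  have si: "set_integrable lborel ({0..R} \<times> {0..T}) (\<lambda>z. of_real (q (fst z)) * v (fst z) (snd z))"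
    if "wave_solution q T f v" for v
    using that unfolding wave_solution_def case_prod_unfold by blast
  have sr: "set_integrable lborel (characteristic_region x t) (\<lambda>z. of_real (q (fst z)) * v (fst z) (snd z))"
    if "wave_solution q T f v" "(x, t) \<in> X" for v x t
    by (rule set_integrable_subset[OF si[OF that(1)]]) (use sub[OF that(2)] in auto)
  have eqF: "F (x, t) = - (1/2 * region_integral p F x t)" if X: "(x, t) \<in> X" for x t
  proof -
    have *: "v x t = (if x \<le> t then f (t - x) else 0) - 1/2 * (LINT z:characteristic_region x t|lborel. of_real (q (fst z)) * v (fst z) (snd z))"
      if "wave_solution q T f v" for v
      using that X by (auto simp: wave_solution_def X_def)
    have "F (x, t) = - (1/2 * ((LINT z:characteristic_region x t|lborel. of_real (q (fst z)) * u (fst z) (snd z))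
        - (LINT z:characteristic_region x t|lborel. of_real (q (fst z)) * u' (fst z) (snd z))))"
      unfolding F_def fst_conv snd_conv by (subst *[OF u], subst *[OF u']) (simp add: algebra_simps)
    also have "(LINT z:characteristic_region x t|lborel. of_real (q (fst z)) * u (fst z) (snd z))
        - (LINT z:characteristic_region x t|lborel. of_real (q (fst z)) * u' (fst z) (snd z))
        = (LINT z:characteristic_region x t|lborel. of_real (q (fst z)) * u (fst z) (snd z) - of_real (q (fst z)) * u' (fst z) (snd z))"
      by (rule set_integral_diff(2)[OF sr[OF u X] sr[OF u' X], symmetric])
    also have "\<dots> = region_integral p F x t"
      unfolding region_integral_def
      by (rule set_lebesgue_integral_cong) (use sub(2)[OF X] in \<open>auto simp: F_def p_def right_diff_distrib indicator_def\<close>)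
    finally show ?thesis .
  qed
  have b0: "b v \<ge> 0" for v unfolding b_def set_lebesgue_integral_def by (intro Bochner_Integration.integral_nonneg) auto
  have bnd: "cmod (LINT z:characteristic_region x t|lborel. of_real (q (fst z)) * v (fst z) (snd z)) \<le> b v"
    if v: "wave_solution q T f v" and X: "(x, t) \<in> X" for v x t
  proof -
    have "cmod (LINT z:characteristic_region x t|lborel. of_real (q (fst z)) * v (fst z) (snd z))
        \<le> (LINT z:characteristic_region x t|lborel. cmod (of_real (q (fst z)) * v (fst z) (snd z)))"
      unfolding set_lebesgue_integral_def by (rule order_trans[OF integral_norm_bound]) simp
    also have "\<dots> \<le> b v"
      unfolding b_def set_lebesgue_integral_def
    proof (rule integral_mono)
      show "integrable lborel (\<lambda>z. indicator (characteristic_region x t) z *\<^sub>R cmod (of_real (q (fst z)) * v (fst z) (snd z)))"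
        using set_integrable_norm[OF sr[OF v X]] by (simp add: set_integrable_def)
      show "integrable lborel (\<lambda>z. indicator ({0..R} \<times> {0..T}) z *\<^sub>R cmod (of_real (q (fst z)) * v (fst z) (snd z)))"
        using set_integrable_norm[OF si[OF v]] by (simp add: set_integrable_def)
    qed (use sub(2)[OF X] in \<open>auto simp: indicator_def\<close>)
    finally show ?thesis .
  qed
  have "F (x0, t0) = 0"
  proof (rule halving_imp_zero[where X = X and w = "\<lambda>z. exp (l * snd z)" and ?c0.0 = "b u + b u'"])
    show "b u + b u' \<ge> 0" using b0 by simp
    show "(x0, t0) \<in> X" using x0 t0 by (auto simp: X_def R_def)
    fix z assume z: "z \<in> X"
    obtain x t where xt: "z = (x, t)" by (cases z)
    have t: "t \<ge> 0" "t \<le> T" "x \<ge> 0" using z by (auto simp: X_def xt)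
    have "cmod (F z) = 1/2 * cmod ((LINT z:characteristic_region x t|lborel. of_real (q (fst z)) * u (fst z) (snd z))
        - (LINT z:characteristic_region x t|lborel. of_real (q (fst z)) * u' (fst z) (snd z)))"
    proof -
      have *: "v x t = (if x \<le> t then f (t - x) else 0) - 1/2 * (LINT z:characteristic_region x t|lborel. of_real (q (fst z)) * v (fst z) (snd z))"
        if "wave_solution q T f v" for v
        using that t by (auto simp: wave_solution_def)
      have "F z = - (1/2 * ((LINT z:characteristic_region x t|lborel. of_real (q (fst z)) * u (fst z) (snd z))
        - (LINT z:characteristic_region x t|lborel. of_real (q (fst z)) * u' (fst z) (snd z))))"
        unfolding F_def xt fst_conv snd_conv by (subst *[OF u], subst *[OF u']) (simp add: algebra_simps)
      then show ?thesis by (simp only: norm_minus_cancel norm_mult) simp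
    qed
    also have "\<dots> \<le> 1/2 * (b u + b u')"
      using norm_triangle_le_diff[OF add_mono[OF bnd[OF u z[unfolded xt]] bnd[OF u' z[unfolded xt]]]] by simp
    also have "\<dots> \<le> (b u + b u') * 1" using b0[of u] b0[of u'] by simp
    also have "\<dots> \<le> (b u + b u') * exp (l * snd z)"
      using b0[of u] b0[of u'] l t by (intro mult_left_mono) (auto simp: xt)
    finally show "cmod (F z) \<le> (b u + b u') * exp (l * snd z)" .
  next
    fix c z assume c: "c \<ge> 0" and F: "\<And>y. y \<in> X \<Longrightarrow> cmod (F y) \<le> c * exp (l * snd y)" and z: "z \<in> X"
    obtain x t where xt: "z = (x, t)" by (cases z)
    have "cmod (F z) = cmod (1/2 * region_integral p F x t)"
      using eqF[of x t] z by (simp add: xt)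
    also have "\<dots> \<le> c / 2 * exp (l * t)"
      using z sub(1)[of x t] F by (intro region_integral_half[OF p l c]) (auto simp: xt X_def)
    finally show "cmod (F z) \<le> c / 2 * exp (l * snd z)" by (simp add: xt)
  qed
  then show ?thesis by (simp add: F_def)
qed

text \<open>By finite speed of propagation the wave up to time T sees \<open>q\<close> on [0,T]
  only; cut off there, \<open>q\<close> becomes integrable on the line.\<close>

definition p :: "real \<Rightarrow> real" where "p y = indicator {0..T} y * q y"
definition P :: real where "P = (LINT y|lborel. \<bar>p y\<bar>)"
definition l :: real where "l = P + 1"
definition Dm :: "(real \<times> real) set" where "Dm = {z. 0 \<le> fst z \<and> 0 \<le> snd z \<and> snd z \<le> T}"
definition ctl :: "(real \<Rightarrow> complex) \<Rightarrow> real \<Rightarrow> complex" where "ctl f s = indicator {0..T} s *\<^sub>R f s"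
text \<open>The L_1 norm of the control up to time \<open>s\<close>. By causality the wave at (x,t)
  feels the control only up to time t - x, and estimates by \<open>cum f (t - x)\<close> are of
  Volterra type.\<close>

definition cum :: "(real \<Rightarrow> complex) \<Rightarrow> real \<Rightarrow> real" where
  "cum f s = (LINT r|lborel. indicator {..s} r *\<^sub>R cmod (ctl f r))"
definition free :: "(real \<Rightarrow> complex) \<Rightarrow> real \<times> real \<Rightarrow> complex" where
  "free f z = indicator {z \<in> Dm. fst z \<le> snd z} z *\<^sub>R ctl f (snd z - fst z)"

lemma p_integrable: "integrable lborel p"
  using q_loc[OF T_pos] by (simp add: set_integrable_def p_def[abs_def])

lemma p_measurable [measurable]: "p \<in> borel_measurable borel"
  using p_integrable by auto

lemma P_nonneg: "P \<ge> 0" by (simp add: P_def)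

lemma l_pos: "l > 0" "l \<ge> (LINT y|lborel. \<bar>p y\<bar>)"
  using P_nonneg by (simp_all add: l_def) (simp add: P_def)

lemma Dm_closed: "closed Dm" "closed {z \<in> Dm. fst z \<le> snd z}"
proof -
  have eq: "Dm = {z. 0 \<le> fst z} \<inter> {z. 0 \<le> snd z} \<inter> {z. snd z \<le> T}"
    "{z \<in> Dm. fst z \<le> snd z} = {z. 0 \<le> fst z} \<inter> {z. 0 \<le> snd z} \<inter> {z. snd z \<le> T} \<inter> {z. fst z \<le> snd z}"
    by (auto simp: Dm_def)
  show "closed Dm" unfolding eq(1) by (intro closed_Int closed_Collect_le continuous_intros)
  show "closed {z \<in> Dm. fst z \<le> snd z}" unfolding eq(2) by (intro closed_Int closed_Collect_le continuous_intros)
qed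

lemma Dm_measurable [measurable]: "Dm \<in> sets borel" "{z \<in> Dm. fst z \<le> snd z} \<in> sets borel"
  by (rule borel_closed[OF Dm_closed(1)] borel_closed[OF Dm_closed(2)])+

lemma region_subset_Dm: "(x, t) \<in> Dm \<Longrightarrow> z \<in> characteristic_region x t \<Longrightarrow> z \<in> Dm"
  by (auto simp: Dm_def characteristic_region_def)

lemma region_diff_le: "z \<in> characteristic_region x t \<Longrightarrow> snd z - fst z \<le> t - x"
  by (auto simp: characteristic_region_def)

text \<open>\<open>f\<close> is measurable on the open interval; its values at 0 and T are added
  back as multiples of indicators of points. They are kept because \<open>wave_solution\<close> is a
  pointwise equation and evaluates \<open>f\<close> there as well.\<close>

lemma ctl_borel:
  assumes "f \<in> borel_measurable (lebI T)"
  shows "ctl f \<in> borel_measurable borel"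
proof -
  have "(\<lambda>s. indicator {0<..<T} s *\<^sub>R f s) \<in> borel_measurable lborel"
    using assms by (simp add: borel_measurable_restrict_space_iff)
  then have [measurable]: "(\<lambda>s. indicator {0<..<T} s *\<^sub>R f s) \<in> borel_measurable borel" by simp
  have "ctl f = (\<lambda>s. indicator {0<..<T} s *\<^sub>R f s + indicator {0} s *\<^sub>R f 0 + indicator {T} s *\<^sub>R f T)"
    using T_pos by (auto simp: ctl_def indicator_def fun_eq_iff)
  then show ?thesis by simp
qed

lemma AE_not_endpoint: "AE s in lborel. s \<noteq> 0 \<and> s \<noteq> T"
  using AE_lborel_singleton[of "0::real"] AE_lborel_singleton[of T] by eventually_elim auto

lemma ctl_integrable:
  assumes f: "integrable (lebI T) f"
  shows "integrable lborel (ctl f)"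
proof -
  have i: "integrable lborel (\<lambda>s. indicator {0<..<T} s *\<^sub>R f s)"
    using f by (simp add: integrable_restrict_space)
  have "ctl f \<in> borel_measurable lborel" using ctl_borel[of f] f by auto
  moreover have "AE s in lborel. indicator {0<..<T} s *\<^sub>R f s = ctl f s"
    using AE_not_endpoint by eventually_elim (auto simp: ctl_def indicator_def)
  ultimately show ?thesis using i integrable_cong_AE_imp by blast
qed

lemma cum_integrable:
  assumes "integrable (lebI T) f"
  shows "integrable lborel (\<lambda>r. indicator {..s} r *\<^sub>R cmod (ctl f r))"
  using ctl_integrable[OF assms] by (intro integrable_mult_indicator) auto

lemma cum_nonneg: "cum f s \<ge> 0"
  unfolding cum_def by (intro Bochner_Integration.integral_nonneg) auto

lemma cum_mono:
  assumes "integrable (lebI T) f" "s \<le> s'"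
  shows "cum f s \<le> cum f s'"
  unfolding cum_def using assms by (intro integral_mono cum_integrable) (auto simp: indicator_def)

text \<open>Finite speed of propagation: corrections bounded by \<open>cum f (t - x)\<close> vanish
  for x > t.\<close>

lemma cum_neg: "s < 0 \<Longrightarrow> cum f s = 0"
proof -
  assume "s < 0"
  then have "indicator {..s} r *\<^sub>R cmod (ctl f r) = 0" for r by (auto simp: indicator_def ctl_def)
  then show ?thesis unfolding cum_def by (simp only:) simp
qed

lemma cum_nn_integral:
  assumes "integrable (lebI T) f"
  shows "(\<integral>\<^sup>+r. ennreal (cmod (ctl f r)) * indicator {..s} r \<partial>lborel) = ennreal (cum f s)"
proof -
  have "(\<integral>\<^sup>+r. ennreal (cmod (ctl f r)) * indicator {..s} r \<partial>lborel) = (\<integral>\<^sup>+r. ennreal (indicator {..s} r *\<^sub>R cmod (ctl f r)) \<partial>lborel)"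
    by (intro nn_integral_cong) (auto simp: indicator_def)
  also have "\<dots> = ennreal (cum f s)"
    unfolding cum_def using cum_integrable[OF assms] by (intro nn_integral_eq_integral) auto
  finally show ?thesis .
qed

lemma cum_le_total:
  assumes "integrable (lebI T) f"
  shows "cum f s \<le> (LINT r|lebI T. cmod (f r))"
proof -
  have "cum f s \<le> (LINT r|lborel. cmod (ctl f r))"
    unfolding cum_def using ctl_integrable[OF assms] cum_integrable[OF assms]
    by (intro integral_mono) (auto simp: indicator_def)
  also have "\<dots> = (LINT r|lborel. indicator {0<..<T} r *\<^sub>R cmod (f r))"
  proof (rule integral_cong_AE)
    show "AE r in lborel. cmod (ctl f r) = indicator {0<..<T} r *\<^sub>R cmod (f r)"
      using AE_not_endpoint by eventually_elim (auto simp: ctl_def indicator_def)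
    have "integrable (lebI T) (\<lambda>r. cmod (f r))" using assms by auto
    then show "(\<lambda>r. indicator {0<..<T} r *\<^sub>R cmod (f r)) \<in> borel_measurable lborel"
      by (auto simp: integrable_restrict_space)
    show "(\<lambda>r. cmod (ctl f r)) \<in> borel_measurable lborel" using ctl_integrable[OF assms] by auto
  qed
  also have "\<dots> = (LINT r|lebI T. cmod (f r))" by (simp add: integral_restrict_space)
  finally show ?thesis .
qed

lemma cum_exp_le:
  assumes f: "integrable (lebI T) f" and a: "a > 0" and c: "c \<ge> 0" and s: "s \<ge> 0"
    and b: "\<And>r. r \<in> {0..T} \<Longrightarrow> r \<le> s \<Longrightarrow> cmod (f r) \<le> c * exp (a * r)"
  shows "cum f s \<le> c * (exp (a * s) / a)"
proof -
  have "ennreal (cum f s) \<le> (\<integral>\<^sup>+r. ennreal c * (ennreal (exp (a * r)) * indicator {0..s} r) \<partial>lborel)"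
    unfolding cum_nn_integral[OF f, symmetric]
  proof (rule nn_integral_mono)
    fix r
    show "ennreal (cmod (ctl f r)) * indicator {..s} r \<le> ennreal c * (ennreal (exp (a * r)) * indicator {0..s} r)"
    proof (cases "r \<in> {0..T} \<and> r \<le> s")
      case True
      then show ?thesis using b[of r] c by (auto simp: ctl_def ennreal_mult[symmetric] intro!: ennreal_leI)
    qed (auto simp: ctl_def indicator_def)
  qed
  also have "\<dots> = ennreal c * (\<integral>\<^sup>+r. ennreal (exp (a * r)) * indicator {0..s} r \<partial>lborel)"
    by (rule nn_integral_cmult) auto
  also have "\<dots> \<le> ennreal c * ennreal (exp (a * s) / a)"
    by (intro mult_left_mono nn_integral_exp a s) auto
  also have "\<dots> = ennreal (c * (exp (a * s) / a))" using c a by (simp flip: ennreal_mult)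
  finally show ?thesis using c a by (subst (asm) ennreal_le_iff) auto
qed

lemma free_measurable:
  assumes "f \<in> borel_measurable (lebI T)"
  shows "free f \<in> borel_measurable borel"
proof -
  have [measurable]: "ctl f \<in> borel_measurable borel" by (rule ctl_borel[OF assms])
  have [measurable]: "(\<lambda>z::real \<times> real. snd z - fst z) \<in> borel_measurable borel"
    by (intro borel_measurable_continuous_onI continuous_intros)
  show ?thesis unfolding free_def by measurable
qed

text \<open>In the sheared coordinates (y, t - y) the integrand is a product.\<close>

lemma nn_integral_convolution:
  fixes g h :: "real \<Rightarrow> ennreal"
  assumes [measurable]: "g \<in> borel_measurable borel" "h \<in> borel_measurable borel"
  shows "(\<integral>\<^sup>+z. g (fst z) * h (snd z - fst z) \<partial>lborel) = (\<integral>\<^sup>+y. g y \<partial>lborel) * (\<integral>\<^sup>+s. h s \<partial>lborel)"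
proof -
  have "(\<integral>\<^sup>+z. g (fst z) * h (snd z - fst z) \<partial>lborel) = (\<integral>\<^sup>+y. \<integral>\<^sup>+t. g y * h (t - y) \<partial>lborel \<partial>lborel)"
    unfolding lborel_prod[symmetric] by (subst lborel.nn_integral_fst[symmetric]) auto
  also have "\<dots> = (\<integral>\<^sup>+y. g y * (\<integral>\<^sup>+s. h s \<partial>lborel) \<partial>lborel)"
  proof (rule nn_integral_cong)
    fix y
    have "(\<integral>\<^sup>+t. g y * h (t - y) \<partial>lborel) = g y * (\<integral>\<^sup>+t. h (t - y) \<partial>lborel)"
      by (rule nn_integral_cmult) auto
    also have "(\<integral>\<^sup>+t. h (t - y) \<partial>lborel) = (\<integral>\<^sup>+s. h s \<partial>lborel)"
      using nn_integral_real_affine[of h 1 "- y"] by simp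
    finally show "(\<integral>\<^sup>+t. g y * h (t - y) \<partial>lborel) = g y * (\<integral>\<^sup>+s. h s \<partial>lborel)" .
  qed
  also have "\<dots> = (\<integral>\<^sup>+y. g y \<partial>lborel) * (\<integral>\<^sup>+s. h s \<partial>lborel)" by (rule nn_integral_multc) auto
  finally show ?thesis .
qed

lemma free_norm_le: "cmod (free f z) \<le> cmod (ctl f (snd z - fst z))"
  by (auto simp: free_def indicator_def)

lemma nn_integral_p_ctl:
  assumes f: "integrable (lebI T) f"
  shows "(\<integral>\<^sup>+z. ennreal (\<bar>p (fst z)\<bar> * cmod (ctl f (snd z - fst z))) * indicator {..s} (snd z - fst z) \<partial>lborel)
      = ennreal (P * cum f s)"
proof -
  have [measurable]: "ctl f \<in> borel_measurable borel" using ctl_integrable[OF f] by auto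
  have "(\<integral>\<^sup>+z. ennreal (\<bar>p (fst z)\<bar> * cmod (ctl f (snd z - fst z))) * indicator {..s} (snd z - fst z) \<partial>lborel)
      = (\<integral>\<^sup>+z. ennreal \<bar>p (fst z)\<bar> * (ennreal (cmod (ctl f (snd z - fst z))) * indicator {..s} (snd z - fst z)) \<partial>lborel)"
    by (simp add: ennreal_mult mult.assoc)
  also have "\<dots> = (\<integral>\<^sup>+y. ennreal \<bar>p y\<bar> \<partial>lborel) * (\<integral>\<^sup>+r. ennreal (cmod (ctl f r)) * indicator {..s} r \<partial>lborel)"
    by (rule nn_integral_convolution[where g = "\<lambda>y. ennreal \<bar>p y\<bar>" and h = "\<lambda>r. ennreal (cmod (ctl f r)) * indicator {..s} r"]) measurable
  finally show ?thesis
    using P_nonneg cum_nonneg by (simp add: nn_integral_norm[OF p_integrable] cum_nn_integral[OF f] P_def ennreal_mult)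
qed

lemma p_free_integrable:
  assumes f: "integrable (lebI T) f"
  shows "integrable lborel (\<lambda>z. of_real (p (fst z)) * free f z)"
proof (rule integrableI_bounded)
  have [measurable]: "free f \<in> borel_measurable borel" using free_measurable f by auto
  have [measurable]: "(\<lambda>z::real \<times> real. p (fst z)) \<in> borel_measurable borel"
    unfolding borel_prod[symmetric] by measurable
  show "(\<lambda>z. complex_of_real (p (fst z)) * free f z) \<in> borel_measurable lborel" by simp
  have "(\<integral>\<^sup>+z. ennreal (norm (complex_of_real (p (fst z)) * free f z)) \<partial>lborel)
      \<le> (\<integral>\<^sup>+z. ennreal (\<bar>p (fst z)\<bar> * cmod (ctl f (snd z - fst z))) * indicator {..T} (snd z - fst z) \<partial>lborel)"
    by (intro nn_integral_mono)
       (auto simp: norm_mult free_def ctl_def indicator_def)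
  also have "\<dots> < \<infinity>" unfolding nn_integral_p_ctl[OF f] by simp
  finally show "(\<integral>\<^sup>+z. ennreal (norm (complex_of_real (p (fst z)) * free f z)) \<partial>lborel) < \<infinity>" .
qed

lemma p_bounded_integrable:
  assumes F: "F \<in> borel_measurable borel" and b: "\<And>z. cmod (F z) \<le> c * indicator Dm z"
  shows "integrable lborel (\<lambda>z. of_real (p (fst z)) * F z)"
proof (rule integrableI_bounded)
  note F[measurable]
  have [measurable]: "(\<lambda>z::real \<times> real. p (fst z)) \<in> borel_measurable borel"
    unfolding borel_prod[symmetric] by measurable
  show "(\<lambda>z. complex_of_real (p (fst z)) * F z) \<in> borel_measurable lborel" by simp
  have "0 \<le> c * indicator Dm (0, 0)" using b[of "(0, 0)"] norm_ge_zero order_trans by blast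
  then have c: "c \<ge> 0" using T_pos by (simp add: Dm_def)
  have "(\<integral>\<^sup>+z. ennreal (norm (complex_of_real (p (fst z)) * F z)) \<partial>lborel)
      \<le> (\<integral>\<^sup>+z. ennreal \<bar>p (fst z)\<bar> * (ennreal c * indicator {0..T} (snd z)) \<partial>lborel)"
  proof (rule nn_integral_mono)
    fix z :: "real \<times> real"
    have "\<bar>p (fst z)\<bar> * cmod (F z) \<le> \<bar>p (fst z)\<bar> * (c * indicator {0..T} (snd z))"
    proof (rule mult_left_mono)
      show "cmod (F z) \<le> c * indicator {0..T} (snd z)"
        by (rule order_trans[OF b]) (use c in \<open>auto simp: Dm_def indicator_def\<close>)
    qed simp
    then have "ennreal (norm (complex_of_real (p (fst z)) * F z)) \<le> ennreal (\<bar>p (fst z)\<bar> * (c * indicator {0..T} (snd z)))"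
      by (intro ennreal_leI) (simp add: norm_mult)
    also have "\<dots> = ennreal \<bar>p (fst z)\<bar> * (ennreal c * indicator {0..T} (snd z))"
      using c by (cases "snd z \<in> {0..T}") (simp_all add: ennreal_mult)
    finally show "ennreal (norm (complex_of_real (p (fst z)) * F z)) \<le> \<dots>" .
  qed
  also have "\<dots> = (\<integral>\<^sup>+y. \<integral>\<^sup>+s. ennreal \<bar>p y\<bar> * (ennreal c * indicator {0..T} s) \<partial>lborel \<partial>lborel)"
    unfolding lborel_prod[symmetric] by (subst lborel.nn_integral_fst[symmetric]) auto
  also have "\<dots> = (\<integral>\<^sup>+y. ennreal \<bar>p y\<bar> * (ennreal c * ennreal T) \<partial>lborel)"
    using T_pos by (simp add: nn_integral_cmult nn_integral_cmult_indicator)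
  also have "\<dots> = (\<integral>\<^sup>+y. ennreal \<bar>p y\<bar> \<partial>lborel) * (ennreal c * ennreal T)"
    by (rule nn_integral_multc) auto
  also have "\<dots> < \<infinity>" by (simp add: nn_integral_norm[OF p_integrable] ennreal_mult_less_top)
  finally show "(\<integral>\<^sup>+z. ennreal (norm (complex_of_real (p (fst z)) * F z)) \<partial>lborel) < \<infinity>" .
qed

lemma region_integral_diff:
  assumes "integrable lborel (\<lambda>z. of_real (p (fst z)) * F z)" "integrable lborel (\<lambda>z. of_real (p (fst z)) * G z)"
  shows "region_integral p (\<lambda>z. F z - G z) x t = region_integral p F x t - region_integral p G x t"
    and "region_integral p (\<lambda>z. F z + G z) x t = region_integral p F x t + region_integral p G x t"
proof -
  have i: "set_integrable lborel (characteristic_region x t) (\<lambda>z. of_real (p (fst z)) * H z)"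
    if "integrable lborel (\<lambda>z. of_real (p (fst z)) * H z)" for H :: "real \<times> real \<Rightarrow> complex"
    unfolding set_integrable_def using that by (intro integrable_mult_indicator) auto
  show "region_integral p (\<lambda>z. F z - G z) x t = region_integral p F x t - region_integral p G x t"
    unfolding region_integral_def right_diff_distrib by (intro set_integral_diff(2) i assms)
  show "region_integral p (\<lambda>z. F z + G z) x t = region_integral p F x t + region_integral p G x t"
    unfolding region_integral_def distrib_left by (intro set_integral_add(2) i assms)
qed

text \<open>On a characteristic region \<open>snd z - fst z\<close> is largest at the vertex
  (\<open>region_diff_le\<close>), so the first factor can be frozen there, and the exponential
  gives the halving of \<open>region_integral_half\<close>.\<close>

definition wt :: "(real \<Rightarrow> complex) \<Rightarrow> real \<times> real \<Rightarrow> real" where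
  "wt f z = indicator Dm z * (cum f (snd z - fst z) * exp (l * snd z))"

text \<open>The unknown is the wave minus the free wave. The free wave is only integrable, like
  \<open>f\<close>, but one application of the integral operator to it is already bounded, by
  \<open>P / 2 * wt f\<close>; from there the Neumann series runs in the sup-norm weighted by
  \<open>wt f\<close>.\<close>

lemma wave_correction_exists:
  assumes f: "integrable (lebI T) f"
  obtains v where "v \<in> borel_measurable borel" "\<And>z. cmod (v z) \<le> P * wt f z"
    "\<And>x t. (x, t) \<in> Dm \<Longrightarrow> v (x, t) = - (1/2 * region_integral p (\<lambda>z. free f z + v z) x t)"
    "integrable lborel (\<lambda>z. of_real (p (fst z)) * v z)"
proof -
  have fm: "f \<in> borel_measurable (lebI T)" using f by auto
  define A where "A F z = - (indicator Dm z *\<^sub>R (1/2 * region_integral p F (fst z) (snd z)))" for F z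
  have wt_le: "wt f z \<le> cum f T * exp (l * T) * indicator Dm z" for z
  proof (cases "z \<in> Dm")
    case True
    then show ?thesis using l_pos cum_nonneg[of f] cum_mono[OF f]
      by (auto simp: wt_def Dm_def intro!: mult_mono)
  qed (simp add: wt_def)
  have int: "integrable lborel (\<lambda>z. of_real (p (fst z)) * F z)"
    if "F \<in> borel_measurable borel" "\<And>z. cmod (F z) \<le> c * wt f z" for F c
  proof (rule p_bounded_integrable[OF that(1)])
    fix z
    have "cmod (F z) \<le> \<bar>c\<bar> * wt f z"
      using that(2)[of z] by (rule order_trans) (intro mult_right_mono, auto simp: wt_def cum_nonneg)
    also have "\<dots> \<le> \<bar>c\<bar> * (cum f T * exp (l * T) * indicator Dm z)" by (intro mult_left_mono wt_le) simp
    finally show "cmod (F z) \<le> \<bar>c\<bar> * (cum f T * exp (l * T)) * indicator Dm z" by (simp add: mult.assoc)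
  qed
  have Am: "A F \<in> borel_measurable borel" if "F \<in> borel_measurable borel" for F
  proof -
    note region_integral_measurable[OF p_measurable that, measurable]
    show ?thesis unfolding A_def by measurable
  qed
  have g_bound: "cmod (A (free f) z) \<le> P / 2 * wt f z" for z
  proof (cases "z \<in> Dm")
    case True
    obtain x t where z: "z = (x, t)" by (cases z)
    have "cmod (region_integral p (free f) x t) \<le> P * cum f (t - x)"
    proof (rule region_integral_norm_le)
      show "\<bar>p (fst y)\<bar> * cmod (free f y) \<le> \<bar>p (fst y)\<bar> * cmod (ctl f (snd y - fst y))" for y
        by (intro mult_left_mono free_norm_le) simp
      have "(\<integral>\<^sup>+y. ennreal (\<bar>p (fst y)\<bar> * cmod (ctl f (snd y - fst y))) * indicator (characteristic_region x t) y \<partial>lborel)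
        \<le> (\<integral>\<^sup>+y. ennreal (\<bar>p (fst y)\<bar> * cmod (ctl f (snd y - fst y))) * indicator {..t - x} (snd y - fst y) \<partial>lborel)"
        by (intro nn_integral_mono mult_left_mono) (auto simp: indicator_def dest: region_diff_le)
      then show "(\<integral>\<^sup>+y. ennreal (\<bar>p (fst y)\<bar> * cmod (ctl f (snd y - fst y))) * indicator (characteristic_region x t) y \<partial>lborel)
        \<le> ennreal (P * cum f (t - x))" unfolding nn_integral_p_ctl[OF f] .
    qed (use P_nonneg cum_nonneg in auto)
    then have "cmod (A (free f) z) \<le> P / 2 * cum f (t - x) * 1"
      using True by (simp add: A_def z norm_mult)
    also have "\<dots> \<le> P / 2 * cum f (t - x) * exp (l * t)"
      using True P_nonneg cum_nonneg[of f] l_pos by (intro mult_left_mono) (auto simp: Dm_def z)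
    finally show ?thesis using True by (simp add: wt_def z)
  qed (simp add: A_def wt_def)
  obtain v where v: "v \<in> borel_measurable borel" "\<And>z. cmod (v z) \<le> 2 * (P / 2) * wt f z"
    "\<And>z. v z = A (free f) z + A v z"
  proof (rule weighted_neumann[where A = A and w = "wt f" and Adm = "\<lambda>F. F \<in> borel_measurable borel" and g = "A (free f)" and ?c0.0 = "P / 2"])
    show "wt f z \<ge> 0" for z by (simp add: wt_def cum_nonneg)
    show "F \<in> borel_measurable borel"
      if "\<And>n. S n \<in> borel_measurable borel" "\<And>x. (\<lambda>n. S n x) \<longlonglongrightarrow> F x" for S and F :: "real \<times> real \<Rightarrow> complex"
      by (rule borel_measurable_LIMSEQ_metric[OF that])
    show "A F \<in> borel_measurable borel" if "F \<in> borel_measurable borel" for F by (rule Am[OF that])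
    show "A (\<lambda>z. F z - G z) z = A F z - A G z"
      if "F \<in> borel_measurable borel" "G \<in> borel_measurable borel" "\<And>z. cmod (F z) \<le> c * wt f z" "\<And>z. cmod (G z) \<le> c * wt f z" for F G c z
      unfolding A_def region_integral_diff(1)[OF int[OF that(1,3)] int[OF that(2,4)]] by (simp add: algebra_simps)
    show "cmod (A F z) \<le> c / 2 * wt f z"
      if F: "\<And>z. cmod (F z) \<le> c * wt f z" and c: "c \<ge> 0" for F c z
    proof (cases "z \<in> Dm")
      case True
      obtain x t where z: "z = (x, t)" by (cases z)
      have "cmod (1/2 * region_integral p F x t) \<le> c * cum f (t - x) / 2 * exp (l * t)"
      proof (rule region_integral_half[OF p_integrable l_pos])
        fix y assume y: "y \<in> characteristic_region x t"
        have yD: "y \<in> Dm" using True y region_subset_Dm z by blast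
        have "cmod (F y) \<le> c * (cum f (snd y - fst y) * exp (l * snd y))" using F[of y] yD by (simp add: wt_def)
        also have "\<dots> \<le> c * (cum f (t - x) * exp (l * snd y))"
          using region_diff_le[OF y] c by (intro mult_left_mono mult_right_mono cum_mono f) auto
        finally show "cmod (F y) \<le> c * cum f (t - x) * exp (l * snd y)" by (simp add: mult.assoc)
      qed (use True c cum_nonneg in \<open>auto simp: Dm_def z\<close>)
      then show ?thesis using True by (simp add: A_def wt_def z)
    qed (simp add: A_def wt_def)
    show "P / 2 \<ge> 0" using P_nonneg by simp
    show "cmod (A (free f) z) \<le> P / 2 * wt f z" for z by (rule g_bound)
    show "A (free f) \<in> borel_measurable borel" by (rule Am[OF free_measurable[OF fm]])
  qed (auto intro!: borel_measurable_add borel_measurable_diff)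
  have vP: "cmod (v z) \<le> P * wt f z" for z using v(2)[of z] by simp
  have iv: "integrable lborel (\<lambda>z. of_real (p (fst z)) * v z)" by (rule int[OF v(1) vP])
  have "v (x, t) = - (1/2 * region_integral p (\<lambda>z. free f z + v z) x t)" if "(x, t) \<in> Dm" for x t
    using v(3)[of "(x, t)"] that
    unfolding region_integral_diff(2)[OF p_free_integrable[OF f] iv] by (simp add: A_def algebra_simps)
  then show ?thesis using that v(1) vP iv by blast
qed

lemma wave_solution_of_correction:
  assumes f: "integrable (lebI T) f"
    and vb: "\<And>z. cmod (v z) \<le> P * wt f z"
    and veq: "\<And>x t. (x, t) \<in> Dm \<Longrightarrow> v (x, t) = - (1/2 * region_integral p (\<lambda>z. free f z + v z) x t)"
    and vi: "integrable lborel (\<lambda>z. of_real (p (fst z)) * v z)"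
  shows "wave_solution q T f (\<lambda>x t. (if x \<le> t then f (t - x) else 0) + v (x, t))"
proof -
  define u where "u x t = (if x \<le> t then f (t - x) else 0) + v (x, t)" for x t
  \<comment> \<open>For y <= s <= T the cut-off is invisible; for y > s both sides vanish, since
    \<open>v\<close> does by \<open>cum_neg\<close>.\<close>
  have pq: "complex_of_real (q y) * u y s = of_real (p y) * (free f (y, s) + v (y, s))" if D: "(y, s) \<in> Dm" for y s
  proof (cases "y \<le> s")
    case True
    then have "p y = q y" "free f (y, s) = f (s - y)" using D by (auto simp: Dm_def p_def free_def ctl_def)
    then show ?thesis using True by (simp add: u_def)
  next
    case False
    then have "v (y, s) = 0" using vb[of "(y, s)"] by (simp add: wt_def cum_neg)
    then show ?thesis using False by (simp add: u_def free_def)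
  qed
  have int: "integrable lborel (\<lambda>z. of_real (p (fst z)) * (free f z + v z))"
    unfolding distrib_left by (intro Bochner_Integration.integrable_add p_free_integrable f vi)
  have "wave_solution q T f u"
    unfolding wave_solution_def
  proof (intro conjI allI ballI impI)
    fix R :: real
    have "set_integrable lborel ({0..R} \<times> {0..T}) (\<lambda>z. of_real (p (fst z)) * (free f z + v z))"
      unfolding set_integrable_def using int
      by (intro integrable_mult_indicator) (auto intro!: borel_closed closed_Times)
    moreover have "indicator ({0..R} \<times> {0..T}) z *\<^sub>R (of_real (p (fst z)) * (free f z + v z))
        = indicator ({0..R} \<times> {0..T}) z *\<^sub>R (case z of (y, s) \<Rightarrow> complex_of_real (q y) * u y s)" for z
      using pq[of "fst z" "snd z"] by (cases z) (auto simp: indicator_def Dm_def)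
    ultimately show "set_integrable lborel ({0..R} \<times> {0..T}) (\<lambda>(y, s). complex_of_real (q y) * u y s)"
      unfolding set_integrable_def by simp
  next
    fix x t :: real assume x: "0 \<le> x" and t: "t \<in> {0..T}"
    then have D: "(x, t) \<in> Dm" by (simp add: Dm_def)
    have "(LINT z:characteristic_region x t|lborel. complex_of_real (q (fst z)) * u (fst z) (snd z))
        = region_integral p (\<lambda>z. free f z + v z) x t"
      unfolding region_integral_def
    proof (rule set_lebesgue_integral_cong)
      show "\<forall>z. z \<in> characteristic_region x t \<longrightarrow> complex_of_real (q (fst z)) * u (fst z) (snd z) = of_real (p (fst z)) * (free f z + v z)"
        using pq region_subset_Dm[OF D] by (metis prod.collapse)
    qed simp
    then show "u x t = (if x \<le> t then f (t - x) else 0) - 1/2 * (LINT z:characteristic_region x t|lborel. complex_of_real (q (fst z)) * u (fst z) (snd z))"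
      using veq[OF D] by (simp add: u_def)
  qed
  then show ?thesis by (simp add: u_def[abs_def])
qed

section \<open>The control operator: bounds, well-definedness, surjectivity\<close>

abbreviation W :: "(real \<Rightarrow> complex) \<Rightarrow> real \<Rightarrow> complex" where
  "W \<equiv> control_operator q T"

text \<open>Uniqueness for x >= 0 makes the value independent of the solution that
  \<open>SOME\<close> picks.\<close>

lemma W_eq:
  assumes "wave_solution q T f u" "x \<ge> 0"
  shows "W f x = u x T"
  unfolding control_operator_def
  using wave_solution_unique[OF someI[of "wave_solution q T f" u] assms(1)] assms T_pos by auto

lemma wave_solution_linear:
  assumes u: "wave_solution q T f u" and v: "wave_solution q T g v"
  shows "wave_solution q T (\<lambda>t. a * f t + b * g t) (\<lambda>x t. a * u x t + b * v x t)"
proof -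
  have eq: "complex_of_real (q y) * (a * u y s + b * v y s) = a * (of_real (q y) * u y s) + b * (of_real (q y) * v y s)" for y s
    by (simp add: algebra_simps)
  have si: "set_integrable lborel ({0..R} \<times> {0..T}) (\<lambda>z. of_real (q (fst z)) * w (fst z) (snd z))"
    if "wave_solution q T h w" for h w R
    using that unfolding wave_solution_def case_prod_unfold by blast
  show ?thesis
    unfolding wave_solution_def
  proof (intro conjI allI ballI impI)
    fix R
    show "set_integrable lborel ({0..R} \<times> {0..T}) (\<lambda>(y, s). complex_of_real (q y) * (a * u y s + b * v y s))"
      unfolding eq case_prod_beta by (intro set_integral_add(1) set_integrable_mult_right si[OF u] si[OF v])
  next
    fix x t :: real assume x: "0 \<le> x" and t: "t \<in> {0..T}"
    have sub: "characteristic_region x t \<subseteq> {0..x + t} \<times> {0..T}"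
      using t by (auto simp: characteristic_region_def)
    have sr: "set_integrable lborel (characteristic_region x t) (\<lambda>z. of_real (q (fst z)) * w (fst z) (snd z))"
      if "wave_solution q T h w" for h w
      by (rule set_integrable_subset[OF si[OF that, of "x + t"] _ sub]) auto
    have "(LINT z:characteristic_region x t|lborel. complex_of_real (q (fst z)) * (a * u (fst z) (snd z) + b * v (fst z) (snd z)))
        = (LINT z:characteristic_region x t|lborel. a * (of_real (q (fst z)) * u (fst z) (snd z)))
          + (LINT z:characteristic_region x t|lborel. b * (of_real (q (fst z)) * v (fst z) (snd z)))"
      unfolding eq by (intro set_integral_add(2) set_integrable_mult_right sr[OF u] sr[OF v])
    then have L: "(LINT z:characteristic_region x t|lborel. complex_of_real (q (fst z)) * (a * u (fst z) (snd z) + b * v (fst z) (snd z)))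
        = a * (LINT z:characteristic_region x t|lborel. of_real (q (fst z)) * u (fst z) (snd z))
          + b * (LINT z:characteristic_region x t|lborel. of_real (q (fst z)) * v (fst z) (snd z))"
      by (simp only: set_integral_mult_right)
    have *: "w x t = (if x \<le> t then h (t - x) else 0) - 1/2 * (LINT z:characteristic_region x t|lborel. of_real (q (fst z)) * w (fst z) (snd z))"
      if "wave_solution q T h w" for h w
      using that x t by (auto simp: wave_solution_def)
    show "a * u x t + b * v x t = (if x \<le> t then a * f (t - x) + b * g (t - x) else 0)
        - 1/2 * (LINT z:characteristic_region x t|lborel. complex_of_real (q (fst z)) * (a * u (fst z) (snd z) + b * v (fst z) (snd z)))"
      unfolding L by (subst *[OF u], subst *[OF v]) (simp add: algebra_simps)
  qed
qed

lemma wave_solution_cnj: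
  assumes u: "wave_solution q T f u"
  shows "wave_solution q T (\<lambda>t. cnj (f t)) (\<lambda>x t. cnj (u x t))"
  unfolding wave_solution_def
proof (intro conjI allI ballI impI)
  fix R
  have "integrable lborel (\<lambda>z. cnj (indicator ({0..R} \<times> {0..T}) z *\<^sub>R (case z of (y, s) \<Rightarrow> complex_of_real (q y) * u y s)))"
    using u by (intro integrable_cnj) (simp add: wave_solution_def set_integrable_def)
  then show "set_integrable lborel ({0..R} \<times> {0..T}) (\<lambda>(y, s). complex_of_real (q y) * cnj (u y s))"
    by (simp add: set_integrable_def case_prod_beta)
next
  fix x t :: real assume "0 \<le> x" and "t \<in> {0..T}"
  then have eq: "u x t = (if x \<le> t then f (t - x) else 0) - 1/2 * (LINT z:characteristic_region x t|lborel. of_real (q (fst z)) * u (fst z) (snd z))"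
    using u by (auto simp: wave_solution_def)
  have "cnj (LINT z:characteristic_region x t|lborel. of_real (q (fst z)) * u (fst z) (snd z))
      = (LINT z:characteristic_region x t|lborel. of_real (q (fst z)) * cnj (u (fst z) (snd z)))"
    unfolding set_lebesgue_integral_def Bochner_Integration.integral_cnj[symmetric] by simp
  then show "cnj (u x t) = (if x \<le> t then cnj (f (t - x)) else 0) - 1/2 * (LINT z:characteristic_region x t|lborel. of_real (q (fst z)) * cnj (u (fst z) (snd z)))"
    by (subst eq) (simp split: if_splits)
qed

lemma wave_solution_exists:
  assumes f: "integrable (lebI T) f"
  shows "\<exists>v. v \<in> borel_measurable borel \<and> (\<forall>z. cmod (v z) \<le> P * wt f z) \<and>
    (\<forall>x t. (x, t) \<in> Dm \<longrightarrow> v (x, t) = - (1/2 * region_integral p (\<lambda>z. free f z + v z) x t)) \<and>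
    integrable lborel (\<lambda>z. of_real (p (fst z)) * v z) \<and>
    wave_solution q T f (\<lambda>x t. (if x \<le> t then f (t - x) else 0) + v (x, t))"
proof (rule wave_correction_exists[OF f])
  fix v assume v: "v \<in> borel_measurable borel" "\<And>z. cmod (v z) \<le> P * wt f z"
    "\<And>x t. (x, t) \<in> Dm \<Longrightarrow> v (x, t) = - (1/2 * region_integral p (\<lambda>z. free f z + v z) x t)"
    "integrable lborel (\<lambda>z. of_real (p (fst z)) * v z)"
  show ?thesis using v wave_solution_of_correction[OF f v(2-4)] by blast
qed

lemma wave_solvable:
  assumes f: "integrable (lebI T) f"
  shows "\<exists>u. wave_solution q T f u"
  using wave_solution_exists[OF f] by blast

lemma W_linear:
  assumes f: "integrable (lebI T) f" and g: "integrable (lebI T) g" and x: "x \<ge> 0"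
  shows "W (\<lambda>t. a * f t + b * g t) x = a * W f x + b * W g x"
proof -
  obtain u v where u: "wave_solution q T f u" and v: "wave_solution q T g v"
    using wave_solvable[OF f] wave_solvable[OF g] by blast
  show ?thesis using W_eq[OF wave_solution_linear[OF u v] x] W_eq[OF u x] W_eq[OF v x] by simp
qed

lemma W_cnj:
  assumes f: "integrable (lebI T) f" and x: "x \<ge> 0"
  shows "W (\<lambda>t. cnj (f t)) x = cnj (W f x)"
proof -
  obtain u where u: "wave_solution q T f u" using wave_solvable[OF f] by blast
  show ?thesis using W_eq[OF wave_solution_cnj[OF u] x] W_eq[OF u x] by simp
qed

definition M :: real where "M = P * exp (l * T)"

lemma M_nonneg: "M \<ge> 0" by (simp add: M_def P_nonneg)

text \<open>The kernel form of W^T reduced to an estimate: a reflected control plus a remainder,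
  bounded at x by the L_1 norm of the control up to time T - x. This Volterra estimate is what
  inverts \<open>W\<close>.\<close>

lemma W_repr:
  assumes f: "integrable (lebI T) f"
  obtains k where "k \<in> borel_measurable borel" "\<And>x. x \<in> {0..T} \<Longrightarrow> W f x = f (T - x) + k x"
    "\<And>x. x \<in> {0..T} \<Longrightarrow> cmod (k x) \<le> M * cum f (T - x)"
proof -
  obtain v where v: "v \<in> borel_measurable borel" "\<And>z. cmod (v z) \<le> P * wt f z"
    and sol: "wave_solution q T f (\<lambda>x t. (if x \<le> t then f (t - x) else 0) + v (x, t))"
    using wave_solution_exists[OF f] by blast
  have [measurable]: "(\<lambda>x::real. (x, T)) \<in> borel_measurable borel"
    by (intro borel_measurable_continuous_onI continuous_intros)
  have "(\<lambda>x. v (x, T)) \<in> borel_measurable borel" using v(1) by measurable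
  moreover have "W f x = f (T - x) + v (x, T)" if "x \<in> {0..T}" for x
    using W_eq[OF sol, of x] that by simp
  moreover have "cmod (v (x, T)) \<le> M * cum f (T - x)" if "x \<in> {0..T}" for x
    using v(2)[of "(x, T)"] that T_pos by (simp add: wt_def Dm_def M_def mult_ac)
  ultimately show ?thesis using that by blast
qed

lemma W_measurable:
  assumes f: "integrable (lebI T) f"
  shows "W f \<in> borel_measurable (lebI T)"
proof -
  obtain k where k: "k \<in> borel_measurable borel" "\<And>x. x \<in> {0..T} \<Longrightarrow> W f x = f (T - x) + k x"
    using W_repr[OF f] by metis
  have "(\<lambda>x. f (T - x)) \<in> borel_measurable (lebI T)" using f by (intro lebI_reflect_measurable) auto
  then have "(\<lambda>x. f (T - x) + k x) \<in> borel_measurable (lebI T)" using lebI_measurable[OF k(1)] by measurable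
  then show ?thesis
    by (rule measurable_cong[THEN iffD1, rotated]) (auto simp: space_restrict_space k(2))
qed

lemma L1_le_L2:
  assumes f: "f \<in> sqint (lebI T)"
  shows "(LINT r|lebI T. cmod (f r)) \<le> sqrt T * sq_nrm (lebI T) f"
proof -
  let ?g = "\<lambda>r. complex_of_real (cmod (f r))"
  have one: "(\<lambda>_. 1) \<in> sqint (lebI T)" by (rule lebI_bounded_sqint[of _ _ 1]) auto
  have g: "?g \<in> sqint (lebI T)" using f by (auto simp: sqint_def)
  have "measure lborel {0<..<T} = T" using T_pos by simp
  then have n1: "sq_nrm (lebI T) (\<lambda>_. 1) = sqrt T"
    by (simp add: sq.nrm_def sq_inner_self measure_restrict_space space_restrict_space)
  have ng: "sq_nrm (lebI T) ?g = sq_nrm (lebI T) f" by (simp add: sq.nrm_def sq_inner_self)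
  have "(LINT r|lebI T. cmod (f r)) = cmod (sq_inner (lebI T) (\<lambda>_. 1) ?g)"
    by (simp add: sq_inner_def)
  also have "\<dots> \<le> sqrt T * sq_nrm (lebI T) f"
    using sq.cauchy_schwarz[OF one g] unfolding n1 ng .
  finally show ?thesis .
qed

lemma sq_nrm_le_const:
  assumes k: "k \<in> borel_measurable (lebI T)" and b: "\<And>x. x \<in> {0<..<T} \<Longrightarrow> cmod (k x) \<le> B" and B: "B \<ge> 0"
  shows "k \<in> sqint (lebI T)" "sq_nrm (lebI T) k \<le> B * sqrt T"
proof -
  show s: "k \<in> sqint (lebI T)" by (rule lebI_bounded_sqint[OF k b])
  show "sq_nrm (lebI T) k \<le> B * sqrt T"
  proof (rule sq_nrm_le_of_nn_integral[OF s])
    have "(\<integral>\<^sup>+x. ennreal ((cmod (k x))\<^sup>2) \<partial>lebI T) \<le> (\<integral>\<^sup>+x. ennreal (B\<^sup>2) \<partial>lebI T)"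
      using b by (intro nn_integral_mono ennreal_leI power_mono) (auto simp: space_restrict_space)
    also have "\<dots> = ennreal (B\<^sup>2) * ennreal T"
      using T_pos by (simp add: emeasure_restrict_space space_restrict_space)
    also have "\<dots> = ennreal ((B * sqrt T)\<^sup>2)"
      using T_pos by (simp add: power_mult_distrib ennreal_mult)
    finally show "(\<integral>\<^sup>+x. ennreal ((cmod (k x))\<^sup>2) \<partial>lebI T) \<le> ennreal ((B * sqrt T)\<^sup>2)" .
  qed (use B T_pos in simp)
qed

lemma sq_nrm_cong:
  assumes "\<And>x. x \<in> space N \<Longrightarrow> f x = g x"
  shows "sq_nrm N f = sq_nrm N g"
proof -
  have "(LINT x|N. (cmod (f x))\<^sup>2) = (LINT x|N. (cmod (g x))\<^sup>2)"
    by (intro Bochner_Integration.integral_cong) (auto simp: assms)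
  then show ?thesis by (simp add: sq.nrm_def sq_inner_self)
qed

lemma sqint_cong:
  assumes "\<And>x. x \<in> space N \<Longrightarrow> f x = g x" "g \<in> sqint N"
  shows "f \<in> sqint N"
proof -
  have "f \<in> borel_measurable N" using assms by (auto simp: sqint_def cong: measurable_cong)
  moreover have "integrable N (\<lambda>x. (cmod (f x))\<^sup>2)"
    using assms Bochner_Integration.integrable_cong[of N N "\<lambda>x. (cmod (f x))\<^sup>2" "\<lambda>x. (cmod (g x))\<^sup>2"]
    by (auto simp: sqint_def)
  ultimately show ?thesis by (simp add: sqint_def)
qed

lemma sq_nrm_reflect:
  assumes f: "f \<in> sqint (lebI T)"
  shows "sq_nrm (lebI T) (\<lambda>s. f (T - s)) = sq_nrm (lebI T) f"
  using lebI_reflect_integral[of T "\<lambda>s. (cmod (f s))\<^sup>2"] by (simp add: sq.nrm_def sq_inner_self)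

lemma W_sqint_bound:
  assumes f: "f \<in> sqint (lebI T)"
  shows "W f \<in> sqint (lebI T)" and "sq_nrm (lebI T) (W f) \<le> (1 + M * T) * sq_nrm (lebI T) f"
proof -
  have fi: "integrable (lebI T) f" by (rule sqint_lebI_integrable[OF f])
  obtain k where k: "k \<in> borel_measurable borel" "\<And>x. x \<in> {0..T} \<Longrightarrow> W f x = f (T - x) + k x"
    "\<And>x. x \<in> {0..T} \<Longrightarrow> cmod (k x) \<le> M * cum f (T - x)"
    using W_repr[OF fi] by metis
  let ?B = "M * (sqrt T * sq_nrm (lebI T) f)"
  have B: "?B \<ge> 0" using M_nonneg T_pos sq.nrm_nonneg[OF f] by simp
  have kb: "cmod (k x) \<le> ?B" if "x \<in> {0<..<T}" for x
  proof -
    have "cmod (k x) \<le> M * cum f (T - x)" using k(3) that by simp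
    also have "\<dots> \<le> ?B"
      using M_nonneg order_trans[OF cum_le_total[OF fi] L1_le_L2[OF f]] by (intro mult_left_mono) auto
    finally show ?thesis .
  qed
  note ks = sq_nrm_le_const[OF lebI_measurable[OF k(1)] kb B]
  have fr: "(\<lambda>s. f (T - s)) \<in> sqint (lebI T)" by (rule sqint_reflect[OF f])
  have eq: "W f x = f (T - x) + k x" if "x \<in> space (lebI T)" for x
    using that k(2) by (auto simp: space_restrict_space)
  show "W f \<in> sqint (lebI T)" by (rule sqint_cong[OF eq sqint_add[OF fr ks(1)]])
  have "sq_nrm (lebI T) (W f) = sq_nrm (lebI T) (\<lambda>x. f (T - x) + k x)" by (rule sq_nrm_cong[OF eq])
  also have "\<dots> \<le> sq_nrm (lebI T) (\<lambda>s. f (T - s)) + sq_nrm (lebI T) k" by (rule sq.nrm_triangle[OF fr ks(1)])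
  also have "\<dots> \<le> sq_nrm (lebI T) f + ?B * sqrt T" using ks(2) sq_nrm_reflect[OF f] by simp
  also have "\<dots> = (1 + M * (sqrt T * sqrt T)) * sq_nrm (lebI T) f" by (simp add: algebra_simps)
  finally show "sq_nrm (lebI T) (W f) \<le> (1 + M * T) * sq_nrm (lebI T) f" using T_pos by simp
qed

text \<open>\<open>W\<close> acts on functions through a pointwise equation; the L_2 bound applied
  to the difference shows that it is well defined on classes.\<close>

lemma W_cong_AE:
  assumes f: "f \<in> sqint (lebI T)" and g: "g \<in> sqint (lebI T)" and eq: "AE t in lebI T. f t = g t"
  shows "AE x in lebI T. W f x = W g x"
proof -
  let ?d = "\<lambda>t. 1 * f t + (-1) * g t"
  have d: "?d \<in> sqint (lebI T)" using sq.diff_mem[OF f g] by simp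
  have "sq_nrm (lebI T) ?d = 0"
  proof -
    have "(LINT x|lebI T. (cmod (?d x))\<^sup>2) = (LINT x|lebI T. 0)"
      by (rule integral_cong_AE) (use eq sqint_measurable[OF d] in \<open>auto elim: eventually_mono\<close>)
    then show ?thesis by (simp add: sq.nrm_def sq_inner_self)
  qed
  then have "sq_nrm (lebI T) (W ?d) = 0"
    using W_sqint_bound(2)[OF d] sq.nrm_nonneg[OF W_sqint_bound(1)[OF d]] by simp
  then have "AE x in lebI T. W ?d x = 0" by (rule sq_nrm_zero_AE[OF W_sqint_bound(1)[OF d]])
  then show ?thesis
    using AE_space
  proof eventually_elim
    case (elim x)
    then have "x \<ge> 0" by (simp add: space_restrict_space)
    then show ?case
      using elim(1) W_linear[OF sqint_lebI_integrable[OF f] sqint_lebI_integrable[OF g], of x 1 "-1"] by simp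
  qed
qed

text \<open>\<open>W\<close> is a reflection followed by a Volterra perturbation of the identity, hence invertible.\<close>

lemma W_surj:
  assumes h: "h \<in> sqint (lebI T)"
  obtains f where "f \<in> sqint (lebI T)" "AE x in lebI T. W f x = h x"
proof -
  \<comment> \<open>Large enough for M / a <= 1/2, the contraction factor in the weight
    \<open>w\<close>.\<close>
  define a where "a = 2 * M + 1"
  have a: "a > 0" "M / a \<le> 1 / 2" using M_nonneg by (auto simp: a_def field_simps)
  define w where "w x = indicator {0<..<T} x * exp (a * (T - x))" for x
  \<comment> \<open>\<open>W\<close> after the reflection, minus the identity. At x it is bounded by
    the integral of |F| over (x,T), hence the weight that grows as x decreases.\<close>
  define K where "K F x = indicator {0<..<T} x *\<^sub>R (W (\<lambda>s. F (T - s)) x - F x)" for F x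
  define A where "A F x = - K F x" for F x
  have refl_refl: "integrable (lebI T) (\<lambda>s. F (T - s))" if "F \<in> sqint (lebI T)" for F
    by (rule sqint_lebI_integrable[OF sqint_reflect[OF that]])
  have K_le: "cmod (K F x) \<le> M * cum (\<lambda>s. F (T - s)) (T - x)" if F: "F \<in> sqint (lebI T)" and x: "x \<in> {0<..<T}" for F x
  proof -
    obtain k where k: "\<And>x. x \<in> {0..T} \<Longrightarrow> W (\<lambda>s. F (T - s)) x = F (T - (T - x)) + k x"
      "\<And>x. x \<in> {0..T} \<Longrightarrow> cmod (k x) \<le> M * cum (\<lambda>s. F (T - s)) (T - x)"
      using W_repr[OF refl_refl[OF F]] by metis
    show ?thesis using k[of x] x by (simp add: K_def)
  qed
  have Km: "K F \<in> borel_measurable borel" if F: "F \<in> sqint (lebI T)" for F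
  proof -
    have "(\<lambda>x. W (\<lambda>s. F (T - s)) x - F x) \<in> borel_measurable (lebI T)"
      using W_measurable[OF refl_refl[OF F]] sqint_measurable[OF F] by measurable
    then have "K F \<in> borel_measurable lborel"
      unfolding K_def by (simp add: borel_measurable_restrict_space_iff)
    then show ?thesis by simp
  qed
  have bs: "F \<in> sqint (lebI T)" if F: "F \<in> borel_measurable borel" and b: "\<And>x. cmod (F x) \<le> c * w x" for F c
  proof (rule lebI_bounded_sqint[OF lebI_measurable[OF F]])
    fix x assume x: "x \<in> {0<..<T}"
    have "cmod (F x) \<le> \<bar>c\<bar> * w x"
      using b[of x] by (rule order_trans) (intro mult_right_mono, auto simp: w_def)
    also have "\<dots> \<le> \<bar>c\<bar> * exp (a * T)" using x a by (intro mult_left_mono) (auto simp: w_def)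
    finally show "cmod (F x) \<le> \<bar>c\<bar> * exp (a * T)" .
  qed
  define c0 where "c0 = M * (LINT r|lebI T. cmod (h (T - r)))"
  have c0: "c0 \<ge> 0" using M_nonneg by (simp add: c0_def)
  \<comment> \<open>\<open>h\<close> is only square integrable. With F the reflected control, the
    equation is solved for the bounded function r = F - h.\<close>
  obtain r where r: "r \<in> borel_measurable borel" "\<And>x. cmod (r x) \<le> 2 * c0 * w x" "\<And>x. r x = A h x + A r x"
  proof (rule weighted_neumann[where A = A and w = w and Adm = "\<lambda>F. F \<in> borel_measurable borel" and g = "A h" and ?c0.0 = c0])
    show "w x \<ge> 0" for x by (simp add: w_def)
    show "F \<in> borel_measurable borel"
      if "\<And>n. S n \<in> borel_measurable borel" "\<And>x. (\<lambda>n. S n x) \<longlonglongrightarrow> F x" for S and F :: "real \<Rightarrow> complex"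
      by (rule borel_measurable_LIMSEQ_metric[OF that])
    show "A F \<in> borel_measurable borel" if "F \<in> borel_measurable borel" "\<And>x. cmod (F x) \<le> c * w x" for F c
      unfolding A_def using Km[OF bs[OF that]] by measurable
    show "A (\<lambda>x. F x - G x) x = A F x - A G x"
      if "F \<in> borel_measurable borel" "G \<in> borel_measurable borel" "\<And>x. cmod (F x) \<le> c * w x" "\<And>x. cmod (G x) \<le> c * w x" for F G c x
    proof (cases "x \<in> {0<..<T}")
      case True
      then show ?thesis
        using W_linear[OF refl_refl[OF bs[OF that(1,3)]] refl_refl[OF bs[OF that(2,4)]], of x 1 "-1"]
        by (simp add: A_def K_def)
    qed (simp add: A_def K_def)
    show "cmod (A F x) \<le> c / 2 * w x"
      if F: "F \<in> borel_measurable borel" "\<And>x. cmod (F x) \<le> c * w x" and c: "c \<ge> 0" for F c x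
    proof (cases "x \<in> {0<..<T}")
      case True
      have Fs: "F \<in> sqint (lebI T)" by (rule bs[OF F])
      have "cum (\<lambda>s. F (T - s)) (T - x) \<le> c * (exp (a * (T - x)) / a)"
      proof (rule cum_exp_le[OF refl_refl[OF Fs] a(1) c])
        show "T - x \<ge> 0" using True by simp
        show "cmod (F (T - r)) \<le> c * exp (a * r)" for r
        proof -
          have "cmod (F (T - r)) \<le> c * w (T - r)" by (rule F)
          also have "\<dots> \<le> c * exp (a * r)" using c by (intro mult_left_mono) (auto simp: w_def indicator_def)
          finally show ?thesis .
        qed
      qed
      then have "M * cum (\<lambda>s. F (T - s)) (T - x) \<le> M * (c * (exp (a * (T - x)) / a))"
        using M_nonneg by (rule mult_left_mono)
      then have "cmod (A F x) \<le> M * (c * (exp (a * (T - x)) / a))"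
        using K_le[OF Fs True] by (simp add: A_def)
      also have "\<dots> = M / a * (c * exp (a * (T - x)))" by simp
      also have "\<dots> \<le> 1 / 2 * (c * exp (a * (T - x)))" using a(2) c by (intro mult_right_mono) auto
      finally show ?thesis using True by (simp add: w_def)
    qed (simp add: A_def K_def w_def)
    show "cmod (A h x) \<le> c0 * w x" for x
    proof (cases "x \<in> {0<..<T}")
      case True
      have "cmod (A h x) \<le> M * cum (\<lambda>s. h (T - s)) (T - x)" using K_le[OF h True] by (simp add: A_def)
      also have "\<dots> \<le> c0" unfolding c0_def using M_nonneg cum_le_total[OF refl_refl[OF h]] by (intro mult_left_mono) auto
      also have "\<dots> \<le> c0 * exp (a * (T - x))"
        using c0 True a mult_left_mono[of 1 "exp (a * (T - x))" c0] by simp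
      finally show ?thesis using True by (simp add: w_def)
    qed (simp add: A_def K_def w_def)
    show "A h \<in> borel_measurable borel" unfolding A_def using Km[OF h] by measurable
  qed (use c0 in \<open>auto intro!: borel_measurable_add borel_measurable_diff\<close>)
  have rs: "r \<in> sqint (lebI T)" by (rule bs[OF r(1,2)])
  define f where "f s = h (T - s) + r (T - s)" for s
  have f: "f \<in> sqint (lebI T)" unfolding f_def by (intro sqint_add sqint_reflect h rs)
  have "W f x = h x" if x: "x \<in> {0<..<T}" for x
  proof -
    have "W f x = W (\<lambda>s. h (T - s)) x + W (\<lambda>s. r (T - s)) x"
      using W_linear[OF refl_refl[OF h] refl_refl[OF rs], of x 1 1] x by (simp add: f_def[abs_def])
    also have "\<dots> = (h x + K h x) + (r x + K r x)" using x by (simp add: K_def)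
    also have "\<dots> = h x" using r(3)[of x] by (simp add: A_def)
    finally show ?thesis .
  qed
  then have "AE x in lebI T. W f x = h x" by (intro AE_I2) (simp add: space_restrict_space)
  then show ?thesis using that f by blast
qed

end

section \<open>The Sturm--Liouville solution\<close>

lemma integrable_bounded_mult:
  fixes f k :: "'a \<Rightarrow> complex"
  assumes f: "integrable N f" and k: "k \<in> borel_measurable N" and b: "\<And>x. cmod (k x) \<le> C"
  shows "integrable N (\<lambda>x. k x * f x)"
proof (rule Bochner_Integration.integrable_bound)
  show "integrable N (\<lambda>x. C * cmod (f x))" using f by auto
  show "(\<lambda>x. k x * f x) \<in> borel_measurable N" using f k by auto
  show "AE x in N. norm (k x * f x) \<le> norm (C * cmod (f x))"
    using b by (intro AE_I2) (auto simp: norm_mult intro!: mult_right_mono order_trans[OF _ abs_ge_self])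
qed

lemma integrable_times:
  fixes f :: "'a::euclidean_space \<Rightarrow> complex" and g :: "'b::euclidean_space \<Rightarrow> complex"
  assumes f: "integrable lborel f" and g: "integrable lborel g"
  shows "integrable (lborel \<Otimes>\<^sub>M lborel) (\<lambda>z. f (fst z) * g (snd z))"
proof (rule lborel_pair.Fubini_integrable)
  have [measurable]: "f \<in> borel_measurable borel" "g \<in> borel_measurable borel" using f g by auto
  show "(\<lambda>z. f (fst z) * g (snd z)) \<in> borel_measurable (lborel \<Otimes>\<^sub>M lborel)" by measurable
  show "integrable lborel (\<lambda>x. LINT y|lborel. norm (f (fst (x, y)) * g (snd (x, y))))"
    using f by (simp add: norm_mult)
  show "AE x in lborel. integrable lborel (\<lambda>y. f (fst (x, y)) * g (snd (x, y)))"
    using g by simp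
qed

text \<open>Volterra integrals are written below as integrals over the line against bounded kernels,
  so that exchanges of integrations, and with them integration by parts, become instances.\<close>

lemma fubini_bounded:
  fixes f :: "'a::euclidean_space \<Rightarrow> complex" and g :: "'b::euclidean_space \<Rightarrow> complex" and k :: "'a \<times> 'b \<Rightarrow> real"
  assumes f: "integrable lborel f" and g: "integrable lborel g"
    and k: "k \<in> borel_measurable (borel \<Otimes>\<^sub>M borel)" and b: "\<And>z. \<bar>k z\<bar> \<le> C"
  shows "(LINT x|lborel. f x * (LINT y|lborel. g y * of_real (k (x, y)))) = (LINT y|lborel. g y * (LINT x|lborel. f x * of_real (k (x, y))))"
    and "(LINT x|lborel. f x * (LINT y|lborel. g y * of_real (k (x, y)))) = (LINT z|lborel. of_real (k z) * (f (fst z) * g (snd z)))"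
    and "integrable lborel (\<lambda>y. g y * (LINT x|lborel. f x * of_real (k (x, y))))"
proof -
  note k[measurable]
  have i: "integrable (lborel \<Otimes>\<^sub>M lborel) (\<lambda>z. of_real (k z) * (f (fst z) * g (snd z)))"
    by (rule integrable_bounded_mult[OF integrable_times[OF f g], where C = C]) (use b in auto)
  then have i2: "integrable (lborel \<Otimes>\<^sub>M lborel) (\<lambda>(x, y). of_real (k (x, y)) * (f x * g y))"
    by (simp add: case_prod_unfold)
  have e1: "(LINT x|lborel. f x * (LINT y|lborel. g y * of_real (k (x, y)))) = (LINT x|lborel. LINT y|lborel. of_real (k (x, y)) * (f x * g y))"
    by (simp add: mult_ac flip: integral_mult_right_zero)
  have e2: "g y * (LINT x|lborel. f x * of_real (k (x, y))) = (LINT x|lborel. of_real (k (x, y)) * (f x * g y))" for y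
    by (simp add: mult_ac flip: integral_mult_right_zero)
  show "(LINT x|lborel. f x * (LINT y|lborel. g y * of_real (k (x, y)))) = (LINT y|lborel. g y * (LINT x|lborel. f x * of_real (k (x, y))))"
    unfolding e1 e2 by (rule lborel_pair.Fubini_integral[OF i2, symmetric])
  show "(LINT x|lborel. f x * (LINT y|lborel. g y * of_real (k (x, y)))) = (LINT z|lborel. of_real (k z) * (f (fst z) * g (snd z)))"
    unfolding e1 using lborel_pair.integral_fst'[OF i] by (simp add: lborel_prod)
  show "integrable lborel (\<lambda>y. g y * (LINT x|lborel. f x * of_real (k (x, y))))"
    unfolding e2 by (rule lborel_pair.integrable_snd[OF i2])
qed

section \<open>Averages over characteristic triangles; integration by parts for primitives\<close>

lemma integral_pos_part:
  assumes ab: "a \<le> (b::real)"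
  shows "(LINT x|lborel. indicator {a..b} x * max 0 (x - c)) = ((max 0 (b - c))\<^sup>2 - (max 0 (a - c))\<^sup>2) / 2"
proof -
  let ?a = "max a c" and ?b = "max b c"
  have "(LINT x|lborel. indicator {a..b} x * max 0 (x - c)) = (LINT x|lborel. indicator {?a..?b} x *\<^sub>R (x - c))"
    by (intro Bochner_Integration.integral_cong) (auto simp: indicator_def max_def)
  also have "\<dots> = (?b - c)\<^sup>2 / 2 - (?a - c)\<^sup>2 / 2"
  proof (rule integral_FTC_atLeastAtMost)
    show "((\<lambda>x. (x - c)\<^sup>2 / 2) has_vector_derivative (x - c)) (at x within {?a..?b})" for x
      unfolding has_real_derivative_iff_has_vector_derivative[symmetric]
      by (auto intro!: derivative_eq_intros)
  qed (use ab in \<open>auto intro!: continuous_intros\<close>)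
  also have "?b - c = max 0 (b - c)" by simp
  also have "?a - c = max 0 (a - c)" by simp
  finally show ?thesis by (simp add: diff_divide_distrib)
qed

text \<open>The condition for \<open>(y, \<tau>)\<close> to lie in the characteristic region of \<open>(x, t)\<close> says that
  \<open>x\<close>, \<open>y\<close> and \<open>r = t - \<tau>\<close> satisfy the triangle inequalities; it is symmetric in all three.\<close>

definition tri :: "real \<Rightarrow> real \<Rightarrow> real \<Rightarrow> bool" where
  "tri x y r \<longleftrightarrow> \<bar>x - r\<bar> \<le> y \<and> y \<le> x + r"

lemma tri_sym: "tri x y r \<longleftrightarrow> tri y x r"
  by (auto simp: tri_def)

lemma region_tri: "(y, s) \<in> characteristic_region x t \<longleftrightarrow> 0 \<le> s \<and> s \<le> t \<and> tri x y (t - s)"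
  by (auto simp: characteristic_region_def tri_def)

text \<open>Half the indicator of \<open>tri y b r\<close> is the Dirichlet Green kernel of the wave
  equation on the half-line; this is its twofold primitive in the time \<open>r\<close>.\<close>

definition tri_kernel :: "real \<Rightarrow> real \<Rightarrow> real \<Rightarrow> real" where
  "tri_kernel y b r = (LINT s|lborel. indicator {0..r} s * of_bool (tri y b (r - s)) * s / 2)"

lemma tri_indicator: "y \<ge> 0 \<Longrightarrow> r \<ge> 0 \<Longrightarrow> of_bool (tri x y r) = indicator {\<bar>y - r\<bar>..y + r} x"
  by (auto simp: tri_def indicator_def)

lemma tri_kernel_eq:
  assumes "y \<ge> 0" "b \<ge> 0" "r \<ge> 0"
  shows "tri_kernel y b r = ((max 0 (r - \<bar>y - b\<bar>))\<^sup>2 - (max 0 (r - y - b))\<^sup>2) / 4"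
proof (cases "\<bar>y - b\<bar> \<le> r")
  case True
  have "tri_kernel y b r = (LINT s|lborel. (indicator {max 0 (r - y - b)..r - \<bar>y - b\<bar>} s * max 0 (s - 0)) / 2)"
    unfolding tri_kernel_def by (intro Bochner_Integration.integral_cong) (auto simp: indicator_def tri_def)
  also have "\<dots> = (LINT s|lborel. indicator {max 0 (r - y - b)..r - \<bar>y - b\<bar>} s * max 0 (s - 0)) / 2"
    by (rule integral_divide_zero)
  also have "\<dots> = ((max 0 (r - \<bar>y - b\<bar> - 0))\<^sup>2 - (max 0 (max 0 (r - y - b) - 0))\<^sup>2) / 2 / 2"
    using True assms by (subst integral_pos_part) auto
  finally show ?thesis by simp
next
  case False
  have "indicator {0..r} s * of_bool (tri y b (r - s)) * s / 2 = 0" for s :: real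
    using False by (auto simp: indicator_def tri_def)
  then have "tri_kernel y b r = 0" unfolding tri_kernel_def by (simp only:) simp
  then show ?thesis using False assms by (auto simp: max_def)
qed

text \<open>The left side is the free half-line wave at time r and place y with initial position 0
  and initial velocity g(y) = max 0 (y - b). As g'' is the point mass at b, the second time
  derivative of this wave is the Green kernel at b; two integrations give r g(y) plus
  \<open>tri_kernel\<close>. The proof compares the explicit piecewise quadratic
  polynomials.\<close>

lemma triangle_average:
  assumes "y \<ge> 0" "b \<ge> 0" "r \<ge> 0"
  shows "(LINT x|lborel. of_bool (tri x y r) * max 0 (x - b) / 2) = r * max 0 (y - b) + tri_kernel y b r"
proof -
  have "(LINT x|lborel. of_bool (tri x y r) * max 0 (x - b) / 2)
      = (LINT x|lborel. indicator {\<bar>y - r\<bar>..y + r} x * max 0 (x - b)) / 2"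
    using assms by (simp add: tri_indicator)
  also have "\<dots> = ((max 0 (y + r - b))\<^sup>2 - (max 0 (\<bar>y - r\<bar> - b))\<^sup>2) / 4"
    using assms by (subst integral_pos_part) auto
  also have "\<dots> = r * max 0 (y - b) + tri_kernel y b r"
  proof -
    have "(max 0 (y + r - b))\<^sup>2 - (max 0 (\<bar>y - r\<bar> - b))\<^sup>2
        = 4 * (r * max 0 (y - b)) + ((max 0 (r - \<bar>y - b\<bar>))\<^sup>2 - (max 0 (r - y - b))\<^sup>2)"
      using assms unfolding max_def abs_if power2_eq_square
      by (auto simp: algebra_simps split: if_splits)
    then show ?thesis unfolding tri_kernel_eq[OF assms] by simp
  qed
  finally show ?thesis .
qed

lemma triangle_average_id:
  assumes "y \<ge> 0" "r \<ge> 0"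
  shows "(LINT x|lborel. of_bool (tri x y r) * x / 2) = r * y"
proof -
  have "(LINT x|lborel. of_bool (tri x y r) * x / 2) = (LINT x|lborel. of_bool (tri x y r) * max 0 (x - 0) / 2)"
    by (intro Bochner_Integration.integral_cong) (auto simp: tri_def)
  also have "\<dots> = r * y" using assms by (subst triangle_average) (auto simp: tri_kernel_eq)
  finally show ?thesis .
qed

lemma indicator_integrable: "integrable lborel (\<lambda>s. complex_of_real (indicator {a..b::real} s))"
proof -
  have "integrable lborel (\<lambda>s. indicator {a..b} s :: real)" by (rule integrable_real_indicator) (auto simp: emeasure_lborel_Icc_eq)
  then show ?thesis by simp
qed

text \<open>Integration by parts for primitives of integrable densities: Fubini's theorem on the
  square [0,T]^2 cut along the diagonal.\<close>

lemma primitive_product: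
  fixes \<alpha> \<beta> :: "real \<Rightarrow> complex" and a0 b0 :: complex and T :: real
  assumes \<alpha>: "integrable lborel \<alpha>" and \<beta>: "integrable lborel \<beta>"
  defines "A \<equiv> \<lambda>s. a0 + (LINT r|lborel. \<alpha> r * of_real (indicator {0..s} r))"
    and "B \<equiv> \<lambda>s. b0 + (LINT r|lborel. \<beta> r * of_real (indicator {0..s} r))"
  shows "(LINT s|lborel. of_real (indicator {0..T} s) * (\<alpha> s * B s)) + (LINT s|lborel. of_real (indicator {0..T} s) * (A s * \<beta> s))
     = A T * B T - a0 * b0"
proof -
  define a where "a s = of_real (indicator {0..T} s) * \<alpha> s" for s
  define b where "b s = of_real (indicator {0..T} s) * \<beta> s" for s
  have ai: "integrable lborel a" and bi: "integrable lborel b"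
    unfolding a_def b_def by (rule integrable_bounded_mult[OF \<alpha>, where C = 1] integrable_bounded_mult[OF \<beta>, where C = 1]; simp add: indicator_def)+
  have [measurable]: "a \<in> borel_measurable borel" "b \<in> borel_measurable borel" using ai bi by auto
  \<comment> \<open>\<open>k\<close> and \<open>k'\<close> are the two closed sides of the diagonal;
    they overlap in a null set of each slice.\<close>
  define k where "k = (\<lambda>z::real \<times> real. of_bool (snd z \<le> fst z) :: real)"
  define k' where "k' = (\<lambda>z::real \<times> real. of_bool (fst z \<le> snd z) :: real)"
  have km: "k \<in> borel_measurable (borel \<Otimes>\<^sub>M borel)" "k' \<in> borel_measurable (borel \<Otimes>\<^sub>M borel)"
    unfolding k_def k'_def by measurable
  have kb: "\<bar>k z\<bar> \<le> 1" "\<bar>k' z\<bar> \<le> 1" for z by (auto simp: k_def k'_def)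
  let ?Ia = "LINT s|lborel. a s" let ?Ib = "LINT s|lborel. b s"
  have inner: "s \<in> {0..T} \<Longrightarrow> \<gamma> r * of_real (indicator {0..s} r) = of_real (indicator {0..T} r) * \<gamma> r * of_real (k (s, r))" for \<gamma> :: "real \<Rightarrow> complex" and r s
    by (auto simp: k_def indicator_def)
  have innerI: "(LINT r|lborel. \<gamma> r * of_real (indicator {0..s} r)) = (LINT r|lborel. of_real (indicator {0..T} r) * \<gamma> r * of_real (k (s, r)))"
    if "s \<in> {0..T}" for \<gamma> :: "real \<Rightarrow> complex" and s
    by (intro Bochner_Integration.integral_cong refl inner that)
  have AB: "A T = a0 + ?Ia" "B T = b0 + ?Ib" by (simp_all add: A_def B_def a_def b_def mult.commute)
  have kint: "integrable lborel (\<lambda>r. c r * of_real (\<kappa> (s, r)))"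
    if "integrable lborel c" "\<kappa> = k \<or> \<kappa> = k'" for c :: "real \<Rightarrow> complex" and s and \<kappa> :: "real \<times> real \<Rightarrow> real"
  proof -
    have "integrable lborel (\<lambda>r. of_real (\<kappa> (s, r)) * c r)"
      by (rule integrable_bounded_mult[OF that(1), where C = 1]) (use that(2) in \<open>auto simp: k_def k'_def\<close>)
    then show ?thesis by (simp add: mult.commute)
  qed
  have I1: "(LINT s|lborel. of_real (indicator {0..T} s) * (\<alpha> s * B s))
      = b0 * ?Ia + (LINT s|lborel. a s * (LINT r|lborel. b r * of_real (k (s, r))))"
  proof -
    have "(LINT s|lborel. of_real (indicator {0..T} s) * (\<alpha> s * B s)) = (LINT s|lborel. b0 * a s + a s * (LINT r|lborel. b r * of_real (k (s, r))))"
    proof (intro Bochner_Integration.integral_cong refl)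
      fix s
      show "of_real (indicator {0..T} s) * (\<alpha> s * B s) = b0 * a s + a s * (LINT r|lborel. b r * of_real (k (s, r)))"
        by (cases "s \<in> {0..T}") (simp_all add: B_def a_def b_def innerI algebra_simps)
    qed
    also have "\<dots> = b0 * ?Ia + (LINT s|lborel. a s * (LINT r|lborel. b r * of_real (k (s, r))))"
      using fubini_bounded(3)[OF bi ai, of "\<lambda>z. k (snd z, fst z)" 1] km kb ai
      by (subst Bochner_Integration.integral_add) auto
    finally show ?thesis .
  qed
  have I2: "(LINT s|lborel. of_real (indicator {0..T} s) * (A s * \<beta> s))
      = a0 * ?Ib + (LINT s|lborel. b s * (LINT r|lborel. a r * of_real (k (s, r))))"
  proof -
    have "(LINT s|lborel. of_real (indicator {0..T} s) * (A s * \<beta> s)) = (LINT s|lborel. a0 * b s + b s * (LINT r|lborel. a r * of_real (k (s, r))))"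
    proof (intro Bochner_Integration.integral_cong refl)
      fix s
      show "of_real (indicator {0..T} s) * (A s * \<beta> s) = a0 * b s + b s * (LINT r|lborel. a r * of_real (k (s, r)))"
        by (cases "s \<in> {0..T}") (simp_all add: A_def a_def b_def innerI algebra_simps)
    qed
    also have "\<dots> = a0 * ?Ib + (LINT s|lborel. b s * (LINT r|lborel. a r * of_real (k (s, r))))"
      using fubini_bounded(3)[OF ai bi, of "\<lambda>z. k (snd z, fst z)" 1] km kb bi
      by (subst Bochner_Integration.integral_add) auto
    finally show ?thesis .
  qed
  have "(LINT s|lborel. b s * (LINT r|lborel. a r * of_real (k (s, r)))) = (LINT r|lborel. a r * (LINT s|lborel. b s * of_real (k (s, r))))"
    by (rule fubini_bounded(1)[OF bi ai km(1) kb(1)])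
  then have "(LINT s|lborel. a s * (LINT r|lborel. b r * of_real (k (s, r)))) + (LINT s|lborel. b s * (LINT r|lborel. a r * of_real (k (s, r))))
      = (LINT s|lborel. a s * (LINT r|lborel. b r * of_real (k (s, r)))) + (LINT s|lborel. a s * (LINT r|lborel. b r * of_real (k' (s, r))))"
    by (simp add: k_def k'_def)
  also have "\<dots> = (LINT s|lborel. a s * (LINT r|lborel. b r * of_real (k (s, r))) + a s * (LINT r|lborel. b r * of_real (k' (s, r))))"
    using fubini_bounded(3)[OF bi ai, of "\<lambda>z. k (snd z, fst z)" 1] fubini_bounded(3)[OF bi ai, of "\<lambda>z. k' (snd z, fst z)" 1] km kb
    by (intro Bochner_Integration.integral_add[symmetric]) auto
  also have "\<dots> = (LINT s|lborel. a s * ?Ib)"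
  proof (rule Bochner_Integration.integral_cong[OF refl])
    fix s
    have "(LINT r|lborel. b r * of_real (k (s, r))) + (LINT r|lborel. b r * of_real (k' (s, r))) = (LINT r|lborel. b r * of_real (k (s, r)) + b r * of_real (k' (s, r)))"
      by (rule Bochner_Integration.integral_add[symmetric]) (auto intro: kint bi)
    also have "\<dots> = ?Ib"
    proof (rule integral_cong_AE)
      show "AE r in lborel. b r * of_real (k (s, r)) + b r * of_real (k' (s, r)) = b r"
        using AE_lborel_singleton[of s] by eventually_elim (auto simp: k_def k'_def)
    qed (use kint[OF bi, of k s] kint[OF bi, of k' s] bi in auto)
    finally show "a s * (LINT r|lborel. b r * of_real (k (s, r))) + a s * (LINT r|lborel. b r * of_real (k' (s, r))) = a s * ?Ib"
      by (simp flip: distrib_left)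
  qed
  also have "\<dots> = ?Ia * ?Ib" by simp
  finally show ?thesis unfolding I1 I2 AB by (simp add: algebra_simps)
qed

section \<open>The solution phi, its derivative and the Lagrange identity\<close>

context wave
begin

definition pot :: "complex \<Rightarrow> real \<Rightarrow> complex" where
  "pot \<mu> y = of_real (p y) - \<mu> * of_real (indicator {0..T} y)"

lemma pot_integrable: "integrable lborel (pot \<mu>)"
  unfolding pot_def using p_integrable indicator_integrable by auto

lemma pot_measurable [measurable]: "pot \<mu> \<in> borel_measurable borel"
  using pot_integrable by auto

definition pot_mass :: "complex \<Rightarrow> real" where "pot_mass \<mu> = (LINT y|lborel. cmod (pot \<mu> y))"

lemma pot_mass_nonneg: "pot_mass \<mu> \<ge> 0" by (simp add: pot_mass_def)

definition volt :: "complex \<Rightarrow> (real \<Rightarrow> complex) \<Rightarrow> real \<Rightarrow> complex" where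
  "volt \<mu> F x = (LINT b|lborel. pot \<mu> b * F b * of_real (indicator {0..x} b * (x - b)))"

text \<open>The initial value problem phi'' = (q - \<mu>) phi, phi(0) = 0, phi'(0) = 1 integrated
  twice, as \<open>q\<close> is merely integrable. Extension by 0 outside [0,T] makes phi integrable
  on the line and unique as a function.\<close>

definition is_phi :: "complex \<Rightarrow> (real \<Rightarrow> complex) \<Rightarrow> bool" where
  "is_phi \<mu> F \<longleftrightarrow> F \<in> borel_measurable borel \<and> (\<exists>c. \<forall>x. cmod (F x) \<le> c * indicator {0..T} x) \<and>
     (\<forall>x. F x = of_real (indicator {0..T} x) * (of_real x + volt \<mu> F x))"

definition pw :: "complex \<Rightarrow> real \<Rightarrow> real" where
  "pw \<mu> x = indicator {0..T} x * exp ((2 * pot_mass \<mu> + 1) * x)"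

lemma pw_ge: "indicator {0..T} x \<le> pw \<mu> x"
  using pot_mass_nonneg[of \<mu>] by (auto simp: pw_def indicator_def)

lemma pw_le: "pw \<mu> x \<le> exp ((2 * pot_mass \<mu> + 1) * T) * indicator {0..T} x"
  using pot_mass_nonneg[of \<mu>] by (auto simp: pw_def indicator_def)

text \<open>The factor x - b is absorbed by x - b <= e^(a (x - b)) / a, which turns the weight at b
  into the weight at x; then a > 2 \<open>pot_mass \<mu>\<close> gives the 1/2.\<close>

lemma volt_half:
  assumes F: "\<And>x. cmod (F x) \<le> c * pw \<mu> x" and c: "c \<ge> 0" and x: "x \<in> {0..T}"
  shows "cmod (volt \<mu> F x) \<le> c / 2 * exp ((2 * pot_mass \<mu> + 1) * x)"
proof -
  let ?a = "2 * pot_mass \<mu> + 1"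
  have a: "?a > 0" using pot_mass_nonneg[of \<mu>] by simp
  have pt: "cmod (pot \<mu> b * F b * of_real (indicator {0..x} b * (x - b))) \<le> cmod (pot \<mu> b) * (c * (exp (?a * x) / ?a))" for b
  proof (cases "b \<in> {0..x}")
    case True
    have "?a * (x - b) \<le> exp (?a * (x - b))" using exp_ge_add_one_self[of "?a * (x - b)"] by linarith
    then have "exp (?a * b) * (?a * (x - b)) \<le> exp (?a * b) * exp (?a * (x - b))" by (intro mult_left_mono) auto
    also have "\<dots> = exp (?a * x)" by (simp add: algebra_simps flip: exp_add)
    finally have e: "exp (?a * b) * (x - b) \<le> exp (?a * x) / ?a" using a by (simp add: field_simps)
    have "cmod (F b) * (x - b) \<le> c * exp (?a * b) * (x - b)"
      using F[of b] True x by (intro mult_right_mono) (auto simp: pw_def)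
    also have "\<dots> \<le> c * (exp (?a * x) / ?a)" using mult_left_mono[OF e c] by (simp add: mult.assoc)
    finally have "cmod (pot \<mu> b) * (cmod (F b) * (x - b)) \<le> cmod (pot \<mu> b) * (c * (exp (?a * x) / ?a))"
      by (rule mult_left_mono) simp
    moreover have "cmod (of_real (indicator {0..x} b * (x - b))) = x - b"
      using True by (simp only: norm_of_real) simp
    ultimately show ?thesis by (simp only: norm_mult mult.assoc)
  next
    case False
    then show ?thesis using c a by simp
  qed
  have "cmod (volt \<mu> F x) \<le> (LINT b|lborel. cmod (pot \<mu> b * F b * of_real (indicator {0..x} b * (x - b))))"
    unfolding volt_def by (rule integral_norm_bound)
  also have "\<dots> \<le> (LINT b|lborel. cmod (pot \<mu> b) * (c * (exp (?a * x) / ?a)))"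
    by (rule integral_mono') (use pot_integrable pt c a in auto)
  also have "\<dots> = pot_mass \<mu> * (c * (exp (?a * x) / ?a))" by (simp add: pot_mass_def)
  also have "\<dots> = pot_mass \<mu> / ?a * (c * exp (?a * x))" by simp
  also have "\<dots> \<le> 1 / 2 * (c * exp (?a * x))"
    using a c by (intro mult_right_mono) (auto simp: field_simps)
  finally show ?thesis by simp
qed

lemma bounded_pot_integrable:
  assumes F: "F \<in> borel_measurable borel" and b: "\<And>x. cmod (F x) \<le> c * indicator {0..T} x"
  shows "integrable lborel (\<lambda>b. pot \<mu> b * F b)"
proof -
  have "integrable lborel (\<lambda>b. F b * pot \<mu> b)"
  proof (rule integrable_bounded_mult[OF pot_integrable])
    show "cmod (F x) \<le> \<bar>c\<bar>" for x using b[of x] by (cases "x \<in> {0..T}") auto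
  qed (use F in simp)
  then show ?thesis by (simp add: mult.commute)
qed

lemma volt_integrand_integrable:
  assumes F: "F \<in> borel_measurable borel" and b: "\<And>x. cmod (F x) \<le> c * indicator {0..T} x"
  shows "integrable lborel (\<lambda>b. pot \<mu> b * F b * of_real (indicator {0..x} b * (x - b)))"
proof -
  have "integrable lborel (\<lambda>b. of_real (indicator {0..x} b * (x - b)) * (pot \<mu> b * F b))"
  proof (rule integrable_bounded_mult[OF bounded_pot_integrable[OF F b]])
    show "cmod (of_real (indicator {0..x} b * (x - b))) \<le> \<bar>x\<bar>" for b
      by (simp only: norm_of_real) (auto simp: indicator_def)
  qed simp
  then show ?thesis by (simp add: mult.commute)
qed

lemma volt_diff:
  assumes F: "F \<in> borel_measurable borel" "\<And>x. cmod (F x) \<le> c * indicator {0..T} x"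
    and G: "G \<in> borel_measurable borel" "\<And>x. cmod (G x) \<le> d * indicator {0..T} x"
  shows "volt \<mu> (\<lambda>x. F x - G x) x = volt \<mu> F x - volt \<mu> G x"
  unfolding volt_def left_diff_distrib right_diff_distrib
  using Bochner_Integration.integral_diff[OF volt_integrand_integrable[OF F] volt_integrand_integrable[OF G]]
  by (simp add: algebra_simps)

lemma volt_measurable:
  assumes [measurable]: "F \<in> borel_measurable borel"
  shows "volt \<mu> F \<in> borel_measurable borel"
proof -
  have "(\<lambda>x. LINT b|lborel. pot \<mu> b * F b * of_real (indicator {0..x} b * (x - b))) \<in> borel_measurable borel"
    by (rule lborel.borel_measurable_lebesgue_integral) (unfold indicator_def atLeastAtMost_iff, measurable)
  then show ?thesis by (simp add: volt_def[abs_def])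
qed

lemma is_phi_exists: "\<exists>F. is_phi \<mu> F"
proof -
  define A where "A F x = of_real (indicator {0..T} x) * volt \<mu> F x" for F x
  have bT: "cmod (F x) \<le> (\<bar>c\<bar> * exp ((2 * pot_mass \<mu> + 1) * T)) * indicator {0..T} x"
    if "\<And>x. cmod (F x) \<le> c * pw \<mu> x" for F :: "real \<Rightarrow> complex" and c x
  proof -
    have "cmod (F x) \<le> \<bar>c\<bar> * pw \<mu> x"
      using that[of x] by (rule order_trans) (intro mult_right_mono, auto simp: pw_def)
    also have "\<dots> \<le> \<bar>c\<bar> * (exp ((2 * pot_mass \<mu> + 1) * T) * indicator {0..T} x)" by (intro mult_left_mono pw_le) simp
    finally show ?thesis by (simp add: mult.assoc)
  qed
  obtain F where F: "F \<in> borel_measurable borel" "\<And>x. cmod (F x) \<le> 2 * T * pw \<mu> x"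
    "\<And>x. F x = of_real (indicator {0..T} x * x) + A F x"
  proof (rule weighted_neumann[where A = A and w = "pw \<mu>" and Adm = "\<lambda>F. F \<in> borel_measurable borel" and g = "\<lambda>x. of_real (indicator {0..T} x * x)" and ?c0.0 = T])
    show "pw \<mu> x \<ge> 0" for x by (simp add: pw_def)
    show "F \<in> borel_measurable borel"
      if "\<And>n. S n \<in> borel_measurable borel" "\<And>x. (\<lambda>n. S n x) \<longlonglongrightarrow> F x" for S and F :: "real \<Rightarrow> complex"
      by (rule borel_measurable_LIMSEQ_metric[OF that])
    show "A F \<in> borel_measurable borel" if "F \<in> borel_measurable borel" for F
      unfolding A_def using volt_measurable[OF that] by measurable
    show "A (\<lambda>x. F x - G x) x = A F x - A G x"
      if "F \<in> borel_measurable borel" "G \<in> borel_measurable borel" "\<And>x. cmod (F x) \<le> c * pw \<mu> x" "\<And>x. cmod (G x) \<le> c * pw \<mu> x" for F G c x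
      unfolding A_def volt_diff[OF that(1) bT[OF that(3)] that(2) bT[OF that(4)]] by (rule right_diff_distrib)
    show "cmod (A F x) \<le> c / 2 * pw \<mu> x" if "\<And>x. cmod (F x) \<le> c * pw \<mu> x" "c \<ge> 0" for F c x
      using volt_half[OF that, of x] by (cases "x \<in> {0..T}") (auto simp: A_def pw_def)
    show "cmod (of_real (indicator {0..T} x * x)) \<le> T * pw \<mu> x" for x
    proof -
      have "cmod (of_real (indicator {0..T} x * x)) \<le> T * indicator {0..T} x" by (auto simp: indicator_def)
      also have "\<dots> \<le> T * pw \<mu> x" using T_pos by (intro mult_left_mono pw_ge) auto
      finally show ?thesis .
    qed
  qed (use T_pos in \<open>auto intro!: borel_measurable_add borel_measurable_diff\<close>)
  have "is_phi \<mu> F"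
    unfolding is_phi_def
  proof (intro conjI allI)
    show "\<exists>c. \<forall>x. cmod (F x) \<le> c * indicator {0..T} x" using bT[OF F(2)] by blast
    show "F x = of_real (indicator {0..T} x) * (of_real x + volt \<mu> F x)" for x
      by (subst F(3)) (simp add: A_def algebra_simps)
  qed (rule F(1))
  then show ?thesis by blast
qed

lemma is_phi_unique:
  assumes F: "is_phi \<mu> F" and G: "is_phi \<mu> G"
  shows "F = G"
proof
  fix x
  obtain c where c: "\<And>x. cmod (F x) \<le> c * indicator {0..T} x" using F unfolding is_phi_def by blast
  obtain d where d: "\<And>x. cmod (G x) \<le> d * indicator {0..T} x" using G unfolding is_phi_def by blast
  have Fm: "F \<in> borel_measurable borel" and Gm: "G \<in> borel_measurable borel" using F G by (auto simp: is_phi_def)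
  have eq: "F x - G x = of_real (indicator {0..T} x) * volt \<mu> (\<lambda>x. F x - G x) x" for x
    unfolding volt_diff[OF Fm c Gm d] using F G unfolding is_phi_def
    by (metis (no_types, lifting) add_diff_add diff_self right_diff_distrib add_0)
  have "F x - G x = 0"
  proof (rule halving_imp_zero[where X = UNIV and w = "pw \<mu>" and F = "\<lambda>x. F x - G x" and ?c0.0 = "\<bar>c\<bar> + \<bar>d\<bar>"])
    show "cmod (F x - G x) \<le> (\<bar>c\<bar> + \<bar>d\<bar>) * pw \<mu> x" for x
    proof -
      have "cmod (F x - G x) \<le> c * indicator {0..T} x + d * indicator {0..T} x"
        by (rule order_trans[OF norm_triangle_ineq4 add_mono[OF c d]])
      also have "\<dots> \<le> (\<bar>c\<bar> + \<bar>d\<bar>) * indicator {0..T} x" by (auto simp: indicator_def)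
      also have "\<dots> \<le> (\<bar>c\<bar> + \<bar>d\<bar>) * pw \<mu> x" by (intro mult_left_mono pw_ge) auto
      finally show ?thesis .
    qed
    show "cmod (F x - G x) \<le> e / 2 * pw \<mu> x"
      if "e \<ge> 0" "\<And>y. y \<in> UNIV \<Longrightarrow> cmod (F y - G y) \<le> e * pw \<mu> y" for e x
      using volt_half[of "\<lambda>x. F x - G x" e \<mu> x] that
      by (subst eq, cases "x \<in> {0..T}") (auto simp: pw_def)
  qed auto
  then show "F x = G x" by simp
qed

definition phi :: "complex \<Rightarrow> real \<Rightarrow> complex" where "phi \<mu> = (SOME F. is_phi \<mu> F)"

lemma phi: "is_phi \<mu> (phi \<mu>)"
  unfolding phi_def by (rule someI_ex[OF is_phi_exists])

lemma phi_measurable [measurable]: "phi \<mu> \<in> borel_measurable borel"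
  using phi by (simp add: is_phi_def)

lemma phi_bounded: obtains c where "c \<ge> 0" "\<And>x. cmod (phi \<mu> x) \<le> c * indicator {0..T} x"
proof -
  obtain c where c: "\<And>x. cmod (phi \<mu> x) \<le> c * indicator {0..T} x" using phi[of \<mu>] unfolding is_phi_def by blast
  have "0 \<le> c" using order_trans[OF norm_ge_zero c[of T]] T_pos by simp
  then show ?thesis using that c by blast
qed

lemma phi_eq: "x \<in> {0..T} \<Longrightarrow> phi \<mu> x = of_real x + volt \<mu> (phi \<mu>) x"
  using phi[of \<mu>] by (auto simp: is_phi_def)

lemma phi_outside: "x \<notin> {0..T} \<Longrightarrow> phi \<mu> x = 0"
  using phi[of \<mu>] by (auto simp: is_phi_def)

lemma pot_cnj: "pot (cnj \<mu>) y = cnj (pot \<mu> y)"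
  by (simp add: pot_def)

lemma phi_cnj: "phi (cnj \<mu>) x = cnj (phi \<mu> x)"
proof -
  have "is_phi (cnj \<mu>) (\<lambda>x. cnj (phi \<mu> x))"
    unfolding is_phi_def
  proof (intro conjI allI)
    show "(\<lambda>x. cnj (phi \<mu> x)) \<in> borel_measurable borel" by measurable
    show "\<exists>c. \<forall>x. cmod (cnj (phi \<mu> x)) \<le> c * indicator {0..T} x"
      using phi[of \<mu>] unfolding is_phi_def complex_mod_cnj by blast
    have v: "volt (cnj \<mu>) (\<lambda>x. cnj (phi \<mu> x)) x = cnj (volt \<mu> (phi \<mu>) x)" for x
      unfolding volt_def pot_cnj Bochner_Integration.integral_cnj[symmetric] by simp
    show "cnj (phi \<mu> x) = of_real (indicator {0..T} x) * (of_real x + volt (cnj \<mu>) (\<lambda>x. cnj (phi \<mu> x)) x)" for x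
      unfolding v by (cases "x \<in> {0..T}") (simp_all add: phi_eq phi_outside)
  qed
  then show ?thesis using is_phi_unique[OF phi[of "cnj \<mu>"]] by (metis)
qed

text \<open>This is phi'' as an integrable density on the line.\<close>

definition mass :: "complex \<Rightarrow> real \<Rightarrow> complex" where "mass \<mu> b = pot \<mu> b * phi \<mu> b"

lemma mass_integrable: "integrable lborel (mass \<mu>)"
proof -
  obtain c where "\<And>x. cmod (phi \<mu> x) \<le> c * indicator {0..T} x" using phi_bounded[of \<mu>] by metis
  from bounded_pot_integrable[OF phi_measurable this] show ?thesis by (simp add: mass_def[abs_def])
qed

lemma mass_measurable [measurable]: "mass \<mu> \<in> borel_measurable borel"
  using mass_integrable by auto

lemma mass_cnj: "mass (cnj \<mu>) b = cnj (mass \<mu> b)"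
  by (simp add: mass_def pot_cnj phi_cnj)

lemma mass_outside: "x \<notin> {0..T} \<Longrightarrow> mass \<mu> x = 0"
  by (simp add: mass_def phi_outside)

definition dphi :: "complex \<Rightarrow> real \<Rightarrow> complex" where
  "dphi \<mu> s = 1 + (LINT b|lborel. mass \<mu> b * of_real (indicator {0..s} b))"

lemma dphi_cnj: "dphi (cnj \<mu>) s = cnj (dphi \<mu> s)"
  unfolding dphi_def mass_cnj by (simp flip: Bochner_Integration.integral_cnj)

lemma dphi_measurable [measurable]: "dphi \<mu> \<in> borel_measurable borel"
proof -
  have "(\<lambda>s. LINT b|lborel. mass \<mu> b * of_real (indicator {0..s} b)) \<in> borel_measurable borel"
    by (rule lborel.borel_measurable_lebesgue_integral) (unfold indicator_def atLeastAtMost_iff, measurable)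
  then show ?thesis by (simp add: dphi_def[abs_def])
qed

lemma dphi_bounded: "cmod (dphi \<mu> s) \<le> 1 + (LINT b|lborel. cmod (mass \<mu> b))"
proof -
  have "cmod (LINT b|lborel. mass \<mu> b * of_real (indicator {0..s} b)) \<le> (LINT b|lborel. cmod (mass \<mu> b * of_real (indicator {0..s} b)))"
    by (rule integral_norm_bound)
  also have "\<dots> \<le> (LINT b|lborel. cmod (mass \<mu> b))"
    by (rule integral_mono') (use mass_integrable in \<open>auto simp: norm_mult indicator_def\<close>)
  finally show ?thesis unfolding dphi_def by (intro norm_triangle_le) simp
qed

text \<open>phi' cut off to [0,T], so as to be an integrable density for
  \<open>primitive_product\<close>.\<close>

definition dphi0 :: "complex \<Rightarrow> real \<Rightarrow> complex" where
  "dphi0 \<mu> s = dphi \<mu> s * of_real (indicator {0..T} s)"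

lemma dphi0_integrable: "integrable lborel (dphi0 \<mu>)"
  unfolding dphi0_def by (rule integrable_bounded_mult[OF indicator_integrable _ dphi_bounded]) simp

text \<open>Exchanging the two integrations turns the double primitive of \<open>mass\<close> into
  the kernel x - b of \<open>volt\<close>.\<close>

lemma phi_primitive:
  assumes x: "x \<in> {0..T}"
  shows "phi \<mu> x = 0 + (LINT s|lborel. dphi0 \<mu> s * of_real (indicator {0..x} s))"
proof -
  define k where "k = (\<lambda>z::real \<times> real. of_bool (0 \<le> snd z \<and> snd z \<le> fst z) :: real)"
  have km: "k \<in> borel_measurable (borel \<Otimes>\<^sub>M borel)" unfolding k_def by measurable
  have kb: "\<bar>k z\<bar> \<le> 1" for z by (simp add: k_def)
  have ki: "of_real (indicator {0..s} b) = complex_of_real (k (s, b))" for s b by (auto simp: k_def indicator_def)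
  let ?f = "\<lambda>s. complex_of_real (indicator {0..x} s)"
  have "(LINT s|lborel. dphi0 \<mu> s * ?f s) = (LINT s|lborel. ?f s + ?f s * (LINT b|lborel. mass \<mu> b * of_real (k (s, b))))"
    using x by (intro Bochner_Integration.integral_cong refl) (auto simp: dphi0_def dphi_def ki[symmetric] indicator_def algebra_simps)
  also have "\<dots> = (LINT s|lborel. ?f s) + (LINT s|lborel. ?f s * (LINT b|lborel. mass \<mu> b * of_real (k (s, b))))"
    using fubini_bounded(3)[OF mass_integrable indicator_integrable, of "\<lambda>z. k (snd z, fst z)" 1] km kb
    by (intro Bochner_Integration.integral_add indicator_integrable) auto
  also have "(LINT s|lborel. ?f s * (LINT b|lborel. mass \<mu> b * of_real (k (s, b)))) = (LINT b|lborel. mass \<mu> b * (LINT s|lborel. ?f s * of_real (k (s, b))))"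
    by (rule fubini_bounded(1)[OF indicator_integrable mass_integrable km kb])
  also have "\<dots> = volt \<mu> (phi \<mu>) x"
    unfolding volt_def
  proof (rule Bochner_Integration.integral_cong[OF refl])
    fix b
    have "(LINT s|lborel. ?f s * of_real (k (s, b))) = (LINT s|lborel. complex_of_real (indicator {0..x} b * indicator {b..x} s))"
      by (intro Bochner_Integration.integral_cong) (auto simp: k_def indicator_def)
    also have "\<dots> = of_real (indicator {0..x} b * (x - b))"
      by (cases "b \<in> {0..x}") (simp_all add: measure_lborel_Icc)
    finally show "mass \<mu> b * (LINT s|lborel. ?f s * of_real (k (s, b))) = pot \<mu> b * phi \<mu> b * of_real (indicator {0..x} b * (x - b))"
      by (simp add: mass_def)
  qed
  also have "(LINT s|lborel. ?f s) = of_real x" using x by simp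
  finally show ?thesis using phi_eq[OF x, of \<mu>] by simp
qed

text \<open>Integration by parts in phi conj(phi_z'') and in phi'' conj(phi_z): the terms with both
  first derivatives cancel, the boundary terms at 0 vanish because phi(0) = 0, and the real
  potential drops out of the difference.\<close>

lemma lagrange_identity:
  "(\<mu> - cnj z) * (LINT s|lborel. phi \<mu> s * cnj (phi z s)) = phi \<mu> T * cnj (dphi z T) - dphi \<mu> T * cnj (phi z T)"
proof -
  let ?I = "\<lambda>s. complex_of_real (indicator {0..T} s)"
  have T: "T \<in> {0..T}" using T_pos by simp
  have pb: "cnj (phi z x) = 0 + (LINT s|lborel. dphi0 (cnj z) s * of_real (indicator {0..x} s))" if "x \<in> {0..T}" for x
    using phi_primitive[OF that, of "cnj z"] by (simp add: phi_cnj)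
  have db: "cnj (dphi z s) = 1 + (LINT b|lborel. mass (cnj z) b * of_real (indicator {0..s} b))" for s
    using dphi_def[of "cnj z" s] by (simp only: dphi_cnj)
  obtain c1 where c1: "\<And>x. cmod (phi \<mu> x) \<le> c1 * indicator {0..T} x" using phi_bounded[of \<mu>] by metis
  obtain c2 where c2: "\<And>x. cmod (phi (cnj z) x) \<le> c2 * indicator {0..T} x" using phi_bounded[of "cnj z"] by metis
  have c1': "cmod (phi \<mu> x) \<le> \<bar>c1\<bar>" and c2': "cmod (phi (cnj z) x) \<le> \<bar>c2\<bar>" for x
    using c1[of x] c2[of x] by (cases "x \<in> {0..T}"; auto)+
  have e1: "(LINT s|lborel. ?I s * (dphi0 \<mu> s * cnj (dphi z s))) + (LINT s|lborel. phi \<mu> s * mass (cnj z) s) = phi \<mu> T * cnj (dphi z T)"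
  proof -
    have "(LINT s|lborel. phi \<mu> s * mass (cnj z) s)
        = (LINT s|lborel. ?I s * ((0 + (LINT r|lborel. dphi0 \<mu> r * of_real (indicator {0..s} r))) * mass (cnj z) s))"
    proof (intro Bochner_Integration.integral_cong refl)
      fix s
      show "phi \<mu> s * mass (cnj z) s = ?I s * ((0 + (LINT r|lborel. dphi0 \<mu> r * of_real (indicator {0..s} r))) * mass (cnj z) s)"
        using phi_primitive[of s \<mu>] by (cases "s \<in> {0..T}") (simp_all add: phi_outside)
    qed
    then show ?thesis
      using primitive_product[OF dphi0_integrable mass_integrable, where T = T and ?a0.0 = 0 and ?b0.0 = 1, of \<mu> "cnj z"] phi_primitive[OF T, of \<mu>]
      by (simp add: db)
  qed
  have e2: "(LINT s|lborel. mass \<mu> s * cnj (phi z s)) + (LINT s|lborel. ?I s * (dphi \<mu> s * dphi0 (cnj z) s)) = dphi \<mu> T * cnj (phi z T)"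
  proof -
    have "(LINT s|lborel. mass \<mu> s * cnj (phi z s))
        = (LINT s|lborel. ?I s * (mass \<mu> s * (0 + (LINT r|lborel. dphi0 (cnj z) r * of_real (indicator {0..s} r)))))"
    proof (intro Bochner_Integration.integral_cong refl)
      fix s
      show "mass \<mu> s * cnj (phi z s) = ?I s * (mass \<mu> s * (0 + (LINT r|lborel. dphi0 (cnj z) r * of_real (indicator {0..s} r))))"
        using pb[of s] by (cases "s \<in> {0..T}") (simp_all add: phi_outside)
    qed
    then show ?thesis
      using primitive_product[OF mass_integrable dphi0_integrable, where T = T and ?a0.0 = 1 and ?b0.0 = 0, of \<mu> "cnj z"] pb[OF T]
      by (simp add: dphi_def)
  qed
  have "phi \<mu> T * cnj (dphi z T) - dphi \<mu> T * cnj (phi z T) = (LINT s|lborel. phi \<mu> s * mass (cnj z) s) - (LINT s|lborel. mass \<mu> s * cnj (phi z s))"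
  proof -
    have "(LINT s|lborel. ?I s * (dphi0 \<mu> s * cnj (dphi z s))) = (LINT s|lborel. ?I s * (dphi \<mu> s * dphi0 (cnj z) s))"
      by (intro Bochner_Integration.integral_cong refl) (simp add: dphi0_def dphi_cnj mult_ac)
    then show ?thesis unfolding e1[symmetric] e2[symmetric] by simp
  qed
  also have "\<dots> = (LINT s|lborel. phi \<mu> s * mass (cnj z) s - mass \<mu> s * phi (cnj z) s)"
  proof -
    have i1: "integrable lborel (\<lambda>s. phi \<mu> s * mass (cnj z) s)"
      by (rule integrable_bounded_mult[OF mass_integrable _ c1']) simp
    have i2: "integrable lborel (\<lambda>s. phi (cnj z) s * mass \<mu> s)"
      by (rule integrable_bounded_mult[OF mass_integrable _ c2']) simp
    show ?thesis using i1 i2 by (simp add: phi_cnj mult.commute)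
  qed
  also have "\<dots> = (LINT s|lborel. (\<mu> - cnj z) * (phi \<mu> s * cnj (phi z s)))"
  proof (intro Bochner_Integration.integral_cong refl)
    fix s
    show "phi \<mu> s * mass (cnj z) s - mass \<mu> s * phi (cnj z) s = (\<mu> - cnj z) * (phi \<mu> s * cnj (phi z s))"
      by (cases "s \<in> {0..T}") (simp_all add: mass_def pot_def phi_cnj phi_outside algebra_simps)
  qed
  also have "\<dots> = (\<mu> - cnj z) * (LINT s|lborel. phi \<mu> s * cnj (phi z s))" by (rule integral_mult_right_zero)
  finally show ?thesis ..
qed

end

section \<open>The Fourier image as a moment of the state\<close>

lemma integral_exp_le:
  assumes l: "l > (0::real)" and t: "t \<ge> 0"
  shows "(LINT s|lborel. indicator {0..t} s * exp (l * s)) \<le> exp (l * t) / l"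
proof -
  have "(LINT s|lborel. indicator {0..t} s *\<^sub>R exp (l * s)) = exp (l * t) / l - exp (l * 0) / l"
  proof (rule integral_FTC_atLeastAtMost[OF t])
    show "((\<lambda>s. exp (l * s) / l) has_vector_derivative exp (l * x)) (at x within {0..t})" for x
      unfolding has_real_derivative_iff_has_vector_derivative[symmetric]
      using l by (auto intro!: derivative_eq_intros)
  qed (intro continuous_intros)
  then show ?thesis using l by simp
qed

text \<open>The equation of phi for zero potential: Taylor's formula at 0 with integral remainder,
  the second derivative of the kernel in x being -\<mu> times the kernel.\<close>

lemma sin_kernel_volterra:
  assumes x: "x \<ge> 0"
  shows "sin_kernel \<mu> x = of_real x - \<mu> * (LINT b|lborel. indicator {0..x} b *\<^sub>R (of_real (x - b) * sin_kernel \<mu> b))"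
proof (cases "\<mu> = 0")
  case False
  define r where "r = csqrt \<mu>"
  have r: "r \<noteq> 0" "r * r = \<mu>" using False power2_csqrt[of \<mu>] by (auto simp: r_def power2_eq_square)
  \<comment> \<open>An antiderivative found by integrating (x - y) sin(r y) / r by parts.\<close>
  define G where "G y = - (of_real (x - y) * cos (r * of_real y)) / \<mu> - sin (r * of_real y) / (r * \<mu>)" for y :: real
  have "(LINT b|lborel. indicator {0..x} b *\<^sub>R (of_real (x - b) * sin_kernel \<mu> b)) = G x - G 0"
  proof (rule integral_FTC_atLeastAtMost[OF x])
    show "(G has_vector_derivative of_real (x - y) * sin_kernel \<mu> y) (at y within {0..x})" for y
    proof -
      have "((\<lambda>y. - ((of_real x - y) * cos (r * y)) / \<mu> - sin (r * y) / (r * \<mu>)) has_field_derivative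
          (of_real x - of_real y) * sin (r * of_real y) / r) (at (of_real y))"
        unfolding r(2)[symmetric] using r(1) by (auto intro!: derivative_eq_intros simp: field_simps)
      from has_vector_derivative_real_field[OF this, of "{0..x}"]
      show ?thesis using False by (simp add: G_def[abs_def] sin_kernel_def r_def of_real_diff)
    qed
    show "continuous_on {0..x} (\<lambda>y. of_real (x - y) * sin_kernel \<mu> y)"
      by (intro continuous_intros sin_kernel_continuous)
  qed
  then show ?thesis using r False by (simp add: G_def sin_kernel_def r_def[symmetric] field_simps)
qed (simp add: sin_kernel_def)

context wave
begin

text \<open>Justifies the exchanges of integrals in \<open>moment_volterra\<close>: the free wave is
  handled by a shear of the plane, and \<open>v\<close> is bounded and vanishes outside 0 <= t <=
  T.\<close>

lemma V_plane_integrable: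
  assumes f: "integrable (lebI T) f" and v: "v \<in> borel_measurable borel" and vb: "\<And>z. cmod (v z) \<le> P * wt f z"
    and n: "integrable lborel n"
  shows "integrable lborel (\<lambda>z. n (fst z) * free f z)" "integrable lborel (\<lambda>z. n (fst z) * v z)"
proof -
  have nm[measurable]: "n \<in> borel_measurable borel" using n by auto
  have cm[measurable]: "ctl f \<in> borel_measurable borel" using ctl_integrable[OF f] by auto
  have fm: "free f \<in> borel_measurable borel" by (rule free_measurable) (use f in auto)
  have n1: "(\<lambda>z::real \<times> real. n (fst z)) \<in> borel_measurable borel" unfolding borel_prod[symmetric] by measurable
  show "integrable lborel (\<lambda>z. n (fst z) * free f z)"
  proof (rule integrableI_bounded)
    show "(\<lambda>z. n (fst z) * free f z) \<in> borel_measurable lborel" using n1 fm by simp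
    have "(\<integral>\<^sup>+z. ennreal (norm (n (fst z) * free f z)) \<partial>lborel)
        \<le> (\<integral>\<^sup>+z. ennreal (cmod (n (fst z))) * ennreal (cmod (ctl f (snd z - fst z))) \<partial>lborel)"
    proof (rule nn_integral_mono)
      fix z :: "real \<times> real"
      show "ennreal (norm (n (fst z) * free f z)) \<le> ennreal (cmod (n (fst z))) * ennreal (cmod (ctl f (snd z - fst z)))"
        using mult_left_mono[OF free_norm_le[of f z], of "cmod (n (fst z))"]
        by (simp only: norm_mult ennreal_mult[symmetric] norm_ge_zero ennreal_leI)
    qed
    also have "\<dots> = (\<integral>\<^sup>+y. ennreal (cmod (n y)) \<partial>lborel) * (\<integral>\<^sup>+s. ennreal (cmod (ctl f s)) \<partial>lborel)"
      by (rule nn_integral_convolution) auto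
    also have "\<dots> < \<infinity>"
      using n ctl_integrable[OF f] by (auto simp: integrable_iff_bounded ennreal_mult_less_top)
    finally show "(\<integral>\<^sup>+z. ennreal (norm (n (fst z) * free f z)) \<partial>lborel) < \<infinity>" .
  qed
  have "integrable lborel (\<lambda>z. v z * (n (fst z) * of_real (indicator {0..T} (snd z))))"
  proof (rule integrable_bounded_mult)
    show "integrable lborel (\<lambda>z. n (fst z) * complex_of_real (indicator {0..T} (snd z)))"
      using integrable_times[OF n indicator_integrable[of 0 T]] by (simp add: lborel_prod)
    show "cmod (v z) \<le> P * (cum f T * exp (l * T))" for z
    proof -
      have "wt f z \<le> cum f T * exp (l * T)"
        using l_pos cum_nonneg[of f] cum_mono[OF f]
        by (cases "z \<in> Dm") (auto simp: wt_def Dm_def intro!: mult_mono)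
      then show ?thesis using vb[of z] P_nonneg mult_left_mono order_trans by blast
    qed
  qed (use v in simp)
  moreover have "v z * (n (fst z) * of_real (indicator {0..T} (snd z))) = n (fst z) * v z" for z
    using vb[of z] by (cases "z \<in> Dm") (auto simp: wt_def Dm_def)
  ultimately show "integrable lborel (\<lambda>z. n (fst z) * v z)" by simp
qed

text \<open>Superposition of \<open>triangle_average\<close>, since on [0,T] phi is x plus the
  integral of max 0 (x - b) against \<open>mass\<close>. The condition on y + r keeps the triangle
  inside [0,T], where phi satisfies its equation.\<close>

lemma phi_triangle_average:
  assumes y: "y \<ge> 0" and r: "r \<ge> 0" and yr: "y + r \<le> T"
  shows "(LINT x|lborel. phi \<mu> x * of_real (of_bool (tri x y r) / 2))
     = of_real r * phi \<mu> y + (LINT b|lborel. mass \<mu> b * of_real (tri_kernel y b r))"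
proof -
  define f where "f x = complex_of_real (of_bool (tri x y r) / 2)" for x
  have fi: "integrable lborel f"
  proof -
    have "integrable lborel (\<lambda>x. (1/2) * complex_of_real (indicator {\<bar>y - r\<bar>..y + r} x))"
      by (intro integrable_mult_right indicator_integrable)
    also have "(\<lambda>x. (1/2) * complex_of_real (indicator {\<bar>y - r\<bar>..y + r} x)) = f"
      unfolding f_def tri_indicator[OF y r] by simp
    finally show ?thesis .
  qed
  have triT: "x \<in> {0..T}" if "tri x y r" for x using that yr by (auto simp: tri_def)
  define k where "k = (\<lambda>z::real \<times> real. indicator {0..T} (fst z) * (indicator {0..T} (snd z) * max 0 (fst z - snd z)))"
  have km: "k \<in> borel_measurable (borel \<Otimes>\<^sub>M borel)" unfolding k_def by measurable
  have kb: "\<bar>k z\<bar> \<le> T" for z using T_pos by (auto simp: k_def indicator_def)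
  have volt_k: "volt \<mu> (phi \<mu>) x = (LINT b|lborel. mass \<mu> b * of_real (k (x, b)))" if "x \<in> {0..T}" for x
    unfolding volt_def
  proof (intro Bochner_Integration.integral_cong refl)
    fix b
    show "pot \<mu> b * phi \<mu> b * of_real (indicator {0..x} b * (x - b)) = mass \<mu> b * of_real (k (x, b))"
    proof (cases "b \<in> {0..T}")
      case True
      then show ?thesis using that by (auto simp: mass_def k_def indicator_def max_def)
    qed (simp add: mass_outside phi_outside)
  qed
  have e1: "(LINT x|lborel. phi \<mu> x * f x) = (LINT x|lborel. of_real (of_bool (tri x y r) * x / 2) + f x * (LINT b|lborel. mass \<mu> b * of_real (k (x, b))))"
  proof (intro Bochner_Integration.integral_cong refl)
    fix x
    show "phi \<mu> x * f x = of_real (of_bool (tri x y r) * x / 2) + f x * (LINT b|lborel. mass \<mu> b * of_real (k (x, b)))"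
    proof (cases "tri x y r")
      case True
      then show ?thesis using phi_eq[OF triT[OF True], of \<mu>] volt_k[OF triT[OF True]] by (simp add: f_def field_simps)
    qed (simp add: f_def)
  qed
  have xi: "integrable lborel (\<lambda>x. complex_of_real (of_bool (tri x y r) * x / 2))"
  proof -
    have "integrable lborel (\<lambda>x. of_real (indicator {0..T} x * x) * f x)"
    proof (rule integrable_bounded_mult[OF fi])
      show "cmod (of_real (indicator {0..T} x * x)) \<le> T" for x
        using T_pos by (simp only: norm_of_real) (auto simp: indicator_def)
    qed simp
    moreover have "of_real (indicator {0..T} x * x) * f x = complex_of_real (of_bool (tri x y r) * x / 2)" for x
      using triT[of x] by (auto simp: f_def)
    ultimately show ?thesis by (simp only:)
  qed
  have fk: "integrable lborel (\<lambda>x. f x * (LINT b|lborel. mass \<mu> b * of_real (k (x, b))))"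
    using fubini_bounded(3)[OF mass_integrable fi, of "\<lambda>z. k (snd z, fst z)" T] km kb by simp
  have "(LINT x|lborel. phi \<mu> x * f x) = (LINT x|lborel. of_real (of_bool (tri x y r) * x / 2)) + (LINT x|lborel. f x * (LINT b|lborel. mass \<mu> b * of_real (k (x, b))))"
    unfolding e1 by (rule Bochner_Integration.integral_add[OF xi fk])
  also have "(LINT x|lborel. complex_of_real (of_bool (tri x y r) * x / 2)) = of_real (r * y)"
    unfolding integral_complex_of_real triangle_average_id[OF y r] ..
  also have "(LINT x|lborel. f x * (LINT b|lborel. mass \<mu> b * of_real (k (x, b)))) = (LINT b|lborel. mass \<mu> b * (LINT x|lborel. f x * of_real (k (x, b))))"
    by (rule fubini_bounded(1)[OF fi mass_integrable km kb])
  also have "\<dots> = (LINT b|lborel. mass \<mu> b * of_real (r * max 0 (y - b) + tri_kernel y b r))"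
  proof (intro Bochner_Integration.integral_cong refl)
    fix b
    show "mass \<mu> b * (LINT x|lborel. f x * of_real (k (x, b))) = mass \<mu> b * of_real (r * max 0 (y - b) + tri_kernel y b r)"
    proof (cases "b \<in> {0..T}")
      case True
      have "(LINT x|lborel. f x * of_real (k (x, b))) = (LINT x|lborel. complex_of_real (of_bool (tri x y r) * max 0 (x - b) / 2))"
        using True triT by (intro Bochner_Integration.integral_cong refl) (auto simp: f_def k_def)
      also have "\<dots> = of_real (r * max 0 (y - b) + tri_kernel y b r)"
        unfolding integral_complex_of_real using True y r by (subst triangle_average) auto
      finally show ?thesis by simp
    qed (simp add: mass_outside)
  qed
  also have "\<dots> = of_real r * volt \<mu> (phi \<mu>) y + (LINT b|lborel. mass \<mu> b * of_real (tri_kernel y b r))"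
  proof -
    have i1: "integrable lborel (\<lambda>b. mass \<mu> b * of_real (r * max 0 (y - b) + tri_kernel y b r))"
    proof -
      have e: "mass \<mu> b * (LINT x|lborel. f x * of_real (k (x, b))) = mass \<mu> b * of_real (r * max 0 (y - b) + tri_kernel y b r)" for b
      proof (cases "b \<in> {0..T}")
        case True
        have "(LINT x|lborel. f x * of_real (k (x, b))) = (LINT x|lborel. complex_of_real (of_bool (tri x y r) * max 0 (x - b) / 2))"
          using True triT by (intro Bochner_Integration.integral_cong refl) (auto simp: f_def k_def)
        also have "\<dots> = of_real (r * max 0 (y - b) + tri_kernel y b r)"
          unfolding integral_complex_of_real using True y r by (subst triangle_average) auto
        finally show ?thesis by simp
      qed (simp add: mass_outside)
      show ?thesis using fubini_bounded(3)[OF fi mass_integrable[of \<mu>] km kb] by (simp only: e)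
    qed
    have yT: "y \<in> {0..T}" using y r yr by auto
    have eqv: "of_real r * (mass \<mu> b * of_real (k (y, b))) = mass \<mu> b * of_real (r * max 0 (y - b))" for b
      using yT by (cases "b \<in> {0..T}") (simp_all add: k_def mass_outside)
    have i2: "integrable lborel (\<lambda>b. mass \<mu> b * of_real (r * max 0 (y - b)))"
    proof -
      have m1: "(\<lambda>b. complex_of_real (k (y, b))) \<in> borel_measurable borel" unfolding k_def fst_conv snd_conv by measurable
      have "integrable lborel (\<lambda>b. of_real (k (y, b)) * mass \<mu> b)"
        by (rule integrable_bounded_mult[OF mass_integrable, where C = T]) (use m1 kb in auto)
      then have "integrable lborel (\<lambda>b. of_real r * (mass \<mu> b * of_real (k (y, b))))"
        by (simp add: mult.commute)
      then show ?thesis unfolding eqv .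
    qed
    have "(LINT b|lborel. mass \<mu> b * of_real (tri_kernel y b r))
        = (LINT b|lborel. mass \<mu> b * of_real (r * max 0 (y - b) + tri_kernel y b r) - mass \<mu> b * of_real (r * max 0 (y - b)))"
      by (simp add: algebra_simps)
    also have "\<dots> = (LINT b|lborel. mass \<mu> b * of_real (r * max 0 (y - b) + tri_kernel y b r)) - (LINT b|lborel. mass \<mu> b * of_real (r * max 0 (y - b)))"
      by (rule Bochner_Integration.integral_diff[OF i1 i2])
    also have "(LINT b|lborel. mass \<mu> b * of_real (r * max 0 (y - b))) = of_real r * volt \<mu> (phi \<mu>) y"
      unfolding volt_k[OF yT] eqv[symmetric] by (rule integral_mult_right_zero)
    finally show ?thesis by simp
  qed
  also have "of_real (r * y) + (of_real r * volt \<mu> (phi \<mu>) y + (LINT b|lborel. mass \<mu> b * of_real (tri_kernel y b r)))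
      = of_real r * phi \<mu> y + (LINT b|lborel. mass \<mu> b * of_real (tri_kernel y b r))"
  proof -
    have "y \<in> {0..T}" using y r yr by auto
    then show ?thesis by (simp add: phi_eq algebra_simps)
  qed
  finally show ?thesis by (simp add: f_def)
qed

text \<open>The kernel of twofold integration in time from 0 to \<open>t\<close>.\<close>

definition gt :: "real \<Rightarrow> real \<Rightarrow> complex" where
  "gt t s = of_real (indicator {0..t} s * (t - s))"

lemma gt_measurable [measurable]: "gt t \<in> borel_measurable borel"
  unfolding gt_def by measurable

lemma gt_bound: "t \<in> {0..T} \<Longrightarrow> cmod (gt t s) \<le> T"
  unfolding gt_def by (simp only: norm_of_real) (auto simp: indicator_def)

lemma gt_integrable: "t \<in> {0..T} \<Longrightarrow> integrable lborel (gt t)"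
proof -
  assume t: "t \<in> {0..T}"
  have "integrable lborel (\<lambda>s. gt t s * of_real (indicator {0..T} s))"
    by (rule integrable_bounded_mult[OF indicator_integrable _ gt_bound[OF t]]) simp
  moreover have "gt t s * of_real (indicator {0..T} s) = gt t s" for s using t by (auto simp: gt_def indicator_def)
  ultimately show ?thesis by simp
qed

lemma free_slice: "t \<in> {0..T} \<Longrightarrow> free f (x, t) = of_real (indicator {0..t} x) * ctl f (t - x)"
  by (auto simp: free_def Dm_def indicator_def)

lemma free_slice_integrable:
  assumes f: "integrable (lebI T) f" and t: "t \<in> {0..T}"
  shows "integrable lborel (\<lambda>x. free f (x, t))"
  unfolding free_slice[OF t]
proof (rule integrable_bounded_mult)
  show "integrable lborel (\<lambda>x. ctl f (t - x))"
    using lborel_integrable_real_affine[OF ctl_integrable[OF f], of "-1" t] by simp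
  show "cmod (of_real (indicator {0..t} x)) \<le> 1" for x by (simp add: indicator_def)
qed simp

text \<open>The free wave at (y,s) depends on s - y alone, so x = t + y - s turns the time integral
  at y into a space integral at time t, with t - s becoming x - y.\<close>

lemma free_duhamel:
  assumes f: "integrable (lebI T) f" and t: "t \<in> {0..T}"
    and n: "integrable lborel n" and n0: "\<And>b. b \<notin> {0..T} \<Longrightarrow> n b = 0"
  shows "(LINT z|lborel. gt t (snd z) * (n (fst z) * free f z))
    = (LINT x|lborel. free f (x, t) * (LINT b|lborel. n b * of_real (max 0 (x - b))))"
proof -
  define k where "k = (\<lambda>z::real \<times> real. indicator {0..T} (fst z) * (indicator {0..T} (snd z) * max 0 (fst z - snd z)))"
  have km: "k \<in> borel_measurable (borel \<Otimes>\<^sub>M borel)" unfolding k_def by measurable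
  have kb: "\<bar>k z\<bar> \<le> T" for z using T_pos by (auto simp: k_def indicator_def)
  have i: "integrable (lborel \<Otimes>\<^sub>M lborel) (\<lambda>z. gt t (snd z) * (n (fst z) * free f z))"
    unfolding lborel_prod
  proof (rule integrable_bounded_mult)
    show "integrable lborel (\<lambda>z. n (fst z) * free f z)"
      by (rule V_plane_integrable(1)[OF f _ _ n, of "\<lambda>_. 0"]) (auto simp: P_nonneg wt_def cum_nonneg)
    show "(\<lambda>z::real \<times> real. gt t (snd z)) \<in> borel_measurable lborel" unfolding lborel_prod[symmetric] by measurable
  qed (rule gt_bound[OF t])
  have "(LINT z|lborel. gt t (snd z) * (n (fst z) * free f z)) = (LINT y|lborel. LINT s|lborel. gt t s * (n y * free f (y, s)))"
    using lborel_pair.integral_fst'[OF i] by (simp add: lborel_prod)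
  also have "\<dots> = (LINT b|lborel. n b * (LINT x|lborel. free f (x, t) * of_real (k (x, b))))"
  proof (intro Bochner_Integration.integral_cong refl)
    fix y
    show "(LINT s|lborel. gt t s * (n y * free f (y, s))) = n y * (LINT x|lborel. free f (x, t) * of_real (k (x, y)))"
    proof (cases "y \<in> {0..T}")
      case True
      have "(LINT s|lborel. gt t s * (n y * free f (y, s))) = n y * (LINT s|lborel. gt t s * free f (y, s))"
        by (simp add: mult_ac flip: integral_mult_right_zero)
      also have "(LINT s|lborel. gt t s * free f (y, s)) = (LINT x|lborel. gt t (t + y + (-1) * x) * free f (y, t + y + (-1) * x))"
        using lborel_integral_real_affine[of "-1" "\<lambda>s. gt t s * free f (y, s)" "t + y"] by simp
      also have "\<dots> = (LINT x|lborel. free f (x, t) * of_real (k (x, y)))"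
      proof (intro Bochner_Integration.integral_cong refl)
        fix x
        show "gt t (t + y + (-1) * x) * free f (y, t + y + (-1) * x) = free f (x, t) * of_real (k (x, y))"
        proof (cases "y \<le> x \<and> x \<le> t")
          case True': True
          then show ?thesis using True t by (simp add: free_def Dm_def gt_def k_def mult.commute)
        next
          case False
          then show ?thesis using True t by (auto simp: free_def Dm_def gt_def k_def indicator_def)
        qed
      qed
      finally show ?thesis .
    qed (simp add: n0)
  qed
  also have "\<dots> = (LINT x|lborel. free f (x, t) * (LINT b|lborel. n b * of_real (k (x, b))))"
    by (rule fubini_bounded(1)[OF free_slice_integrable[OF f t] n km kb, symmetric])
  also have "\<dots> = (LINT x|lborel. free f (x, t) * (LINT b|lborel. n b * of_real (max 0 (x - b))))"
  proof (intro Bochner_Integration.integral_cong refl)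
    fix x
    show "free f (x, t) * (LINT b|lborel. n b * of_real (k (x, b))) = free f (x, t) * (LINT b|lborel. n b * of_real (max 0 (x - b)))"
    proof (cases "x \<in> {0..t}")
      case True
      have "n b * of_real (k (x, b)) = n b * of_real (max 0 (x - b))" for b
        using True t by (cases "b \<in> {0..T}") (simp_all add: k_def n0)
      then show ?thesis by (simp only:)
    qed (simp add: free_slice[OF t])
  qed
  finally show ?thesis .
qed

lemma slice_integral_gt:
  fixes n :: "real \<Rightarrow> complex" and U :: "real \<times> real \<Rightarrow> complex"
  assumes n: "integrable lborel (\<lambda>z. n (fst z) * U z)" and t: "t \<in> {0..T}"
  shows "(LINT z|lborel. gt t (snd z) * (n (fst z) * U z)) = (LINT s|lborel. gt t s * (LINT y|lborel. U (y, s) * n y))"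
    and "integrable lborel (\<lambda>s. gt t s * (LINT y|lborel. U (y, s) * n y))"
proof -
  have i: "integrable (lborel \<Otimes>\<^sub>M lborel) (\<lambda>z. gt t (snd z) * (n (fst z) * U z))"
    unfolding lborel_prod
  proof (rule integrable_bounded_mult[OF n])
    show "(\<lambda>z::real \<times> real. gt t (snd z)) \<in> borel_measurable lborel" unfolding lborel_prod[symmetric] by measurable
  qed (rule gt_bound[OF t])
  then have i': "integrable (lborel \<Otimes>\<^sub>M lborel) (\<lambda>(y, s). gt t s * (n y * U (y, s)))"
    by (simp add: case_prod_unfold)
  have e: "(LINT y|lborel. gt t s * (n y * U (y, s))) = gt t s * (LINT y|lborel. U (y, s) * n y)" for s
    by (simp add: mult_ac flip: integral_mult_right_zero)
  show "(LINT z|lborel. gt t (snd z) * (n (fst z) * U z)) = (LINT s|lborel. gt t s * (LINT y|lborel. U (y, s) * n y))"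
    using lborel_pair.integral_snd[OF i'] unfolding e by (simp add: lborel_prod case_prod_unfold)
  show "integrable lborel (\<lambda>s. gt t s * (LINT y|lborel. U (y, s) * n y))"
    using lborel_pair.integrable_snd[OF i'] unfolding e .
qed

text \<open>Time reversal r -> t - r; \<open>tri_sym\<close> exchanges source and observation
  point.\<close>

lemma tri_kernel_shift:
  assumes s: "0 \<le> s" "s \<le> t"
  shows "(LINT r|lborel. gt t r * of_real (of_bool (0 \<le> s \<and> s \<le> r \<and> r \<le> t \<and> tri b y (r - s)) / 2)) = of_real (tri_kernel y b (t - s))"
proof -
  have "(LINT r|lborel. gt t r * of_real (of_bool (0 \<le> s \<and> s \<le> r \<and> r \<le> t \<and> tri b y (r - s)) / 2))
     = (LINT r|lborel. complex_of_real (indicator {0..t} r * (t - r) * of_bool (0 \<le> s \<and> s \<le> r \<and> r \<le> t \<and> tri b y (r - s)) / 2))"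
    by (intro Bochner_Integration.integral_cong refl) (simp add: gt_def)
  also have "\<dots> = of_real (LINT r|lborel. indicator {0..t} r * (t - r) * of_bool (0 \<le> s \<and> s \<le> r \<and> r \<le> t \<and> tri b y (r - s)) / 2)"
    by (rule integral_complex_of_real)
  also have "(LINT r|lborel. indicator {0..t} r * (t - r) * of_bool (0 \<le> s \<and> s \<le> r \<and> r \<le> t \<and> tri b y (r - s)) / 2)
     = (LINT r|lborel. indicator {0..t} (t + (-1) * r) * (t - (t + (-1) * r)) * of_bool (0 \<le> s \<and> s \<le> t + (-1) * r \<and> t + (-1) * r \<le> t \<and> tri b y (t + (-1) * r - s)) / 2)"
    using lborel_integral_real_affine[of "-1" "\<lambda>r. indicator {0..t} r * (t - r) * of_bool (0 \<le> s \<and> s \<le> r \<and> r \<le> t \<and> tri b y (r - s)) / 2" t] by simp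
  also have "\<dots> = tri_kernel y b (t - s)"
    unfolding tri_kernel_def
  proof (intro Bochner_Integration.integral_cong refl)
    fix r
    have eq: "t + (-1) * r - s = t - s - r" by simp
    show "indicator {0..t} (t + (-1) * r) * (t - (t + (-1) * r)) * of_bool (0 \<le> s \<and> s \<le> t + (-1) * r \<and> t + (-1) * r \<le> t \<and> tri b y (t + (-1) * r - s)) / 2
        = indicator {0..t - s} r * of_bool (tri y b (t - s - r)) * r / 2"
      unfolding eq tri_sym[of b y] using s by (auto simp: indicator_def)
  qed
  finally show ?thesis .
qed

definition moment :: "(real \<times> real \<Rightarrow> complex) \<Rightarrow> complex \<Rightarrow> real \<Rightarrow> complex" where
  "moment V \<mu> t = (LINT x|lborel. V (x, t) * phi \<mu> x)"

text \<open>Testing the mild equation against \<open>phi\<close>: the function \<open>a(t) = \<integral> u(x,t) phi(x) dx\<close> satisfies the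
  integrated form of \<open>a'' + \<mu> a = f\<close>, \<open>a(0) = a'(0) = 0\<close>.\<close>

lemma moment_volterra:
  assumes f: "integrable (lebI T) f" and v: "v \<in> borel_measurable borel" and vb: "\<And>z. cmod (v z) \<le> P * wt f z"
    and veq: "\<And>x t. (x, t) \<in> Dm \<Longrightarrow> v (x, t) = - (1/2 * region_integral p (\<lambda>z. free f z + v z) x t)"
    and t: "t \<in> {0..T}"
  defines "V \<equiv> \<lambda>z. free f z + v z"
  shows "moment V \<mu> t = (LINT x|lborel. free f (x, t) * of_real x) - \<mu> * (LINT s|lborel. gt t s * moment V \<mu> s)"
    and "integrable lborel (\<lambda>s. gt t s * moment V \<mu> s)"
proof -
  have ni: "integrable lborel (\<lambda>z. n (fst z) * V z)" if "integrable lborel n" for n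
    unfolding V_def distrib_left using V_plane_integrable[OF f v vb that] by auto
  have nfi: "integrable lborel (\<lambda>z. n (fst z) * free f z)" if "integrable lborel n" for n
    using V_plane_integrable[OF f v vb that] by auto
  have gi: "integrable lborel (\<lambda>z::real \<times> real. gt t (snd z) * F z)" if "integrable lborel F" for F
  proof (rule integrable_bounded_mult[OF that])
    show "(\<lambda>z::real \<times> real. gt t (snd z)) \<in> borel_measurable lborel" unfolding lborel_prod[symmetric] by measurable
  qed (rule gt_bound[OF t])
  have Vsupp: "0 \<le> fst z \<and> fst z \<le> snd z \<and> snd z \<le> T" if "V z \<noteq> 0" for z
  proof (rule ccontr)
    assume a: "\<not> ?thesis"
    then have "free f z = 0" by (auto simp: free_def Dm_def)
    moreover have "wt f z = 0" using a by (auto simp: wt_def Dm_def indicator_def intro: cum_neg)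
    then have "v z = 0" using vb[of z] by simp
    ultimately show False using that by (simp add: V_def)
  qed
  have pi: "integrable lborel (\<lambda>b. complex_of_real (p b))" using p_integrable by auto
  have phi_i: "integrable lborel (phi \<mu>)"
  proof -
    obtain c where "\<And>x. cmod (phi \<mu> x) \<le> c * indicator {0..T} x" using phi_bounded[of \<mu>] by metis
    then have c: "cmod (phi \<mu> x) \<le> \<bar>c\<bar>" for x by (cases "x \<in> {0..T}") (metis abs_ge_self indicator_simps(1) mult.right_neutral order_trans, simp add: phi_outside)
    have "integrable lborel (\<lambda>x. phi \<mu> x * of_real (indicator {0..T} x))"
      by (rule integrable_bounded_mult[OF indicator_integrable _ c]) simp
    moreover have "phi \<mu> x * of_real (indicator {0..T} x) = phi \<mu> x" for x by (cases "x \<in> {0..T}") (simp_all add: phi_outside)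
    ultimately show ?thesis by simp
  qed
  obtain c where c: "\<And>x. cmod (phi \<mu> x) \<le> c"
  proof -
    obtain c where "c \<ge> 0" "\<And>x. cmod (phi \<mu> x) \<le> c * indicator {0..T} x" using phi_bounded[of \<mu>] by metis
    then have "cmod (phi \<mu> x) \<le> c" for x by (cases "x \<in> {0..T}") (metis indicator_simps(1) mult.right_neutral, simp add: phi_outside)
    then show ?thesis using that by blast
  qed
  define pV where "pV z = of_real (p (fst z)) * V z" for z
  have pVi: "integrable lborel pV" unfolding pV_def by (rule ni[OF pi])
  \<comment> \<open>The half-line Green kernel at time t for a source z = (y,s); \<open>k2\<close>
    is the same at an intermediate point w = (b,r) with r <= t.\<close>
  define k1 where "k1 = (\<lambda>w::real \<times> real \<times> real. of_bool (0 \<le> snd (snd w) \<and> snd (snd w) \<le> t \<and> tri (fst w) (fst (snd w)) (t - snd (snd w))) / 2 :: real)"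
  have k1m: "k1 \<in> borel_measurable (borel \<Otimes>\<^sub>M borel)" unfolding k1_def tri_def borel_prod[symmetric] by measurable
  have k1b: "\<bar>k1 w\<bar> \<le> 1" for w by (simp add: k1_def)
  define k2 where "k2 = (\<lambda>w::(real \<times> real) \<times> real \<times> real. of_bool (0 \<le> snd (snd w) \<and> snd (snd w) \<le> snd (fst w) \<and> snd (fst w) \<le> t \<and> tri (fst (fst w)) (fst (snd w)) (snd (fst w) - snd (snd w))) / 2 :: real)"
  have k2m: "k2 \<in> borel_measurable (borel \<Otimes>\<^sub>M borel)" unfolding k2_def tri_def borel_prod[symmetric] by measurable
  have k2b: "\<bar>k2 w\<bar> \<le> 1" for w by (simp add: k2_def)
  define G where "G w = mass \<mu> (fst w) * gt t (snd w)" for w :: "real \<times> real"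
  have Gi: "integrable lborel G"
    unfolding G_def using integrable_times[OF mass_integrable gt_integrable[OF t]] by (simp add: lborel_prod)
  have reg: "of_real (1/2) * region_integral p V x r = (LINT z|lborel. pV z * of_real (of_bool (0 \<le> snd z \<and> snd z \<le> r \<and> tri x (fst z) (r - snd z)) / 2))" for x r
    unfolding region_integral_def set_lebesgue_integral_def integral_mult_right_zero[symmetric]
  proof (intro Bochner_Integration.integral_cong refl)
    fix z
    show "of_real (1/2) * (indicator (characteristic_region x r) z *\<^sub>R (complex_of_real (p (fst z)) * V z))
        = pV z * of_real (of_bool (0 \<le> snd z \<and> snd z \<le> r \<and> tri x (fst z) (r - snd z)) / 2)"
      using region_tri[of "fst z" "snd z" x r] by (cases "z \<in> characteristic_region x r") (auto simp: pV_def)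
  qed
  have Veq: "V (x, r) = free f (x, r) - of_real (1/2) * region_integral p V x r" if "(x, r) \<in> Dm" for x r
    using veq[OF that] by (simp add: V_def)
  define X where "X = (LINT x|lborel. phi \<mu> x * (LINT z|lborel. pV z * of_real (k1 (x, z))))"
  have a1: "moment V \<mu> t = (LINT x|lborel. free f (x, t) * phi \<mu> x) - X"
  proof -
    have "moment V \<mu> t = (LINT x|lborel. phi \<mu> x * free f (x, t) - phi \<mu> x * (LINT z|lborel. pV z * of_real (k1 (x, z))))"
      unfolding moment_def
    proof (intro Bochner_Integration.integral_cong refl)
      fix x
      show "V (x, t) * phi \<mu> x = phi \<mu> x * free f (x, t) - phi \<mu> x * (LINT z|lborel. pV z * of_real (k1 (x, z)))"
      proof (cases "x \<in> {0..T}")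
        case True
        then have D: "(x, t) \<in> Dm" using t by (simp add: Dm_def)
        show ?thesis unfolding Veq[OF D] reg by (simp add: k1_def algebra_simps)
      qed (simp add: phi_outside)
    qed
    also have "\<dots> = (LINT x|lborel. phi \<mu> x * free f (x, t)) - X"
      unfolding X_def
    proof (rule Bochner_Integration.integral_diff)
      show "integrable lborel (\<lambda>x. phi \<mu> x * free f (x, t))"
        by (rule integrable_bounded_mult[OF free_slice_integrable[OF f t] _ c]) simp
      show "integrable lborel (\<lambda>x. phi \<mu> x * (LINT z|lborel. pV z * of_real (k1 (x, z))))"
        using fubini_bounded(3)[OF pVi phi_i, of "\<lambda>w. k1 (snd w, fst w)" 1] k1m k1b by simp
    qed
    finally show ?thesis by (simp add: mult.commute)
  qed
  define Y where "Y = (LINT z|lborel. pV z * (LINT w|lborel. G w * of_real (k2 (w, z))))"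
  have Yint: "integrable lborel (\<lambda>z. pV z * (LINT w|lborel. G w * of_real (k2 (w, z))))"
    by (rule fubini_bounded(3)[OF Gi pVi k2m k2b])
  \<comment> \<open>The heart of the proof: \<open>phi_triangle_average\<close> at each source
    (y,s). It applies where \<open>V\<close> is not 0, since there y <= s and so y + (t - s) <= t <=
    T.\<close>
  have inner: "pV z * (LINT x|lborel. phi \<mu> x * of_real (k1 (x, z)))
      = gt t (snd z) * (phi \<mu> (fst z) * pV z) + pV z * (LINT w|lborel. G w * of_real (k2 (w, z)))" for z
  proof (cases "V z \<noteq> 0 \<and> snd z \<le> t")
    case True
    define y where "y = fst z"
    define s where "s = snd z"
    have ys: "0 \<le> y" "y \<le> s" "s \<le> t" "0 \<le> s" using Vsupp[of z] True by (auto simp: y_def s_def)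
    have "(LINT x|lborel. phi \<mu> x * of_real (k1 (x, z))) = (LINT x|lborel. phi \<mu> x * of_real (of_bool (tri x y (t - s)) / 2))"
      using ys by (simp add: k1_def y_def s_def)
    also have "\<dots> = of_real (t - s) * phi \<mu> y + (LINT b|lborel. mass \<mu> b * of_real (tri_kernel y b (t - s)))"
      by (rule phi_triangle_average) (use ys t in auto)
    also have "of_real (t - s) = gt t s" using ys by (simp add: gt_def)
    also have "(LINT b|lborel. mass \<mu> b * of_real (tri_kernel y b (t - s))) = (LINT w|lborel. G w * of_real (k2 (w, z)))"
    proof -
      define k where "k = (\<lambda>w. k2 (w, z))"
      have km: "k \<in> borel_measurable (borel \<Otimes>\<^sub>M borel)"
        unfolding k_def k2_def tri_def fst_conv snd_conv by measurable
      have "(LINT b|lborel. mass \<mu> b * of_real (tri_kernel y b (t - s))) = (LINT b|lborel. mass \<mu> b * (LINT r|lborel. gt t r * of_real (k (b, r))))"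
        unfolding k_def k2_def fst_conv snd_conv y_def[symmetric] s_def[symmetric]
        by (simp only: tri_kernel_shift[OF ys(4,3)])
      also have "\<dots> = (LINT w|lborel. of_real (k w) * (mass \<mu> (fst w) * gt t (snd w)))"
        by (rule fubini_bounded(2)[OF mass_integrable gt_integrable[OF t] km, of 1]) (simp add: k_def k2b)
      finally show ?thesis by (simp add: G_def k_def mult.commute)
    qed
    finally show ?thesis by (simp add: y_def s_def algebra_simps)
  next
    case False
    then show ?thesis
    proof (cases "V z = 0")
      case False': False
      then have "snd z > t" using False by simp
      then have "gt t (snd z) = 0" "k1 (x, z) = 0" "k2 (w, z) = 0" for x w by (auto simp: gt_def k1_def k2_def indicator_def)
      then show ?thesis by simp
    qed (simp add: pV_def)
  qed
  have phipV: "integrable lborel (\<lambda>z. phi \<mu> (fst z) * pV z)"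
  proof (rule integrable_bounded_mult[OF pVi])
    show "(\<lambda>z::real \<times> real. phi \<mu> (fst z)) \<in> borel_measurable lborel" unfolding lborel_prod[symmetric] by measurable
  qed (rule c)
  have "X = (LINT z|lborel. pV z * (LINT x|lborel. phi \<mu> x * of_real (k1 (x, z))))"
    unfolding X_def by (rule fubini_bounded(1)[OF phi_i pVi k1m k1b])
  also have "\<dots> = (LINT z|lborel. gt t (snd z) * (phi \<mu> (fst z) * pV z)) + Y"
    unfolding inner Y_def by (rule Bochner_Integration.integral_add[OF gi[OF phipV] Yint])
  finally have Xeq: "X = (LINT z|lborel. gt t (snd z) * (phi \<mu> (fst z) * pV z)) + Y" .
  have mV: "integrable lborel (\<lambda>z. gt t (snd z) * (mass \<mu> (fst z) * V z))" by (rule gi[OF ni[OF mass_integrable]])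
  have mF: "integrable lborel (\<lambda>z. gt t (snd z) * (mass \<mu> (fst z) * free f z))" by (rule gi[OF nfi[OF mass_integrable]])
  \<comment> \<open>After the exchange the inner integral is again a Duhamel term, so the mild
    equation is used a second time, at the points \<open>w\<close>.\<close>
  have "Y = (LINT w|lborel. G w * (LINT z|lborel. pV z * of_real (k2 (w, z))))"
    unfolding Y_def by (rule fubini_bounded(1)[OF Gi pVi k2m k2b, symmetric])
  also have "\<dots> = (LINT w|lborel. gt t (snd w) * (mass \<mu> (fst w) * free f w) - gt t (snd w) * (mass \<mu> (fst w) * V w))"
  proof (intro Bochner_Integration.integral_cong refl)
    fix w :: "real \<times> real"
    show "G w * (LINT z|lborel. pV z * of_real (k2 (w, z))) = gt t (snd w) * (mass \<mu> (fst w) * free f w) - gt t (snd w) * (mass \<mu> (fst w) * V w)"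
    proof (cases "fst w \<in> {0..T} \<and> snd w \<in> {0..t}")
      case True
      then have D: "(fst w, snd w) \<in> Dm" using t by (auto simp: Dm_def)
      have "(LINT z|lborel. pV z * of_real (k2 (w, z))) = of_real (1/2) * region_integral p V (fst w) (snd w)"
        unfolding reg using True by (simp add: k2_def)
      also have "\<dots> = free f w - V w" using Veq[OF D] by simp
      finally have I: "(LINT z|lborel. pV z * of_real (k2 (w, z))) = free f w - V w" .
      show ?thesis unfolding I G_def by (simp add: algebra_simps)
    next
      case False
      then show ?thesis by (auto simp: G_def mass_outside gt_def)
    qed
  qed
  also have "\<dots> = (LINT w|lborel. gt t (snd w) * (mass \<mu> (fst w) * free f w)) - (LINT w|lborel. gt t (snd w) * (mass \<mu> (fst w) * V w))"
    by (rule Bochner_Integration.integral_diff[OF mF mV])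
  finally have Yeq: "Y = (LINT w|lborel. gt t (snd w) * (mass \<mu> (fst w) * free f w)) - (LINT w|lborel. gt t (snd w) * (mass \<mu> (fst w) * V w))" .
  \<comment> \<open>On [0,T] the potential cancels: p phi minus \<open>mass \<mu>\<close> is \<mu>
    phi.\<close>
  have "(LINT z|lborel. gt t (snd z) * (phi \<mu> (fst z) * pV z)) - (LINT w|lborel. gt t (snd w) * (mass \<mu> (fst w) * V w))
      = (LINT z|lborel. gt t (snd z) * (phi \<mu> (fst z) * pV z) - gt t (snd z) * (mass \<mu> (fst z) * V z))"
    by (rule Bochner_Integration.integral_diff[OF gi[OF phipV] mV, symmetric])
  also have "\<dots> = (LINT z|lborel. \<mu> * (gt t (snd z) * (phi \<mu> (fst z) * V z)))"
  proof (intro Bochner_Integration.integral_cong refl)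
    fix z :: "real \<times> real"
    show "gt t (snd z) * (phi \<mu> (fst z) * pV z) - gt t (snd z) * (mass \<mu> (fst z) * V z) = \<mu> * (gt t (snd z) * (phi \<mu> (fst z) * V z))"
      by (cases "fst z \<in> {0..T}") (simp_all add: pV_def mass_def pot_def phi_outside algebra_simps)
  qed
  also have "\<dots> = \<mu> * (LINT s|lborel. gt t s * moment V \<mu> s)"
    unfolding integral_mult_right_zero moment_def slice_integral_gt(1)[OF ni[OF phi_i] t] ..
  finally have main: "(LINT z|lborel. gt t (snd z) * (phi \<mu> (fst z) * pV z)) - (LINT w|lborel. gt t (snd w) * (mass \<mu> (fst w) * V w))
      = \<mu> * (LINT s|lborel. gt t s * moment V \<mu> s)" .
  show "integrable lborel (\<lambda>s. gt t s * moment V \<mu> s)"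
    unfolding moment_def by (rule slice_integral_gt(2)[OF ni[OF phi_i] t])
  \<comment> \<open>The free part of \<open>Y\<close> meets the moment of the free wave against phi:
    as phi(x) - x is the Volterra integral of \<open>mass\<close>, only the moment against x
    survives.\<close>
  have "(LINT w|lborel. gt t (snd w) * (mass \<mu> (fst w) * free f w)) = (LINT x|lborel. free f (x, t) * (LINT b|lborel. mass \<mu> b * of_real (max 0 (x - b))))"
    by (rule free_duhamel[OF f t mass_integrable mass_outside])
  also have "\<dots> = (LINT x|lborel. free f (x, t) * phi \<mu> x - free f (x, t) * of_real x)"
  proof (intro Bochner_Integration.integral_cong refl)
    fix x
    show "free f (x, t) * (LINT b|lborel. mass \<mu> b * of_real (max 0 (x - b))) = free f (x, t) * phi \<mu> x - free f (x, t) * of_real x"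
    proof (cases "x \<in> {0..t}")
      case True
      then have xT: "x \<in> {0..T}" using t by auto
      have "(LINT b|lborel. mass \<mu> b * of_real (max 0 (x - b))) = volt \<mu> (phi \<mu>) x"
        unfolding volt_def
      proof (intro Bochner_Integration.integral_cong refl)
        fix b
        show "mass \<mu> b * of_real (max 0 (x - b)) = pot \<mu> b * phi \<mu> b * of_real (indicator {0..x} b * (x - b))"
          using xT by (cases "b \<in> {0..T}") (auto simp: mass_def phi_outside indicator_def max_def)
      qed
      then show ?thesis using phi_eq[OF xT, of \<mu>] by (simp add: algebra_simps)
    qed (simp add: free_slice[OF t])
  qed
  also have "\<dots> = (LINT x|lborel. free f (x, t) * phi \<mu> x) - (LINT x|lborel. free f (x, t) * of_real x)"
  proof (rule Bochner_Integration.integral_diff)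
    have "integrable lborel (\<lambda>x. phi \<mu> x * free f (x, t))"
      by (rule integrable_bounded_mult[OF free_slice_integrable[OF f t] _ c]) simp
    then show "integrable lborel (\<lambda>x. free f (x, t) * phi \<mu> x)" by (simp add: mult.commute)
    have "integrable lborel (\<lambda>x. of_real (indicator {0..T} x * x) * free f (x, t))"
    proof (rule integrable_bounded_mult[OF free_slice_integrable[OF f t]])
      show "cmod (of_real (indicator {0..T} x * x)) \<le> T" for x
        using T_pos by (simp only: norm_of_real) (auto simp: indicator_def)
    qed simp
    moreover have "of_real (indicator {0..T} x * x) * free f (x, t) = free f (x, t) * of_real x" for x
      using t by (cases "x \<in> {0..T}") (auto simp: free_slice)
    ultimately show "integrable lborel (\<lambda>x. free f (x, t) * of_real x)" by (simp only:)
  qed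
  finally have F': "(LINT w|lborel. gt t (snd w) * (mass \<mu> (fst w) * free f w))
      = (LINT x|lborel. free f (x, t) * phi \<mu> x) - (LINT x|lborel. free f (x, t) * of_real x)" .
  show "moment V \<mu> t = (LINT x|lborel. free f (x, t) * of_real x) - \<mu> * (LINT s|lborel. gt t s * moment V \<mu> s)"
    unfolding a1 Xeq Yeq F' using main by (simp add: algebra_simps)
qed

text \<open>The Volterra equation of \<open>moment_volterra\<close> again, now for the free wave
  tested against the sine kernel; it comes from \<open>free_duhamel\<close> and the equation of the
  kernel itself.\<close>

lemma free_sin_volterra:
  fixes \<mu> :: complex
  assumes f: "integrable (lebI T) f" and t: "t \<in> {0..T}"
  defines "b \<equiv> \<lambda>t. LINT x|lborel. free f (x, t) * sin_kernel \<mu> x"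
  shows "b t = (LINT x|lborel. free f (x, t) * of_real x) - \<mu> * (LINT s|lborel. gt t s * b s)"
    and "integrable lborel (\<lambda>s. gt t s * b s)"
proof -
  define n where "n x = of_real (indicator {0..T} x) * sin_kernel \<mu> x" for x
  obtain B where B: "B \<ge> 0" "\<And>s. s \<in> {0..T} \<Longrightarrow> cmod (sin_kernel \<mu> s) \<le> B" using sin_kernel_bounded[OF T_pos, of \<mu>] by metis
  have nb: "cmod (n x) \<le> B" for x using B by (cases "x \<in> {0..T}") (auto simp: n_def)
  have nm: "n \<in> borel_measurable borel" unfolding n_def by measurable
  have n0: "x \<notin> {0..T} \<Longrightarrow> n x = 0" for x by (simp add: n_def)
  have ni: "integrable lborel n"
  proof -
    have "integrable lborel (\<lambda>x. n x * of_real (indicator {0..T} x))"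
      by (rule integrable_bounded_mult[OF indicator_integrable _ nb]) (use nm in simp)
    moreover have "n x * of_real (indicator {0..T} x) = n x" for x by (cases "x \<in> {0..T}") (simp_all add: n0)
    ultimately show ?thesis by simp
  qed
  have bn: "b s = (LINT y|lborel. free f (y, s) * n y)" for s
    unfolding b_def by (intro Bochner_Integration.integral_cong refl) (auto simp: free_def Dm_def n_def indicator_def)
  have pl: "integrable lborel (\<lambda>z. n (fst z) * free f z)"
    by (rule V_plane_integrable(1)[OF f _ _ ni, of "\<lambda>_. 0"]) (auto simp: P_nonneg wt_def cum_nonneg)
  show "integrable lborel (\<lambda>s. gt t s * b s)"
    unfolding bn by (rule slice_integral_gt(2)[OF pl t])
  have "(LINT s|lborel. gt t s * b s) = (LINT x|lborel. free f (x, t) * (LINT b|lborel. n b * of_real (max 0 (x - b))))"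
    unfolding bn slice_integral_gt(1)[OF pl t, symmetric] by (rule free_duhamel[OF f t ni n0])
  then have "\<mu> * (LINT s|lborel. gt t s * b s) = (LINT x|lborel. \<mu> * (free f (x, t) * (LINT b|lborel. n b * of_real (max 0 (x - b)))))"
    by (simp only: integral_mult_right_zero)
  also have "\<dots> = (LINT x|lborel. free f (x, t) * of_real x - free f (x, t) * sin_kernel \<mu> x)"
  proof (intro Bochner_Integration.integral_cong refl)
    fix x
    show "\<mu> * (free f (x, t) * (LINT b|lborel. n b * of_real (max 0 (x - b)))) = free f (x, t) * of_real x - free f (x, t) * sin_kernel \<mu> x"
    proof (cases "x \<in> {0..t}")
      case True
      define I where "I = (LINT b|lborel. indicator {0..x} b *\<^sub>R (of_real (x - b) * sin_kernel \<mu> b))"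
      have S: "sin_kernel \<mu> x = of_real x - \<mu> * I"
        unfolding I_def using True by (intro sin_kernel_volterra) simp
      have nI: "(LINT b|lborel. n b * of_real (max 0 (x - b))) = I"
        unfolding I_def
        using True t by (intro Bochner_Integration.integral_cong refl) (auto simp: n_def indicator_def max_def)
      show ?thesis unfolding nI S by (simp add: algebra_simps)
    qed (simp add: free_slice[OF t])
  qed
  also have "\<dots> = (LINT x|lborel. free f (x, t) * of_real x) - b t"
    unfolding b_def
  proof (rule Bochner_Integration.integral_diff)
    have "integrable lborel (\<lambda>x. n x * free f (x, t))"
      by (rule integrable_bounded_mult[OF free_slice_integrable[OF f t] _ nb]) (use nm in simp)
    moreover have "n x * free f (x, t) = free f (x, t) * sin_kernel \<mu> x" for x
      using t by (auto simp: free_def Dm_def n_def indicator_def)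
    ultimately show "integrable lborel (\<lambda>x. free f (x, t) * sin_kernel \<mu> x)" by simp
    have "integrable lborel (\<lambda>x. of_real (indicator {0..T} x * x) * free f (x, t))"
    proof (rule integrable_bounded_mult[OF free_slice_integrable[OF f t]])
      show "cmod (of_real (indicator {0..T} x * x)) \<le> T" for x
        using T_pos by (simp only: norm_of_real) (auto simp: indicator_def)
    qed simp
    moreover have "of_real (indicator {0..T} x * x) * free f (x, t) = free f (x, t) * of_real x" for x
      using t by (cases "x \<in> {0..T}") (auto simp: free_slice)
    ultimately show "integrable lborel (\<lambda>x. free f (x, t) * of_real x)" by (simp only:)
  qed
  finally show "b t = (LINT x|lborel. free f (x, t) * of_real x) - \<mu> * (LINT s|lborel. gt t s * b s)" by simp
qed

text \<open>The integrated form of d'' + \<mu> d = 0 with zero initial data: the bound of a bounded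
  solution halves in an exponential weight.\<close>

lemma volterra_gt_zero:
  assumes d: "\<And>t. t \<in> {0..T} \<Longrightarrow> d t = - \<mu> * (LINT s|lborel. gt t s * d s)"
    and bd: "\<And>t. t \<in> {0..T} \<Longrightarrow> cmod (d t) \<le> c0" and t: "t \<in> {0..T}"
  shows "d t = 0"
proof -
  \<comment> \<open>\<open>gt\<close> is at most T, so the equation costs a factor |\<mu>| T / a,
    which this rate makes at most 1/2.\<close>
  define a where "a = 2 * cmod \<mu> * T + 1"
  have muT: "cmod \<mu> * T \<ge> 0" using T_pos by simp
  have a0: "a > 0" using muT by (simp add: a_def)
  have "cmod \<mu> * T \<le> 1 / 2 * a" by (simp add: a_def)
  then have a: "a > 0" "cmod \<mu> * T / a \<le> 1 / 2" using a0 by (simp_all add: pos_divide_le_eq)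
  have c0: "c0 \<ge> 0" using bd[OF t] norm_ge_zero order_trans by blast
  show ?thesis
  proof (rule halving_imp_zero[where X = "{0..T}" and w = "\<lambda>t. exp (a * t)" and F = d and ?c0.0 = c0])
    show "cmod (d x) \<le> c0 * exp (a * x)" if "x \<in> {0..T}" for x
      using bd[OF that] mult_left_mono[of 1 "exp (a * x)" c0] c0 a that by simp
    fix c x assume c: "c \<ge> 0" and h: "\<And>y. y \<in> {0..T} \<Longrightarrow> cmod (d y) \<le> c * exp (a * y)" and x: "x \<in> {0..T}"
    have "cmod (LINT s|lborel. gt x s * d s) \<le> (LINT s|lborel. cmod (gt x s * d s))" by (rule integral_norm_bound)
    also have "\<dots> \<le> (LINT s|lborel. T * c * (indicator {0..x} s * exp (a * s)))"
    proof (rule integral_mono')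
      have "set_integrable lborel {0..x} (\<lambda>s. exp (a * s))"
        by (rule borel_integrable_atLeastAtMost') (intro continuous_intros)
      then show "integrable lborel (\<lambda>s. T * c * (indicator {0..x} s * exp (a * s)))"
        by (simp add: set_integrable_def)
      show "cmod (gt x s * d s) \<le> T * c * (indicator {0..x} s * exp (a * s))" for s
      proof (cases "s \<in> {0..x}")
        case True
        have "cmod (gt x s) * cmod (d s) \<le> T * (c * exp (a * s))"
          using gt_bound[OF x, of s] h[of s] True x T_pos by (intro mult_mono) auto
        then show ?thesis using True by (simp add: norm_mult mult.assoc)
      qed (simp add: gt_def)
      show "0 \<le> T * c * (indicator {0..x} s * exp (a * s))" for s using c T_pos by simp
    qed
    also have "\<dots> = T * c * (LINT s|lborel. indicator {0..x} s * exp (a * s))" by simp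
    also have "\<dots> \<le> T * c * (exp (a * x) / a)"
      using integral_exp_le[OF a(1), of x] x c T_pos by (intro mult_left_mono) auto
    finally have I: "cmod (LINT s|lborel. gt x s * d s) \<le> T * c * (exp (a * x) / a)" .
    have "cmod (d x) = cmod \<mu> * cmod (LINT s|lborel. gt x s * d s)"
      by (subst d[OF x]) (simp add: norm_mult)
    also have "\<dots> \<le> cmod \<mu> * (T * c * (exp (a * x) / a))" by (rule mult_left_mono[OF I]) simp
    also have "\<dots> = cmod \<mu> * T / a * (c * exp (a * x))" by simp
    also have "\<dots> \<le> 1 / 2 * (c * exp (a * x))" using a(2) c by (intro mult_right_mono) auto
    finally show "cmod (d x) \<le> c / 2 * exp (a * x)" by simp
  qed (use c0 t in auto)
qed

text \<open>Supplies the a priori bound that \<open>volterra_gt_zero\<close> asks for: the L_1 norm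
  of the free wave on a time slice does not exceed that of the control, uniformly in t.\<close>

lemma slice_moment_bound:
  assumes f: "integrable (lebI T) f" and v: "\<And>z. cmod (v z) \<le> C * indicator Dm z" and C: "C \<ge> 0"
    and g: "\<And>x. x \<in> {0..T} \<Longrightarrow> cmod (g x) \<le> B" and B: "B \<ge> 0" and t: "t \<in> {0..T}"
    and vg: "\<And>x. x \<notin> {0..T} \<Longrightarrow> (free f (x, t) + v (x, t)) * g x = 0"
  shows "cmod (LINT x|lborel. (free f (x, t) + v (x, t)) * g x) \<le> B * ((LINT r|lborel. cmod (ctl f r)) + C * T)"
proof -
  have i1: "integrable lborel (\<lambda>x. cmod (ctl f (t - x)))"
    using lborel_integrable_real_affine[OF ctl_integrable[OF f], of "-1" t] by simp
  have i2: "integrable lborel (\<lambda>x. C * indicator {0..T} x :: real)"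
    by (intro integrable_mult_right integrable_real_indicator) (auto simp: emeasure_lborel_Icc_eq)
  have "cmod (LINT x|lborel. (free f (x, t) + v (x, t)) * g x) \<le> (LINT x|lborel. cmod ((free f (x, t) + v (x, t)) * g x))"
    by (rule integral_norm_bound)
  also have "\<dots> \<le> (LINT x|lborel. B * (cmod (ctl f (t - x)) + C * indicator {0..T} x))"
  proof (rule integral_mono')
    show "integrable lborel (\<lambda>x. B * (cmod (ctl f (t - x)) + C * indicator {0..T} x))" using i1 i2 by simp
    show "cmod ((free f (x, t) + v (x, t)) * g x) \<le> B * (cmod (ctl f (t - x)) + C * indicator {0..T} x)" for x
    proof (cases "x \<in> {0..T}")
      case True
      have "cmod (free f (x, t) + v (x, t)) \<le> cmod (ctl f (t - x)) + C"
        using norm_triangle_mono[OF free_norm_le[of f "(x, t)"] order_trans[OF v[of "(x, t)"], of C]] C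
        by (simp add: indicator_def)
      then have "cmod (free f (x, t) + v (x, t)) * cmod (g x) \<le> (cmod (ctl f (t - x)) + C) * B"
        using g[OF True] C by (intro mult_mono) auto
      then show ?thesis using True by (simp add: norm_mult mult.commute)
    next
      case False
      show ?thesis unfolding vg[OF False] using B C by simp
    qed
    show "0 \<le> B * (cmod (ctl f (t - x)) + C * indicator {0..T} x)" for x using B C by simp
  qed
  also have "\<dots> = B * ((LINT x|lborel. cmod (ctl f (t - x))) + C * T)"
    using i1 i2 T_pos by simp
  also have "(LINT x|lborel. cmod (ctl f (t - x))) = (LINT r|lborel. cmod (ctl f r))"
    using lborel_integral_real_affine[of "-1" "\<lambda>r. cmod (ctl f r)" t] by simp
  finally show ?thesis .
qed

text \<open>As functions of t, the moment of the wave against phi and that of the free wave against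
  the sine kernel satisfy the same Volterra equation, so they agree; at t = T they are the two
  sides, up to the endpoints of the interval.\<close>

lemma fourier_image_eq_moment:
  assumes f: "integrable (lebI T) f"
  shows "fourier_image T f \<mu> = (LINT x|lebI T. phi \<mu> x * W f x)"
proof -
  obtain v where v: "v \<in> borel_measurable borel" "\<And>z. cmod (v z) \<le> P * wt f z"
    "\<And>x t. (x, t) \<in> Dm \<Longrightarrow> v (x, t) = - (1/2 * region_integral p (\<lambda>z. free f z + v z) x t)"
    and sol: "wave_solution q T f (\<lambda>x t. (if x \<le> t then f (t - x) else 0) + v (x, t))"
    using wave_solution_exists[OF f] by blast
  define V where "V z = free f z + v z" for z
  define b where "b t = (LINT x|lborel. free f (x, t) * sin_kernel \<mu> x)" for t
  have TT: "T \<in> {0..T}" using T_pos by simp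
  have mv: "moment V \<mu> t = (LINT x|lborel. free f (x, t) * of_real x) - \<mu> * (LINT s|lborel. gt t s * moment V \<mu> s)"
    "integrable lborel (\<lambda>s. gt t s * moment V \<mu> s)" if "t \<in> {0..T}" for t
    unfolding V_def by (rule moment_volterra[OF f v(1,2) _ that]; erule v(3))+
  have bv: "b t = (LINT x|lborel. free f (x, t) * of_real x) - \<mu> * (LINT s|lborel. gt t s * b s)"
    "integrable lborel (\<lambda>s. gt t s * b s)" if "t \<in> {0..T}" for t
    unfolding b_def by (rule free_sin_volterra[OF f that])+
  define C where "C = P * (cum f T * exp (l * T))"
  have C: "C \<ge> 0" using P_nonneg cum_nonneg by (simp add: C_def)
  have vC: "cmod (v z) \<le> C * indicator Dm z" for z
  proof -
    have "wt f z \<le> cum f T * exp (l * T) * indicator Dm z"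
      using l_pos cum_nonneg[of f] cum_mono[OF f]
      by (cases "z \<in> Dm") (auto simp: wt_def Dm_def intro!: mult_mono)
    then have "P * wt f z \<le> P * (cum f T * exp (l * T) * indicator Dm z)" using P_nonneg by (rule mult_left_mono)
    then show ?thesis using v(2)[of z] by (simp add: C_def mult.assoc)
  qed
  obtain B1 where B1: "B1 \<ge> 0" "\<And>x. cmod (phi \<mu> x) \<le> B1 * indicator {0..T} x" using phi_bounded[of \<mu>] by metis
  obtain B2 where B2: "B2 \<ge> 0" "\<And>s. s \<in> {0..T} \<Longrightarrow> cmod (sin_kernel \<mu> s) \<le> B2" using sin_kernel_bounded[OF T_pos, of \<mu>] by metis
  let ?N = "(LINT r|lborel. cmod (ctl f r))"
  have ab: "cmod (moment V \<mu> t) \<le> B1 * (?N + C * T)" if t: "t \<in> {0..T}" for t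
    unfolding moment_def V_def
  proof (rule slice_moment_bound[OF f vC C _ B1(1) t])
    show "cmod (phi \<mu> x) \<le> B1" if "x \<in> {0..T}" for x using B1(2)[of x] that by simp
  qed (simp add: phi_outside)
  have bb: "cmod (b t) \<le> B2 * (?N + 0 * T)" if t: "t \<in> {0..T}" for t
  proof -
    have "cmod (LINT x|lborel. (free f (x, t) + (\<lambda>_. 0) (x, t)) * sin_kernel \<mu> x) \<le> B2 * (?N + 0 * T)"
      by (rule slice_moment_bound[OF f _ _ B2(2) B2(1) t, of "\<lambda>_. 0" 0])
         (use t in \<open>auto simp: free_slice indicator_def\<close>)
    then show ?thesis by (simp add: b_def)
  qed
  have "moment V \<mu> T - b T = 0"
  proof (rule volterra_gt_zero[where d = "\<lambda>t. moment V \<mu> t - b t" and \<mu> = \<mu> and ?c0.0 = "B1 * (?N + C * T) + B2 * (?N + 0 * T)"])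
    fix t assume t: "t \<in> {0..T}"
    have "moment V \<mu> t - b t = - \<mu> * ((LINT s|lborel. gt t s * moment V \<mu> s) - (LINT s|lborel. gt t s * b s))"
      by (subst mv(1)[OF t], subst bv(1)[OF t]) (simp add: algebra_simps)
    also have "(LINT s|lborel. gt t s * moment V \<mu> s) - (LINT s|lborel. gt t s * b s) = (LINT s|lborel. gt t s * (moment V \<mu> s - b s))"
      unfolding right_diff_distrib by (rule Bochner_Integration.integral_diff[OF mv(2)[OF t] bv(2)[OF t], symmetric])
    finally show "moment V \<mu> t - b t = - \<mu> * (LINT s|lborel. gt t s * (moment V \<mu> s - b s))" .
    show "cmod (moment V \<mu> t - b t) \<le> B1 * (?N + C * T) + B2 * (?N + 0 * T)"
      by (rule order_trans[OF norm_triangle_ineq4 add_mono[OF ab[OF t] bb[OF t]]])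
  qed (rule TT)
  then have eq: "moment V \<mu> T = b T" by simp
  have fm: "f \<in> borel_measurable (lebI T)" using f by auto
  have "(LINT x|lebI T. phi \<mu> x * W f x) = (LINT x|lborel. indicator {0<..<T} x *\<^sub>R (phi \<mu> x * W f x))"
    by (simp add: integral_restrict_space)
  also have "\<dots> = moment V \<mu> T"
    unfolding moment_def
  proof (rule integral_cong_AE)
    have "(\<lambda>x. phi \<mu> x * W f x) \<in> borel_measurable (lebI T)"
      using W_measurable[OF f] lebI_measurable[OF phi_measurable] by measurable
    then show "(\<lambda>x. indicator {0<..<T} x *\<^sub>R (phi \<mu> x * W f x)) \<in> borel_measurable lborel"
      by (simp add: borel_measurable_restrict_space_iff)
    have [measurable]: "V \<in> borel_measurable borel" unfolding V_def using v(1) free_measurable[OF fm] by measurable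
    have [measurable]: "(\<lambda>x::real. (x, T)) \<in> borel_measurable borel"
      by (intro borel_measurable_continuous_onI continuous_intros)
    show "(\<lambda>x. V (x, T) * phi \<mu> x) \<in> borel_measurable lborel" by measurable
    show "AE x in lborel. indicator {0<..<T} x *\<^sub>R (phi \<mu> x * W f x) = V (x, T) * phi \<mu> x"
      using AE_not_endpoint
    proof eventually_elim
      case (elim x)
      show ?case
      proof (cases "x \<in> {0<..<T}")
        case True
        then have "W f x = V (x, T)" using W_eq[OF sol, of x] by (auto simp: V_def free_def Dm_def ctl_def)
        then show ?thesis using True by simp
      next
        case False
        then have "x \<notin> {0..T}" using elim by auto
        then show ?thesis using False by (simp add: phi_outside)
      qed
    qed
  qed
  also have "\<dots> = b T" by (rule eq)
  also have "\<dots> = (LINT x|lborel. indicator {0<..<T} x *\<^sub>R (sin_kernel \<mu> x * f (T - x)))"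
    unfolding b_def
  proof (rule integral_cong_AE)
    have "(\<lambda>x. sin_kernel \<mu> x * f (T - x)) \<in> borel_measurable (lebI T)"
      using lebI_reflect_measurable[OF fm] lebI_measurable[OF sin_kernel_measurable] by measurable
    then show "(\<lambda>x. indicator {0<..<T} x *\<^sub>R (sin_kernel \<mu> x * f (T - x))) \<in> borel_measurable lborel"
      by (simp add: borel_measurable_restrict_space_iff)
    have [measurable]: "(\<lambda>x. free f (x, T)) \<in> borel_measurable lborel" using free_slice_integrable[OF f TT] by auto
    show "(\<lambda>x. free f (x, T) * sin_kernel \<mu> x) \<in> borel_measurable lborel" by measurable
    show "AE x in lborel. free f (x, T) * sin_kernel \<mu> x = indicator {0<..<T} x *\<^sub>R (sin_kernel \<mu> x * f (T - x))"
      using AE_not_endpoint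
      by eventually_elim (auto simp: free_slice[OF TT] ctl_def indicator_def)
  qed
  also have "\<dots> = fourier_image T f \<mu>"
    by (simp add: fourier_image_eq integral_restrict_space)
  finally show ?thesis ..
qed

end

section \<open>The space of Fourier images\<close>

lemma hilbert_space_onI:
  assumes "complete_pre_hilbert V ip" and "\<And>F. F \<in> V \<Longrightarrow> ip F F = 0 \<Longrightarrow> F = (\<lambda>z. 0)"
  shows "hilbert_space_on UNIV V ip"
proof -
  interpret complete_pre_hilbert V ip by fact
  have pos: "Re (ip F F) > 0" if "F \<in> V" "F \<noteq> (\<lambda>z. 0)" for F
  proof -
    have "nrm F \<noteq> 0" using assms(2)[OF that(1)] that(2) ip_self[OF that(1)] by auto
    then show ?thesis using nrm_sq[OF that(1)] by (metis zero_less_power2)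
  qed
  have comp: "\<exists>F\<in>V. (\<lambda>n. sqrt (Re (ip (\<lambda>z. S n z - F z) (\<lambda>z. S n z - F z)))) \<longlonglongrightarrow> 0"
    if "\<forall>n. S n \<in> V" "\<forall>e>0. \<exists>N. \<forall>m\<ge>N. \<forall>n\<ge>N. sqrt (Re (ip (\<lambda>z. S m z - S n z) (\<lambda>z. S m z - S n z))) < e" for S
    using complete[of S] that unfolding cauchy_in_def converges_in_def nrm_def by blast
  show ?thesis
    unfolding hilbert_space_on_def
    by (intro conjI ballI allI impI; (elim conjE)?;
        (rule zero_mem add_mem scale_mem ip_add ip_scale ip_cnj pos comp UNIV_I; assumption?))
qed

section \<open>Adjoint, connecting operator and the scalar product of Fourier images\<close>

context wave
begin

abbreviation "H2 \<equiv> sqint (lebI T)"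
abbreviation "hip \<equiv> sq_inner (lebI T)"
abbreviation "hnrm \<equiv> sq_nrm (lebI T)"
abbreviation "FI \<equiv> fourier_image T"
abbreviation "C \<equiv> connecting_operator q T"
abbreviation "BIP \<equiv> BS_inner q T"

lemma hip_cong: "(\<And>x. x \<in> {0<..<T} \<Longrightarrow> f x = f' x) \<Longrightarrow> (\<And>x. x \<in> {0<..<T} \<Longrightarrow> g x = g' x) \<Longrightarrow> hip f g = hip f' g'"
  unfolding sq_inner_def by (intro Bochner_Integration.integral_cong) (auto simp: space_restrict_space)

lemma W_H2: "f \<in> H2 \<Longrightarrow> W f \<in> H2"
  by (rule W_sqint_bound(1))

lemma W_lin_H2:
  assumes "f \<in> H2" "g \<in> H2" "x \<in> {0<..<T}"
  shows "W (\<lambda>t. a * f t + b * g t) x = a * W f x + b * W g x"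
  using W_linear[OF sqint_lebI_integrable[OF assms(1)] sqint_lebI_integrable[OF assms(2)], of x a b] assms(3) by simp

text \<open>Gives the \<open>SOME\<close> in \<open>L2_adjoint\<close> something to choose: Riesz
  representation of g -> (h, W g), bounded because \<open>W\<close> is.\<close>

lemma adjoint_exists:
  assumes h: "h \<in> H2"
  shows "\<exists>k\<in>H2. \<forall>g\<in>H2. hip k g = hip h (W g)"
proof -
  obtain k where "k \<in> H2" "\<And>g. g \<in> H2 \<Longrightarrow> hip k g = hip h (W g)"
  proof (rule sq.riesz[of "lebI T" "\<lambda>g. hip h (W g)" "hnrm h * (1 + M * T)"])
    fix f g assume f: "f \<in> H2" and g: "g \<in> H2"
    have "hip h (W (\<lambda>x. f x + g x)) = hip h (\<lambda>x. W f x + W g x)"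
      using W_lin_H2[OF f g, of _ 1 1] by (intro hip_cong) auto
    also have "\<dots> = hip h (W f) + hip h (W g)" by (rule sq.ip_add[OF h W_H2[OF f] W_H2[OF g]])
    finally show "hip h (W (\<lambda>x. f x + g x)) = hip h (W f) + hip h (W g)" .
  next
    fix f c assume f: "f \<in> H2"
    have "hip h (W (\<lambda>x. c * f x)) = hip h (\<lambda>x. c * W f x)"
      using W_lin_H2[OF f f, of _ c 0] by (intro hip_cong) auto
    also have "\<dots> = c * hip h (W f)" by (rule sq.ip_scale[OF h W_H2[OF f]])
    finally show "hip h (W (\<lambda>x. c * f x)) = c * hip h (W f)" .
    have "cmod (hip h (W f)) \<le> hnrm h * hnrm (W f)" by (rule sq.cauchy_schwarz[OF h W_H2[OF f]])
    also have "\<dots> \<le> hnrm h * ((1 + M * T) * hnrm f)"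
      by (intro mult_left_mono W_sqint_bound(2) f sq.nrm_nonneg h)
    finally show "cmod (hip h (W f)) \<le> hnrm h * (1 + M * T) * hnrm f" by (simp add: mult.assoc)
  qed blast
  then show ?thesis by blast
qed

lemma connecting:
  assumes f: "f \<in> H2"
  shows "C f \<in> H2" and "g \<in> H2 \<Longrightarrow> hip (C f) g = hip (W f) (W g)"
proof -
  have "\<exists>k. k \<in> H2 \<and> (\<forall>g\<in>H2. hip k g = hip (W f) (W g))"
    using adjoint_exists[OF W_H2[OF f]] by blast
  from someI_ex[OF this] show "C f \<in> H2" "g \<in> H2 \<Longrightarrow> hip (C f) g = hip (W f) (W g)"
    by (simp_all add: connecting_operator_def L2_adjoint_def L2_eq_sqint L2_inner_eq)
qed

lemma FI_linear: "f \<in> H2 \<Longrightarrow> g \<in> H2 \<Longrightarrow> FI (\<lambda>t. a * f t + b * g t) = (\<lambda>\<mu>. a * FI f \<mu> + b * FI g \<mu>)"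
  using fourier_image_linear by (intro ext) blast

lemma FI_zero_AE: "f \<in> H2 \<Longrightarrow> FI f = (\<lambda>_. 0) \<Longrightarrow> AE t in lebI T. f t = 0"
  using fourier_image_injective[OF _ T_pos] by metis

lemma FI_inj:
  assumes f: "f \<in> H2" and g: "g \<in> H2" and eq: "FI f = FI g"
  shows "AE t in lebI T. f t = g t"
proof -
  have d: "(\<lambda>t. 1 * f t + (-1) * g t) \<in> H2" using sq.diff_mem[OF f g] by simp
  have "FI (\<lambda>t. 1 * f t + (-1) * g t) = (\<lambda>_. 0)" unfolding FI_linear[OF f g] eq by simp
  from FI_zero_AE[OF d this] show ?thesis by eventually_elim simp
qed

lemma hip_W_cong:
  assumes "f \<in> H2" "f' \<in> H2" "g \<in> H2" "g' \<in> H2" "AE t in lebI T. f t = f' t" "AE t in lebI T. g t = g' t"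
  shows "hip (W f) (W g) = hip (W f') (W g')"
  by (rule sq_inner_cong_AE[OF W_cong_AE[OF assms(1,2,5)] W_cong_AE[OF assms(3,4,6)]])
     (use assms W_H2 sqint_measurable in blast)+

text \<open>\<open>control_of\<close> returns some control with the given Fourier image; by
  injectivity it equals the original one almost everywhere, and \<open>W\<close> respects this
  equality.\<close>

lemma BIP_eq:
  assumes f: "f \<in> H2" and g: "g \<in> H2"
  shows "BIP (FI f) (FI g) = hip (W f) (W g)"
proof -
  have ctl: "control_of T (FI h) \<in> H2 \<and> FI h = FI (control_of T (FI h))" if "h \<in> H2" for h
    unfolding control_of_def L2_eq_sqint by (rule someI[of _ h]) (use that in simp)
  note cf = ctl[OF f] and cg = ctl[OF g]
  have "BIP (FI f) (FI g) = hip (C (control_of T (FI f))) (control_of T (FI g))"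
    by (simp add: BS_inner_def L2_inner_eq)
  also have "\<dots> = hip (W (control_of T (FI f))) (W (control_of T (FI g)))"
    using cf cg by (intro connecting(2)) auto
  also have "\<dots> = hip (W f) (W g)"
    using cf cg f g by (intro hip_W_cong FI_inj) auto
  finally show ?thesis .
qed

text \<open>The decomposition F + i G of an image corresponds to the real and imaginary parts of a
  complex control.\<close>

lemma BS_complex_eq: "BS_complex T = FI ` H2"
proof
  show "BS_complex T \<subseteq> FI ` H2"
  proof
    fix F assume "F \<in> BS_complex T"
    then obtain f g where f: "f \<in> H2" and g: "g \<in> H2" and F: "F = (\<lambda>z. FI f z + \<i> * FI g z)"
      by (auto simp: BS_complex_def BS_def L2_eq_sqint)
    have "F = FI (\<lambda>t. 1 * f t + \<i> * g t)" unfolding FI_linear[OF f g] F by simp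
    moreover have "(\<lambda>t. 1 * f t + \<i> * g t) \<in> H2" using sqint_add[OF f sqint_scale[OF g]] by simp
    ultimately show "F \<in> FI ` H2" by blast
  qed
  show "FI ` H2 \<subseteq> BS_complex T"
  proof
    fix F assume "F \<in> FI ` H2"
    then obtain f where f: "f \<in> H2" and F: "F = FI f" by blast
    define g where "g t = (1/2) * f t + (1/2) * cnj (f t)" for t
    define h where "h t = (- \<i>/2) * f t + (\<i>/2) * cnj (f t)" for t
    have gh: "g \<in> H2" "h \<in> H2" unfolding g_def h_def by (intro sqint_add sqint_scale sqint_cnj f)+
    have real: "g t \<in> \<real>" "h t \<in> \<real>" for t by (simp_all add: complex_is_Real_iff g_def h_def)
    have "f = (\<lambda>t. 1 * g t + \<i> * h t)" by (simp add: fun_eq_iff g_def h_def algebra_simps)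
    then have "F = (\<lambda>z. 1 * FI g z + \<i> * FI h z)" unfolding F using FI_linear[OF gh, of 1 \<i>] by metis
    then have "F = (\<lambda>z. FI g z + \<i> * FI h z)" by simp
    moreover have "FI g \<in> BS T" "FI h \<in> BS T"
      unfolding BS_def L2_eq_sqint mem_Collect_eq
      by (intro bexI[OF _ gh(1)] conjI ballI real refl) (intro bexI[OF _ gh(2)] conjI ballI real refl)
    ultimately show "F \<in> BS_complex T" unfolding BS_complex_def by blast
  qed
qed

text \<open>Conjugating the control applies \<open>sharp\<close> to its image, so real controls give
  the fixed points of \<open>sharp\<close>.\<close>

lemma BS_iff: "F \<in> BS T \<longleftrightarrow> F \<in> BS_complex T \<and> sharp F = F"
proof
  assume "F \<in> BS T"
  then obtain f where f: "f \<in> H2" "\<And>t. t \<in> {0<..<T} \<Longrightarrow> f t \<in> \<real>" and F: "F = FI f"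
    by (auto simp: BS_def L2_eq_sqint)
  have "sharp F = FI (\<lambda>t. cnj (f t))" unfolding F by (rule fourier_image_cnj[symmetric])
  also have "\<dots> = F"
    unfolding F fun_eq_iff fourier_image_eq
    using f(2) by (auto intro!: Bochner_Integration.integral_cong simp: space_restrict_space Reals_cnj_iff)
  finally show "F \<in> BS_complex T \<and> sharp F = F" using f(1) F BS_complex_eq by blast
next
  assume a: "F \<in> BS_complex T \<and> sharp F = F"
  then obtain f where f: "f \<in> H2" and F: "F = FI f" unfolding BS_complex_eq by blast
  define g where "g t = (1/2) * f t + (1/2) * cnj (f t)" for t
  have g: "g \<in> H2" "\<And>t. g t \<in> \<real>" unfolding g_def by (intro sqint_add sqint_scale sqint_cnj f) (simp add: complex_is_Real_iff)
  have "FI g = (\<lambda>z. (1/2) * FI f z + (1/2) * FI (\<lambda>t. cnj (f t)) z)"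
    unfolding g_def by (rule FI_linear[OF f sqint_cnj[OF f]])
  also have "\<dots> = F" using a by (simp add: fourier_image_cnj F[symmetric])
  finally have "F = FI g" ..
  then show "F \<in> BS T"
    unfolding BS_def L2_eq_sqint mem_Collect_eq by (intro bexI[OF _ g(1)] conjI ballI g(2))
qed

lemma BS_subset: "BS T \<subseteq> BS_complex T"
  using BS_iff by blast

lemma BS_pre_hilbert: "pre_hilbert (BS_complex T) BIP"
proof
  have z: "(\<lambda>t. 0 * 0 + 0 * 0) \<in> H2" using sq.zero_mem by simp
  have "FI (\<lambda>t. 0 * 0 + 0 * 0) = (\<lambda>z. 0)" using FI_linear[OF sq.zero_mem sq.zero_mem, of 0 0] by simp
  then show "(\<lambda>z. 0) \<in> BS_complex T" unfolding BS_complex_eq using imageI[OF z, of FI] by simp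
next
  fix F G assume "F \<in> BS_complex T" "G \<in> BS_complex T"
  then obtain f g where f: "f \<in> H2" and g: "g \<in> H2" and F: "F = FI f" and G: "G = FI g" unfolding BS_complex_eq by blast
  have s: "(\<lambda>z. F z + G z) = FI (\<lambda>t. f t + g t)" using FI_linear[OF f g, of 1 1] by (simp add: F G)
  show "(\<lambda>z. F z + G z) \<in> BS_complex T" unfolding s BS_complex_eq by (rule imageI[OF sqint_add[OF f g]])
  show "BIP G F = cnj (BIP F G)" unfolding F G BIP_eq[OF f g] BIP_eq[OF g f] by (rule sq.ip_cnj[OF W_H2[OF f] W_H2[OF g]])
  show "BIP F (\<lambda>z. c * G z) = c * BIP F G" for c
  proof -
    have e: "(\<lambda>z. c * G z) = FI (\<lambda>t. c * g t)" using FI_linear[OF g g, of c 0] by (simp add: G)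
    have "BIP F (\<lambda>z. c * G z) = hip (W f) (W (\<lambda>t. c * g t))" unfolding e F by (rule BIP_eq[OF f sqint_scale[OF g]])
    also have "\<dots> = hip (W f) (\<lambda>x. c * W g x)" using W_lin_H2[OF g g, of _ c 0] by (intro hip_cong) auto
    also have "\<dots> = c * BIP F G" unfolding F G BIP_eq[OF f g] by (rule sq.ip_scale[OF W_H2[OF f] W_H2[OF g]])
    finally show ?thesis .
  qed
  fix H assume "H \<in> BS_complex T"
  then obtain h where h: "h \<in> H2" and H: "H = FI h" unfolding BS_complex_eq by blast
  have e: "(\<lambda>z. G z + H z) = FI (\<lambda>t. g t + h t)" using FI_linear[OF g h, of 1 1] by (simp add: G H)
  have "BIP F (\<lambda>z. G z + H z) = hip (W f) (W (\<lambda>t. g t + h t))" unfolding e F by (rule BIP_eq[OF f sqint_add[OF g h]])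
  also have "\<dots> = hip (W f) (\<lambda>x. W g x + W h x)" using W_lin_H2[OF g h, of _ 1 1] by (intro hip_cong) auto
  also have "\<dots> = BIP F G + BIP F H"
    unfolding F G H BIP_eq[OF f g] BIP_eq[OF f h] by (rule sq.ip_add[OF W_H2[OF f] W_H2[OF g] W_H2[OF h]])
  finally show "BIP F (\<lambda>z. G z + H z) = BIP F G + BIP F H" .
next
  fix F c assume "F \<in> BS_complex T"
  then obtain f where f: "f \<in> H2" and F: "F = FI f" unfolding BS_complex_eq by blast
  have e: "(\<lambda>z. c * F z) = FI (\<lambda>t. c * f t)" using FI_linear[OF f f, of c 0] by (simp add: F)
  show "(\<lambda>z. c * F z) \<in> BS_complex T" unfolding e BS_complex_eq by (rule imageI[OF sqint_scale[OF f]])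
  show "0 \<le> Re (BIP F F)" unfolding F BIP_eq[OF f f] by (rule sq.ip_nonneg[OF W_H2[OF f]])
qed

interpretation bs: pre_hilbert "BS_complex T" BIP by (rule BS_pre_hilbert)

lemma bs_nrm: "f \<in> H2 \<Longrightarrow> bs.nrm (FI f) = hnrm (W f)"
  by (simp add: bs.nrm_def sq.nrm_def BIP_eq)

lemma bs_nrm_diff:
  assumes f: "f \<in> H2" and g: "g \<in> H2"
  shows "bs.nrm (\<lambda>z. FI f z - FI g z) = hnrm (\<lambda>x. W f x - W g x)"
proof -
  have e: "(\<lambda>z. FI f z - FI g z) = FI (\<lambda>t. f t - g t)" using FI_linear[OF f g, of 1 "-1"] by simp
  have "bs.nrm (\<lambda>z. FI f z - FI g z) = hnrm (W (\<lambda>t. f t - g t))" unfolding e by (rule bs_nrm[OF sq.diff_mem[OF f g]])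
  also have "\<dots> = hnrm (\<lambda>x. W f x - W g x)"
    using W_lin_H2[OF f g, of _ 1 "-1"] by (intro sq_nrm_cong) (auto simp: space_restrict_space)
  finally show ?thesis .
qed

lemma hnrm_cong_AE:
  assumes "AE x in lebI T. f x = g x" "f \<in> borel_measurable (lebI T)" "g \<in> borel_measurable (lebI T)"
  shows "hnrm f = hnrm g"
  using sq_inner_cong_AE[OF assms(1) assms(1)] assms(2,3) by (simp add: sq.nrm_def)

lemma BS_complete: "complete_pre_hilbert (BS_complex T) BIP"
proof
  fix S assume C: "bs.cauchy_in S"
  have "S n \<in> BS_complex T" for n using C unfolding bs.cauchy_in_def by blast
  then have "\<forall>n. \<exists>f. f \<in> H2 \<and> S n = FI f" unfolding BS_complex_eq by blast
  then obtain f where f: "\<And>n. f n \<in> H2" and S: "\<And>n. S n = FI (f n)" by metis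
  have "sq.cauchy_in (lebI T) (\<lambda>n. W (f n))"
    unfolding sq.cauchy_in_def
  proof (intro conjI allI impI W_H2 f)
    fix e :: real assume "e > 0"
    then show "\<exists>N. \<forall>m\<ge>N. \<forall>n\<ge>N. hnrm (\<lambda>x. W (f m) x - W (f n) x) < e"
      using C unfolding bs.cauchy_in_def S bs_nrm_diff[OF f f] by blast
  qed
  then obtain h where h: "h \<in> H2" and conv: "sq.converges_in (lebI T) (\<lambda>n. W (f n)) h"
    using sq.complete by blast
  obtain g where g: "g \<in> H2" "AE x in lebI T. W g x = h x" using W_surj[OF h] by blast
  have "bs.nrm (\<lambda>z. S n z - FI g z) = hnrm (\<lambda>x. W (f n) x - h x)" for n
    unfolding S bs_nrm_diff[OF f g(1)]
  proof (rule hnrm_cong_AE)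
    show "AE x in lebI T. W (f n) x - W g x = W (f n) x - h x" using g(2) by eventually_elim simp
  qed (use sqint_measurable[OF W_H2[OF f[of n]]] sqint_measurable[OF W_H2[OF g(1)]] sqint_measurable[OF h] in measurable)
  then have "bs.converges_in S (FI g)" using conv by (simp add: bs.converges_in_def sq.converges_in_def)
  then show "\<exists>F\<in>BS_complex T. bs.converges_in S F" unfolding BS_complex_eq using g(1) by blast
qed

text \<open>If the state vanishes, so do its moments against every phi; these are the Fourier image,
  which determines the control.\<close>

lemma W_inj:
  assumes f: "f \<in> H2" and z: "hnrm (W f) = 0"
  shows "AE t in lebI T. f t = 0"
proof (rule FI_zero_AE[OF f], rule ext)
  fix \<mu>
  have a: "AE x in lebI T. W f x = 0" by (rule sq_nrm_zero_AE[OF W_H2[OF f] z])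
  have "FI f \<mu> = (LINT x|lebI T. phi \<mu> x * W f x)"
    by (rule fourier_image_eq_moment[OF sqint_lebI_integrable[OF f]])
  also have "\<dots> = (LINT x|lebI T. 0)"
  proof (rule integral_cong_AE)
    show "AE x in lebI T. phi \<mu> x * W f x = 0" using a by eventually_elim simp
  qed (use lebI_measurable[OF phi_measurable] sqint_measurable[OF W_H2[OF f]] in measurable)
  finally show "FI f \<mu> = 0" by simp
qed

section \<open>The Krein equation and the reproducing kernel\<close>

lemma phi_H2: "phi \<mu> \<in> H2"
proof -
  obtain c where c: "c \<ge> 0" "\<And>x. cmod (phi \<mu> x) \<le> c * indicator {0..T} x" using phi_bounded[of \<mu>] by metis
  show ?thesis
  proof (rule lebI_bounded_sqint[OF lebI_measurable[OF phi_measurable]])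
    show "cmod (phi \<mu> t) \<le> c" if "t \<in> {0<..<T}" for t using c(2)[of t] that by simp
  qed
qed

definition rhs :: "complex \<Rightarrow> real \<Rightarrow> complex" where "rhs z s = cnj (sin_kernel z (T - s))"

lemma rhs_H2: "rhs z \<in> H2"
proof -
  obtain B where B: "\<And>s. s \<in> {0..T} \<Longrightarrow> cmod (sin_kernel z s) \<le> B" using sin_kernel_bounded[OF T_pos, of z] by metis
  have "rhs z \<in> borel_measurable borel" unfolding rhs_def by measurable
  then show ?thesis
    by (intro lebI_bounded_sqint[of _ _ B] lebI_measurable) (auto simp: rhs_def intro!: B)
qed

text \<open>Tested against controls, the Krein equation thus says that the Fourier image of its
  solution reproduces values at \<open>z\<close>.\<close>

lemma hip_rhs: "hip (rhs z) g = FI g z"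
proof -
  have "FI g z = (LINT s|lebI T. sin_kernel z (T - s) * g (T - (T - s)))"
    unfolding fourier_image_eq using lebI_reflect_integral[of T "\<lambda>s. sin_kernel z s * g (T - s)"] by simp
  then show ?thesis by (simp add: sq_inner_def rhs_def)
qed

lemma H2_nondegenerate:
  assumes a: "a \<in> H2" and b: "b \<in> H2" and eq: "\<And>g. g \<in> H2 \<Longrightarrow> hip a g = hip b g"
  shows "AE x in lebI T. a x = b x"
proof -
  let ?d = "\<lambda>x. a x - b x"
  have d: "?d \<in> H2" by (rule sq.diff_mem[OF a b])
  have "hip ?d ?d = 0" using eq[OF d] by (simp add: sq.ip_diff_left[OF d a b])
  then have "hnrm ?d = 0" by (simp add: sq.nrm_def)
  from sq_nrm_zero_AE[OF d this] show ?thesis by eventually_elim simp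
qed

lemma krein_iff: "krein_solution q T z j \<longleftrightarrow> j \<in> H2 \<and> (AE s in lebI T. C j s = rhs z s)"
  by (simp add: krein_solution_def L2_eq_sqint eq_on_interval_iff rhs_def)

lemma krein_weak:
  assumes "krein_solution q T z j" "g \<in> H2"
  shows "hip (W j) (W g) = FI g z"
proof -
  have j: "j \<in> H2" "AE s in lebI T. C j s = rhs z s" using assms(1) by (auto simp: krein_iff)
  have "hip (W j) (W g) = hip (C j) g" by (rule connecting(2)[OF j(1) assms(2), symmetric])
  also have "\<dots> = hip (rhs z) g"
    by (rule sq_inner_cong_AE[OF j(2)])
       (use sqint_measurable[OF connecting(1)[OF j(1)]] sqint_measurable[OF rhs_H2] sqint_measurable[OF assms(2)] in auto)
  finally show ?thesis by (simp add: hip_rhs)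
qed

text \<open>Surjectivity of \<open>W\<close> gives j with state conj phi(.,z); the moment formula
  then verifies the equation when tested against all controls.\<close>

lemma krein_exists: "\<exists>j. krein_solution q T z j \<and> (AE x in lebI T. W j x = cnj (phi z x))"
proof -
  obtain j where j: "j \<in> H2" "AE x in lebI T. W j x = cnj (phi z x)" using W_surj[OF sqint_cnj[OF phi_H2[of z]]] by blast
  have "AE s in lebI T. C j s = rhs z s"
  proof (rule H2_nondegenerate[OF connecting(1)[OF j(1)] rhs_H2])
    fix g assume g: "g \<in> H2"
    have "hip (C j) g = hip (W j) (W g)" by (rule connecting(2)[OF j(1) g])
    also have "\<dots> = hip (\<lambda>x. cnj (phi z x)) (W g)"
      by (rule sq_inner_cong_AE[OF j(2)])
         (use sqint_measurable[OF W_H2[OF j(1)]] sqint_measurable[OF sqint_cnj[OF phi_H2[of z]]] sqint_measurable[OF W_H2[OF g]] in auto)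
    also have "\<dots> = FI g z"
      unfolding fourier_image_eq_moment[OF sqint_lebI_integrable[OF g]] by (simp add: sq_inner_def)
    finally show "hip (C j) g = hip (rhs z) g" by (simp add: hip_rhs)
  qed
  then show ?thesis using j by (auto simp: krein_iff)
qed

lemma krein_unique:
  assumes j: "krein_solution q T z j" and j': "krein_solution q T z j'"
  shows "AE t in lebI T. j t = j' t"
proof -
  have h: "j \<in> H2" "j' \<in> H2" using j j' by (auto simp: krein_iff)
  let ?d = "\<lambda>t. 1 * j t + (-1) * j' t"
  have d: "?d \<in> H2" using sq.diff_mem[OF h] by simp
  have "hip (W ?d) (W ?d) = hip (\<lambda>x. W j x - W j' x) (W ?d)"
    using W_lin_H2[OF h, of _ 1 "-1"] by (intro hip_cong) auto
  also have "\<dots> = hip (W j) (W ?d) - hip (W j') (W ?d)"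
    by (rule sq.ip_diff_left[OF W_H2[OF d] W_H2[OF h(1)] W_H2[OF h(2)]])
  also have "\<dots> = 0" by (simp only: krein_weak[OF j d] krein_weak[OF j' d] diff_self)
  finally have "hnrm (W ?d) = 0" by (simp add: sq.nrm_def)
  from W_inj[OF d this] show ?thesis by eventually_elim simp
qed

lemma krein_j: "krein_solution q T z (krein_j q T z)"
  unfolding krein_j_def using krein_exists[of z] by (intro someI_ex[of "krein_solution q T z"]) blast

lemma krein_j_H2: "krein_j q T z \<in> H2"
  using krein_j by (simp add: krein_iff)

lemma W_krein_j: "AE x in lebI T. W (krein_j q T z) x = cnj (phi z x)"
proof -
  obtain j where j: "krein_solution q T z j" "AE x in lebI T. W j x = cnj (phi z x)" using krein_exists by blast
  have "j \<in> H2" using j(1) by (simp add: krein_iff)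
  from W_cong_AE[OF krein_j_H2 this krein_unique[OF krein_j j(1)]] j(2) show ?thesis by eventually_elim simp
qed

lemma J_eq: "J_kernel q T z = FI (krein_j q T z)"
proof
  fix \<mu>
  have "J_kernel q T z \<mu> = (LINT s|lebI T. sin_kernel \<mu> (T - s) * krein_j q T z s)"
    by (simp add: J_kernel_def lebI_integral)
  also have "\<dots> = FI (krein_j q T z) \<mu>"
    unfolding fourier_image_eq using lebI_reflect_integral[of T "\<lambda>s. sin_kernel \<mu> s * krein_j q T z (T - s)"] by simp
  finally show "J_kernel q T z \<mu> = FI (krein_j q T z) \<mu>" .
qed

lemma J_mem: "J_kernel q T z \<in> BS_complex T"
  unfolding J_eq BS_complex_eq using krein_j_H2 by blast

lemma J_rep:
  assumes "F \<in> BS_complex T"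
  shows "BIP (J_kernel q T z) F = F z"
proof -
  obtain f where f: "f \<in> H2" and F: "F = FI f" using assms unfolding BS_complex_eq by blast
  show ?thesis unfolding J_eq F BIP_eq[OF krein_j_H2 f] by (rule krein_weak[OF krein_j f])
qed

lemma J_AB: "(\<mu> - cnj z) * J_kernel q T z \<mu> = phi \<mu> T * cnj (dphi z T) - dphi \<mu> T * cnj (phi z T)"
proof -
  have "J_kernel q T z \<mu> = (LINT x|lebI T. phi \<mu> x * W (krein_j q T z) x)"
    unfolding J_eq by (rule fourier_image_eq_moment[OF sqint_lebI_integrable[OF krein_j_H2]])
  also have "\<dots> = (LINT x|lebI T. phi \<mu> x * cnj (phi z x))"
  proof (rule integral_cong_AE)
    show "AE x in lebI T. phi \<mu> x * W (krein_j q T z) x = phi \<mu> x * cnj (phi z x)"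
      using W_krein_j[of z] by eventually_elim simp
  qed (use lebI_measurable[OF phi_measurable] sqint_measurable[OF W_H2[OF krein_j_H2]] in auto)
  also have "\<dots> = (LINT x|lborel. indicator {0<..<T} x *\<^sub>R (phi \<mu> x * cnj (phi z x)))"
    by (simp add: integral_restrict_space)
  also have "\<dots> = (LINT x|lborel. phi \<mu> x * cnj (phi z x))"
  proof (rule integral_cong_AE)
    show "AE x in lborel. indicator {0<..<T} x *\<^sub>R (phi \<mu> x * cnj (phi z x)) = phi \<mu> x * cnj (phi z x)"
      using AE_not_endpoint
    proof eventually_elim
      case (elim x)
      then show ?case by (cases "x \<in> {0..T}") (auto simp: phi_outside)
    qed
  qed auto
  finally show ?thesis by (simp only: lagrange_identity)
qed

text \<open>At a common zero \<open>w\<close> the vector \<open>rhs w\<close> would be orthogonal to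
  itself, so the sine kernel at \<open>w\<close> would vanish almost everywhere on (0,T); but then
  its Volterra equation makes it equal to x.\<close>

lemma BS_nontrivial: "\<exists>F\<in>BS_complex T. F w \<noteq> 0"
proof (rule ccontr)
  assume "\<not> ?thesis"
  then have z: "FI f w = 0" if "f \<in> H2" for f using that unfolding BS_complex_eq by blast
  have "hip (rhs w) (rhs w) = 0" unfolding hip_rhs by (rule z[OF rhs_H2])
  then have "hnrm (rhs w) = 0" by (simp add: sq.nrm_def)
  from sq_nrm_zero_AE[OF rhs_H2 this] have "AE s in lebI T. sin_kernel w (T - s) = 0"
    by eventually_elim (simp add: rhs_def)
  then have ae: "AE s in lebI T. sin_kernel w s = 0"
    using AE_lebI_reflect[of "sin_kernel w" T "\<lambda>_. 0"] lebI_measurable[OF sin_kernel_measurable] by simp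
  then have ae': "AE s in lborel. s \<in> {0<..<T} \<longrightarrow> sin_kernel w s = 0" by (simp add: AE_restrict_space_iff)
  have sk: "sin_kernel w x = of_real x" if x: "x \<in> {0<..<T}" for x
  proof -
    have "(LINT b|lborel. indicator {0..x} b *\<^sub>R (of_real (x - b) * sin_kernel w b)) = (LINT b::real|lborel. 0)"
    proof (rule integral_cong_AE)
      show "AE b in lborel. indicator {0..x} b *\<^sub>R (of_real (x - b) * sin_kernel w b) = 0"
        using ae' AE_not_endpoint by eventually_elim (use x in \<open>auto simp: indicator_def\<close>)
    qed auto
    then show ?thesis using sin_kernel_volterra[of x w] x by simp
  qed
  have "AE s in lebI T. False"
    by (rule eventually_elim2[OF ae AE_space]) (auto simp: space_restrict_space sk)
  then have "emeasure (lebI T) (space (lebI T)) = 0"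
    by (subst (asm) AE_iff_measurable[OF sets.top]) auto
  then show False using T_pos by (simp add: emeasure_restrict_space space_restrict_space)
qed

lemma de_branges_BS: "de_branges_kernel (BS_complex T) BIP (J_kernel q T) (\<lambda>z. phi z T) (\<lambda>z. dphi z T)"
proof (intro de_branges_kernel.intro BS_complete de_branges_kernel_axioms.intro)
  show "F holomorphic_on UNIV" if "F \<in> BS_complex T" for F
    using that fourier_image_entire unfolding BS_complex_eq by blast
qed (auto simp: J_mem J_rep BS_nontrivial J_AB phi_cnj dphi_cnj)

end

theorem mainTheorem1:
  fixes q :: "real \<Rightarrow> real" and T :: real
  assumes q_loc: "\<And>a. a > 0 \<Longrightarrow> set_integrable lborel {0..a} q"
    and T_pos: "T > 0"
  shows
    "(\<forall>f\<in>L2 T. \<forall>g\<in>L2 T.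
        BS_inner q T (fourier_image T f) (fourier_image T g)
          = L2_inner T (connecting_operator q T f) g)
     \<and> hilbert_space_on \<real> (BS T) (BS_inner q T)
     \<and> hilbert_space_on UNIV (BS_complex T) (BS_inner q T)
     \<and> (\<forall>z. (\<exists>j. krein_solution q T z j) \<and>
           (\<forall>j j'. krein_solution q T z j \<longrightarrow> krein_solution q T z j' \<longrightarrow> eq_on_interval T j j'))
     \<and> (\<forall>z. J_kernel q T z \<in> BS_complex T \<and>
           (\<forall>F\<in>BS T. BS_inner q T (J_kernel q T z) F = F z) \<and>
           (\<forall>F\<in>BS_complex T. BS_inner q T (J_kernel q T z) F = F z) \<and>
           (\<forall>G\<in>BS_complex T. (\<forall>F\<in>BS T. BS_inner q T G F = F z) \<longrightarrow> G = J_kernel q T z))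
     \<and> (\<forall>V\<in>{BS T, BS_complex T}.
           (\<forall>\<omega>. \<exists>C. \<forall>F\<in>V. cmod (F \<omega>) \<le> C * BS_norm q T F) \<and>
           (\<forall>F\<in>V. sharp F \<in> V \<and> BS_norm q T (sharp F) = BS_norm q T F))
     \<and> (\<forall>F\<in>BS T \<union> BS_complex T. \<forall>\<omega>. F \<omega> = 0 \<longrightarrow>
           move_zero \<omega> F \<in> BS_complex T \<and> BS_norm q T (move_zero \<omega> F) = BS_norm q T F)
     \<and> hermite_biehler (E_function q T)
     \<and> BS_complex T = de_branges_space (E_function q T)
     \<and> (\<forall>F\<in>BS_complex T. \<forall>G\<in>BS_complex T.
           BS_inner q T F G = of_real pi * de_branges_inner (E_function q T) F G)"
proof -
  interpret wave q T by unfold_locales (fact q_loc T_pos)+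
  interpret db: de_branges_kernel "BS_complex T" "BS_inner q T" "J_kernel q T" "\<lambda>z. phi z T" "\<lambda>z. dphi z T"
    by (rule de_branges_BS)
  have nrm: "db.nrm F = BS_norm q T F" for F by (simp add: db.nrm_def BS_norm_def)
  have E: "E_function q T = db.E"
    by (simp add: fun_eq_iff E_function_def db.E_def nrm)
  \<comment> \<open>The seminorm is a norm here because evaluations are bounded.\<close>
  have definite: "F = (\<lambda>z. 0)" if "F \<in> BS_complex T" "BS_inner q T F F = 0" for F
  proof
    fix z
    have "db.nrm F = 0" using that(2) by (simp add: db.nrm_def)
    then show "F z = 0" using db.eval_le[OF that(1), of z] by simp
  qed
  have hilbert: "hilbert_space_on UNIV (BS_complex T) (BS_inner q T)"
    by (rule hilbert_space_onI[OF BS_complete definite])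
  have sharp_C: "sharp F \<in> BS_complex T \<and> BS_norm q T (sharp F) = BS_norm q T F" if FV: "F \<in> BS_complex T" for F
  proof -
    obtain f where f: "f \<in> H2" and F: "F = FI f" using FV unfolding BS_complex_eq by blast
    have s: "sharp F = FI (\<lambda>t. cnj (f t))" unfolding F by (rule fourier_image_cnj[symmetric])
    have "hnrm (W (\<lambda>t. cnj (f t))) = hnrm (\<lambda>x. cnj (W f x))"
      using W_cnj[OF sqint_lebI_integrable[OF f]] by (intro sq_nrm_cong) (simp add: space_restrict_space)
    also have "\<dots> = hnrm (W f)" by (simp add: sq.nrm_def sq_inner_self)
    finally have "db.nrm (sharp F) = db.nrm F" unfolding s unfolding F bs_nrm[OF f] bs_nrm[OF sqint_cnj[OF f]] .
    then show ?thesis using sqint_cnj[OF f] unfolding s nrm BS_complex_eq by blast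
  qed
  \<comment> \<open>Conjugating both controls changes neither image, and it conjugates the product
    because \<open>W\<close> commutes with conjugation.\<close>
  have BS_real: "BS_inner q T F G \<in> \<real>" if "F \<in> BS T" "G \<in> BS T" for F G
  proof -
    have FG: "F \<in> BS_complex T" "G \<in> BS_complex T" "sharp F = F" "sharp G = G" using that BS_iff by auto
    obtain f g where f: "f \<in> H2" and g: "g \<in> H2" and F: "F = FI f" and G: "G = FI g"
      using FG unfolding BS_complex_eq by blast
    have "FI (\<lambda>t. cnj (f t)) = FI f" "FI (\<lambda>t. cnj (g t)) = FI g" using FG by (simp_all add: fourier_image_cnj F G)
    then have "hip (W f) (W g) = hip (W (\<lambda>t. cnj (f t))) (W (\<lambda>t. cnj (g t)))"
      by (metis BIP_eq f g sqint_cnj)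
    also have "\<dots> = hip (\<lambda>x. cnj (W f x)) (\<lambda>x. cnj (W g x))"
      using W_cnj[OF sqint_lebI_integrable[OF f]] W_cnj[OF sqint_lebI_integrable[OF g]] by (intro hip_cong) auto
    also have "\<dots> = cnj (hip (W f) (W g))"
      unfolding sq_inner_def Bochner_Integration.integral_cnj[symmetric] by simp
    finally show ?thesis unfolding F G BIP_eq[OF f g] by (simp add: Reals_cnj_iff)
  qed
  have BS_closed: "(\<lambda>z. 0) \<in> BS T" "F \<in> BS T \<Longrightarrow> G \<in> BS T \<Longrightarrow> (\<lambda>z. F z + G z) \<in> BS T"
    "c \<in> \<real> \<Longrightarrow> F \<in> BS T \<Longrightarrow> (\<lambda>z. c * F z) \<in> BS T" for F G c
    using db.zero_mem db.add_mem[of F G] db.scale_mem[of F c]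
    unfolding BS_iff by (auto simp: sharp_def fun_eq_iff Reals_cnj_iff)
  \<comment> \<open>The real space is closed in its complexification: norm limits are pointwise
    limits, and these preserve \<open>sharp F = F\<close>.\<close>
  have BS_lim: "\<exists>F\<in>BS T. (\<lambda>n. sqrt (Re (BS_inner q T (\<lambda>z. S n z - F z) (\<lambda>z. S n z - F z)))) \<longlonglongrightarrow> 0"
    if S: "\<forall>n. S n \<in> BS T"
      and C: "\<forall>e>0. \<exists>N. \<forall>m\<ge>N. \<forall>n\<ge>N. sqrt (Re (BS_inner q T (\<lambda>z. S m z - S n z) (\<lambda>z. S m z - S n z))) < e" for S
  proof -
    have SV: "S n \<in> BS_complex T" and Ssharp: "sharp (S n) = S n" for n using S BS_iff by auto
    have "db.cauchy_in S" using SV C by (auto simp: db.cauchy_in_def db.nrm_def)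
    then obtain F where F: "F \<in> BS_complex T" and conv: "db.converges_in S F" using db.complete by blast
    have pw: "(\<lambda>n. S n z) \<longlonglongrightarrow> F z" for z by (rule db.converges_pointwise[OF SV F conv])
    have "sharp F z = F z" for z
    proof -
      have "(\<lambda>n. cnj (S n (cnj z))) \<longlonglongrightarrow> cnj (F (cnj z))" by (intro tendsto_cnj pw)
      moreover have "cnj (S n (cnj z)) = S n z" for n using Ssharp[of n] by (simp add: sharp_def fun_eq_iff)
      ultimately show ?thesis using pw[of z] LIMSEQ_unique by (simp add: sharp_def) blast
    qed
    then have "F \<in> BS T" using F BS_iff by blast
    then show ?thesis using conv unfolding db.converges_in_def db.nrm_def by blast
  qed
  have hilbert_real: "hilbert_space_on \<real> (BS T) (BS_inner q T)"
  proof -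
    have mem: "F \<in> BS_complex T" if "F \<in> BS T" for F using that BS_subset by blast
    have pos: "Re (BS_inner q T F F) > 0" if "F \<in> BS_complex T" "F \<noteq> (\<lambda>z. 0)" for F
      using hilbert that unfolding hilbert_space_on_def by blast
    show ?thesis
      unfolding hilbert_space_on_def
      by (intro conjI ballI allI impI; (elim conjE)?;
          (rule BS_closed BS_real db.ip_add db.ip_scale db.ip_cnj pos BS_lim;
           (assumption | rule mem, assumption)?))
  qed
  \<comment> \<open>Testing with real \<open>F\<close> determines \<open>G\<close>, since these span
    the complexification over the complex numbers.\<close>
  have J_unique: "G = J_kernel q T z" if G: "G \<in> BS_complex T" and h: "\<forall>F\<in>BS T. BS_inner q T G F = F z" for G z
  proof -
    have rep: "BS_inner q T G F = F z" if F: "F \<in> BS_complex T" for F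
    proof -
      obtain F1 F2 where F12: "F1 \<in> BS T" "F2 \<in> BS T" and Feq: "F = (\<lambda>z. F1 z + \<i> * F2 z)"
        using F unfolding BS_complex_def by blast
      have c: "F1 \<in> BS_complex T" "F2 \<in> BS_complex T" using F12 BS_subset by auto
      show ?thesis
        unfolding Feq db.ip_add[OF G c(1) db.scale_mem[OF c(2)]] db.ip_scale[OF G c(2)] using h F12 by simp
    qed
    let ?d = "\<lambda>w. G w - J_kernel q T z w"
    have d: "?d \<in> BS_complex T" by (rule db.diff_mem[OF G J_mem])
    have "BS_inner q T ?d ?d = 0" unfolding db.ip_diff_left[OF d G J_mem] rep[OF d] J_rep[OF d] by simp
    from definite[OF d this] show ?thesis by (simp add: fun_eq_iff)
  qed
  have conn: "BS_inner q T (FI f) (FI g) = L2_inner T (connecting_operator q T f) g" if "f \<in> L2 T" "g \<in> L2 T" for f g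
    using that unfolding L2_eq_sqint L2_inner_eq by (simp add: BIP_eq connecting(2))
  have krein: "(\<exists>j. krein_solution q T z j) \<and>
      (\<forall>j j'. krein_solution q T z j \<longrightarrow> krein_solution q T z j' \<longrightarrow> eq_on_interval T j j')" for z
    using krein_j krein_unique unfolding eq_on_interval_iff by blast
  have eval: "\<exists>C. \<forall>F\<in>BS_complex T. cmod (F \<omega>) \<le> C * BS_norm q T F" for \<omega>
    using db.eval_le unfolding nrm by blast
  have sharp_R: "sharp F \<in> BS T \<and> BS_norm q T (sharp F) = BS_norm q T F" if "F \<in> BS T" for F
    using that sharp_C[of F] unfolding BS_iff by auto
  have moved: "move_zero \<omega> F \<in> BS_complex T \<and> BS_norm q T (move_zero \<omega> F) = BS_norm q T F"
    if "F \<in> BS_complex T" "F \<omega> = 0" for F \<omega>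
    using db.move_zero_mem[OF that] by (simp add: BS_norm_def)
  show ?thesis
  proof (intro conjI)
    show "\<forall>f\<in>L2 T. \<forall>g\<in>L2 T. BS_inner q T (FI f) (FI g) = L2_inner T (connecting_operator q T f) g"
      using conn by blast
    show "\<forall>z. J_kernel q T z \<in> BS_complex T \<and>
           (\<forall>F\<in>BS T. BS_inner q T (J_kernel q T z) F = F z) \<and>
           (\<forall>F\<in>BS_complex T. BS_inner q T (J_kernel q T z) F = F z) \<and>
           (\<forall>G\<in>BS_complex T. (\<forall>F\<in>BS T. BS_inner q T G F = F z) \<longrightarrow> G = J_kernel q T z)"
      using J_mem J_rep J_unique BS_subset by blast
    show "\<forall>V\<in>{BS T, BS_complex T}.
           (\<forall>\<omega>. \<exists>C. \<forall>F\<in>V. cmod (F \<omega>) \<le> C * BS_norm q T F) \<and>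
           (\<forall>F\<in>V. sharp F \<in> V \<and> BS_norm q T (sharp F) = BS_norm q T F)"
    proof -
      have "\<exists>C. \<forall>F\<in>BS T. cmod (F \<omega>) \<le> C * BS_norm q T F" for \<omega>
        using eval[of \<omega>] BS_subset by blast
      then show ?thesis using eval sharp_C sharp_R by simp
    qed
    show "\<forall>F\<in>BS T \<union> BS_complex T. \<forall>\<omega>. F \<omega> = 0 \<longrightarrow>
           move_zero \<omega> F \<in> BS_complex T \<and> BS_norm q T (move_zero \<omega> F) = BS_norm q T F"
      using moved BS_subset by blast
    show "hermite_biehler (E_function q T)" unfolding E by (rule db.E_hermite_biehler)
    show "BS_complex T = de_branges_space (E_function q T)" unfolding E by (rule db.V_eq_DB)
    show "\<forall>F\<in>BS_complex T. \<forall>G\<in>BS_complex T. BS_inner q T F G = of_real pi * de_branges_inner (E_function q T) F G"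
      unfolding E using db.ip_eq_ipE db.ipE_eq by simp
  qed (use hilbert hilbert_real krein in blast)+
qed

end
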